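(* Let $G$ be a connected Lie group acting freely and properly on a foliated manifold $(P,\mathcal F)$, with quotient map $\pi:P\to M=P/G$, and assume that $\Gamma_c(\ker d\pi)\subset\mathcal F$. Let $\mathcal F_M$ be the unique singular foliation on $M$ with $\pi^{-1}\mathcal F_M=\mathcal F$. Consider these two Lie 2-group actions of $G\rtimes G\rightrightarrows G$ on $\mathcal H(\mathcal F)$: - the action $(h,g)\star\xi=h\,\overleftarrow\star\,(g\,\vec\star\,\xi)$; - the action corresponding, under the canonical isomorphism $\varphi:\mathcal H(\mathcal F)\to\pi^{-1}\mathcal H(\mathcal F_M)$, to $(h,g)*(p,[v],q)=(hgp,[v],gq)$. These two actions coincide; in other words, $$\varphi((h,g)\star\xi)=(h,g)*\varphi(\xi)\qquad\text{for all }(h,g)\in G\rtimes G,\ \xi\in\mathcal H(\mathcal F).$$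
   Context: **Foliations.** $\mathfrak X_c(M)$ denotes the compactly supported vector fields on a smooth manifold $M$. A singular foliation on $M$ is a $C^\infty(M)$-submodule $\mathcal F\subset\mathfrak X_c(M)$ with $[\mathcal F,\mathcal F]\subset\mathcal F$ which is locally finitely generated: every point has an open neighbourhood $U$ and $Y^1,\dots,Y^r\in\mathfrak X(U)$ such that $\{X|_U: X\in\mathcal F,\ \mathrm{supp}\,X\subset U\}$ is the $C_c^\infty(U)$-span of the $Y^i$. For a submersion $\pi:P\to M$, $\pi^{-1}\mathcal F$ is the set of $X\in\mathfrak X_c(P)$ such that $d\pi(X)\in\Gamma(\pi^*TM)$ lies in the $C_c^\infty(P)$-span of $\{Y\circ\pi:Y\in\mathcal F\}$. For $g\in G$, $\widehat g:P\to P$ is $p\mapsto gp$; under the assumptions of the claim each $\widehat g$ preserves $\mathcal F$. **Holonomy groupoid.** A bisubmersion of $(M,\mathcal F)$ is a manifold $U$ with submersions $\mathbf t,\mathbf s:U\to M$ such that $\mathbf s^{-1}\mathcal F=\mathbf t^{-1}\mathcal F=\Gamma_c(\ker d\mathbf s)+\Gamma_c(\ker d\mathbf t)$. Morphisms are smooth maps commuting with $\mathbf s,\mathbf t$. The inverse of $(U,\mathbf t,\mathbf s)$ is $(U,\mathbf s,\mathbf t)$; the composition is $U\circ V=U\,{}_{\mathbf s}\!\times_{\mathbf t}V$ with $\mathbf t(u,v)=\mathbf t(u)$, $\mathbf s(u,v)=\mathbf s(v)$. $U$ carries a local diffeomorphism $\phi$ at $u$ if there is a local section $\sigma$ of $\mathbf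 s$ through $u$, transverse to the $\mathbf t$-fibres, with $\phi=\mathbf t\circ\sigma$. Points $u_1\in U_1$, $u_2\in U_2$ are equivalent if some morphism of bisubmersions from a neighbourhood of $u_1$ to $U_2$ maps $u_1$ to $u_2$ (equivalently, $U_1$ at $u_1$ and $U_2$ at $u_2$ carry a common local diffeomorphism). With $I_x$ the functions vanishing at $x$, a path holonomy bisubmersion at $x_0$ is obtained from $X_1,\dots,X_n\in\mathcal F$ whose classes form a basis of $\mathcal F/I_{x_0}\mathcal F$: it is a neighbourhood $U\subset\mathbb R^n\times M$ of $(0,x_0)$ with $\mathbf s(v,x)=x$, $\mathbf t(v,x)=\exp(\sum v_iX_i)(x)$ (time-one flow), which is a bisubmersion with connected $\mathbf s$-fibres. A path holonomy atlas $\mathcal U$ consists of the finite compositions of elements (and their inverses) of a family of path holonomy bisubmersions whose sources cover $M$. The holonomy groupoid is the topological groupoid $\mathcal H(\mathcal F)=\big(\bigsqcup_{U\in\mathcal U}U\big)/\!\sim$ over $M$ with the quotient topology, $\mathbf s[u]=\mathbf s(u)$, $\mathbf t[u]=\mathbf t(u)$, $[u]\circ[v]=[(u,v)]$; up to canonical isomorphism it is independent of $\mathcal U$. An element $[u]$ carries a diffeomorphism if a representative does. **The isomorphism $\varphi$.** $\pi^{-1}\mathcal H(\mathcal F_M)=P\,{}_\pi\!\times_{\mathbf t}\mathcal H(\mathcal F_M)\,{}_{\mathbf s}\!\times_\pi P$ is a groupoid over $P$ with target and source the first and third projections. For a path holonomy atlas $\mathcal U$ of $\mathcal F_M$, the bisubmersions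 $\pi^{-1}U=P\,{}_\pi\!\times_{\mathbf t}U\,{}_{\mathbf s}\!\times_\pi P$, $U\in\mathcal U$, form an atlas for $\mathcal F$ whose groupoid is $\mathcal H(\mathcal F)$, and $\varphi[(p,u,q)]=(p,[u],q)$. **The action $\star$.** For $g\in G$ and $W$ in a path holonomy atlas of $\mathcal F$, $gW:=(W,\widehat g\circ\mathbf t,\widehat g\circ\mathbf s)$ is a bisubmersion all of whose points are equivalent to points of the atlas; $g\,\vec\star\,[v]:=[v]_{gW}$ is the class of $v\in W$ regarded as an element of $gW$. There is a canonical groupoid morphism $\phi:G\times P\to\mathcal H(\mathcal F)$ from the transformation groupoid: $\phi(h,p)$ is the unique element of $\mathcal H(\mathcal F)$ with source $p$ carrying the diffeomorphism $\widehat h$ near $p$ (it is defined on all of $G\times P$ because the infinitesimal generators of the action multiplied by compactly supported functions lie in $\mathcal F$). Put $h\,\overleftarrow\star\,\xi:=\phi(h,\mathbf t(\xi))\circ\xi$. **Lie 2-group.** $G\rtimes G\rightrightarrows G$ has source $(h,g)\mapsto g$, target $(h,g)\mapsto hg$, groupoid composition $(h_2,h_1g)\circ(h_1,g)=(h_2h_1,g)$, and group multiplication $(h_1,g_1)\cdot(h_2,g_2)=(h_1\,g_1h_2g_1^{-1},\,g_1g_2)$. A Lie 2-group action on a groupoid is a group action (on arrows and on objects) whose action map is a groupoid morphism. *)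

theory Defs
  imports "HOL-Analysis.Analysis" "HOL-Algebra.Group"
begin

section \<open>Smooth functions on Euclidean space of variable dimension\<close>

text \<open>
  Bisubmersions of one and the same atlas have different dimensions, so the dimension cannot be
  a type. Points of n-space are sequences vanishing from index n on, with the product topology.
\<close>

definition Rn :: "nat \<Rightarrow> (nat \<Rightarrow> real) set" where
  "Rn n = {x. \<forall>i\<ge>n. x i = 0}"

primrec Ck :: "nat \<Rightarrow> nat \<Rightarrow> ((nat \<Rightarrow> real) \<Rightarrow> real) \<Rightarrow> bool" where
  "Ck 0 n f \<longleftrightarrow> continuous_on (Rn n) f"
| "Ck (Suc k) n f \<longleftrightarrow> continuous_on (Rn n) f \<and>
     (\<forall>i<n. (\<forall>x\<in>Rn n. (\<lambda>t. f (x(i := t))) differentiable (at (x i))) \<and>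
            Ck k n (\<lambda>x. deriv (\<lambda>t. f (x(i := t))) (x i)))"

definition smooth_fun :: "nat \<Rightarrow> ((nat \<Rightarrow> real) \<Rightarrow> real) \<Rightarrow> bool" where
  "smooth_fun n f \<longleftrightarrow> (\<forall>k. Ck k n f)"


section \<open>Smooth manifolds\<close>

text \<open>
  A smooth structure on a set is given by its algebra of smooth functions (a differential
  structure in the sense of Sikorski); by convention these functions are 0 outside the carrier,
  so that functions and derivations have a unique representation. A manifold is such a space
  that is locally diffeomorphic to n-space, Hausdorff and second countable. Open subsets,
  products and fibre products of submersions then carry the structure generated by the obvious
  functions.
\<close>

record 'a smooth_space =
  pts :: "'a set"
  cinf :: "('a \<Rightarrow> real) set"

definition init_top :: "'a set \<Rightarrow> ('a \<Rightarrow> real) set \<Rightarrow> 'a topology" where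
  "init_top S A = topology_generated_by (insert S {{x\<in>S. a x \<in> T} | a T. a \<in> A \<and> open T})"

definition dtop :: "'a smooth_space \<Rightarrow> 'a topology" where
  "dtop X = init_top (pts X) (cinf X)"

text \<open>The structure on \<open>S\<close> generated by a set of functions \<open>A\<close>: the functions which are locally
  of the form \<open>F(a\<^sub>0, \<dots>, a\<^sub>n\<^sub>-\<^sub>1)\<close> with \<open>F\<close> smooth and all \<open>a\<^sub>i\<close> in \<open>A\<close>.\<close>

definition gen :: "'a set \<Rightarrow> ('a \<Rightarrow> real) set \<Rightarrow> 'a smooth_space" where
  "gen S A = \<lparr> pts = S,
     cinf = {f. (\<forall>x. x \<notin> S \<longrightarrow> f x = 0) \<and>
       (\<forall>x\<in>S. \<exists>V n a F. openin (init_top S A) V \<and> x \<in> V \<and> (\<forall>i<n. a i \<in> A) \<and> smooth_fun n F \<and>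
          (\<forall>y\<in>V. f y = F (\<lambda>i::nat. if i < n then a i y else 0)))} \<rparr>"

definition sub :: "'a smooth_space \<Rightarrow> 'a set \<Rightarrow> 'a smooth_space" where
  "sub X S = gen S (cinf X)"

definition euclid :: "nat \<Rightarrow> (nat \<Rightarrow> real) smooth_space" where
  "euclid n = gen (Rn n) {f. smooth_fun n f}"

definition sprod :: "'a smooth_space \<Rightarrow> 'b smooth_space \<Rightarrow> ('a \<times> 'b) smooth_space" where
  "sprod X Y = gen (pts X \<times> pts Y) ({a \<circ> fst | a. a \<in> cinf X} \<union> {b \<circ> snd | b. b \<in> cinf Y})"

definition pull :: "'a set \<Rightarrow> ('a \<Rightarrow> 'b) \<Rightarrow> ('b \<Rightarrow> real) \<Rightarrow> 'a \<Rightarrow> real" where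
  "pull S f a = (\<lambda>x. if x \<in> S then a (f x) else 0)"

definition smooth_map :: "'a smooth_space \<Rightarrow> 'b smooth_space \<Rightarrow> ('a \<Rightarrow> 'b) \<Rightarrow> bool" where
  "smooth_map X Y f \<longleftrightarrow> f ` pts X \<subseteq> pts Y \<and> (\<forall>a\<in>cinf Y. pull (pts X) f a \<in> cinf X)"

definition diffeomorphic :: "'a smooth_space \<Rightarrow> 'b smooth_space \<Rightarrow> bool" where
  "diffeomorphic X Y \<longleftrightarrow> (\<exists>f g. smooth_map X Y f \<and> smooth_map Y X g \<and>
     (\<forall>x\<in>pts X. g (f x) = x) \<and> (\<forall>y\<in>pts Y. f (g y) = y))"

definition second_countable_space :: "'a topology \<Rightarrow> bool" where
  "second_countable_space T \<longleftrightarrow> (\<exists>B. countable B \<and> (\<forall>V\<in>B. openin T V) \<and>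
     (\<forall>V x. openin T V \<and> x \<in> V \<longrightarrow> (\<exists>W\<in>B. x \<in> W \<and> W \<subseteq> V)))"

definition manifold :: "'a smooth_space \<Rightarrow> bool" where
  "manifold X \<longleftrightarrow> X = gen (pts X) (cinf X) \<and>
     Hausdorff_space (dtop X) \<and> second_countable_space (dtop X) \<and>
     (\<exists>n. \<forall>x\<in>pts X. \<exists>V W. openin (dtop X) V \<and> x \<in> V \<and> openin (dtop (euclid n)) W \<and>
        diffeomorphic (sub X V) (sub (euclid n) W))"


section \<open>Tangent vectors, submersions, vector fields\<close>

text \<open>Derivations are extended by 0 to functions that are not smooth on the space.\<close>

definition tvec :: "'a smooth_space \<Rightarrow> 'a \<Rightarrow> (('a \<Rightarrow> real) \<Rightarrow> real) set" where
  "tvec X x = {D. (\<forall>a. a \<notin> cinf X \<longrightarrow> D a = 0) \<and>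
     (\<forall>a\<in>cinf X. \<forall>b\<in>cinf X. \<forall>c. D (\<lambda>y. a y + b y) = D a + D b \<and> D (\<lambda>y. c * a y) = c * D a \<and>
        D (\<lambda>y. a y * b y) = D a * b x + a x * D b)}"

definition dmap :: "'a smooth_space \<Rightarrow> 'b smooth_space \<Rightarrow> ('a \<Rightarrow> 'b) \<Rightarrow>
    (('a \<Rightarrow> real) \<Rightarrow> real) \<Rightarrow> ('b \<Rightarrow> real) \<Rightarrow> real" where
  "dmap X Y f D = (\<lambda>a. if a \<in> cinf Y then D (pull (pts X) f a) else 0)"

definition submersion :: "'a smooth_space \<Rightarrow> 'b smooth_space \<Rightarrow> ('a \<Rightarrow> 'b) \<Rightarrow> bool" where
  "submersion X Y f \<longleftrightarrow> smooth_map X Y f \<and> (\<forall>x\<in>pts X. dmap X Y f ` tvec X x = tvec Y (f x))"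

type_synonym 'a vfield = "('a \<Rightarrow> real) \<Rightarrow> 'a \<Rightarrow> real"

definition vfields :: "'a smooth_space \<Rightarrow> 'a vfield set" where
  "vfields M = {X. (\<forall>a. X a \<in> cinf M) \<and> (\<forall>a. a \<notin> cinf M \<longrightarrow> X a = (\<lambda>_. 0)) \<and>
     (\<forall>a\<in>cinf M. \<forall>b\<in>cinf M. \<forall>c.
        X (\<lambda>y. a y + b y) = (\<lambda>y. X a y + X b y) \<and> X (\<lambda>y. c * a y) = (\<lambda>y. c * X a y) \<and>
        X (\<lambda>y. a y * b y) = (\<lambda>y. X a y * b y + a y * X b y))}"

definition vadd :: "'a vfield \<Rightarrow> 'a vfield \<Rightarrow> 'a vfield" where
  "vadd X Y = (\<lambda>a x. X a x + Y a x)"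

definition vlin :: "nat \<Rightarrow> (nat \<Rightarrow> 'a \<Rightarrow> real) \<Rightarrow> (nat \<Rightarrow> 'a vfield) \<Rightarrow> 'a vfield" where
  "vlin k f Y = (\<lambda>a x. \<Sum>i<k. f i x * Y i a x)"

definition bracket :: "'a vfield \<Rightarrow> 'a vfield \<Rightarrow> 'a vfield" where
  "bracket X Y = (\<lambda>a x. X (Y a) x - Y (X a) x)"

definition supp :: "'a smooth_space \<Rightarrow> 'a vfield \<Rightarrow> 'a set" where
  "supp M X = dtop M closure_of {x\<in>pts M. \<exists>a. X a x \<noteq> 0}"

definition vfields_c :: "'a smooth_space \<Rightarrow> 'a vfield set" where
  "vfields_c M = {X\<in>vfields M. compactin (dtop M) (supp M X)}"

definition cinf_c :: "'a smooth_space \<Rightarrow> ('a \<Rightarrow> real) set" where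
  "cinf_c M = {f\<in>cinf M. compactin (dtop M) (dtop M closure_of {x\<in>pts M. f x \<noteq> 0})}"

definition integral_curve :: "'a smooth_space \<Rightarrow> 'a vfield \<Rightarrow> (real \<Rightarrow> 'a) \<Rightarrow> bool" where
  "integral_curve M X c \<longleftrightarrow> range c \<subseteq> pts M \<and>
     (\<forall>a\<in>cinf M. \<forall>r. ((\<lambda>r. a (c r)) has_real_derivative X a (c r)) (at r))"

text \<open>Time-one flow; used only for compactly supported vector fields, which are complete.\<close>

definition vexp :: "'a smooth_space \<Rightarrow> 'a vfield \<Rightarrow> 'a \<Rightarrow> 'a" where
  "vexp M X x = (THE y. \<exists>c. integral_curve M X c \<and> c 0 = x \<and> c 1 = y)"


section \<open>Singular foliations\<close>

text \<open>\<open>Z\<close> is the restriction of \<open>X\<close> to the open set \<open>V\<close>.\<close>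

definition restricts_to :: "'a smooth_space \<Rightarrow> 'a set \<Rightarrow> 'a vfield \<Rightarrow> 'a vfield \<Rightarrow> bool" where
  "restricts_to M V X Z \<longleftrightarrow> Z \<in> vfields (sub M V) \<and>
     (\<forall>a\<in>cinf M. Z (pull V id a) = pull V id (X a))"

definition locally_fin_gen :: "'a smooth_space \<Rightarrow> 'a vfield set \<Rightarrow> bool" where
  "locally_fin_gen M F \<longleftrightarrow> (\<forall>x\<in>pts M. \<exists>V r Y. openin (dtop M) V \<and> x \<in> V \<and>
     (\<forall>i<r. Y i \<in> vfields (sub M V)) \<and>
     {Z. \<exists>X\<in>F. supp M X \<subseteq> V \<and> restricts_to M V X Z} =
     {vlin r f Y | f. \<forall>i<r. f i \<in> cinf_c (sub M V)})"

definition singular_foliation :: "'a smooth_space \<Rightarrow> 'a vfield set \<Rightarrow> bool" where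
  "singular_foliation M F \<longleftrightarrow> F \<subseteq> vfields_c M \<and>
     (\<lambda>_ _. 0) \<in> F \<and> (\<forall>X\<in>F. \<forall>Y\<in>F. vadd X Y \<in> F) \<and>
     (\<forall>f\<in>cinf M. \<forall>X\<in>F. (\<lambda>a x. f x * X a x) \<in> F) \<and>
     (\<forall>X\<in>F. \<forall>Y\<in>F. bracket X Y \<in> F) \<and> locally_fin_gen M F"

definition ker_c :: "'a smooth_space \<Rightarrow> 'b smooth_space \<Rightarrow> ('a \<Rightarrow> 'b) \<Rightarrow> 'a vfield set" where
  "ker_c P M f = {X\<in>vfields_c P. \<forall>a\<in>cinf M. X (pull (pts P) f a) = (\<lambda>_. 0)}"

text \<open>Sections of the pulled back tangent bundle are derivations along the map.\<close>

definition pullback_fol ::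
    "'a smooth_space \<Rightarrow> 'b smooth_space \<Rightarrow> ('a \<Rightarrow> 'b) \<Rightarrow> 'b vfield set \<Rightarrow> 'a vfield set" where
  "pullback_fol P M f F = {X\<in>vfields_c P. \<exists>k u Y. (\<forall>i<k. u i \<in> cinf_c P \<and> Y i \<in> F) \<and>
     (\<forall>a\<in>cinf M. \<forall>p\<in>pts P. X (pull (pts P) f a) p = (\<Sum>i<(k::nat). u i p * Y i a (f p)))}"


section \<open>Bisubmersions\<close>

record ('u, 'm) bisub =
  total :: "'u smooth_space"
  tgt :: "'u \<Rightarrow> 'm"
  src :: "'u \<Rightarrow> 'm"

definition bisubmersion :: "'m smooth_space \<Rightarrow> 'm vfield set \<Rightarrow> ('u, 'm) bisub \<Rightarrow> bool" where
  "bisubmersion M F B \<longleftrightarrow> manifold (total B) \<and>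
     submersion (total B) M (tgt B) \<and> submersion (total B) M (src B) \<and>
     pullback_fol (total B) M (src B) F = pullback_fol (total B) M (tgt B) F \<and>
     pullback_fol (total B) M (src B) F =
       {vadd X Y | X Y. X \<in> ker_c (total B) M (src B) \<and> Y \<in> ker_c (total B) M (tgt B)}"

definition binv :: "('u, 'm) bisub \<Rightarrow> ('u, 'm) bisub" where
  "binv B = \<lparr> total = total B, tgt = src B, src = tgt B \<rparr>"

definition btranslate :: "('m \<Rightarrow> 'm) \<Rightarrow> ('u, 'm) bisub \<Rightarrow> ('u, 'm) bisub" where
  "btranslate f B = \<lparr> total = total B, tgt = f \<circ> tgt B, src = f \<circ> src B \<rparr>"

definition bpullback ::
    "'p smooth_space \<Rightarrow> ('p \<Rightarrow> 'm) \<Rightarrow> ('u, 'm) bisub \<Rightarrow> ('p \<times> 'u \<times> 'p, 'p) bisub" where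
  "bpullback P \<pi> B = \<lparr> total = gen
       {(p, u, q). p \<in> pts P \<and> u \<in> pts (total B) \<and> q \<in> pts P \<and> \<pi> p = tgt B u \<and> src B u = \<pi> q}
       ({(\<lambda>(p, u, q). a p) | a. a \<in> cinf P} \<union> {(\<lambda>(p, u, q). b u) | b. b \<in> cinf (total B)} \<union>
        {(\<lambda>(p, u, q). a q) | a. a \<in> cinf P}),
     tgt = (\<lambda>(p, u, q). p), src = (\<lambda>(p, u, q). q) \<rparr>"

definition equiv_pt :: "'m smooth_space \<Rightarrow> ('u, 'm) bisub \<Rightarrow> 'u \<Rightarrow> ('v, 'm) bisub \<Rightarrow> 'v \<Rightarrow> bool" where
  "equiv_pt M B u C v \<longleftrightarrow> (\<exists>V f. openin (dtop (total B)) V \<and> u \<in> V \<and>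
     smooth_map (sub (total B) V) (total C) f \<and> f u = v \<and>
     (\<forall>w\<in>V. tgt C (f w) = tgt B w \<and> src C (f w) = src B w))"

text \<open>\<open>B\<close> carries at \<open>u\<close> the germ of \<open>f\<close> at \<open>src B u\<close>. Transversality of the section \<open>s\<close>
  to the target fibres is the condition on tangent spaces.\<close>

definition carries :: "'m smooth_space \<Rightarrow> ('u, 'm) bisub \<Rightarrow> 'u \<Rightarrow> ('m \<Rightarrow> 'm) \<Rightarrow> bool" where
  "carries M B u f \<longleftrightarrow> (\<exists>V s. openin (dtop M) V \<and> src B u \<in> V \<and>
     smooth_map (sub M V) (total B) s \<and> s (src B u) = u \<and>
     (\<forall>x\<in>V. src B (s x) = x \<and> tgt B (s x) = f x \<and>
        tvec (total B) (s x) =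
          {(\<lambda>a. D a + E a) | D E. D \<in> dmap (sub M V) (total B) s ` tvec (sub M V) x \<and>
             E \<in> tvec (total B) (s x) \<and> dmap (total B) M (tgt B) E = (\<lambda>_. 0)}))"


section \<open>Path holonomy atlases\<close>

text \<open>
  All bisubmersions of a path holonomy atlas have points in one type: a point of a path holonomy
  bisubmersion is \<open>Exp v x\<close>, standing for the pair \<open>(v, x)\<close>, and a point of a composition is
  \<open>Comp u v\<close>, standing for the pair \<open>(u, v)\<close>.
\<close>

datatype 'm hpt =
    Exp (param: "nat \<Rightarrow> real") (base: 'm)
  | Comp (outer: "'m hpt") (inner: "'m hpt")

definition exp_space :: "nat \<Rightarrow> 'm smooth_space \<Rightarrow> 'm hpt smooth_space" where
  "exp_space n M = gen {Exp v x | v x. v \<in> Rn n \<and> x \<in> pts M}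
     ({a \<circ> param | a. a \<in> cinf (euclid n)} \<union> {b \<circ> base | b. b \<in> cinf M})"

text \<open>\<open>I\<^sub>x F\<close>, with \<open>I\<^sub>x\<close> the ideal of functions vanishing at \<open>x\<close>.\<close>

definition ideal_fol :: "'m smooth_space \<Rightarrow> 'm vfield set \<Rightarrow> 'm \<Rightarrow> 'm vfield set" where
  "ideal_fol M F x =
     {vlin k f Y | k f Y. \<forall>i<k. f i \<in> cinf M \<and> f i x = 0 \<and> Y i \<in> F}"

definition fibre_basis ::
    "'m smooth_space \<Rightarrow> 'm vfield set \<Rightarrow> 'm \<Rightarrow> nat \<Rightarrow> (nat \<Rightarrow> 'm vfield) \<Rightarrow> bool" where
  "fibre_basis M F x n X \<longleftrightarrow> (\<forall>i<n. X i \<in> F) \<and>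
     (\<forall>Y\<in>F. \<exists>c. (\<lambda>a y. Y a y - vlin n (\<lambda>i _. c i) X a y) \<in> ideal_fol M F x) \<and>
     (\<forall>c. vlin n (\<lambda>i _. c i) X \<in> ideal_fol M F x \<longrightarrow> (\<forall>i<n. c i = 0))"

definition path_holonomy_bisub ::
    "'m smooth_space \<Rightarrow> 'm vfield set \<Rightarrow> 'm \<Rightarrow> ('m hpt, 'm) bisub \<Rightarrow> bool" where
  "path_holonomy_bisub M F x0 B \<longleftrightarrow> x0 \<in> pts M \<and> (\<exists>n X V. fibre_basis M F x0 n X \<and>
     openin (dtop (exp_space n M)) V \<and> Exp (\<lambda>_. 0) x0 \<in> V \<and> total B = sub (exp_space n M) V \<and>
     (\<forall>v x. Exp v x \<in> V \<longrightarrow>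
        src B (Exp v x) = x \<and> tgt B (Exp v x) = vexp M (vlin n (\<lambda>i _. v i) X) x)) \<and>
     bisubmersion M F B \<and>
     (\<forall>x\<in>pts M. connectedin (dtop (total B)) {u\<in>pts (total B). src B u = x})"

definition bcomp :: "('m hpt, 'm) bisub \<Rightarrow> ('m hpt, 'm) bisub \<Rightarrow> ('m hpt, 'm) bisub" where
  "bcomp B C = \<lparr> total = gen
       {Comp u v | u v. u \<in> pts (total B) \<and> v \<in> pts (total C) \<and> src B u = tgt C v}
       ({a \<circ> outer | a. a \<in> cinf (total B)} \<union> {b \<circ> inner | b. b \<in> cinf (total C)}),
     tgt = tgt B \<circ> outer, src = src C \<circ> inner \<rparr>"

inductive_set finite_comps :: "('m hpt, 'm) bisub set \<Rightarrow> ('m hpt, 'm) bisub set"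
  for E :: "('m hpt, 'm) bisub set" where
  "B \<in> E \<Longrightarrow> B \<in> finite_comps E"
| "B \<in> E \<Longrightarrow> binv B \<in> finite_comps E"
| "B \<in> finite_comps E \<Longrightarrow> C \<in> finite_comps E \<Longrightarrow> bcomp B C \<in> finite_comps E"

definition path_holonomy_atlas ::
    "'m smooth_space \<Rightarrow> 'm vfield set \<Rightarrow> ('m hpt, 'm) bisub set \<Rightarrow> bool" where
  "path_holonomy_atlas M F \<U> \<longleftrightarrow> (\<exists>E. (\<forall>B\<in>E. \<exists>x0. path_holonomy_bisub M F x0 B) \<and>
     (\<Union>B\<in>E. src B ` pts (total B)) = pts M \<and> \<U> = finite_comps E)"


section \<open>The holonomy groupoid\<close>

type_synonym 'm hol = "(('m hpt, 'm) bisub \<times> 'm hpt) set"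

text \<open>
  The class, in the groupoid of the atlas \<open>\<U>\<close>, of a point \<open>u\<close> of an arbitrary bisubmersion \<open>B\<close>,
  not necessarily in the atlas: the set of all points of the atlas equivalent to \<open>u\<close>. Functions
  of classes defined through representatives are written with \<^const>\<open>the_elem\<close>, the common value.
\<close>

definition hclass :: "'m smooth_space \<Rightarrow> ('m hpt, 'm) bisub set \<Rightarrow> ('u, 'm) bisub \<Rightarrow> 'u \<Rightarrow> 'm hol" where
  "hclass M \<U> B u = {(C, v). C \<in> \<U> \<and> v \<in> pts (total C) \<and> equiv_pt M B u C v}"

definition holonomy :: "'m smooth_space \<Rightarrow> ('m hpt, 'm) bisub set \<Rightarrow> 'm hol set" where
  "holonomy M \<U> = {hclass M \<U> B u | B u. B \<in> \<U> \<and> u \<in> pts (total B)}"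

definition hsrc :: "'m hol \<Rightarrow> 'm" where
  "hsrc \<xi> = the_elem {src B u | B u. (B, u) \<in> \<xi>}"

definition htgt :: "'m hol \<Rightarrow> 'm" where
  "htgt \<xi> = the_elem {tgt B u | B u. (B, u) \<in> \<xi>}"

definition hcomp :: "'m smooth_space \<Rightarrow> ('m hpt, 'm) bisub set \<Rightarrow> 'm hol \<Rightarrow> 'm hol \<Rightarrow> 'm hol" where
  "hcomp M \<U> \<xi> \<eta> = the_elem {hclass M \<U> (bcomp B C) (Comp u v) | B u C v.
     (B, u) \<in> \<xi> \<and> (C, v) \<in> \<eta> \<and> src B u = tgt C v}"

definition hcarries :: "'m smooth_space \<Rightarrow> 'm hol \<Rightarrow> ('m \<Rightarrow> 'm) \<Rightarrow> bool" where
  "hcarries M \<xi> f \<longleftrightarrow> (\<exists>(B, u)\<in>\<xi>. carries M B u f)"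

text \<open>The canonical map \<open>[(p, u, q)] \<mapsto> (p, [u], q)\<close> from the holonomy groupoid of the pulled back
  foliation (atlas \<open>\<W>\<close>) to the pullback of the holonomy groupoid downstairs (atlas \<open>\<U>\<close>).\<close>

definition hol_iso :: "'p smooth_space \<Rightarrow> 'm smooth_space \<Rightarrow> ('p \<Rightarrow> 'm) \<Rightarrow>
    ('m hpt, 'm) bisub set \<Rightarrow> ('p hpt, 'p) bisub set \<Rightarrow> 'p hol \<Rightarrow> 'p \<times> 'm hol \<times> 'p" where
  "hol_iso P M \<pi> \<U> \<W> \<xi> = the_elem {(p, hclass M \<U> B u, q) | p B u q.
     B \<in> \<U> \<and> (p, u, q) \<in> pts (total (bpullback P \<pi> B)) \<and>
     \<xi> = hclass P \<W> (bpullback P \<pi> B) (p, u, q)}"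


section \<open>Lie groups and principal actions\<close>

definition lie_group :: "('g, 'x) monoid_scheme \<Rightarrow> 'g smooth_space \<Rightarrow> bool" where
  "lie_group G S \<longleftrightarrow> group G \<and> manifold S \<and> pts S = carrier G \<and>
     smooth_map (sprod S S) S (\<lambda>(x, y). x \<otimes>\<^bsub>G\<^esub> y) \<and> smooth_map S S (\<lambda>x. inv\<^bsub>G\<^esub> x)"

definition smooth_action ::
    "('g, 'x) monoid_scheme \<Rightarrow> 'g smooth_space \<Rightarrow> 'p smooth_space \<Rightarrow> ('g \<Rightarrow> 'p \<Rightarrow> 'p) \<Rightarrow> bool" where
  "smooth_action G S P act \<longleftrightarrow> smooth_map (sprod S P) P (\<lambda>(g, p). act g p) \<and>
     (\<forall>p\<in>pts P. act \<one>\<^bsub>G\<^esub> p = p) \<and>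
     (\<forall>g\<in>carrier G. \<forall>h\<in>carrier G. \<forall>p\<in>pts P. act (g \<otimes>\<^bsub>G\<^esub> h) p = act g (act h p))"

definition free_action ::
    "('g, 'x) monoid_scheme \<Rightarrow> 'p smooth_space \<Rightarrow> ('g \<Rightarrow> 'p \<Rightarrow> 'p) \<Rightarrow> bool" where
  "free_action G P act \<longleftrightarrow> (\<forall>g\<in>carrier G. \<forall>p\<in>pts P. act g p = p \<longrightarrow> g = \<one>\<^bsub>G\<^esub>)"

definition proper_action :: "'g smooth_space \<Rightarrow> 'p smooth_space \<Rightarrow> ('g \<Rightarrow> 'p \<Rightarrow> 'p) \<Rightarrow> bool" where
  "proper_action S P act \<longleftrightarrow>
     proper_map (dtop (sprod S P)) (dtop (sprod P P)) (\<lambda>(g, p). (act g p, p))"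

text \<open>\<open>M\<close> with \<open>\<pi>\<close> is the quotient manifold: its points correspond to the orbits, and it carries
  the unique smooth structure making \<open>\<pi>\<close> a submersion.\<close>

definition quotient_manifold :: "('g, 'x) monoid_scheme \<Rightarrow> 'p smooth_space \<Rightarrow> ('g \<Rightarrow> 'p \<Rightarrow> 'p) \<Rightarrow>
    'm smooth_space \<Rightarrow> ('p \<Rightarrow> 'm) \<Rightarrow> bool" where
  "quotient_manifold G P act M \<pi> \<longleftrightarrow> manifold M \<and> submersion P M \<pi> \<and> \<pi> ` pts P = pts M \<and>
     (\<forall>p\<in>pts P. \<forall>q\<in>pts P. \<pi> p = \<pi> q \<longleftrightarrow> (\<exists>g\<in>carrier G. q = act g p))"


section \<open>The two actions\<close>

text \<open>The group of arrows of the Lie 2-group; its elements are written \<open>(h, g)\<close>.\<close>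

definition arrow_group :: "('g, 'x) monoid_scheme \<Rightarrow> ('g \<times> 'g) monoid" where
  "arrow_group G = \<lparr> carrier = carrier G \<times> carrier G,
     mult = (\<lambda>(h1, g1) (h2, g2). (h1 \<otimes>\<^bsub>G\<^esub> (g1 \<otimes>\<^bsub>G\<^esub> h2 \<otimes>\<^bsub>G\<^esub> inv\<^bsub>G\<^esub> g1), g1 \<otimes>\<^bsub>G\<^esub> g2)),
     one = (\<one>\<^bsub>G\<^esub>, \<one>\<^bsub>G\<^esub>) \<rparr>"

definition translate_star :: "'p smooth_space \<Rightarrow> ('p hpt, 'p) bisub set \<Rightarrow> ('g \<Rightarrow> 'p \<Rightarrow> 'p) \<Rightarrow>
    'g \<Rightarrow> 'p hol \<Rightarrow> 'p hol" where
  "translate_star P \<W> act g \<xi> =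
     the_elem {hclass P \<W> (btranslate (act g) W) v | W v. (W, v) \<in> \<xi>}"

definition action_morphism :: "'p smooth_space \<Rightarrow> ('p hpt, 'p) bisub set \<Rightarrow> ('g \<Rightarrow> 'p \<Rightarrow> 'p) \<Rightarrow>
    'g \<Rightarrow> 'p \<Rightarrow> 'p hol" where
  "action_morphism P \<W> act h p =
     (THE \<xi>. \<xi> \<in> holonomy P \<W> \<and> hsrc \<xi> = p \<and> hcarries P \<xi> (act h))"

definition left_star :: "'p smooth_space \<Rightarrow> ('p hpt, 'p) bisub set \<Rightarrow> ('g \<Rightarrow> 'p \<Rightarrow> 'p) \<Rightarrow>
    'g \<Rightarrow> 'p hol \<Rightarrow> 'p hol" where
  "left_star P \<W> act h \<xi> = hcomp P \<W> (action_morphism P \<W> act h (htgt \<xi>)) \<xi>"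

definition star_action :: "'p smooth_space \<Rightarrow> ('p hpt, 'p) bisub set \<Rightarrow> ('g \<Rightarrow> 'p \<Rightarrow> 'p) \<Rightarrow>
    'g \<times> 'g \<Rightarrow> 'p hol \<Rightarrow> 'p hol" where
  "star_action P \<W> act = (\<lambda>(h, g) \<xi>. left_star P \<W> act h (translate_star P \<W> act g \<xi>))"

definition pullback_action :: "('g, 'x) monoid_scheme \<Rightarrow> ('g \<Rightarrow> 'p \<Rightarrow> 'p) \<Rightarrow>
    'g \<times> 'g \<Rightarrow> 'p \<times> 'm hol \<times> 'p \<Rightarrow> 'p \<times> 'm hol \<times> 'p" where
  "pullback_action G act = (\<lambda>(h, g) (p, \<eta>, q). (act (h \<otimes>\<^bsub>G\<^esub> g) p, \<eta>, act g q))"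

end

theory Submission
  imports Defs
begin

text \<open>
  Two points of bisubmersions are equivalent as soon as sections of the two source maps through them
  are moved to the same germ by the target maps; this is where differential equations enter. Points of
  a holonomy groupoid are therefore determined by germs, and germs multiply under composition. A point
  \<open>(p, u, q)\<close> of the pullback of a bisubmersion carries a germ covering that of \<open>u\<close>, and translating it
  by \<open>g\<close> gives \<open>(g p, u, g q)\<close>. The germ of \<open>p \<mapsto> h p\<close> is carried by \<open>(h p, e, p)\<close> with \<open>e\<close> a unit, so
  composition with it turns \<open>(g p, u, g q)\<close> into \<open>(h g p, u, g q)\<close>. That the two atlases upstairs reach
  the same points follows by moving in small steps from the units, along flows of vector fields of the
  foliation in one direction, along flows and inside the connected fibres of \<open>\<pi>\<close> in the other.
\<close>

section \<open>Smooth functions of several variables\<close>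

text \<open>The definition of a bisubmersion is hard to carry over to compositions and pullbacks:
  their total spaces would have to be manifolds again and their vertical fields known. So only
  consequences about moving points are kept (\<open>good\<close>): when the source of a family moves
  along the foliation, so does its target, and every motion of the target along the foliation lifts
  with the source fixed. Such statements pass through a fibre product one factor at a time. The
  families are smooth over an arbitrary parameter space, which need not have charts; parameters are
  therefore turned into initial values of a larger system, and smooth dependence on initial values
  suffices. In place of the inverse function theorem a flow exchanges one coordinate at a time. A
  morphism between bisubmersions of different dimensions has no inverse, so even the symmetry of
  equivalence, and with it the calculus of classes, rests on germs.\<close>

definition pd :: "nat => ((nat => real) => real) => (nat => real) => real" where
 "pd i f = (%x. deriv (%t. f (x(i := t))) (x i))"

text \<open>The form in which \<open>gen\<close> passes finitely many generators to a function of n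
  variables, so that local expressions of smooth functions are literally compositions with
  \<open>trunc\<close>.\<close>

definition trunc :: "nat => (nat => real) => nat => real" where
 "trunc n x = (%i. if i < n then x i else 0)"

lemma trunc_Rn [simp]: "trunc n x \<in> Rn n"
 by (simp add: trunc_def Rn_def)

lemma trunc_id [simp]: "x \<in> Rn n ==> trunc n x = x"
 by (auto simp: trunc_def Rn_def)

lemma trunc_apply [simp]: "i < n ==> trunc n x i = x i"
 by (simp add: trunc_def)

lemma trunc_cong: "(\<And>i. i < n ==> x i = y i) ==> trunc n x = trunc n y"
 by (auto simp: trunc_def)

lemma Rn_upd [simp]: "x \<in> Rn n ==> i < n ==> x(i := t) \<in> Rn n"
 by (simp add: Rn_def)

lemma Rn_eqI: "x \<in> Rn n ==> y \<in> Rn n ==> (\<And>i. i < n ==> x i = y i) ==> x = y"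
 unfolding Rn_def by (rule ext) (metis (mono_tags) leI mem_Collect_eq)

lemma Ck_Suc: "Ck (Suc k) n f \<longleftrightarrow> continuous_on (Rn n) f \<and>
  (\<forall>i<n. (\<forall>x\<in>Rn n. (%t. f (x(i := t))) differentiable (at (x i))) \<and> Ck k n (pd i f))"
 by (simp add: pd_def)

declare Ck.simps(2) [simp del]

lemma pd_cong: "(\<And>x. x \<in> Rn n ==> f x = g x) ==> i < n ==> x \<in> Rn n ==> pd i f x = pd i g x"
 by (simp add: pd_def)

lemma Ck_cong: "(\<And>x. x \<in> Rn n ==> f x = g x) ==> Ck k n f = Ck k n g"
proof (induction k arbitrary: f g)
 case 0
 thus ?case by (simp cong: continuous_on_cong)
next
 case (Suc k)
 have "continuous_on (Rn n) f = continuous_on (Rn n) g"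
  using Suc.prems by (simp cong: continuous_on_cong)
 moreover have "Ck k n (pd i f) = Ck k n (pd i g)" if "i < n" for i
  by (rule Suc.IH) (use Suc.prems that in "auto intro!: pd_cong")
 ultimately show ?case using Suc.prems by (simp add: Ck_Suc)
qed

lemma Ck_continuous: "Ck k n f ==> continuous_on (Rn n) f"
 by (cases k) (auto simp: Ck_Suc)

lemma Ck_SucD: "Ck (Suc k) n f ==> Ck k n f"
 by (induction k arbitrary: f) (auto simp: Ck_Suc)

lemma Ck_pd: "Ck (Suc k) n f ==> i < n ==> Ck k n (pd i f)"
 by (simp add: Ck_Suc)

lemma Ck_DERIV:
 assumes "Ck (Suc k) n f" "i < n" "x \<in> Rn n"
 shows "((%t. f (x(i := t))) has_real_derivative pd i f (x(i := s))) (at s)"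
proof -
 have "(%t. f ((x(i := s))(i := t))) differentiable (at ((x(i := s)) i))"
  using assms unfolding Ck_Suc by (meson Rn_upd)
 hence "((%t. f (x(i := t))) has_real_derivative deriv (%t. f (x(i := t))) s) (at s)"
  by (metis (no_types, lifting) DERIV_deriv_iff_real_differentiable fun_upd_same fun_upd_upd ext)
 thus ?thesis by (simp add: pd_def)
qed

lemma Ck_DERIV0:
 assumes "Ck (Suc k) n f" "i < n" "x \<in> Rn n"
 shows "((%t. f (x(i := t))) has_real_derivative pd i f x) (at (x i))"
 using Ck_DERIV[OF assms, of "x i"] by (simp only: fun_upd_triv)

lemma smooth_cong: "(\<And>x. x \<in> Rn n ==> f x = g x) ==> smooth_fun n f = smooth_fun n g"
 unfolding smooth_fun_def using Ck_cong by blast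

lemma smooth_continuous: "smooth_fun n f ==> continuous_on (Rn n) f"
 unfolding smooth_fun_def using Ck_continuous by blast

lemma smooth_pd: "smooth_fun n f ==> i < n ==> smooth_fun n (pd i f)"
 unfolding smooth_fun_def using Ck_pd by blast

lemma smooth_DERIV:
 "smooth_fun n f ==> i < n ==> x \<in> Rn n ==>
  ((%t. f (x(i := t))) has_real_derivative pd i f (x(i := s))) (at s)"
 unfolding smooth_fun_def using Ck_DERIV by blast

lemma Ck_SucI:
 assumes "continuous_on (Rn n) f"
  and "\<And>i x. i < n ==> x \<in> Rn n ==> ((%t. f (x(i := t))) has_real_derivative d i x) (at (x i))"
  and "\<And>i. i < n ==> Ck k n (d i)"
 shows "Ck (Suc k) n f"
proof -
 have "pd i f x = d i x" if "i < n" "x \<in> Rn n" for i x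
  unfolding pd_def using DERIV_imp_deriv[OF assms(2)[OF that]] .
 hence "Ck k n (pd i f)" if "i < n" for i
  using Ck_cong[of n "pd i f" "d i" k] assms(3) that by auto
 thus ?thesis using assms
  unfolding Ck_Suc by (meson real_differentiable_def)
qed

lemma pd_eqI: "((%t. f (x(i := t))) has_real_derivative d) (at (x i)) ==> pd i f x = d"
 unfolding pd_def by (rule DERIV_imp_deriv)

lemma Ck_const [simp]: "Ck k n (%_. c)"
proof (induction k arbitrary: c)
 case (Suc k)
 show ?case by (rule Ck_SucI[where d = "%_ _. 0"]) (auto simp: Suc)
qed simp

lemma Ck_coord: "Ck k n (%x. x i)"
proof (cases k)
 case 0
 thus ?thesis
  by (simp add: continuous_on_subset[OF continuous_on_product_coordinates])
next
 case (Suc j)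
 show ?thesis unfolding Suc
  by (rule Ck_SucI[where d = "%l _. if l = i then 1 else 0"])
   (auto intro!: derivative_eq_intros continuous_on_subset[OF continuous_on_product_coordinates])
qed

lemma Ck_add: "Ck k n f ==> Ck k n g ==> Ck k n (%x. f x + g x)"
proof (induction k arbitrary: f g)
 case 0
 thus ?case by (simp add: continuous_on_add)
next
 case (Suc k)
 show ?case
 proof (rule Ck_SucI[where d = "%i x. pd i f x + pd i g x"])
  fix i x assume "i < n" "x \<in> Rn n"
  thus "((%t. f (x(i := t)) + g (x(i := t))) has_real_derivative pd i f x + pd i g x) (at (x i))"
   by (intro DERIV_add Ck_DERIV0[OF Suc.prems(1)] Ck_DERIV0[OF Suc.prems(2)])
 qed (use Suc in "auto intro!: continuous_on_add dest: Ck_pd Ck_continuous")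
qed

lemma Ck_mult: "Ck k n f ==> Ck k n g ==> Ck k n (%x. f x * g x)"
proof (induction k arbitrary: f g)
 case 0
 thus ?case by (simp add: continuous_on_mult)
next
 case (Suc k)
 show ?case
 proof (rule Ck_SucI[where d = "%i x. pd i f x * g x + f x * pd i g x"])
  fix i x assume ix: "i < n" "x \<in> Rn n"
  show "((%t. f (x(i := t)) * g (x(i := t))) has_real_derivative pd i f x * g x + f x * pd i g x) (at (x i))"
   using DERIV_mult'[OF Ck_DERIV0[OF Suc.prems(1) ix] Ck_DERIV0[OF Suc.prems(2) ix]]
   by (simp only: fun_upd_triv add.commute)
 qed (use Suc in "auto intro!: continuous_on_mult Ck_add dest: Ck_pd Ck_SucD Ck_continuous")
qed

lemma Ck_sum: "(\<And>i. i \<in> I ==> Ck k n (f i)) ==> Ck k n (%x. \<Sum>i\<in>I. f i x)"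
 by (induction I rule: infinite_finite_induct) (auto intro: Ck_add)

lemma smooth_const [simp]: "smooth_fun n (%_. c)"
 and smooth_coord: "smooth_fun n (%x. x i)"
 and smooth_add: "smooth_fun n f ==> smooth_fun n g ==> smooth_fun n (%x. f x + g x)"
 and smooth_mult: "smooth_fun n f ==> smooth_fun n g ==> smooth_fun n (%x. f x * g x)"
 by (auto simp: smooth_fun_def Ck_coord Ck_add Ck_mult)

lemma smooth_sum: "(\<And>i. i \<in> I ==> smooth_fun n (f i)) ==> smooth_fun n (%x. \<Sum>i\<in>I. f i x)"
 by (auto simp: smooth_fun_def intro: Ck_sum)

lemma smooth_minus: "smooth_fun n f ==> smooth_fun n (%x. - f x)"
 using smooth_mult[of n "%_. -1" f] by simp

lemma smooth_diff: "smooth_fun n f ==> smooth_fun n g ==> smooth_fun n (%x. f x - g x)"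
 using smooth_add[of n f "%x. - g x"] smooth_minus[of n g] by simp

lemma smooth_prod: "(\<And>i. i \<in> I ==> smooth_fun n (f i)) ==> smooth_fun n (%x. \<Prod>i\<in>I. f i x)"
 by (induction I rule: infinite_finite_induct) (auto intro: smooth_mult)

lemmas smooth_intros = smooth_const smooth_coord smooth_add smooth_mult smooth_sum smooth_minus
 smooth_diff smooth_prod

section \<open>Limits, the chain rule and composition\<close>

lemma Rn_tendsto:
 fixes f :: "(nat => real) => real"
 assumes "continuous_on (Rn n) f" "x \<in> Rn n" "\<And>s. \<xi> s \<in> Rn n"
  and "\<And>i. i < n ==> ((%s. \<xi> s i) \<longlongrightarrow> x i) Fl"
 shows "((%s. f (\<xi> s)) \<longlongrightarrow> f x) Fl"
proof -
 have "((%s. \<xi> s i) \<longlongrightarrow> x i) Fl" for i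
 proof (cases "i < n")
  case False
  hence "\<xi> s i = 0" "x i = 0" for s using assms by (auto simp: Rn_def)
  thus ?thesis by simp
 qed (use assms in auto)
 hence "limitin (product_topology (%_. euclidean) UNIV) \<xi> x Fl"
  by (simp add: limitin_componentwise)
 hence "(\<xi> \<longlongrightarrow> x) Fl"
  by (simp add: euclidean_product_topology)
 thus ?thesis
  using continuous_on_tendsto_compose[OF assms(1) _ assms(2), of \<xi> Fl] assms(3) by simp
qed

text \<open>Partial derivatives only see curves, so the chain rule along curves is all that is needed.\<close>

lemma chain_curve:
 assumes F: "Ck 1 m F" and c: "\<And>s. c s \<in> Rn m"
  and d: "\<And>i. i < m ==> ((%s. c s i) has_real_derivative d i) (at t)"
 shows "((%s. F (c s)) has_real_derivative (\<Sum>i<m. pd i F (c t) * d i)) (at t)"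
proof -
 \<comment> \<open>A staircase from \<open>c t\<close> to \<open>c s\<close> that changes one
   coordinate at a time. The mean value theorem turns each step into a partial derivative at a point
   which is, in every coordinate, no farther from \<open>c t\<close> than \<open>c s\<close> is;
   continuity of the partial derivatives then gives the limit.\<close>
 define z where "z s i = (%j. if j < i then c s j else c t j)" for s :: real and i :: nat
 have z_Rn: "z s i \<in> Rn m" for s i
  using c[of s] c[of t] by (auto simp: z_def Rn_def)
 have zSuc: "z s (Suc i) = (z s i)(i := c s i)" and zi: "z s i = (z s i)(i := c t i)" for s i
  by (auto simp: z_def less_Suc_eq)
 have F': "Ck (Suc 0) m F" using F by simp
 have "\<exists>\<xi>. \<xi> \<in> Rn m \<and> (\<forall>j. \<bar>\<xi> j - c t j\<bar> \<le> \<bar>c s j - c t j\<bar>) \<and>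
   F (z s (Suc i)) - F (z s i) = pd i F \<xi> * (c s i - c t i)" if "i < m" for s i
 proof -
  define h where "h = (%u. F ((z s i)(i := u)))"
  define h' where "h' = (%u. pd i F ((z s i)(i := u)))"
  have D: "(h has_real_derivative h' u) (at u)" for u
   unfolding h_def h'_def by (rule Ck_DERIV[OF F' that z_Rn])
  have "\<exists>u. \<bar>u - c t i\<bar> \<le> \<bar>c s i - c t i\<bar> \<and> h (c s i) - h (c t i) = h' u * (c s i - c t i)"
  proof (cases "c s i" "c t i" rule: linorder_cases)
   case less
   then obtain u where "c s i < u" "u < c t i" "h (c t i) - h (c s i) = (c t i - c s i) * h' u"
    using MVT2[of "c s i" "c t i" h h'] D by blast
   thus ?thesis by (intro exI[of _ u]) (auto simp: algebra_simps)
  next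
   case greater
   then obtain u where "c t i < u" "u < c s i" "h (c s i) - h (c t i) = (c s i - c t i) * h' u"
    using MVT2[of "c t i" "c s i" h h'] D by blast
   thus ?thesis by (intro exI[of _ u]) (auto simp: algebra_simps)
  qed auto
  then obtain u where u: "\<bar>u - c t i\<bar> \<le> \<bar>c s i - c t i\<bar>" "h (c s i) - h (c t i) = h' u * (c s i - c t i)"
   by blast
  show ?thesis
  proof (intro exI[of _ "(z s i)(i := u)"] conjI allI)
   show "(z s i)(i := u) \<in> Rn m" using z_Rn that by simp
   show "\<bar>((z s i)(i := u)) j - c t j\<bar> \<le> \<bar>c s j - c t j\<bar>" for j
    using u(1) by (auto simp: z_def)
   show "F (z s (Suc i)) - F (z s i) = pd i F ((z s i)(i := u)) * (c s i - c t i)"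
    using u(2) unfolding h_def h'_def using zSuc zi by metis
  qed
 qed
 hence "\<forall>s i. \<exists>\<xi>. i < m --> \<xi> \<in> Rn m \<and> (\<forall>j. \<bar>\<xi> j - c t j\<bar> \<le> \<bar>c s j - c t j\<bar>) \<and>
   F (z s (Suc i)) - F (z s i) = pd i F \<xi> * (c s i - c t i)"
  by blast
 then obtain \<xi> where \<xi>: "\<And>s i. i < m ==> \<xi> s i \<in> Rn m"
   "\<And>s i j. i < m ==> \<bar>\<xi> s i j - c t j\<bar> \<le> \<bar>c s j - c t j\<bar>"
   "\<And>s i. i < m ==> F (z s (Suc i)) - F (z s i) = pd i F (\<xi> s i) * (c s i - c t i)"
  unfolding choice_iff by blast
 have lim: "((%s. pd i F (\<xi> s i)) \<longlongrightarrow> pd i F (c t)) (at t)" if "i < m" for i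
 proof (rule Rn_tendsto[OF _ c])
  show "continuous_on (Rn m) (pd i F)"
   using Ck_pd[OF F' that] by simp
  fix j assume "j < m"
  have "((%s. c s j - c t j) \<longlongrightarrow> 0) (at t)"
   using DERIV_isCont[OF d[OF \<open>j < m\<close>]] by (simp add: isCont_def LIM_zero)
  hence "((%s. \<bar>c s j - c t j\<bar>) \<longlongrightarrow> 0) (at t)"
   by (simp add: tendsto_rabs_zero)
  hence "((%s. \<xi> s i j - c t j) \<longlongrightarrow> 0) (at t)"
   by (rule Lim_null_comparison[rotated]) (use \<xi>(2)[OF that] in auto)
  thus "((%s. \<xi> s i j) \<longlongrightarrow> c t j) (at t)"
   using LIM_zero_iff by blast
 qed (use \<xi>(1) that in auto)
 have tel: "F (c s) - F (c t) = (\<Sum>i<m. pd i F (\<xi> s i) * (c s i - c t i))" for s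
 proof -
  have "z s m = c s" by (rule Rn_eqI[OF z_Rn c]) (simp add: z_def)
  moreover have "z s 0 = c t" by (simp add: z_def)
  ultimately have "F (c s) - F (c t) = (\<Sum>i<m. F (z s (Suc i)) - F (z s i))"
   using sum_lessThan_telescope[of "%i. F (z s i)" m] by simp
  thus ?thesis using \<xi>(3) by simp
 qed
 have "((%s. \<Sum>i<m. pd i F (\<xi> s i) * ((c s i - c t i) / (s - t))) \<longlongrightarrow> (\<Sum>i<m. pd i F (c t) * d i)) (at t)"
  by (intro tendsto_sum tendsto_mult lim) (use d in "auto simp: has_field_derivative_iff")
 moreover have "(\<Sum>i<m. pd i F (\<xi> s i) * ((c s i - c t i) / (s - t))) = (F (c s) - F (c t)) / (s - t)" for s
  by (simp add: tel sum_divide_distrib)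
 ultimately show ?thesis by (simp add: has_field_derivative_iff)
qed

lemma continuous_trunc:
 fixes g :: "nat => 'a::topological_space => real"
 assumes "\<And>i. i < m ==> continuous_on A (g i)"
 shows "continuous_on A (%x. trunc m (%i. g i x))"
proof (rule continuous_on_coordinatewise_then_product)
 show "continuous_on A (%x. trunc m (%i. g i x) i)" for i
  by (cases "i < m") (use assms in "auto simp: trunc_def")
qed

text \<open>\<open>F\<close> is generalised in the induction because its partial derivatives are
  composed with the same inner functions.\<close>

lemma Ck_compose:
 "Ck k m F ==> (\<And>i. i < m ==> Ck k n (g i)) ==> Ck k n (%x. F (trunc m (%i. g i x)))"
proof (induction k arbitrary: F)
 case 0
 have "continuous_on (Rn n) (F \<circ> (%x. trunc m (%i. g i x)))"
 proof (rule continuous_on_compose)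
  show "continuous_on (Rn n) (%x. trunc m (%i. g i x))"
   by (rule continuous_trunc) (use 0 in auto)
  show "continuous_on ((%x. trunc m (%i. g i x)) ` Rn n) F"
   by (rule continuous_on_subset[of "Rn m"]) (use 0 in auto)
 qed
 thus ?case by (simp add: o_def)
next
 case (Suc k)
 have C1: "Ck 1 m F" using Suc.prems(1)
  by (induction k) (auto dest: Ck_SucD)
 show ?case
 proof (rule Ck_SucI[where d = "%j x. \<Sum>i<m. pd i F (trunc m (%i. g i x)) * pd j (g i) x"])
  have "continuous_on (Rn n) (F \<circ> (%x. trunc m (%i. g i x)))"
  proof (rule continuous_on_compose)
   show "continuous_on (Rn n) (%x. trunc m (%i. g i x))"
    by (rule continuous_trunc) (use Suc Ck_continuous in blast)
   show "continuous_on ((%x. trunc m (%i. g i x)) ` Rn n) F"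
    by (rule continuous_on_subset[of "Rn m"]) (use Suc Ck_continuous in auto)
  qed
  thus "continuous_on (Rn n) (%x. F (trunc m (%i. g i x)))" by (simp add: o_def)
 next
  fix j x assume j: "j < n" "x \<in> Rn n"
  show "((%t. F (trunc m (%i. g i (x(j := t))))) has_real_derivative
     (\<Sum>i<m. pd i F (trunc m (%i. g i x)) * pd j (g i) x)) (at (x j))"
   using chain_curve[OF C1, of "%t. trunc m (%i. g i (x(j := t)))" "%i. pd j (g i) x" "x j"]
    Ck_DERIV0[OF Suc.prems(2) j] by (simp del: fun_upd_apply)
 next
  fix j assume "j < n"
  thus "Ck k n (%x. \<Sum>i<m. pd i F (trunc m (%i. g i x)) * pd j (g i) x)"
   using Suc by (auto intro!: Ck_sum Ck_mult Suc.IH dest: Ck_pd Ck_SucD)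
 qed
qed

lemma smooth_compose:
 "smooth_fun m F ==> (\<And>i. i < m ==> smooth_fun n (g i)) ==> smooth_fun n (%x. F (trunc m (%i. g i x)))"
 unfolding smooth_fun_def using Ck_compose by blast

lemma smooth_compose': "smooth_fun m F ==> (\<And>i. i < m ==> smooth_fun n (%x. g x i)) ==>
  (\<And>x. x \<in> Rn n ==> g x \<in> Rn m) ==> smooth_fun n (%x. F (g x))"
 using smooth_compose[of m F n "%i x. g x i"] smooth_cong[of n "%x. F (trunc m (g x))" "%x. F (g x)"]
 by simp

lemma pd_compose:
 assumes F: "smooth_fun m F" and "\<And>i. i < m ==> smooth_fun n (g i)" "j < n" "x \<in> Rn n"
 shows "pd j (%x. F (trunc m (%i. g i x))) x = (\<Sum>i<m. pd i F (trunc m (%i. g i x)) * pd j (g i) x)"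
 using chain_curve[of m F "%t. trunc m (%i. g i (x(j := t)))" "%i. pd j (g i) x" "x j"] assms
  smooth_DERIV[OF assms(2-4), of _ "x j"] by (intro pd_eqI) (simp add: smooth_fun_def del: fun_upd_apply)

lemma smooth_chain:
 assumes "smooth_fun m F" "\<And>s. c s \<in> Rn m"
  and "\<And>i. i < m ==> ((%s. c s i) has_real_derivative d i) (at t)"
 shows "((%s. F (c s)) has_real_derivative (\<Sum>i<m. pd i F (c t) * d i)) (at t)"
 using chain_curve[of m F c d t] assms by (simp add: smooth_fun_def)

text \<open>The outer function comes with the tower of all its derivatives. Differentiating once
  moves one level up the tower, so the induction on the order must range over all levels.\<close>

lemma smooth_univariate:
 assumes h: "h 0 = f" "\<And>k t. (h k has_real_derivative h (Suc k) t) (at t)" and g: "smooth_fun n g"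
 shows "smooth_fun n (%x. f (g x))"
proof -
 have "Ck k n (%x. h j (g x))" for k j
 proof (induction k arbitrary: j)
  case 0
  have "continuous_on UNIV (h j)"
   using DERIV_isCont[OF h(2)] by (auto simp: continuous_on_eq_continuous_at)
  thus ?case using smooth_continuous[OF g]
   by (auto intro: continuous_on_compose2)
 next
  case (Suc k)
  show ?case
  proof (rule Ck_SucI[where d = "%i x. h (Suc j) (g x) * pd i g x"])
   have "continuous_on UNIV (h j)"
    using DERIV_isCont[OF h(2)] by (auto simp: continuous_on_eq_continuous_at)
   thus "continuous_on (Rn n) (%x. h j (g x))" using smooth_continuous[OF g]
    by (auto intro: continuous_on_compose2)
   show "((%t. h j (g (x(i := t)))) has_real_derivative h (Suc j) (g x) * pd i g x) (at (x i))"
    if "i < n" "x \<in> Rn n" for i x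
    using DERIV_chain2[OF _ smooth_DERIV[OF g that, of "x i"], of "h j" "h (Suc j) (g x)"] h(2)
    by simp
   show "Ck k n (%x. h (Suc j) (g x) * pd i g x)" if "i < n" for i
    using Suc smooth_pd[OF g that] by (auto intro!: Ck_mult simp: smooth_fun_def)
  qed
 qed
 thus ?thesis using h(1) by (auto simp: smooth_fun_def)
qed

text \<open>The partial derivatives of \<open>1 / g\<close> are products of those of
  \<open>g\<close> with \<open>1 / g\<close> itself, so the induction on the order closes.\<close>

lemma smooth_inverse:
 assumes g: "smooth_fun n g" and nz: "\<And>x. x \<in> Rn n ==> g x \<noteq> 0"
 shows "smooth_fun n (%x. 1 / g x)"
proof -
 have "Ck k n (%x. 1 / g x)" for k
 proof (induction k)
  case 0
  show ?case using smooth_continuous[OF g] nz by (auto intro!: continuous_on_divide)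
 next
  case (Suc k)
  show ?case
  proof (rule Ck_SucI[where d = "%i x. (- 1) * (pd i g x * ((1 / g x) * (1 / g x)))"])
   show "continuous_on (Rn n) (%x. 1 / g x)"
    using smooth_continuous[OF g] nz by (auto intro!: continuous_on_divide)
   show "((%t. 1 / g (x(i := t))) has_real_derivative (- 1) * (pd i g x * ((1 / g x) * (1 / g x)))) (at (x i))"
    if "i < n" "x \<in> Rn n" for i x
    using smooth_DERIV[OF g that, of "x i"] nz[OF that(2)]
    by (auto intro!: derivative_eq_intros simp: divide_simps)
   show "Ck k n (%x. (- 1) * (pd i g x * ((1 / g x) * (1 / g x))))" if "i < n" for i
    using Suc smooth_pd[OF g that] by (intro Ck_mult Ck_const) (auto simp: smooth_fun_def)
  qed
 qed
 thus ?thesis by (simp add: smooth_fun_def)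
qed

definition cube :: "nat => (nat => real) => real => (nat => real) set" where
 "cube n x r = {y \<in> Rn n. \<forall>i<n. \<bar>y i - x i\<bar> < r}"

lemma cube_mem [simp]: "x \<in> Rn n ==> r > 0 ==> x \<in> cube n x r"
 by (simp add: cube_def)

lemma cube_mono: "r \<le> s ==> cube n x r \<subseteq> cube n x s"
 by (force simp: cube_def)

lemma Rn_limit:
 assumes "x \<in> Rn n" "\<And>s. \<xi> s \<in> Rn n"
  and "\<And>i. i < n ==> ((%s. \<xi> s i) \<longlongrightarrow> x i) Fl"
 shows "(\<xi> \<longlongrightarrow> x) Fl"
proof -
 have "((%s. \<xi> s i) \<longlongrightarrow> x i) Fl" for i
 proof (cases "i < n")
  case False
  hence "\<xi> s i = 0" "x i = 0" for s using assms by (auto simp: Rn_def)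
  thus ?thesis by simp
 qed (use assms in auto)
 hence "limitin (product_topology (%_. euclidean) UNIV) \<xi> x Fl"
  by (simp add: limitin_componentwise)
 thus ?thesis
  by (simp add: euclidean_product_topology)
qed

text \<open>Otherwise points outside \<open>V\<close> in the cubes of radius
  \<open>1 / Suc k\<close> would converge to \<open>x\<close>: coordinates from index n on vanish,
  so control of the first n suffices.\<close>

lemma cube_nbhd:
 assumes "openin (top_of_set (Rn n)) V" "x \<in> V"
 shows "\<exists>r>0. cube n x r \<subseteq> V"
proof (rule ccontr)
 assume "\<not> ?thesis"
 hence "\<forall>k. \<exists>y. y \<in> cube n x (1 / Suc k) \<and> y \<notin> V"
  by (metis divide_pos_pos of_nat_0_less_iff subsetI zero_less_Suc zero_less_one)
 then obtain y where y: "\<And>k. y k \<in> cube n x (1 / Suc k)" "\<And>k. y k \<notin> V" by metis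
 from assms obtain T where T: "open T" "V = Rn n \<inter> T"
  by (auto simp: openin_open)
 have xR: "x \<in> Rn n" using T assms by auto
 have "(y \<longlongrightarrow> x) sequentially"
 proof (rule Rn_limit[OF xR])
  show "y k \<in> Rn n" for k using y(1)[of k] by (simp add: cube_def)
  fix i assume i: "i < n"
  have "(%k. y k i - x i) \<longlonglongrightarrow> 0"
  proof (rule Lim_null_comparison)
   show "\<forall>\<^sub>F k in sequentially. norm (y k i - x i) \<le> 1 / Suc k"
    using y(1) i by (auto simp: cube_def less_imp_le)
   show "(%k. 1 / real (Suc k)) \<longlonglongrightarrow> 0"
    using LIMSEQ_inverse_real_of_nat by (simp add: inverse_eq_divide)
  qed
  thus "(%k. y k i) \<longlonglongrightarrow> x i" using LIM_zero_iff by blast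
 qed
 hence "\<forall>\<^sub>F k in sequentially. y k \<in> T"
  using T assms by (simp add: topological_tendstoD)
 then obtain k where "y k \<in> T" using eventually_happens by force
 moreover have "y k \<in> Rn n" using y(1)[of k] by (simp add: cube_def)
 ultimately show False using y(2) T by blast
qed

lemma continuous_cube:
 fixes f :: "(nat => real) => real"
 assumes f: "continuous_on (Rn n) f" and "x \<in> Rn n" "open T" "f x \<in> T"
 shows "\<exists>r>0. \<forall>y\<in>cube n x r. f y \<in> T"
proof -
 have "openin (top_of_set (Rn n)) (Rn n \<inter> f -` T)"
  using continuous_openin_preimage_gen[OF f \<open>open T\<close>] .
 from cube_nbhd[OF this, of x] obtain r where "r > 0" "cube n x r \<subseteq> Rn n \<inter> f -` T"
  using assms by auto
 thus ?thesis by blast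
qed

lemma continuous_compose_Rn:
 fixes c :: "'a::topological_space => nat => real"
 assumes "continuous_on (Rn m) F" "\<And>p. p \<in> A ==> c p \<in> Rn m"
  and "\<And>i. i < m ==> continuous_on A (%p. c p i)"
 shows "continuous_on A (%p. F (c p) :: real)"
proof -
 have "continuous_on A c"
 proof (rule continuous_on_coordinatewise_then_product)
  fix i
  show "continuous_on A (%p. c p i)"
  proof (cases "i < m")
   case False
   hence "\<And>p. p \<in> A ==> c p i = 0" using assms(2) by (auto simp: Rn_def)
   thus ?thesis by (simp cong: continuous_on_cong)
  qed (use assms in auto)
 qed
 thus ?thesis
  using assms by (intro continuous_on_compose2[OF assms(1)]) auto
qed

subsection \<open>Bump functions\<close>

text \<open>Differentiating p(1/t) exp(-1/t) replaces p(u) by u^2 (p(u) - p'(u)), where u = 1/t.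
  Hence \<open>flat k\<close> is the k-th derivative of the function that is exp(-1/t) for t > 0 and
  0 elsewhere.\<close>

primrec flat_poly :: "nat => real poly" where
 "flat_poly 0 = 1"
| "flat_poly (Suc k) = [:0, 0, 1:] * (flat_poly k - pderiv (flat_poly k))"

definition flat :: "nat => real => real" where
 "flat k t = (if t > 0 then poly (flat_poly k) (1 / t) * exp (- 1 / t) else 0)"

lemma poly_exp_tendsto_0: "((%u::real. poly p u * exp (- u)) \<longlongrightarrow> 0) at_top"
proof -
 have "((%u::real. \<Sum>i\<le>degree p. coeff p i * (u ^ i / exp u)) \<longlongrightarrow> (\<Sum>i\<le>degree p. coeff p i * 0)) at_top"
  by (intro tendsto_intros tendsto_power_div_exp_0)
 thus ?thesis
  by (simp add: poly_altdef sum_distrib_right exp_minus divide_inverse mult.assoc)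
qed

text \<open>Only t = 0 is delicate. From the right the difference quotient is again a polynomial in
  1/t times exp(-1/t) and tends to 0; from the left it is 0.\<close>

lemma flat_DERIV: "(flat k has_real_derivative flat (Suc k) t) (at t)"
proof (cases "t > 0")
 case True
 have "((%s. poly (flat_poly k) (1 / s) * exp (- 1 / s)) has_real_derivative flat (Suc k) t) (at t)"
  unfolding flat_def using True
  by (auto intro!: derivative_eq_intros DERIV_chain2[OF poly_DERIV] simp: field_simps power2_eq_square)
 thus ?thesis
 proof (rule has_field_derivative_transform_within_open[of _ _ _ "{0<..}"])
  show "poly (flat_poly k) (1 / s) * exp (- 1 / s) = flat k s" if "s \<in> {0<..}" for s
   using that by (simp add: flat_def)
 qed (use True in auto)
next
 case False
 show ?thesis
 proof (cases "t < 0")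
  case True
  have "((%s::real. 0::real) has_real_derivative flat (Suc k) t) (at t)"
   using True by (simp add: flat_def)
  thus ?thesis
   by (rule has_field_derivative_transform_within_open[of _ _ _ "{..<0}"])
    (use True in "auto simp: flat_def")
 next
  case f2: False
  have t0: "t = 0" using False f2 by auto
  have "((%s. flat k s / s) \<longlongrightarrow> 0) (at_right 0)"
  proof -
   have "((%s. poly ([:0, 1:] * flat_poly k) (inverse s) * exp (- inverse s)) \<longlongrightarrow> 0) (at_right (0::real))"
    by (rule filterlim_compose[OF poly_exp_tendsto_0 filterlim_inverse_at_top_right])
   thus ?thesis
    by (rule Lim_transform_eventually)
     (auto simp: eventually_at_right_field flat_def field_simps intro!: exI[of _ 1])
  qed
  moreover have "((%s. flat k s / s) \<longlongrightarrow> 0) (at_left 0)"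
   by (rule tendsto_eventually) (auto simp: eventually_at_left_field flat_def intro!: exI[of _ "-1"])
  ultimately have "((%s. flat k s / s) \<longlongrightarrow> 0) (at 0)"
   by (rule filterlim_split_at_real[rotated])
  thus ?thesis unfolding t0 by (simp add: has_field_derivative_iff flat_def)
 qed
qed

lemma smooth_flat: "smooth_fun n g ==> smooth_fun n (%x. flat 0 (g x))"
 by (rule smooth_univariate[of flat]) (auto simp: flat_DERIV)

definition smooth_step :: "real => real" where
 "smooth_step t = flat 0 t * (1 / (flat 0 t + flat 0 (1 - t)))"

lemma flat_sum_pos: "flat 0 t + flat 0 (1 - t) > 0"
 by (auto simp: flat_def intro: add_pos_pos)

lemma smooth_smooth_step: "smooth_fun n g ==> smooth_fun n (%x. smooth_step (g x))"
 unfolding smooth_step_def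
 by (intro smooth_mult smooth_inverse smooth_add smooth_flat smooth_diff smooth_const)
  (use flat_sum_pos in "auto simp: less_imp_neq[THEN not_sym]")

lemma smooth_step_eqs:
 "t \<ge> 1 ==> smooth_step t = 1" "t \<le> 0 ==> smooth_step t = 0"
 "0 \<le> smooth_step t" "smooth_step t \<le> 1"
proof -
 have "flat 0 s \<ge> 0" for s by (simp add: flat_def)
 thus "0 \<le> smooth_step t" "smooth_step t \<le> 1"
  using flat_sum_pos[of t] by (auto simp: smooth_step_def field_simps)
qed (auto simp: smooth_step_def flat_def)

lemma bump_exists:
 assumes "r > 0"
 shows "\<exists>b. smooth_fun n b \<and> (\<forall>x. 0 \<le> b x \<and> b x \<le> 1) \<and> (\<forall>x\<in>cube n c (r/2). b x = 1) \<and>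
  (\<forall>x. b x \<noteq> 0 --> (\<forall>i<n. \<bar>x i - c i\<bar> < 3 * r / 4))"
proof (intro exI conjI allI ballI impI)
 \<comment> \<open>Squares keep the argument smooth. It is at least 1 when the distance is at most
   r/2, and at most 0 when the distance is at least 3r/4, because (3/2)^2 exceeds 2.\<close>
 let ?b = "%x. \<Prod>i<n. smooth_step (2 - ((x i - c i) * (2 / r)) * ((x i - c i) * (2 / r)))"
 show "smooth_fun n ?b"
  by (intro smooth_intros smooth_smooth_step)
 show "0 \<le> ?b x" for x by (intro prod_nonneg) (auto simp: smooth_step_eqs)
 show "?b x \<le> 1" for x by (intro prod_le_1) (auto simp: smooth_step_eqs)
 show "?b x = 1" if "x \<in> cube n c (r/2)" for x
 proof (rule prod.neutral, safe)
  fix i assume "i < n"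
  hence "\<bar>x i - c i\<bar> < r / 2" using that by (simp add: cube_def)
  hence "\<bar>x i - c i\<bar> * (2 / r) \<le> 1" using assms by (simp add: field_simps del: abs_mult_pos)
  hence "\<bar>(x i - c i) * (2 / r)\<bar> \<le> 1" using assms by (simp only: abs_mult) simp
  hence "((x i - c i) * (2 / r)) * ((x i - c i) * (2 / r)) \<le> 1"
   by (metis abs_square_le_1 power2_eq_square)
  thus "smooth_step (2 - ((x i - c i) * (2 / r)) * ((x i - c i) * (2 / r))) = 1"
   by (intro smooth_step_eqs) linarith
 qed
 show "\<bar>x i - c i\<bar> < 3 * r / 4" if "?b x \<noteq> 0" "i < n" for x i
 proof (rule ccontr)
  assume "\<not> ?thesis"
  hence "3 / 2 \<le> \<bar>x i - c i\<bar> * (2 / r)" using assms by (simp add: field_simps del: abs_mult_pos)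
  hence "3 / 2 \<le> \<bar>(x i - c i) * (2 / r)\<bar>" using assms by (simp only: abs_mult) simp
  hence "(3/2)\<^sup>2 \<le> ((x i - c i) * (2 / r))\<^sup>2"
   by (metis abs_ge_zero power2_abs power_mono zero_le_divide_iff zero_le_numeral)
  hence "2 \<le> ((x i - c i) * (2 / r)) * ((x i - c i) * (2 / r))"
   unfolding power2_eq_square[of "(x i - c i) * (2 / r)", symmetric]
   by (rule order_trans[rotated]) (simp add: power2_eq_square)
  hence "smooth_step (2 - ((x i - c i) * (2 / r)) * ((x i - c i) * (2 / r))) = 0"
   by (intro smooth_step_eqs) linarith
  hence "?b x = 0" using \<open>i < n\<close> by (intro prod_zero) auto
  thus False using that by simp
 qed
qed

subsection \<open>Parameter integrals and Hadamard's lemma\<close>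

definition cat :: "nat => (nat => real) => (nat => real) => nat => real" where
 "cat n x y = (%i. if i < n then x i else y (i - n))"

lemma cat_Rn [simp]: "y \<in> Rn m ==> cat n x y \<in> Rn (n + m)"
 by (auto simp: cat_def Rn_def)

lemma cat_simps [simp]: "i < n ==> cat n x y i = x i" "cat n x y (n + i) = y i"
 by (auto simp: cat_def)

abbreviation scons :: "real => (nat => real) => nat => real" where
 "scons t x \<equiv> case_nat t x"

lemma scons_Rn [simp]: "x \<in> Rn n ==> scons t x \<in> Rn (Suc n)"
 by (auto simp: Rn_def split: nat.split)

lemma scons_upd: "(scons t x)(0 := s) = scons s x" "(scons t x)(Suc i := s) = scons t (x(i := s))"
 by (auto split: nat.split)

text \<open>Partial derivatives pass under the integral and yield integrals of the same kind.
  Variable i of the parameter is variable \<open>Suc i\<close> of the integrand, variable 0 being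
  the one integrated.\<close>

lemma smooth_integral:
 assumes "smooth_fun (Suc n) F"
 shows "smooth_fun n (%x. integral {0..1} (%s. F (scons s x)))"
proof -
 have C: "continuous_on (Rn n \<times> cbox 0 1) (%(x, s). F (scons s x))" if "smooth_fun (Suc n) F" for F
 proof -
  have "continuous_on (Rn n \<times> cbox 0 1) (%p. F (scons (snd p) (fst p)))"
  proof (rule continuous_compose_Rn[OF smooth_continuous[OF that]])
   show "continuous_on (Rn n \<times> cbox 0 1) (%p. scons (snd p) (fst p) i)" for i
   proof (cases i)
    case 0
    thus ?thesis by (simp add: continuous_intros)
   next
    case (Suc j)
    have "continuous_on UNIV (%x::nat => real. x j)" by (rule continuous_on_product_coordinates)
    from continuous_on_compose2[OF this continuous_on_fst[OF continuous_on_id]]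
    show ?thesis using Suc by simp
   qed
  qed auto
  thus ?thesis by (simp add: case_prod_beta)
 qed
 have "smooth_fun (Suc n) F ==> Ck k n (%x. integral {0..1} (%s. F (scons s x)))" for k
 proof (induction k arbitrary: F)
  case 0
  show ?case using integral_continuous_on_param[OF C[OF 0]] by simp
 next
  case (Suc k)
  show ?case
  proof (rule Ck_SucI[where d = "%i x. integral {0..1} (%s. pd (Suc i) F (scons s x))"])
   show "continuous_on (Rn n) (%x. integral {0..1} (%s. F (scons s x)))"
    using integral_continuous_on_param[OF C[OF Suc.prems]] by simp
   fix i assume i: "i < n"
   show "Ck k n (%x. integral {0..1} (%s. pd (Suc i) F (scons s x)))"
    by (rule Suc.IH) (use Suc.prems i in "auto intro: smooth_pd")
   fix x assume x: "x \<in> Rn n"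
   have "((%u. integral (cbox 0 1) (%s. F (scons s (x(i := u))))) has_real_derivative
     integral (cbox 0 1) (%s. pd (Suc i) F (scons s (x(i := x i))))) (at (x i) within UNIV)"
   proof (rule leibniz_rule_field_derivative[of UNIV 0 1 "%u s. F (scons s (x(i := u)))"
      "%u s. pd (Suc i) F (scons s (x(i := u)))"])
    show "((%u. F (scons s (x(i := u)))) has_real_derivative pd (Suc i) F (scons s (x(i := u)))) (at u within UNIV)"
     for u s
     using smooth_DERIV[OF Suc.prems, of "Suc i" "scons s x" u] i x by (simp add: scons_upd)
    have CC: "continuous_on (UNIV \<times> cbox 0 1) (%(u, s). G (scons s (x(i := u))))" if "smooth_fun (Suc n) G" for G
    proof -
     have "continuous_on (UNIV \<times> cbox 0 1) (%p. G (scons (snd p) (x(i := fst p))))"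
     proof (rule continuous_compose_Rn[OF smooth_continuous[OF that]])
      show "continuous_on (UNIV \<times> cbox 0 1) (%p. scons (snd p) (x(i := fst p)) j)" for j
       by (cases j; cases "j = Suc i") (auto intro!: continuous_intros)
     qed (use x i in auto)
     thus ?thesis by (simp add: case_prod_beta)
    qed
    show "continuous_on (UNIV \<times> cbox 0 1) (%(u, s). pd (Suc i) F (scons s (x(i := u))))"
     by (rule CC) (use Suc.prems i in "auto intro: smooth_pd")
    show "(%s. F (scons s (x(i := u)))) integrable_on cbox 0 1" for u
    proof (rule integrable_continuous)
     show "continuous_on (cbox 0 1) (%s. F (scons s (x(i := u))))"
     proof (rule continuous_compose_Rn[OF smooth_continuous[OF Suc.prems]])
      show "continuous_on (cbox 0 1) (%s. scons s (x(i := u)) j)" for j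
       by (cases j) (auto intro!: continuous_intros)
     qed (use x i in auto)
    qed
   qed auto
   thus "((%u. integral {0..1} (%s. F (scons s (x(i := u))))) has_real_derivative
     integral {0..1} (%s. pd (Suc i) F (scons s x))) (at (x i))"
    by simp
  qed
 qed
 thus ?thesis using assms by (simp add: smooth_fun_def)
qed

text \<open>The two-point form: g_j(x, y) is the integral of \<partial>_j f over the segment from x
  to y, and it is smooth in both end points jointly. This yields Lipschitz bounds on cubes, the
  chain rule for derivations and the variational equation of a flow.\<close>

lemma hadamard:
 assumes f: "smooth_fun n f"
 obtains g where "\<And>j. j < n ==> smooth_fun (n + n) (g j)"
  "\<And>x y. x \<in> Rn n ==> y \<in> Rn n ==> f y - f x = (\<Sum>j<n. (y j - x j) * g j (cat n x y))"
  "\<And>j x. j < n ==> x \<in> Rn n ==> g j (cat n x x) = pd j f x"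
proof -
 \<comment> \<open>The variables of \<open>w\<close> are s, then the n coordinates of x, then those
   of y; the argument of the derivative is x + s (y - x).\<close>
 define G where "G j w = pd j f (trunc n (%i. w (Suc i) + w 0 * (w (Suc (n + i)) - w (Suc i))))" for j and w :: "nat => real"
 define g where "g j z = integral {0..1} (%s. G j (scons s z))" for j and z :: "nat => real"
 have G: "smooth_fun (Suc (n + n)) (G j)" if "j < n" for j
  unfolding G_def by (intro smooth_compose[OF smooth_pd[OF f that]] smooth_intros)
 have Gc: "G j (scons s (cat n x y)) = pd j f (%i. x i + s * (y i - x i))" if "x \<in> Rn n" "y \<in> Rn n" for j s x y
 proof -
  have "(%i. x i + s * (y i - x i)) \<in> Rn n" using that by (simp add: Rn_def)
  hence "trunc n (%i. cat n x y i + s * (cat n x y (n + i) - cat n x y i)) = (%i. x i + s * (y i - x i))"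
   by (intro Rn_eqI[of _ n]) auto
  thus ?thesis by (simp add: G_def)
 qed
 show thesis
 proof
  show "smooth_fun (n + n) (g j)" if "j < n" for j
   unfolding g_def by (rule smooth_integral[OF G[OF that]])
  show "g j (cat n x x) = pd j f x" if "j < n" "x \<in> Rn n" for j x
   using that by (simp add: g_def Gc)
  fix x y assume xy: "x \<in> Rn n" "y \<in> Rn n"
  define c where "c s = (%i. x i + s * (y i - x i))" for s :: real
  have c: "c s \<in> Rn n" for s using xy by (simp add: c_def Rn_def)
  have "((%s. \<Sum>j<n. pd j f (c s) * (y j - x j)) has_integral f (c 1) - f (c 0)) {0..1}"
  proof (rule fundamental_theorem_of_calculus)
   show "((%s. f (c s)) has_vector_derivative (\<Sum>j<n. pd j f (c s) * (y j - x j))) (at s within {0..1})"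
    if "s \<in> {0..1}" for s
   proof -
    have "((%s. f (c s)) has_real_derivative (\<Sum>j<n. pd j f (c s) * (y j - x j))) (at s)"
     by (rule smooth_chain[OF f c]) (auto simp: c_def intro!: derivative_eq_intros)
    thus ?thesis
     using has_field_derivative_at_within has_real_derivative_iff_has_vector_derivative by blast
   qed
  qed simp
  moreover have "((%s. \<Sum>j<n. pd j f (c s) * (y j - x j)) has_integral
    (\<Sum>j<n. g j (cat n x y) * (y j - x j))) {0..1}"
  proof (intro has_integral_sum has_integral_mult_left)
   fix j assume j: "j \<in> {..<n}"
   have "continuous_on {0..1} (%s. pd j f (c s))"
    by (rule continuous_compose_Rn[OF smooth_continuous[OF smooth_pd[OF f]]])
     (use j c in "auto simp: c_def intro!: continuous_intros")
   hence "(%s. pd j f (c s)) integrable_on {0..1}"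
    by (rule integrable_continuous_real)
   thus "((%s. pd j f (c s)) has_integral g j (cat n x y)) {0..1}"
    unfolding g_def Gc[OF xy] c_def by (rule integrable_integral)
  qed simp
  ultimately have "f (c 1) - f (c 0) = (\<Sum>j<n. g j (cat n x y) * (y j - x j))"
   by (rule has_integral_unique)
  moreover have "c 1 = y" "c 0 = x" by (auto simp: c_def)
  ultimately show "f y - f x = (\<Sum>j<n. (y j - x j) * g j (cat n x y))"
   by (simp add: mult.commute)
 qed
qed

section \<open>Ordinary differential equations\<close>

lemma antiderivative_exists:
 assumes "continuous_on UNIV (g :: real => real)"
 obtains G where "G 0 = 0" "\<And>t. (G has_real_derivative g t) (at t)"
proof -
 have "\<exists>F. \<forall>x::real. - \<infinity> < ereal x --> ereal x < \<infinity> --> (F has_vector_derivative g x) (at x)"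
  by (rule einterval_antiderivative) (use assms in "auto simp: continuous_on_eq_continuous_at")
 then obtain F where F: "\<And>x. (F has_real_derivative g x) (at x)"
  by (auto simp: has_real_derivative_iff_has_vector_derivative)
 show thesis
  by (rule that[of "%t. F t - F 0"]) (auto intro!: derivative_eq_intros F)
qed

text \<open>The exponential weight for the Picard iteration: a derivative bounded by M K exp(K |t|)
  integrates to at most M exp(K |t|), without a factor that grows with the interval. Negative times
  are reduced to positive ones by reflection.\<close>

lemma exp_comparison:
 fixes G :: "real => real"
 assumes G: "\<And>t. abs t \<le> T ==> (G has_real_derivative g t) (at t)" "G 0 = 0" and "M \<ge> 0"
  and b: "\<And>t. abs t \<le> T ==> \<bar>g t\<bar> \<le> M * K * exp (K * abs t)" and t: "abs t \<le> T"
 shows "\<bar>G t\<bar> \<le> M * exp (K * abs t)"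
proof -
 have pos: "G t \<le> M * exp (K * t)"
  if G: "\<And>t. [|0 \<le> t; t \<le> T|] ==> (G has_real_derivative g t) (at t)" "G 0 = 0"
   and b: "\<And>t. [|0 \<le> t; t \<le> T|] ==> g t \<le> M * K * exp (K * t)" and t: "0 \<le> t" "t \<le> T"
  for G g t
 proof -
  have "M * exp (K * 0) - G 0 \<le> M * exp (K * t) - G t"
  proof (rule DERIV_nonneg_imp_nondecreasing[OF t(1)])
   fix s assume s: "0 \<le> s" "s \<le> t"
   hence "((%s. M * exp (K * s) - G s) has_real_derivative M * K * exp (K * s) - g s) (at s)"
    using G(1)[of s] t by (auto intro!: derivative_eq_intros)
   moreover have "M * K * exp (K * s) - g s \<ge> 0" using b[of s] s t by simp
   ultimately show "\<exists>y. ((%s. M * exp (K * s) - G s) has_real_derivative y) (at s) \<and> 0 \<le> y" by blast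
  qed
  thus ?thesis using G(2) \<open>M \<ge> 0\<close> by simp
 qed
 have refl: "((%s. G (- s)) has_real_derivative - g (- s)) (at s)" if "abs s \<le> T" for s
  using DERIV_mirror[of G "g (- s)" s] G(1)[of "- s"] that by simp
 have neg: "((%s. - G s) has_real_derivative - g s) (at s)" if "abs s \<le> T" for s
  using G(1)[OF that] by (auto intro!: derivative_eq_intros)
 have refl_neg: "((%s. - G (- s)) has_real_derivative g (- s)) (at s)" if "abs s \<le> T" for s
  using DERIV_minus[OF refl[OF that]] by simp
 show ?thesis
 proof (cases "t \<ge> 0")
  case True
  have "G t \<le> M * exp (K * t)"
   by (rule pos[of G g]) (use G b t True in "force simp: abs_le_iff")+
  moreover have "- G t \<le> M * exp (K * t)"
   by (rule pos[of "%s. - G s" "%s. - g s"]) (use G b t True neg in "force simp: abs_le_iff")+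
  ultimately show ?thesis using True by simp
 next
  case False
  have b': "\<bar>g (- s)\<bar> \<le> M * K * exp (K * s)" if "0 \<le> s" "s \<le> T" for s
   using b[of "- s"] that by simp
  have "G (- (- t)) \<le> M * exp (K * (- t))"
   by (rule pos[of "%s. G (- s)" "%s. - g (- s)"])
    (use G b' t False refl in "force simp: abs_le_iff")+
  moreover have "- G (- (- t)) \<le> M * exp (K * (- t))"
   by (rule pos[of "%s. - G (- s)" "%s. g (- s)"])
    (use G b' t False refl_neg in "force simp: abs_le_iff")+
  ultimately show ?thesis using False by simp
 qed
qed

lemma gronwall:
 fixes E :: "real => real"
 assumes E: "\<And>t. abs t \<le> T ==> (E has_real_derivative E' t) (at t)"
  and b: "\<And>t. abs t \<le> T ==> \<bar>E' t\<bar> \<le> K * E t" and t: "abs t \<le> T"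
 shows "E t \<le> E 0 * exp (K * abs t)"
proof -
 have pos: "E t \<le> E 0 * exp (K * t)"
  if E: "\<And>t. [|0 \<le> t; t \<le> T|] ==> (E has_real_derivative E' t) (at t)"
   and b: "\<And>t. [|0 \<le> t; t \<le> T|] ==> E' t \<le> K * E t" and t: "0 \<le> t" "t \<le> T"
  for E E' t
 proof -
  have "- (E 0 * exp (- K * 0)) \<le> - (E t * exp (- K * t))"
  proof (rule DERIV_nonneg_imp_nondecreasing[OF t(1)])
   fix s assume s: "0 \<le> s" "s \<le> t"
   hence "((%s. - (E s * exp (- K * s))) has_real_derivative (K * E s - E' s) * exp (- K * s)) (at s)"
    using E[of s] t by (auto intro!: derivative_eq_intros simp: algebra_simps)
   moreover have "(K * E s - E' s) * exp (- K * s) \<ge> 0" using b[of s] s t by simp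
   ultimately show "\<exists>y. ((%s. - (E s * exp (- K * s))) has_real_derivative y) (at s) \<and> 0 \<le> y" by blast
  qed
  hence "E t * exp (- K * t) * exp (K * t) \<le> E 0 * exp (K * t)"
   by (intro mult_right_mono) auto
  thus ?thesis by (simp add: mult.assoc exp_minus)
 qed
 have refl: "((%s. E (- s)) has_real_derivative - E' (- s)) (at s)" if "abs s \<le> T" for s
  using DERIV_mirror[of E "E' (- s)" s] E[of "- s"] that by simp
 show ?thesis
 proof (cases "t \<ge> 0")
  case True
  have "E t \<le> E 0 * exp (K * t)"
   by (rule pos[of E E']) (use E b t True in "force simp: abs_le_iff")+
  thus ?thesis using True by simp
 next
  case False
  have b': "\<bar>E' (- s)\<bar> \<le> K * E (- s)" if "0 \<le> s" "s \<le> T" for s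
   using b[of "- s"] that by simp
  have "E (- (- t)) \<le> E (- 0) * exp (K * (- t))"
   by (rule pos[of "%s. E (- s)" "%s. - E' (- s)"])
    (use b' t False refl in "force simp: abs_le_iff")+
  thus ?thesis using False by simp
 qed
qed

lemma geometric_limit:
 fixes a :: "nat => real"
 assumes d: "\<And>k. \<bar>a (Suc k) - a k\<bar> \<le> C * (1/2) ^ k"
 shows "convergent a" "\<bar>a k - lim a\<bar> \<le> 2 * C * (1/2) ^ k"
proof -
 have C0: "C \<ge> 0" using d[of 0] by simp
 have tri: "\<bar>a (k + m) - a k\<bar> \<le> 2 * C * ((1/2) ^ k - (1/2) ^ (k + m))" for k m
 proof (induction m)
  case (Suc m)
  have "\<bar>a (k + Suc m) - a k\<bar> \<le> C * (1/2) ^ (k + m) + 2 * C * ((1/2) ^ k - (1/2) ^ (k + m))"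
   using d[of "k + m"] Suc by simp
  also have "\<dots> = 2 * C * ((1/2) ^ k - (1/2) ^ (k + Suc m))"
   by (simp add: algebra_simps)
  finally show ?case .
 qed simp
 have le: "\<bar>a (k + m) - a k\<bar> \<le> 2 * C * (1/2) ^ k" for k m
 proof -
  have "2 * C * ((1/2) ^ k - (1/2) ^ (k + m)) \<le> 2 * C * (1/2) ^ k"
   using C0 by (intro mult_left_mono) auto
  thus ?thesis using tri[of k m] by linarith
 qed
 have lim0: "(%k. 2 * C * (1/2) ^ k) \<longlonglongrightarrow> 0"
  by (intro tendsto_mult_right_zero LIMSEQ_power_zero) simp
 have "Cauchy a"
 proof (rule metric_CauchyI)
  fix e :: real assume "e > 0"
  hence "\<forall>\<^sub>F k in sequentially. 2 * C * (1/2) ^ k < e / 2"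
   using order_tendstoD(2)[OF lim0, of "e/2"] by simp
  then obtain N where N: "2 * C * (1/2) ^ N < e / 2"
   using eventually_happens[of _ sequentially] by auto
  have "dist (a m) (a k) < e" if "m \<ge> N" "k \<ge> N" for m k
  proof -
   from that obtain i j where "m = N + i" "k = N + j" by (metis le_Suc_ex)
   thus ?thesis using le[of N i] le[of N j] N by (auto simp: dist_real_def)
  qed
  thus "\<exists>M. \<forall>m\<ge>M. \<forall>n\<ge>M. dist (a m) (a n) < e" by blast
 qed
 thus c: "convergent a" by (simp add: Cauchy_convergent_iff)
 have l: "(%m. \<bar>a (k + m) - a k\<bar>) \<longlonglongrightarrow> \<bar>lim a - a k\<bar>"
  using LIMSEQ_ignore_initial_segment[OF c[unfolded convergent_LIMSEQ_iff], of k]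
  by (intro tendsto_rabs tendsto_diff) (auto simp: add.commute)
 have "\<bar>lim a - a k\<bar> \<le> 2 * C * (1/2) ^ k"
  by (rule LIMSEQ_le_const2[OF l]) (use le in auto)
 thus "\<bar>a k - lim a\<bar> \<le> 2 * C * (1/2) ^ k" by (simp add: abs_minus_commute)
qed

text \<open>The Lipschitz constant is uniform in the state but may depend on the time interval,
  which allows linear systems with coefficients depending on time. Continuity is asked only along
  curves, where the right-hand side is integrated.\<close>

lemma picard:
 fixes F :: "nat => real => (nat => real) => real"
 assumes cont: "\<And>c i. i < n ==> (\<And>t. c t \<in> Rn n) ==>
   (\<And>j. j < n ==> continuous_on UNIV (%t. c t j)) ==> continuous_on UNIV (%t. F i t (c t))"
  and lip: "\<And>T. \<exists>L. \<forall>t i x y. abs t \<le> T --> i < n --> x \<in> Rn n --> y \<in> Rn n -->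
   \<bar>F i t x - F i t y\<bar> \<le> L * (\<Sum>j<n. \<bar>x j - y j\<bar>)"
  and x0: "x0 \<in> Rn n"
 shows "\<exists>c. c 0 = x0 \<and> (\<forall>t. c t \<in> Rn n) \<and>
  (\<forall>t i. i < n --> ((%s. c s i) has_real_derivative F i t (c t)) (at t))"
proof -
 \<comment> \<open>Choosing one antiderivative vanishing at 0 for every continuous function makes
   the iterates definable by recursion.\<close>
 define AD where "AD g = (SOME G. G 0 = (0::real) \<and> (\<forall>t. (G has_real_derivative g t) (at t)))" for g :: "real => real"
 have AD: "AD g 0 = 0" "(AD g has_real_derivative g t) (at t)" if "continuous_on UNIV g" for g t
 proof -
  have "\<exists>G. G 0 = (0::real) \<and> (\<forall>t. (G has_real_derivative g t) (at t))"
   using antiderivative_exists[OF that] by blast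
  from someI_ex[OF this] show "AD g 0 = 0" "(AD g has_real_derivative g t) (at t)"
   unfolding AD_def by blast+
 qed
 define X where "X = rec_nat (%t. x0) (%_ c t. trunc n (%i. x0 i + AD (%s. F i s (c s)) t))"
 have X0: "X 0 t = x0" for t by (simp add: X_def)
 have XS: "X (Suc k) t = trunc n (%i. x0 i + AD (%s. F i s (X k s)) t)" for k t by (simp add: X_def)
 have XR: "X k t \<in> Rn n" for k t by (cases k) (auto simp: X0 XS x0)
 have Xc: "\<forall>j<n. continuous_on UNIV (%t. X k t j)" for k
 proof (induction k)
  case 0
  show ?case by (simp add: X0)
 next
  case (Suc k)
  show ?case
  proof (intro allI impI)
   fix j assume j: "j < n"
   have "continuous_on UNIV (%s. F j s (X k s))" by (rule cont[OF j XR]) (use Suc in auto)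
   from AD(2)[OF this] have "continuous_on UNIV (AD (%s. F j s (X k s)))"
    by (meson DERIV_isCont continuous_at_imp_continuous_on)
   thus "continuous_on UNIV (%t. X (Suc k) t j)" using j
    by (simp add: XS continuous_intros)
  qed
 qed
 have Fc: "continuous_on UNIV (%s. F i s (X k s))" if "i < n" for i k
  by (rule cont[OF that XR]) (use Xc in auto)
 have X'0: "X k 0 = x0" for k
  by (rule Rn_eqI[OF XR x0]) (cases k; simp add: X0 XS AD(1)[OF Fc])
 have X': "((%t. X (Suc k) t i) has_real_derivative F i t (X k t)) (at t)" if "i < n" for k i t
  using AD(2)[OF Fc[OF that]] that by (auto simp: XS intro!: derivative_eq_intros)
 have diff_bound: "\<exists>C. \<forall>k t i. abs t \<le> T --> i < n --> \<bar>X (Suc k) t i - X k t i\<bar> \<le> C * (1/2) ^ k" for T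
 proof -
  obtain L0 where L0: "\<And>t i x y. abs t \<le> T ==> i < n ==> x \<in> Rn n ==> y \<in> Rn n ==>
   \<bar>F i t x - F i t y\<bar> \<le> L0 * (\<Sum>j<n. \<bar>x j - y j\<bar>)" using lip by metis
  define L where "L = abs L0"
  have L: "\<bar>F i t x - F i t y\<bar> \<le> L * (\<Sum>j<n. \<bar>x j - y j\<bar>)" if "abs t \<le> T" "i < n" "x \<in> Rn n" "y \<in> Rn n" for t i x y
   using L0[OF that] mult_right_mono[of L0 L "\<Sum>j<n. \<bar>x j - y j\<bar>"]
   unfolding L_def by (smt (verit) sum_nonneg)
  \<comment> \<open>With this weight the Lipschitz estimate, which costs a factor L n, equals K/2;
    so each iteration halves the bound on every interval, whatever its length.\<close>
  define K where "K = 2 * n * L"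
  have K0: "K \<ge> 0" by (simp add: K_def L_def)
  have "\<exists>C. \<forall>t. abs t \<le> T --> \<bar>X 1 t i - x0 i\<bar> \<le> C" if "i < n" for i
  proof -
   have "continuous_on {-T..T} (%t. X 1 t i - x0 i)"
    by (rule continuous_on_subset[of UNIV]) (use Xc[of 1] that in "auto intro!: continuous_intros")
   hence "bounded ((%t. X 1 t i - x0 i) ` {-T..T})"
    by (intro compact_imp_bounded compact_continuous_image) auto
   thus ?thesis by (force simp: bounded_iff)
  qed
  then obtain C0 where C0: "\<And>i t. i < n ==> abs t \<le> T ==> \<bar>X 1 t i - x0 i\<bar> \<le> C0 i" by metis
  define C where "C = (\<Sum>i<n. \<bar>C0 i\<bar>)"
  have C: "\<bar>X 1 t i - x0 i\<bar> \<le> C" if "i < n" "abs t \<le> T" for i t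
  proof -
   have "\<bar>C0 i\<bar> \<le> C" unfolding C_def by (rule member_le_sum) (use that in auto)
   thus ?thesis using C0[OF that] by linarith
  qed
  have Cp: "C \<ge> 0" unfolding C_def by (simp add: sum_nonneg)
  have main: "\<forall>t i. abs t \<le> T --> i < n --> \<bar>X (Suc k) t i - X k t i\<bar> \<le> C * (1/2) ^ k * exp (K * abs t)" for k
  proof (induction k)
   case 0
   have "C * 1 \<le> C * exp (K * abs t)" for t
    by (rule mult_left_mono) (use K0 Cp in auto)
   thus ?case using C by (auto simp: X0 intro: order_trans)
  next
   case (Suc k)
   show ?case
   proof (intro allI impI)
    fix t i assume t: "abs t \<le> T" and i: "i < n"
    show "\<bar>X (Suc (Suc k)) t i - X (Suc k) t i\<bar> \<le> C * (1/2) ^ Suc k * exp (K * abs t)"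
    proof (rule exp_comparison[OF _ _ _ _ t, where g = "%t. F i t (X (Suc k) t) - F i t (X k t)"])
     show "((%t. X (Suc (Suc k)) t i - X (Suc k) t i) has_real_derivative F i t (X (Suc k) t) - F i t (X k t)) (at t)" for t
      by (intro DERIV_diff X' i)
     show "X (Suc (Suc k)) 0 i - X (Suc k) 0 i = 0" by (simp add: X'0)
     show "0 \<le> C * (1/2) ^ Suc k" using Cp by simp
     fix t assume t: "abs t \<le> T"
     have "\<bar>F i t (X (Suc k) t) - F i t (X k t)\<bar> \<le> L * (\<Sum>j<n. \<bar>X (Suc k) t j - X k t j\<bar>)"
      by (rule L) (use t i XR in auto)
     also have "\<dots> \<le> L * (\<Sum>j<n. C * (1/2) ^ k * exp (K * abs t))"
      by (intro mult_left_mono sum_mono) (use Suc t in "auto simp: L_def")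
     also have "\<dots> = C * (1/2) ^ Suc k * K * exp (K * abs t)"
      by (simp add: K_def)
     finally show "\<bar>F i t (X (Suc k) t) - F i t (X k t)\<bar> \<le> C * (1/2) ^ Suc k * K * exp (K * abs t)" .
    qed
   qed
  qed
  have "\<bar>X (Suc k) t i - X k t i\<bar> \<le> C * exp (K * T) * (1/2) ^ k" if "abs t \<le> T" "i < n" for k t i
  proof -
   have "\<bar>X (Suc k) t i - X k t i\<bar> \<le> C * (1/2) ^ k * exp (K * abs t)"
    using main that by blast
   also have "\<dots> \<le> C * (1/2) ^ k * exp (K * T)"
    using that K0 Cp by (intro mult_left_mono) (auto intro: mult_left_mono)
   finally show ?thesis by (simp add: mult_ac)
  qed
  thus ?thesis by blast
 qed
 define c where "c t = trunc n (%i. lim (%k. X k t i))" for t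
 have conv: "(%k. X k t i) \<longlonglongrightarrow> c t i" if i: "i < n" for t i
 proof -
  obtain C where "\<And>k. \<bar>X (Suc k) t i - X k t i\<bar> \<le> C * (1/2) ^ k"
   using diff_bound[of "abs t"] i by (meson order_refl)
  from geometric_limit(1)[of "%k. X k t i", OF this]
  show ?thesis using that by (simp add: c_def convergent_LIMSEQ_iff)
 qed
 have unif: "\<exists>C. \<forall>k t i. abs t \<le> T --> i < n --> \<bar>X k t i - c t i\<bar> \<le> C * (1/2) ^ k" for T
 proof -
  obtain C where C: "\<And>k t i. abs t \<le> T ==> i < n ==> \<bar>X (Suc k) t i - X k t i\<bar> \<le> C * (1/2) ^ k"
   using diff_bound[of T] by auto
  have "\<bar>X k t i - c t i\<bar> \<le> 2 * C * (1/2) ^ k" if "abs t \<le> T" "i < n" for k t i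
   using geometric_limit(2)[of "%k. X k t i", OF C[OF that]] that by (simp add: c_def)
  thus ?thesis by blast
 qed
 have "((%s. c s i) has_real_derivative F i t (c t)) (at t)" if i: "i < n" for t i
 proof -
  define T where "T = abs t + 1"
  obtain C where C: "\<And>k t i. abs t \<le> T ==> i < n ==> \<bar>X k t i - c t i\<bar> \<le> C * (1/2) ^ k" using unif by metis
  obtain L0 where L0: "\<And>t i x y. abs t \<le> T ==> i < n ==> x \<in> Rn n ==> y \<in> Rn n ==>
   \<bar>F i t x - F i t y\<bar> \<le> L0 * (\<Sum>j<n. \<bar>x j - y j\<bar>)" using lip by metis
  have FB: "\<bar>F i s (X k s) - F i s (c s)\<bar> \<le> abs L0 * n * C * (1/2) ^ k" if "abs s \<le> T" for s k
  proof -
   have "\<bar>F i s (X k s) - F i s (c s)\<bar> \<le> L0 * (\<Sum>j<n. \<bar>X k s j - c s j\<bar>)"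
    by (rule L0) (use that i XR in "auto simp: c_def")
   also have "\<dots> \<le> abs L0 * (\<Sum>j<n. C * (1/2) ^ k)"
    by (intro mult_mono sum_mono) (use that C in "auto intro: sum_nonneg")
   finally show ?thesis by simp
  qed
  have "\<exists>g. \<forall>s\<in>{-T..T}. (%k. X (Suc k) s i) \<longlonglongrightarrow> g s \<and>
    (g has_derivative (%h. h * F i s (c s))) (at s within {-T..T})"
  proof (rule has_derivative_sequence[where f' = "%k s h. h * F i s (X k s)"])
   show "((%s. X (Suc k) s i) has_derivative (%h. h * F i s (X k s))) (at s within {-T..T})" for k s
    using X'[OF i, of k s] unfolding has_field_derivative_def mult_commute_abs
    by (rule has_derivative_at_withinI)
   show "(0::real) \<in> {-T..T}" by (simp add: T_def)
   show "(%k. X (Suc k) 0 i) \<longlonglongrightarrow> x0 i" by (simp add: X'0)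
   fix e :: real assume e: "e > 0"
   have "(%k. abs L0 * n * C * (1/2) ^ k) \<longlonglongrightarrow> 0"
    by (intro tendsto_mult_right_zero LIMSEQ_power_zero) simp
   hence ev: "\<forall>\<^sub>F k in sequentially. abs L0 * n * C * (1/2) ^ k < e"
    using order_tendstoD(2) e by blast
   show "\<forall>\<^sub>F k in sequentially. \<forall>s\<in>{-T..T}. \<forall>h. norm (h * F i s (X k s) - h * F i s (c s)) \<le> e * norm h"
    using ev
   proof eventually_elim
    case (elim k)
    show ?case
    proof (intro ballI allI)
     fix s h assume "s \<in> {-T..T}"
     hence "abs s \<le> T" by auto
     hence "\<bar>F i s (X k s) - F i s (c s)\<bar> \<le> e" using FB[of s k] elim by linarith
     hence "abs h * \<bar>F i s (X k s) - F i s (c s)\<bar> \<le> abs h * e" by (intro mult_left_mono) auto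
     thus "norm (h * F i s (X k s) - h * F i s (c s)) \<le> e * norm h"
      by (simp add: right_diff_distrib[symmetric] abs_mult mult.commute)
    qed
   qed
  qed auto
  then obtain g where g: "\<And>s. s \<in> {-T..T} ==> (%k. X (Suc k) s i) \<longlonglongrightarrow> g s"
    "\<And>s. s \<in> {-T..T} ==> (g has_derivative (%h. h * F i s (c s))) (at s within {-T..T})" by blast
  have gc: "g s = c s i" if "s \<in> {-T..T}" for s
   using LIMSEQ_unique[OF g(1)[OF that]] LIMSEQ_Suc[OF conv[OF i]] by blast
  have tT: "t \<in> {-T<..<T}" by (auto simp: T_def)
  have "(g has_derivative (%h. h * F i t (c t))) (at t)"
  proof -
   have "at t within {-T..T} = at t"
    by (rule at_within_interior) (use tT in auto)
   thus ?thesis using g(2)[of t] tT by auto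
  qed
  hence "(g has_real_derivative F i t (c t)) (at t)"
   by (simp add: has_field_derivative_def mult_commute_abs)
  thus ?thesis
   by (rule has_field_derivative_transform_within_open[of _ _ _ "{-T<..<T}"]) (use tT gc in auto)
 qed
 moreover have "c 0 = x0"
 proof (rule Rn_eqI[OF _ x0])
  fix i assume i: "i < n"
  show "c 0 i = x0 i" using conv[OF i, of 0] by (simp add: X'0 LIMSEQ_const_iff)
 qed (simp add: c_def)
 ultimately show ?thesis by (intro exI[of _ c]) (auto simp: c_def)
qed

section \<open>Lipschitz bounds on cubes, cut-off systems and flows\<close>

definition ccube :: "nat => real => (nat => real) set" where
 "ccube n R = {x \<in> Rn n. \<forall>i<n. \<bar>x i\<bar> \<le> R}"

lemma compact_ccube: "compact (ccube n R)"
proof -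
 have "ccube n R = PiE UNIV (%i. if i < n then {-R..R::real} else {0})"
 proof -
  have "x \<in> ccube n R \<longleftrightarrow> x \<in> PiE UNIV (%i. if i < n then {-R..R} else {0})" for x
  proof -
  have "(\<forall>i. x i \<in> (if i < n then {-R..R} else {0})) \<longleftrightarrow> (\<forall>i\<ge>n. x i = 0) \<and> (\<forall>i<n. \<bar>x i\<bar> \<le> R)"
   by (auto simp: abs_le_iff not_less)
  thus ?thesis
   by (simp add: ccube_def Rn_def PiE_def Pi_def)
  qed
  thus ?thesis by blast
 qed
 moreover have "compactin (product_topology (%_. euclidean) UNIV) (PiE UNIV (%i. if i < n then {-R..R::real} else {0}))"
  by (subst compactin_PiE) auto
 ultimately show ?thesis by (simp add: euclidean_product_topology)
qed

lemma continuous_bounded_ccube: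
 assumes "continuous_on (Rn n) (f :: _ => real)"
 obtains B where "B \<ge> 0" "\<And>x. x \<in> ccube n R ==> \<bar>f x\<bar> \<le> B"
proof -
 have "bounded (f ` ccube n R)"
  by (intro compact_imp_bounded compact_continuous_image compact_ccube continuous_on_subset[OF assms])
   (auto simp: ccube_def)
 then obtain B where "\<And>x. x \<in> ccube n R ==> \<bar>f x\<bar> \<le> B" by (force simp: bounded_iff)
 thus thesis using that[of "abs B"] by force
qed

text \<open>The Hadamard factors are continuous on the compact cube in 2n variables, hence bounded;
  summing the bounds gives one constant for all components.\<close>

lemma lipschitz_ccube:
 assumes f: "\<And>i. i < n ==> smooth_fun n (f i)"
 shows "\<exists>L\<ge>0. \<forall>i x y. i < n --> x \<in> ccube n R --> y \<in> ccube n R -->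
  \<bar>f i x - f i y\<bar> \<le> L * (\<Sum>j<n. \<bar>x j - y j\<bar>)"
proof -
 have "\<exists>L\<ge>0. \<forall>x y. x \<in> ccube n R --> y \<in> ccube n R --> \<bar>f i x - f i y\<bar> \<le> L * (\<Sum>j<n. \<bar>x j - y j\<bar>)"
  if i: "i < n" for i
 proof -
  obtain g where g: "\<And>j. j < n ==> smooth_fun (n + n) (g j)"
   "\<And>x y. x \<in> Rn n ==> y \<in> Rn n ==> f i y - f i x = (\<Sum>j<n. (y j - x j) * g j (cat n x y))"
   by (rule hadamard[OF f[OF i]]) blast
  have "\<forall>j. \<exists>B. j < n --> B \<ge> 0 \<and> (\<forall>z\<in>ccube (n + n) R. \<bar>g j z\<bar> \<le> B)"
   using continuous_bounded_ccube[OF smooth_continuous[OF g(1)], of _ R] by metis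
  from choice[OF this] obtain B where B: "\<And>j. j < n ==> B j \<ge> 0" "\<And>j z. j < n ==> z \<in> ccube (n + n) R ==> \<bar>g j z\<bar> \<le> B j"
   by blast
  have "\<bar>f i y - f i x\<bar> \<le> sum B {..<n} * (\<Sum>j<n. \<bar>y j - x j\<bar>)" if "x \<in> ccube n R" "y \<in> ccube n R" for x y
  proof -
   have c: "cat n x y \<in> ccube (n + n) R" using that by (auto simp: ccube_def cat_def Rn_def)
   have "\<bar>f i y - f i x\<bar> \<le> (\<Sum>j<n. \<bar>(y j - x j) * g j (cat n x y)\<bar>)"
    using g(2)[of x y] that by (auto simp: ccube_def intro: sum_abs)
   also have "\<dots> \<le> (\<Sum>j<n. \<bar>y j - x j\<bar> * sum B {..<n})"
   proof (rule sum_mono)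
    fix j assume j: "j \<in> {..<n}"
    have "B j \<le> sum B {..<n}" by (rule member_le_sum) (use j B in auto)
    hence "\<bar>g j (cat n x y)\<bar> \<le> sum B {..<n}" using B(2)[of j, OF _ c] j by auto
    thus "\<bar>(y j - x j) * g j (cat n x y)\<bar> \<le> \<bar>y j - x j\<bar> * sum B {..<n}"
     by (simp add: abs_mult mult_left_mono)
   qed
   also have "\<dots> = sum B {..<n} * (\<Sum>j<n. \<bar>y j - x j\<bar>)"
    by (simp add: sum_distrib_right[symmetric])
   finally show ?thesis .
  qed
  moreover have "sum B {..<n} \<ge> 0" using B by (intro sum_nonneg) auto
  ultimately show ?thesis by blast
 qed
 then obtain L where L: "\<And>i. i < n ==> L i \<ge> 0" "\<And>i x y. i < n ==> x \<in> ccube n R ==> y \<in> ccube n R ==>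
  \<bar>f i x - f i y\<bar> \<le> L i * (\<Sum>j<n. \<bar>x j - y j\<bar>)" by metis
 show ?thesis
 proof (intro exI[of _ "sum L {..<n}"] conjI allI impI)
  show "sum L {..<n} \<ge> 0" using L by (intro sum_nonneg) auto
  fix i x y assume i: "i < n" and xy: "x \<in> ccube n R" "y \<in> ccube n R"
  have "L i \<le> sum L {..<n}" by (rule member_le_sum) (use i L in auto)
  hence "L i * (\<Sum>j<n. \<bar>x j - y j\<bar>) \<le> sum L {..<n} * (\<Sum>j<n. \<bar>x j - y j\<bar>)"
   by (intro mult_right_mono) (auto intro: sum_nonneg)
  thus "\<bar>f i x - f i y\<bar> \<le> sum L {..<n} * (\<Sum>j<n. \<bar>x j - y j\<bar>)" using L(2)[OF i xy] by linarith
 qed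
qed

text \<open>The squared distance, chosen because it can be differentiated along curves, unlike the
  sum of absolute values in the Lipschitz conditions.\<close>

definition sqd :: "nat => (nat => real) => (nat => real) => real" where
 "sqd n x y = (\<Sum>i<n. (x i - y i)\<^sup>2)"

lemma sqd_0: "x \<in> Rn n ==> y \<in> Rn n ==> sqd n x y \<le> 0 ==> x = y"
proof -
 assume a: "x \<in> Rn n" "y \<in> Rn n" "sqd n x y \<le> 0"
 have "sqd n x y = 0" using a(3) by (auto simp: sqd_def intro!: antisym sum_nonneg)
 hence "\<forall>i<n. x i = y i" unfolding sqd_def by (subst (asm) sum_nonneg_eq_0_iff) auto
 thus ?thesis using a Rn_eqI by blast
qed

text \<open>The Cauchy-Schwarz inequality bounds the square of the sum of the n absolute differences
  by n times \<open>sqd\<close>; this gives the rate 2 L n. The set \<open>A\<close> is where the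
  Lipschitz bound is available, and both curves are assumed to stay in it.\<close>

lemma ode_gronwall:
 assumes c: "\<And>t i. abs t \<le> T ==> i < n ==> ((%s. c s i) has_real_derivative f i t (c t)) (at t)"
  and d: "\<And>t i. abs t \<le> T ==> i < n ==> ((%s. d s i) has_real_derivative f i t (d t)) (at t)"
  and A: "\<And>t. abs t \<le> T ==> c t \<in> A \<and> d t \<in> A"
  and L: "\<And>i t x y. abs t \<le> T ==> i < n ==> x \<in> A ==> y \<in> A ==> \<bar>f i t x - f i t y\<bar> \<le> L * (\<Sum>j<n. \<bar>x j - y j\<bar>)"
  and L0: "L \<ge> 0" and t: "abs t \<le> T"
 shows "sqd n (c t) (d t) \<le> sqd n (c 0) (d 0) * exp (2 * L * n * abs t)"
proof (rule gronwall[OF _ _ t, where E' = "%t. \<Sum>i<n. 2 * (c t i - d t i) * (f i t (c t) - f i t (d t))"])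
 fix t assume t: "abs t \<le> T"
 show "((%t. sqd n (c t) (d t)) has_real_derivative (\<Sum>i<n. 2 * (c t i - d t i) * (f i t (c t) - f i t (d t)))) (at t)"
  unfolding sqd_def by (rule DERIV_sum) (use c[OF t] d[OF t] in "auto intro!: derivative_eq_intros")
 define s where "s = (\<Sum>j<n. \<bar>c t j - d t j\<bar>)"
 have s0: "s \<ge> 0" by (simp add: s_def sum_nonneg)
 have "\<bar>\<Sum>i<n. 2 * (c t i - d t i) * (f i t (c t) - f i t (d t))\<bar> \<le> (\<Sum>i<n. \<bar>2 * (c t i - d t i) * (f i t (c t) - f i t (d t))\<bar>)"
  by (rule sum_abs)
 also have "\<dots> \<le> (\<Sum>i<n. 2 * \<bar>c t i - d t i\<bar> * (L * s))"
 proof (rule sum_mono)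
  fix i assume "i \<in> {..<n}"
  hence "\<bar>f i t (c t) - f i t (d t)\<bar> \<le> L * s" unfolding s_def using L[OF t] A[OF t] by auto
  hence "2 * \<bar>c t i - d t i\<bar> * \<bar>f i t (c t) - f i t (d t)\<bar> \<le> 2 * \<bar>c t i - d t i\<bar> * (L * s)"
   by (intro mult_left_mono) auto
  thus "\<bar>2 * (c t i - d t i) * (f i t (c t) - f i t (d t))\<bar> \<le> 2 * \<bar>c t i - d t i\<bar> * (L * s)"
   by (simp only: abs_mult abs_numeral)
 qed
 also have "\<dots> = 2 * L * s\<^sup>2"
  by (simp add: s_def sum_distrib_right[symmetric] sum_distrib_left[symmetric] power2_eq_square mult_ac)
 also have "\<dots> \<le> 2 * L * (sqd n (c t) (d t) * n)"
 proof (intro mult_left_mono)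
  show "s\<^sup>2 \<le> sqd n (c t) (d t) * n"
   unfolding s_def sqd_def using sum_squared_le_sum_of_squares[of "%j. \<bar>c t j - d t j\<bar>" "{..<n}"] by simp
 qed (use L0 in auto)
 finally show "\<bar>\<Sum>i<n. 2 * (c t i - d t i) * (f i t (c t) - f i t (d t))\<bar> \<le> 2 * L * n * sqd n (c t) (d t)"
  by (simp add: mult_ac)
qed

lemma bounded_curve:
 assumes "\<And>t. abs t \<le> T ==> c t \<in> Rn n"
  and "\<And>t i. abs t \<le> T ==> i < n ==> ((%s. c s i) has_real_derivative c' t i) (at t)"
 obtains R where "R \<ge> 0" "\<And>t. abs t \<le> T ==> c t \<in> ccube n R"
proof -
 have "\<exists>B. \<forall>t. abs t \<le> T --> \<bar>c t i\<bar> \<le> B" if "i < n" for i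
 proof -
  have "continuous_on {-T..T} (%t. c t i)"
   by (rule continuous_at_imp_continuous_on) (use assms(2) that in "force intro: DERIV_isCont simp: abs_le_iff")
  hence "bounded ((%t. c t i) ` {-T..T})"
   by (intro compact_imp_bounded compact_continuous_image) auto
  thus ?thesis by (force simp: bounded_iff abs_le_iff)
 qed
 then obtain B where B: "\<And>i t. i < n ==> abs t \<le> T ==> \<bar>c t i\<bar> \<le> B i" by metis
 show thesis
 proof (rule that[of "\<Sum>i<n. \<bar>B i\<bar>"])
  show "(\<Sum>i<n. \<bar>B i\<bar>) \<ge> 0" by (simp add: sum_nonneg)
  fix t assume t: "abs t \<le> T"
  have "\<bar>c t i\<bar> \<le> (\<Sum>i<n. \<bar>B i\<bar>)" if "i < n" for i
  proof -
   have "\<bar>B i\<bar> \<le> (\<Sum>i<n. \<bar>B i\<bar>)" by (rule member_le_sum) (use that in auto)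
   thus ?thesis using B[OF that t] by linarith
  qed
  thus "c t \<in> ccube n (\<Sum>i<n. \<bar>B i\<bar>)" using assms(1)[OF t] by (simp add: ccube_def)
 qed
qed

lemma ode_unique:
 assumes f: "\<And>i. i < n ==> smooth_fun n (f i)"
  and c: "\<And>t. abs t \<le> T ==> c t \<in> Rn n"
   "\<And>t i. abs t \<le> T ==> i < n ==> ((%s. c s i) has_real_derivative f i (c t)) (at t)"
  and d: "\<And>t. abs t \<le> T ==> d t \<in> Rn n"
   "\<And>t i. abs t \<le> T ==> i < n ==> ((%s. d s i) has_real_derivative f i (d t)) (at t)"
  and "c 0 = d 0" and t: "abs t \<le> T"
 shows "c t = d t"
proof -
 obtain R1 where R1: "R1 \<ge> 0" "\<And>t. abs t \<le> T ==> c t \<in> ccube n R1"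
  by (rule bounded_curve[of T c n "%t i. f i (c t)"]) (use c in auto)
 obtain R2 where R2: "R2 \<ge> 0" "\<And>t. abs t \<le> T ==> d t \<in> ccube n R2"
  by (rule bounded_curve[of T d n "%t i. f i (d t)"]) (use d in auto)
 from lipschitz_ccube[of n f "max R1 R2", OF f] obtain L where L0: "L \<ge> 0"
  "\<forall>i x y. i < n --> x \<in> ccube n (max R1 R2) --> y \<in> ccube n (max R1 R2) -->
  \<bar>f i x - f i y\<bar> \<le> L * (\<Sum>j<n. \<bar>x j - y j\<bar>)" by auto
 note L = L0(1) L0(2)[rule_format]
 have "sqd n (c t) (d t) \<le> sqd n (c 0) (d 0) * exp (2 * L * n * abs t)"
 proof (rule ode_gronwall[where f = "%i _. f i", OF c(2) d(2) _ L(2) L(1) t])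
  show "c t \<in> ccube n (max R1 R2) \<and> d t \<in> ccube n (max R1 R2)" if "abs t \<le> T" for t
   using R1(2)[OF that] R2(2)[OF that] by (auto simp: ccube_def le_max_iff_disj)
 qed
 thus ?thesis
  using sqd_0[OF c(1)[OF t] d(1)[OF t]] \<open>c 0 = d 0\<close> by (simp add: sqd_def)
qed

definition sol :: "nat => (nat => (nat => real) => real) => (real => nat => real) => bool" where
 "sol n f c \<longleftrightarrow> (\<forall>t. c t \<in> Rn n) \<and> (\<forall>t i. i < n --> ((%s. c s i) has_real_derivative f i (c t)) (at t))"

definition complete_ode :: "nat => (nat => (nat => real) => real) => bool" where
 "complete_ode n f \<longleftrightarrow> (\<forall>i<n. smooth_fun n (f i)) \<and> (\<forall>x\<in>Rn n. \<exists>c. sol n f c \<and> c 0 = x)"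

definition flow :: "nat => (nat => (nat => real) => real) => real => (nat => real) => nat => real" where
 "flow n f t x = (SOME c. sol n f c \<and> c 0 = x) t"

lemma complete_smooth: "complete_ode n f ==> i < n ==> smooth_fun n (f i)"
 by (simp add: complete_ode_def)

lemma sol_unique:
 assumes "complete_ode n f" "sol n f c" "sol n f d" "c 0 = d 0"
 shows "c t = d t"
 by (rule ode_unique[of n f "abs t"]) (use assms in "auto simp: complete_ode_def sol_def")

lemma flow_sol:
 assumes "complete_ode n f" "x \<in> Rn n"
 shows "sol n f (%t. flow n f t x)" "flow n f 0 x = x"
proof -
 have "\<exists>c. sol n f c \<and> c 0 = x" using assms by (auto simp: complete_ode_def)
 from someI_ex[OF this] show "sol n f (%t. flow n f t x)" "flow n f 0 x = x"
  by (auto simp: flow_def)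
qed

lemma flow_eqI: "complete_ode n f ==> sol n f c ==> c 0 = x ==> flow n f t x = c t"
 using sol_unique[of n f "%t. flow n f t x" c t] flow_sol[of n f x] by (force simp: sol_def)

lemma flow_Rn [simp]: "complete_ode n f ==> x \<in> Rn n ==> flow n f t x \<in> Rn n"
 using flow_sol[of n f x] by (simp add: sol_def)

lemma flow_DERIV: "complete_ode n f ==> x \<in> Rn n ==> i < n ==>
  ((%s. flow n f s x i) has_real_derivative f i (flow n f t x)) (at t)"
 using flow_sol[of n f x] by (simp add: sol_def)

lemma lipschitz_complete:
 assumes f: "\<And>i. i < n ==> smooth_fun n (f i)"
  and L: "\<And>i x y. i < n ==> x \<in> Rn n ==> y \<in> Rn n ==> \<bar>f i x - f i y\<bar> \<le> L * (\<Sum>j<n. \<bar>x j - y j\<bar>)"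
 shows "complete_ode n f"
 unfolding complete_ode_def
proof (intro conjI ballI)
 fix x assume x: "x \<in> Rn n"
 have "\<exists>c. c 0 = x \<and> (\<forall>t. c t \<in> Rn n) \<and> (\<forall>t i. i < n --> ((%s. c s i) has_real_derivative f i (c t)) (at t))"
  by (rule picard[of n "%i t. f i", OF _ _ x])
   (auto intro!: continuous_compose_Rn[OF smooth_continuous[OF f]] exI[of _ L] L)
 thus "\<exists>c. sol n f c \<and> c 0 = x" by (auto simp: sol_def)
qed (use f in auto)

text \<open>Multiplying by a bump function keeps the system on a given cube and makes it globally
  Lipschitz, hence complete. Lipschitz bounds on a larger cube do not cover pairs with one point
  outside it, so such pairs are treated separately.\<close>

lemma cutoff:
 assumes f: "\<And>i. i < n ==> smooth_fun n (f i)" and R: "R \<ge> 0"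
 shows "\<exists>f' L. (\<forall>i<n. smooth_fun n (f' i)) \<and> L \<ge> 0 \<and>
  (\<forall>i x y. i < n --> x \<in> Rn n --> y \<in> Rn n --> \<bar>f' i x - f' i y\<bar> \<le> L * (\<Sum>j<n. \<bar>x j - y j\<bar>)) \<and>
  (\<forall>x i. x \<in> ccube n R --> i < n --> f' i x = f i x)"
proof -
 define r where "r = R + 1"
 have r: "r > 0" "R < r" using R by (auto simp: r_def)
 obtain b where b: "smooth_fun n b" "\<And>x. x \<in> cube n (%_. 0) r ==> b x = 1"
   "\<And>x i. b x \<noteq> 0 ==> i < n ==> \<bar>x i\<bar> < 3 / 2 * r"
 proof -
  from bump_exists[of "2 * r" n "%_. 0"] r obtain b where b: "smooth_fun n b"
   "\<forall>x\<in>cube n (%_. 0) r. b x = 1" "\<forall>x. b x \<noteq> 0 --> (\<forall>i<n. \<bar>x i - 0\<bar> < 3 * (2 * r) / 4)" by auto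
  thus thesis using that[of b] by auto
 qed
 define f' where "f' i x = b x * f i x" for i x
 have f': "smooth_fun n (f' i)" if "i < n" for i
  unfolding f'_def using smooth_mult[OF b(1) f[OF that]] .
 from lipschitz_ccube[of n f' "2*r", OF f'] obtain L where L0: "L \<ge> 0"
  "\<forall>i x y. i < n --> x \<in> ccube n (2*r) --> y \<in> ccube n (2*r) -->
  \<bar>f' i x - f' i y\<bar> \<le> L * (\<Sum>j<n. \<bar>x j - y j\<bar>)" by auto
 note L = L0(1) L0(2)[rule_format]
 \<comment> \<open>The second summand serves the pairs with one point in the support of the bump and
   the other outside the cube of radius 2r. These are at least r/2 apart, so 4r is at most 8 times
   their distance.\<close>
 define L' where "L' = L + L * n * 8"
 have L'L: "L \<le> L'" using L by (simp add: L'_def)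
 have mixed: "\<bar>f' i x\<bar> \<le> L' * (\<Sum>j<n. \<bar>x j - y j\<bar>)"
  if i: "i < n" and x: "x \<in> Rn n" and y: "y \<in> Rn n" "y \<notin> ccube n (2*r)" for i x y
 proof (cases "b x = 0")
  case True
  thus ?thesis using L L'L by (auto simp: f'_def intro!: mult_nonneg_nonneg sum_nonneg)
 next
  case False
  \<comment> \<open>A corner of the larger cube: the cut-off field vanishes there, so its value at
    \<open>x\<close> is bounded by L times the distance to the corner, each coordinate contributing
    at most 4r.\<close>
  define z where "z = trunc n (%_. 2 * r)"
  have z: "z \<in> ccube n (2*r)" using r by (simp add: z_def ccube_def)
  have bz: "b z = 0" using b(3)[of z i] i r by (auto simp: z_def)
  have xc: "\<bar>x j\<bar> < 3/2*r" if "j < n" for j using b(3)[OF False that] .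
  hence xcc: "x \<in> ccube n (2*r)" using x r by (force simp: ccube_def)
  from y obtain j where j: "j < n" "\<bar>y j\<bar> > 2 * r" by (auto simp: ccube_def not_le)
  have "r / 2 \<le> \<bar>x j - y j\<bar>" using xc[OF j(1)] j(2) by linarith
  also have "\<dots> \<le> (\<Sum>j<n. \<bar>x j - y j\<bar>)" by (rule member_le_sum) (use j in auto)
  finally have S: "4 * r \<le> 8 * (\<Sum>j<n. \<bar>x j - y j\<bar>)" by simp
  have "\<bar>f' i x\<bar> \<le> L * (\<Sum>j<n. \<bar>x j - z j\<bar>)" using L(2)[OF i xcc z] bz by (simp add: f'_def)
  also have "\<dots> \<le> L * (\<Sum>j<n. 4 * r)"
   using xc r L by (intro mult_left_mono sum_mono) (force simp: z_def abs_le_iff abs_less_iff)+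
  also have "\<dots> = L * n * (4 * r)" by simp
  also have "\<dots> \<le> L * n * (8 * (\<Sum>j<n. \<bar>x j - y j\<bar>))"
   using S L by (intro mult_left_mono) auto
  also have "\<dots> \<le> L' * (\<Sum>j<n. \<bar>x j - y j\<bar>)"
   using L by (simp add: L'_def distrib_right sum_nonneg)
  finally show ?thesis .
 qed
 show ?thesis
 proof (intro exI[of _ f'] exI[of _ L'] conjI allI impI)
  show "L' \<ge> 0" using L L'L by linarith
  show "f' i x = f i x" if "x \<in> ccube n R" "i < n" for x i
   using that r b(2)[of x] by (force simp: f'_def ccube_def cube_def)
  fix i x y assume i: "i < n" and x: "x \<in> Rn n" and y: "y \<in> Rn n"
  have out: "f' i x = 0" if "x \<notin> ccube n (2*r)" "x \<in> Rn n" for x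
   using that b(3)[of x] r unfolding f'_def ccube_def by force
  show "\<bar>f' i x - f' i y\<bar> \<le> L' * (\<Sum>j<n. \<bar>x j - y j\<bar>)"
  proof (cases "x \<in> ccube n (2*r)")
   case True
   note xc = this
   show ?thesis
   proof (cases "y \<in> ccube n (2*r)")
    case True
    have "L * (\<Sum>j<n. \<bar>x j - y j\<bar>) \<le> L' * (\<Sum>j<n. \<bar>x j - y j\<bar>)"
     by (intro mult_right_mono L'L sum_nonneg) auto
    thus ?thesis using L(2)[OF i xc True] by linarith
   qed (use mixed[OF i x y] out y in auto)
  next
   case False
   thus ?thesis using mixed[OF i y x False] out x by (simp add: abs_minus_commute)
  qed
 qed (use f' in auto)
qed

text \<open>Cut off around the orbit of \<open>x0\<close> and compare inside the cut-off system,
  where the Gronwall estimate applies. A solution starting near \<open>x0\<close> stays within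
  distance 1 of the orbit, hence where nothing was cut off, so it also solves the original
  system.\<close>

lemma flow_continuous:
 assumes f: "complete_ode n f" and x0: "x0 \<in> Rn n" and e: "e > 0"
 shows "\<exists>\<delta>>0. \<forall>x\<in>cube n x0 \<delta>. \<forall>t. abs t \<le> T --> (\<forall>i<n. \<bar>flow n f t x i - flow n f t x0 i\<bar> < e)"
proof -
 define c where "c t = flow n f t x0" for t
 have c: "sol n f c" "c 0 = x0" using flow_sol[OF f x0] by (auto simp: c_def[abs_def])
 obtain R where R: "R \<ge> 0" "\<And>t. abs t \<le> T ==> c t \<in> ccube n R"
  by (rule bounded_curve[of T c n "%t i. f i (c t)"]) (use c(1) in "auto simp: sol_def")
 have "R + 1 \<ge> 0" using R(1) by simp
 from cutoff[of n f "R + 1", OF complete_smooth[OF f] this] obtain f' L where f'0: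
  "\<forall>i<n. smooth_fun n (f' i)" "L \<ge> 0"
  "\<forall>i x y. i < n --> x \<in> Rn n --> y \<in> Rn n --> \<bar>f' i x - f' i y\<bar> \<le> L * (\<Sum>j<n. \<bar>x j - y j\<bar>)"
  "\<forall>x i. x \<in> ccube n (R + 1) --> i < n --> f' i x = f i x"
  by blast
 note f' = f'0(1)[rule_format] f'0(2) f'0(3)[rule_format] f'0(4)[rule_format]
 have cf': "complete_ode n f'" using lipschitz_complete[OF f'(1,3)] .
 define e' where "e' = min 1 e"
 have e': "e' > 0" "e' \<le> 1" "e' \<le> e" using e by (auto simp: e'_def)
 define B where "B = exp (2 * L * n * abs T)"
 have B: "B > 0" by (simp add: B_def)
 \<comment> \<open>The cap at 1 bounds squares of coordinate differences by \<delta>. The other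
   bound makes n \<delta> times the Gronwall factor \<open>B\<close> smaller than the square of
   \<open>e'\<close>; n + 1 also serves n = 0.\<close>
 define \<delta> where "\<delta> = min 1 (e'\<^sup>2 / (B * (n + 1)))"
 have \<delta>: "\<delta> > 0" using e' B by (auto simp: \<delta>_def)
 have "\<bar>flow n f t x i - c t i\<bar> < e" if x: "x \<in> cube n x0 \<delta>" and t: "abs t \<le> T" and i: "i < n" for x t i
 proof -
  have xR: "x \<in> Rn n" using x by (simp add: cube_def)
  define d where "d t = flow n f' t x" for t
  have d: "sol n f' d" "d 0 = x" using flow_sol[OF cf' xR] by (auto simp: d_def[abs_def])
  have cR1: "c t \<in> ccube n (R+1)" if "abs t \<le> T" for t using R(2)[OF that] by (force simp: ccube_def)
  have close: "\<bar>d t j - c t j\<bar> < e'" if t: "abs t \<le> T" and j: "j < n" for t j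
  proof -
   have "sqd n (d t) (c t) \<le> sqd n (d 0) (c 0) * exp (2 * L * n * abs t)"
   proof (rule ode_gronwall[where f = "%i _. f' i", OF _ _ _ f'(3) f'(2) t])
    show "((%s. c s i) has_real_derivative f' i (c t)) (at t)" if "abs t \<le> T" "i < n" for t i
     using c(1) f'(4)[OF cR1[OF that(1)] that(2)] that by (simp add: sol_def)
   qed (use d c in "auto simp: sol_def")
   also have "\<dots> \<le> sqd n (d 0) (c 0) * B"
    unfolding B_def by (intro mult_left_mono) (use t f'(2) in "auto simp: sqd_def intro!: sum_nonneg mult_left_mono")
   also have "\<dots> \<le> (n * \<delta>) * B"
   proof (intro mult_right_mono)
    have "sqd n x x0 \<le> (\<Sum>i<n. \<delta>)"
     unfolding sqd_def
    proof (rule sum_mono)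
     fix i assume "i \<in> {..<n}"
     hence "\<bar>x i - x0 i\<bar> < \<delta>" using x by (simp add: cube_def)
     moreover have "\<delta> \<le> 1" by (simp add: \<delta>_def)
     ultimately have "\<bar>x i - x0 i\<bar> * \<bar>x i - x0 i\<bar> \<le> \<delta> * 1" by (intro mult_mono) auto
     thus "(x i - x0 i)\<^sup>2 \<le> \<delta>" by (simp add: power2_eq_square flip: abs_mult)
    qed
    thus "sqd n (d 0) (c 0) \<le> n * \<delta>" using d c by simp
   qed (use B in auto)
   also have "\<dots> < e'\<^sup>2"
   proof -
    have "\<delta> * (B * (n + 1)) \<le> e'\<^sup>2"
    proof -
     have "\<delta> * (B * (n + 1)) \<le> e'\<^sup>2 / (B * (n + 1)) * (B * (n + 1))"
      by (rule mult_right_mono) (use B in "auto simp: \<delta>_def")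
     thus ?thesis using B by simp
    qed
    moreover have "n * \<delta> * B < \<delta> * (B * (n + 1))" using B \<delta> by (simp add: algebra_simps)
    ultimately show ?thesis by linarith
   qed
   finally have "sqd n (d t) (c t) < e'\<^sup>2" .
   moreover have "(d t j - c t j)\<^sup>2 \<le> sqd n (d t) (c t)"
    unfolding sqd_def by (rule member_le_sum) (use j in auto)
   ultimately have "(d t j - c t j)\<^sup>2 < e'\<^sup>2" by linarith
   thus ?thesis using e' by (metis abs_of_pos power2_less_imp_less abs_ge_zero power2_abs)
  qed
  have dR: "d t \<in> ccube n (R+1)" if "abs t \<le> T" for t
  proof -
   have "\<bar>d t j\<bar> \<le> R + 1" if j: "j < n" for j
    using close[OF \<open>\<bar>t\<bar> \<le> T\<close> j] e'(2) R(2)[OF \<open>\<bar>t\<bar> \<le> T\<close>] j unfolding ccube_def by force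
   thus ?thesis using d(1) by (simp add: ccube_def sol_def)
  qed
  have "flow n f t x = d t"
  proof (rule ode_unique[of n f T, OF _ _ _ _ _ _ t])
   show "((%s. d s i) has_real_derivative f i (d t)) (at t)" if "abs t \<le> T" "i < n" for t i
    using d(1) that unfolding f'(4)[OF dR[OF that(1)] that(2), symmetric] by (simp add: sol_def)
  qed (use f xR d flow_sol[OF f xR] in "auto simp: sol_def complete_smooth")
  thus ?thesis using close[OF t i] e' by simp
 qed
 thus ?thesis using \<delta> unfolding c_def by blast
qed

lemma continuous_on_RnI:
 fixes f :: "(nat => real) => real"
 assumes "\<And>x e. x \<in> Rn n ==> e > 0 ==> \<exists>r>0. \<forall>y\<in>cube n x r. \<bar>f y - f x\<bar> < e"
 shows "continuous_on (Rn n) f"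
 unfolding continuous_on_def
proof (intro ballI tendstoI)
 fix x :: "nat => real" and e :: real assume "x \<in> Rn n" "e > 0"
 then obtain r where r: "r > 0" "\<And>y. y \<in> cube n x r ==> \<bar>f y - f x\<bar> < e" using assms by blast
 have "open (\<Inter>i<n. {y. \<bar>y i - x i\<bar> < r})"
 proof (intro open_INT ballI)
  fix i
  have "continuous_on UNIV (%y :: nat => real. \<bar>y i - x i\<bar>)"
   using continuous_on_product_coordinates[of i] by (intro continuous_intros) auto
  from open_vimage[OF _ this, of "{..<r}"] show "open {y :: nat => real. \<bar>y i - x i\<bar> < r}"
   by (simp add: vimage_def)
 qed simp
 hence "\<forall>\<^sub>F y in at x within Rn n. y \<in> (\<Inter>i<n. {y. \<bar>y i - x i\<bar> < r})"
  using r(1) by (intro topological_tendstoD[OF tendsto_ident_at]) auto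
 moreover have "\<forall>\<^sub>F y in at x within Rn n. y \<in> Rn n" by (simp add: eventually_at_filter)
 ultimately show "\<forall>\<^sub>F y in at x within Rn n. dist (f y) (f x) < e"
  by eventually_elim (use r(2) in "auto simp: cube_def dist_real_def")
qed

lemma flow_continuous_on:
 assumes f: "complete_ode n f" and i: "i < n"
 shows "continuous_on (Rn (Suc n)) (%z. flow n f (z 0) (%i. z (Suc i)) i)"
proof (rule continuous_on_RnI)
 fix z :: "nat => real" and e :: real assume z: "z \<in> Rn (Suc n)" and e: "e > 0"
 define x0 where "x0 = (%i. z (Suc i))"
 have x0: "x0 \<in> Rn n" using z by (simp add: x0_def Rn_def)
 obtain \<delta> where \<delta>: "\<delta> > 0" "\<And>x t. x \<in> cube n x0 \<delta> ==> abs t \<le> \<bar>z 0\<bar> + 1 ==> \<bar>flow n f t x i - flow n f t x0 i\<bar> < e / 2"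
  using flow_continuous[OF f x0, of "e/2" "\<bar>z 0\<bar> + 1"] e i by auto
 have "isCont (%t. flow n f t x0 i) (z 0)"
  using flow_DERIV[OF f x0 i] DERIV_isCont by blast
 then obtain d where d: "d > 0" "\<And>t. \<bar>t - z 0\<bar> < d ==> \<bar>flow n f t x0 i - flow n f (z 0) x0 i\<bar> < e / 2"
  unfolding continuous_at_eps_delta dist_real_def using e by (metis half_gt_zero)
 show "\<exists>r>0. \<forall>y\<in>cube (Suc n) z r. \<bar>flow n f (y 0) (%i. y (Suc i)) i - flow n f (z 0) (%i. z (Suc i)) i\<bar> < e"
 proof (intro exI[of _ "min 1 (min d \<delta>)"] conjI ballI)
  fix y assume y: "y \<in> cube (Suc n) z (min 1 (min d \<delta>))"
  have "(%i. y (Suc i)) \<in> cube n x0 \<delta>" using y by (auto simp: cube_def x0_def Rn_def)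
  moreover have "\<bar>y 0 - z 0\<bar> < 1" "\<bar>y 0 - z 0\<bar> < d" using y by (auto simp: cube_def)
  ultimately show "\<bar>flow n f (y 0) (%i. y (Suc i)) i - flow n f (z 0) (%i. z (Suc i)) i\<bar> < e"
   using \<delta>(2)[of "%i. y (Suc i)" "y 0"] d(2)[of "y 0"] by (fold x0_def) linarith
 qed (use d \<delta> in auto)
qed

subsection \<open>Smooth dependence on initial conditions\<close>

text \<open>
 The divided difference of the flow in the direction of \<open>w\<close> is the third component of the flow of
 the system \<open>x' = f x\<close>, \<open>y' = f y\<close>, \<open>w' = g x y w\<close> where \<open>f y - f x = g x y (y - x)\<close>. Hence continuous
 dependence on initial conditions, applied to such systems, gives smooth dependence.
\<close>

definition ext_ode where
 "ext_ode n f g i z = (if i < n then f i (trunc n z) else if i < n + n then f (i - n) (trunc n (%j. z (n + j)))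
   else (\<Sum>j<n. g (i - (n + n)) j (trunc (n + n) z) * z (n + n + j)))"

lemma ext_ode_blocks:
 assumes "x \<in> Rn n" "y \<in> Rn n" "w \<in> Rn n"
 shows "trunc n (cat (n + n) (cat n x y) w) = x"
  "trunc n (%j. cat (n + n) (cat n x y) w (n + j)) = y"
  "trunc (n + n) (cat (n + n) (cat n x y) w) = cat n x y"
  "cat (n + n) (cat n x y) w (n + n + j) = w j"
  "cat (n + n) (cat n x y) w \<in> Rn (n + n + n)"
 using assms by (auto simp: trunc_def cat_def Rn_def fun_eq_iff)

lemma index_blocks:
 assumes "(i::nat) < n + n + n"
 obtains "i < n" | j where "i = n + j" "j < n" | j where "i = n + n + j" "j < n"
 using assms by (metis add.assoc add_less_cancel_left le_Suc_ex not_less)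

lemma ext_ode_sol:
 assumes x: "sol n f x" and y: "sol n f y" and w: "\<And>t. w t \<in> Rn n"
  and w': "\<And>t i. i < n ==> ((%s. w s i) has_real_derivative (\<Sum>j<n. g i j (cat n (x t) (y t)) * w t j)) (at t)"
 shows "sol (n + n + n) (ext_ode n f g) (%t. cat (n + n) (cat n (x t) (y t)) (w t))"
 unfolding sol_def
proof (intro conjI allI impI)
 have R: "x t \<in> Rn n" "y t \<in> Rn n" for t using x y by (auto simp: sol_def)
 note eb = ext_ode_blocks[OF R w]
 show "cat (n + n) (cat n (x t) (y t)) (w t) \<in> Rn (n + n + n)" for t by (rule eb)
 fix t i assume "i < n + n + n"
 thus "((%s. cat (n + n) (cat n (x s) (y s)) (w s) i) has_real_derivative
   ext_ode n f g i (cat (n + n) (cat n (x t) (y t)) (w t))) (at t)"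
 proof (cases rule: index_blocks)
  case 1
  thus ?thesis using x by (simp add: ext_ode_def eb sol_def)
 next
  case (2 j)
  have "ext_ode n f g i (cat (n + n) (cat n (x t) (y t)) (w t)) = f j (y t)"
   using 2 by (simp add: ext_ode_def eb)
  moreover have "cat (n + n) (cat n (x s) (y s)) (w s) i = y s j" for s
   using 2 by (simp add: cat_def)
  ultimately show ?thesis using 2 y by (simp add: sol_def)
 next
  case (3 j)
  thus ?thesis using w'[of j t] by (simp add: ext_ode_def eb)
 qed
qed

lemma ext_ode_complete:
 assumes f: "complete_ode n f" and g: "\<And>i j. i < n ==> j < n ==> smooth_fun (n + n) (g i j)"
 shows "complete_ode (n + n + n) (ext_ode n f g)"
 unfolding complete_ode_def
proof (intro conjI ballI allI impI)
 fix i assume i: "i < n + n + n"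
 have [simp]: "smooth_fun (n + n + n) (%z. f i (trunc n z))" if "i < n" for i
  by (rule smooth_compose[OF complete_smooth[OF f that]]) (rule smooth_coord)
 have [simp]: "smooth_fun (n + n + n) (%z. f i (trunc n (%j. z (n + j))))" if "i < n" for i
  by (rule smooth_compose[OF complete_smooth[OF f that]]) (rule smooth_coord)
 have [simp]: "smooth_fun (n + n + n) (%z. \<Sum>j<n. g i j (trunc (n + n) z) * z (n + n + j))" if "i < n" for i
  by (intro smooth_sum smooth_mult smooth_coord smooth_compose[OF g]) (use that in auto)
 show "smooth_fun (n + n + n) (ext_ode n f g i)"
  unfolding ext_ode_def[abs_def] using i by (cases rule: index_blocks) simp_all
next
 fix z :: "nat => real" assume z: "z \<in> Rn (n + n + n)"
 define x where "x t = flow n f t (trunc n z)" for t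
 define y where "y t = flow n f t (trunc n (%j. z (n + j)))" for t
 have x: "sol n f x" "x 0 = trunc n z" and y: "sol n f y" "y 0 = trunc n (%j. z (n + j))"
  using flow_sol[OF f] by (auto simp: x_def[abs_def] y_def[abs_def])
 have R: "x t \<in> Rn n" "y t \<in> Rn n" for t using x y by (auto simp: sol_def)
 have xyc: "continuous_on UNIV (%t. x t i)" "continuous_on UNIV (%t. y t i)" if "i < n" for i
  using x(1) y(1) that unfolding sol_def by (meson DERIV_isCont continuous_at_imp_continuous_on)+
 have ac: "continuous_on UNIV (%t. g i j (cat n (x t) (y t)))" if ij: "i < n" "j < n" for i j
 proof (rule continuous_compose_Rn[OF smooth_continuous[OF g[OF ij]]])
  fix k assume k: "k < n + n"
  show "continuous_on UNIV (%t. cat n (x t) (y t) k)"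
   using xyc[of k] xyc[of "k - n"] k by (cases "k < n") (auto simp: cat_def)
 qed (use R in auto)
 have "\<exists>w. w 0 = trunc n (%j. z (n + n + j)) \<and> (\<forall>t. w t \<in> Rn n) \<and> (\<forall>t i. i < n -->
   ((%s. w s i) has_real_derivative (\<Sum>j<n. g i j (cat n (x t) (y t)) * w t j)) (at t))"
 proof (rule picard[where F = "%i t w. \<Sum>j<n. g i j (cat n (x t) (y t)) * w j"])
  fix c :: "real => nat => real" and i assume "i < n" "\<And>j. j < n ==> continuous_on UNIV (%t. c t j)"
  thus "continuous_on UNIV (%t. \<Sum>j<n. g i j (cat n (x t) (y t)) * c t j)"
   by (intro continuous_on_sum continuous_on_mult ac) auto
 next
  fix T :: real
  have "\<forall>i j. \<exists>B. i < n --> j < n --> (\<forall>t. abs t \<le> T --> \<bar>g i j (cat n (x t) (y t))\<bar> \<le> B)"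
  proof (intro allI)
   fix i j
   have "bounded ((%t. g i j (cat n (x t) (y t))) ` {-T..T})" if "i < n" "j < n"
    by (intro compact_imp_bounded compact_continuous_image continuous_on_subset[OF ac[OF that]]) auto
   thus "\<exists>B. i < n --> j < n --> (\<forall>t. abs t \<le> T --> \<bar>g i j (cat n (x t) (y t))\<bar> \<le> B)"
    by (force simp: bounded_iff abs_le_iff)
  qed
  then obtain B where B: "\<And>i j t. i < n ==> j < n ==> abs t \<le> T ==> \<bar>g i j (cat n (x t) (y t))\<bar> \<le> B i j"
   unfolding choice_iff by blast
  define L where "L = (\<Sum>i<n. \<Sum>j<n. \<bar>B i j\<bar>)"
  have BL: "\<bar>g i j (cat n (x t) (y t))\<bar> \<le> L" if "i < n" "j < n" "abs t \<le> T" for i j t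
  proof -
   have "\<bar>B i j\<bar> \<le> (\<Sum>j<n. \<bar>B i j\<bar>)" by (rule member_le_sum) (use that in auto)
   also have "\<dots> \<le> L" unfolding L_def
    by (rule member_le_sum[of i "{..<n}" "%i. \<Sum>j<n. \<bar>B i j\<bar>"]) (use that in "auto intro: sum_nonneg")
   finally show ?thesis using B[OF that] by linarith
  qed
  show "\<exists>L. \<forall>t i xa ya. abs t \<le> T --> i < n --> xa \<in> Rn n --> ya \<in> Rn n -->
    \<bar>(\<Sum>j<n. g i j (cat n (x t) (y t)) * xa j) - (\<Sum>j<n. g i j (cat n (x t) (y t)) * ya j)\<bar> \<le> L * (\<Sum>j<n. \<bar>xa j - ya j\<bar>)"
  proof (intro exI[of _ L] allI impI)
   fix t i and u v :: "nat => real" assume a: "abs t \<le> T" "i < n"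
   have "\<bar>(\<Sum>j<n. g i j (cat n (x t) (y t)) * u j) - (\<Sum>j<n. g i j (cat n (x t) (y t)) * v j)\<bar>
    = \<bar>\<Sum>j<n. g i j (cat n (x t) (y t)) * (u j - v j)\<bar>"
    by (simp add: sum_subtractf right_diff_distrib)
   also have "\<dots> \<le> (\<Sum>j<n. \<bar>g i j (cat n (x t) (y t)) * (u j - v j)\<bar>)" by (rule sum_abs)
   also have "\<dots> \<le> (\<Sum>j<n. L * \<bar>u j - v j\<bar>)"
    by (rule sum_mono) (use BL a in "auto simp: abs_mult intro!: mult_right_mono")
   finally show "\<bar>(\<Sum>j<n. g i j (cat n (x t) (y t)) * u j) - (\<Sum>j<n. g i j (cat n (x t) (y t)) * v j)\<bar>
     \<le> L * (\<Sum>j<n. \<bar>u j - v j\<bar>)" by (simp add: sum_distrib_left)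
  qed
 qed simp
 then obtain w where w: "w 0 = trunc n (%j. z (n + n + j))" "\<And>t. w t \<in> Rn n"
   "\<And>t i. i < n ==> ((%s. w s i) has_real_derivative (\<Sum>j<n. g i j (cat n (x t) (y t)) * w t j)) (at t)"
  by blast
 have "cat (n + n) (cat n (x 0) (y 0)) (w 0) = z"
 proof (rule Rn_eqI[OF _ z])
  fix i assume "i < n + n + n"
  thus "cat (n + n) (cat n (x 0) (y 0)) (w 0) i = z i"
   by (cases rule: index_blocks) (auto simp: x y w cat_def trunc_def)
 qed (use ext_ode_blocks[OF R w(2)] in blast)
 thus "\<exists>c. sol (n + n + n) (ext_ode n f g) c \<and> c 0 = z"
  using ext_ode_sol[OF x(1) y(1) w(2,3)] by blast
qed

lemma flow_difference:
 assumes f: "complete_ode n f" and g: "\<And>i j. i < n ==> j < n ==> smooth_fun (n + n) (g i j)"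
  and gf: "\<And>i x y. i < n ==> x \<in> Rn n ==> y \<in> Rn n ==> f i y - f i x = (\<Sum>j<n. (y j - x j) * g i j (cat n x y))"
  and x0: "x0 \<in> Rn n" and j: "j < n" and h: "h \<noteq> 0" and i: "i < n"
 shows "(flow n f t (x0(j := x0 j + h)) i - flow n f t x0 i) / h =
  flow (n + n + n) (ext_ode n f g) t (cat (n + n) (cat n x0 (x0(j := x0 j + h))) ((%_. 0)(j := 1))) (n + n + i)"
proof -
 define y0 where "y0 = x0(j := x0 j + h)"
 have y0: "y0 \<in> Rn n" using x0 j by (simp add: y0_def)
 define x where "x t = flow n f t x0" for t
 define y where "y t = flow n f t y0" for t
 define w where "w t = trunc n (%i. (y t i - x t i) / h)" for t
 have x: "sol n f x" "x 0 = x0" and y: "sol n f y" "y 0 = y0"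
  using flow_sol[OF f] x0 y0 by (auto simp: x_def[abs_def] y_def[abs_def])
 have R: "x t \<in> Rn n" "y t \<in> Rn n" for t using x y by (auto simp: sol_def)
 have "sol (n + n + n) (ext_ode n f g) (%t. cat (n + n) (cat n (x t) (y t)) (w t))"
 proof (rule ext_ode_sol[OF x(1) y(1)])
  show "w t \<in> Rn n" for t by (simp add: w_def)
  fix t i assume i: "i < n"
  have "((%s. (y s i - x s i) / h) has_real_derivative (f i (y t) - f i (x t)) / h) (at t)"
   using x(1) y(1) i by (intro DERIV_cdivide DERIV_diff) (auto simp: sol_def)
  moreover have "(f i (y t) - f i (x t)) / h = (\<Sum>j<n. g i j (cat n (x t) (y t)) * w t j)"
   unfolding gf[OF i R] sum_divide_distrib by (rule sum.cong) (auto simp: w_def)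
  ultimately show "((%s. w s i) has_real_derivative (\<Sum>j<n. g i j (cat n (x t) (y t)) * w t j)) (at t)"
   using i by (simp add: w_def)
 qed
 moreover have "w 0 = (%_. 0)(j := 1)"
  by (rule Rn_eqI[of _ n]) (use j h x y in "auto simp: w_def y0_def Rn_def")
 ultimately have "flow (n + n + n) (ext_ode n f g) t (cat (n + n) (cat n x0 y0) ((%_. 0)(j := 1)))
  = cat (n + n) (cat n (x t) (y t)) (w t)"
  by (intro flow_eqI[OF ext_ode_complete[OF f g]]) (auto simp: x y)
 thus ?thesis using i by (simp add: y0_def[symmetric] w_def x_def y_def)
qed

lemma smooth_if: "smooth_fun n f ==> smooth_fun n g ==> smooth_fun n (%z. if b then f z else g z)"
 by (cases b) simp_all

lemma Ck_compose':
 "Ck k m F ==> (\<And>i. i < m ==> smooth_fun n (%x. g x i)) ==> (\<And>x. x \<in> Rn n ==> g x \<in> Rn m) ==> Ck k n (%x. F (g x))"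
 using Ck_compose[of k m F n "%i x. g x i"] Ck_cong[of n "%x. F (trunc m (g x))" "%x. F (g x)" k]
 by (simp add: smooth_fun_def)

text \<open>The induction generalises the system: a derivative in a spatial direction is a component
  of the flow of a system in 3n variables, to which the hypothesis for order k applies.\<close>

lemma Ck_flow:
 "complete_ode n f ==> i < n ==> Ck k (Suc n) (%z. flow n f (z 0) (%i. z (Suc i)) i)"
proof (induction k arbitrary: n f i)
 case 0
 thus ?case using flow_continuous_on by simp
next
 case (Suc k)
 note f = Suc.prems(1) and i = Suc.prems(2)
 have "\<forall>i. \<exists>g. i < n --> (\<forall>j<n. smooth_fun (n + n) (g j)) \<and>
  (\<forall>x y. x \<in> Rn n --> y \<in> Rn n --> f i y - f i x = (\<Sum>j<n. (y j - x j) * g j (cat n x y)))"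
 proof
  fix i
  show "\<exists>g. i < n --> (\<forall>j<n. smooth_fun (n + n) (g j)) \<and>
   (\<forall>x y. x \<in> Rn n --> y \<in> Rn n --> f i y - f i x = (\<Sum>j<n. (y j - x j) * g j (cat n x y)))"
  proof (cases "i < n")
   case True
   show ?thesis by (rule hadamard[OF complete_smooth[OF f True]]) blast
  qed auto
 qed
 from choice[OF this] obtain g where g:
  "\<And>i j. i < n ==> j < n ==> smooth_fun (n + n) (g i j)"
  "\<And>i x y. i < n ==> x \<in> Rn n ==> y \<in> Rn n ==> f i y - f i x = (\<Sum>j<n. (y j - x j) * g i j (cat n x y))"
  by blast
 define N where "N = n + n + n"
 define fe where "fe = ext_ode n f g"
 have fe: "complete_ode N fe" unfolding N_def fe_def by (rule ext_ode_complete[OF f g(1)])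
 define pt where "pt x y j = cat (n + n) (cat n x y) ((%_. 0)(j := 1))" for x y :: "nat => real" and j
 have pt: "pt x y j \<in> Rn N" if "x \<in> Rn n" "y \<in> Rn n" "j < n" for x y j
  using ext_ode_blocks(5)[OF that(1,2), of "(%_. 0)(j := 1)"] that by (auto simp: pt_def N_def Rn_def)
 \<comment> \<open>The expected partial derivatives: in time the field along the flow, in direction
   j the extended flow started at (x, x, e_j), which is the limit of the divided differences started
   at (x, x + h e_j, e_j).\<close>
 define d where "d m z = (case m of 0 => f i (flow n f (z 0) (%i. z (Suc i)))
   | Suc j => flow N fe (z 0) (pt (%i. z (Suc i)) (%i. z (Suc i)) j) (n + n + i))" for m and z :: "nat => real"
 have zR: "(%i. z (Suc i)) \<in> Rn n" if "z \<in> Rn (Suc n)" for z :: "nat => real" using that by (simp add: Rn_def)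
 show ?case
 proof (rule Ck_SucI[of _ _ d])
  show "continuous_on (Rn (Suc n)) (%z. flow n f (z 0) (%i. z (Suc i)) i)"
   by (rule flow_continuous_on[OF f i])
 next
  fix m z assume m: "m < Suc n" and z: "z \<in> Rn (Suc n)"
  define x where "x = (%i. z (Suc i))"
  have x: "x \<in> Rn n" using zR[OF z] by (simp add: x_def)
  show "((%t. flow n f ((z(m := t)) 0) (%i. (z(m := t)) (Suc i)) i) has_real_derivative d m z) (at (z m))"
  proof (cases m)
   case 0
   thus ?thesis using flow_DERIV[OF f zR[OF z] i] by (simp add: d_def)
  next
   case (Suc j)
   hence j: "j < n" using m by simp
   have up: "(%i. (z(m := t)) (Suc i)) = x(j := t)" for t using Suc by (auto simp: x_def)
   define W where "W s = flow N fe (z 0) (pt x (x(j := s)) j) (n + n + i)" for s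
   have Wc: "isCont W (x j)"
    unfolding continuous_at_eps_delta
   proof (intro allI impI)
    fix e :: real assume e: "e > 0"
    have xj: "pt x (x(j := x j)) j \<in> Rn N" by (rule pt) (use x j in auto)
    obtain \<delta> where \<delta>: "\<delta> > 0" "\<And>y. y \<in> cube N (pt x (x(j := x j)) j) \<delta> ==>
      \<bar>flow N fe (z 0) y (n + n + i) - flow N fe (z 0) (pt x (x(j := x j)) j) (n + n + i)\<bar> < e"
     using flow_continuous[OF fe xj e, of "\<bar>z 0\<bar>"] i unfolding N_def by auto
    show "\<exists>d>0. \<forall>x'. dist x' (x j) < d --> dist (W x') (W (x j)) < e"
    proof (intro exI[of _ \<delta>] conjI allI impI)
     fix s assume s: "dist s (x j) < \<delta>"
     have "pt x (x(j := s)) j \<in> cube N (pt x (x(j := x j)) j) \<delta>"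
      using pt[OF x Rn_upd[OF x j] j, of s] s \<delta>(1)
      by (auto simp: cube_def pt_def cat_def dist_real_def)
     from \<delta>(2)[OF this] show "dist (W s) (W (x j)) < e" by (simp add: W_def dist_real_def)
    qed (use \<delta> in auto)
   qed
   have "((%s. (flow n f (z 0) (x(j := s)) i - flow n f (z 0) x i) / (s - x j)) \<longlongrightarrow> W (x j)) (at (x j))"
   proof (rule Lim_transform_eventually)
    show "(W \<longlongrightarrow> W (x j)) (at (x j))" using Wc by (simp add: isCont_def)
    have "W s = (flow n f (z 0) (x(j := s)) i - flow n f (z 0) x i) / (s - x j)" if "s \<noteq> x j" for s
    proof -
     have e: "x j + (s - x j) = s" and h: "s - x j \<noteq> 0" using that by auto
     show ?thesis
      unfolding W_def N_def fe_def pt_def using flow_difference[OF f g x j h i, of "z 0"]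
      unfolding e by (rule sym)
    qed
    thus "\<forall>\<^sub>F s in at (x j). W s = (flow n f (z 0) (x(j := s)) i - flow n f (z 0) x i) / (s - x j)"
     by (simp add: eventually_at_filter)
   qed
   hence "((%s. flow n f (z 0) (x(j := s)) i) has_real_derivative W (x j)) (at (x j))"
    by (simp add: has_field_derivative_iff del: fun_upd_apply)
   moreover have "W (x j) = d m z" unfolding W_def fun_upd_triv by (simp add: d_def Suc x_def)
   moreover have "z m = x j" "(z(m := t)) 0 = z 0" for t by (auto simp: x_def Suc)
   ultimately show ?thesis unfolding up by simp
  qed
 next
  fix m assume m: "m < Suc n"
  show "Ck k (Suc n) (d m)"
  proof (cases m)
   case 0
   have "Ck k n (f i)" using complete_smooth[OF f i] by (simp add: smooth_fun_def)
   hence "Ck k (Suc n) (%z. f i (trunc n (%l. flow n f (z 0) (%i. z (Suc i)) l)))"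
    by (rule Ck_compose) (use Suc.IH[OF f] in auto)
   thus ?thesis unfolding 0
    by (rule Ck_cong[THEN iffD1, rotated]) (use zR f in "auto simp: d_def")
  next
   case (Suc j)
   hence j: "j < n" using m by simp
   have "Ck k (Suc n) (%z. (%u. flow N fe (u 0) (%i. u (Suc i)) (n + n + i))
     (scons (z 0) (pt (%i. z (Suc i)) (%i. z (Suc i)) j)))"
   proof (rule Ck_compose'[where m = "Suc N" and F = "%u. flow N fe (u 0) (%i. u (Suc i)) (n + n + i)"
      and g = "%z. scons (z 0) (pt (%i. z (Suc i)) (%i. z (Suc i)) j)"])
    show "Ck k (Suc N) (%u. flow N fe (u 0) (%i. u (Suc i)) (n + n + i))"
     using Suc.IH[OF fe, of "n + n + i"] i by (simp add: N_def)
    fix l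
    show "smooth_fun (Suc n) (%z. scons (z 0) (pt (%i. z (Suc i)) (%i. z (Suc i)) j) l)"
     by (cases l) (auto simp: pt_def cat_def intro!: smooth_coord smooth_if)
   qed (use pt zR j in auto)
   thus ?thesis by (simp add: d_def[abs_def] Suc)
  qed
 qed
qed

lemma smooth_flow:
 "complete_ode n f ==> i < n ==> smooth_fun (Suc n) (%z. flow n f (z 0) (%i. z (Suc i)) i)"
 by (simp add: smooth_fun_def Ck_flow)

text \<open>\<Phi> is the flow of a cut-off system. It is therefore defined and smooth everywhere,
  but solves the given equation only near \<open>x0\<close> and for small times, while orbits stay
  in the cube where nothing was cut off.\<close>

lemma ode_local:
 assumes f: "\<And>i. i < n ==> smooth_fun n (f i)" and x0: "x0 \<in> Rn n"
 shows "\<exists>\<Phi>. (\<forall>i<n. smooth_fun (Suc n) (%z. \<Phi> (z 0) (%i. z (Suc i)) i)) \<and> (\<forall>t. \<forall>x\<in>Rn n. \<Phi> t x \<in> Rn n) \<and>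
  (\<forall>x\<in>Rn n. \<Phi> 0 x = x) \<and> (\<exists>r>0. \<forall>x\<in>cube n x0 r. \<forall>t i. abs t < r --> i < n -->
   ((%s. \<Phi> s x i) has_real_derivative f i (\<Phi> t x)) (at t))"
proof -
 define R where "R = (\<Sum>i<n. \<bar>x0 i\<bar>) + 1"
 have R0: "R \<ge> 0" by (auto simp: R_def intro: add_nonneg_nonneg sum_nonneg)
 have x0R: "\<bar>x0 i\<bar> + 1 \<le> R" if "i < n" for i
  unfolding R_def using member_le_sum[of i "{..<n}" "%i. \<bar>x0 i\<bar>"] that by auto
 from cutoff[of n f R, OF f R0] obtain f' L where f'0:
  "\<forall>i<n. smooth_fun n (f' i)" "L \<ge> 0"
  "\<forall>i x y. i < n --> x \<in> Rn n --> y \<in> Rn n --> \<bar>f' i x - f' i y\<bar> \<le> L * (\<Sum>j<n. \<bar>x j - y j\<bar>)"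
  "\<forall>x i. x \<in> ccube n R --> i < n --> f' i x = f i x"
  by blast
 have cf': "complete_ode n f'" by (rule lipschitz_complete) (use f'0 in auto)
 have sm: "smooth_fun (Suc n) (%z. flow n f' (z 0) (%i. z (Suc i)) i)" if "i < n" for i
  by (rule smooth_flow[OF cf' that])
 have "\<forall>i. \<exists>r. i < n --> r > 0 \<and> (\<forall>z\<in>cube (Suc n) (scons 0 x0) r. \<bar>flow n f' (z 0) (%i. z (Suc i)) i - x0 i\<bar> < 1)"
 proof (intro allI)
  fix i
  show "\<exists>r. i < n --> r > 0 \<and> (\<forall>z\<in>cube (Suc n) (scons 0 x0) r. \<bar>flow n f' (z 0) (%i. z (Suc i)) i - x0 i\<bar> < 1)"
  proof (cases "i < n")
   case True
   have "\<exists>r>0. \<forall>z\<in>cube (Suc n) (scons 0 x0) r. flow n f' (z 0) (%i. z (Suc i)) i \<in> {x0 i - 1<..<x0 i + 1}"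
    by (rule continuous_cube[OF smooth_continuous[OF sm[OF True]]]) (use x0 flow_sol[OF cf' x0] in auto)
   thus ?thesis by (force simp: abs_less_iff)
  qed auto
 qed
 from choice[OF this] obtain r where r: "\<And>i. i < n ==> r i > 0"
  "\<And>i z. i < n ==> z \<in> cube (Suc n) (scons 0 x0) (r i) ==> \<bar>flow n f' (z 0) (%i. z (Suc i)) i - x0 i\<bar> < 1"
  by blast
 define \<rho> where "\<rho> = Min (insert 1 (r ` {..<n}))"
 have \<rho>: "\<rho> > 0" "\<And>i. i < n ==> \<rho> \<le> r i" using r(1) by (auto simp: \<rho>_def)
 show ?thesis
 proof (intro exI[of _ "flow n f'"] conjI exI[of _ \<rho>] ballI allI impI)
  fix x t i assume x: "x \<in> cube n x0 \<rho>" and t: "abs t < \<rho>" and i: "i < n"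
  have xR: "x \<in> Rn n" using x by (simp add: cube_def)
  have "\<bar>flow n f' t x j\<bar> \<le> R" if j: "j < n" for j
  proof -
   have "scons t x \<in> cube (Suc n) (scons 0 x0) (r j)"
    using x t \<rho>(2)[OF j] xR by (auto simp: cube_def less_Suc_eq_0_disj intro: less_le_trans)
   from r(2)[OF j this] x0R[OF j] show ?thesis by simp
  qed
  hence "f' i (flow n f' t x) = f i (flow n f' t x)"
   using f'0(4) i xR cf' by (simp add: ccube_def)
  thus "((%s. flow n f' s x i) has_real_derivative f i (flow n f' t x)) (at t)"
   using flow_DERIV[OF cf' xR i, of t] by simp
 qed (use sm flow_sol[OF cf'] cf' \<rho> in auto)
qed

subsection \<open>Exchanging one coordinate\<close>

lemma zero_derivative_const:
 fixes f :: "real => real"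
 assumes "\<And>s. abs s < r ==> (f has_real_derivative 0) (at s)" "abs t < r"
 shows "f t = f 0"
proof -
 have "\<exists>c. \<forall>x\<in>{-r<..<r}. f x = c"
  by (rule has_field_derivative_zero_constant) (use assms in "auto simp: has_field_derivative_at_within")
 thus ?thesis using assms(2) by (auto simp: abs_less_iff)
qed

text \<open>A bump function interpolates between \<open>h\<close> near \<open>x0\<close> and the
  constant \<open>h x0\<close> elsewhere. Where both contribute they have the same sign, so the
  interpolation has no zero and its reciprocal is smooth everywhere.\<close>

lemma smooth_local_inverse:
 assumes h: "smooth_fun m h" and x0: "x0 \<in> Rn m" and nz: "h x0 \<noteq> 0"
 shows "\<exists>w r. smooth_fun m w \<and> r > 0 \<and> (\<forall>x\<in>cube m x0 r. h x \<noteq> 0 \<and> w x = 1 / h x)"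
proof -
 have "\<exists>r>0. \<forall>x\<in>cube m x0 r. h x * h x0 \<in> {0<..}"
  by (rule continuous_cube[OF _ x0])
   (use smooth_continuous[OF h] nz in "auto intro!: continuous_intros simp: zero_less_mult_iff linorder_neq_iff")
 then obtain r where r: "r > 0" "\<And>x. x \<in> cube m x0 r ==> h x * h x0 > 0" by auto
 from bump_exists[OF r(1), of m x0] obtain b where b: "smooth_fun m b" "\<forall>x. 0 \<le> b x \<and> b x \<le> 1"
  "\<forall>x\<in>cube m x0 (r/2). b x = 1" "\<forall>x. b x \<noteq> 0 --> (\<forall>i<m. \<bar>x i - x0 i\<bar> < 3 * r / 4)" by blast
 define \<beta> where "\<beta> x = b x * h x + (1 - b x) * h x0" for x
 have \<beta>: "\<beta> x \<noteq> 0" if "x \<in> Rn m" for x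
 proof (cases "b x = 0")
  case False
  hence "x \<in> cube m x0 r" using b(4) r(1) that by (force simp: cube_def)
  from r(2)[OF this] have "b x * (h x * h x0) > 0" using b(2) False by (metis less_eq_real_def mult_pos_pos)
  moreover have "(1 - b x) * (h x0 * h x0) \<ge> 0" using b(2) by (simp add: zero_le_mult_iff)
  ultimately have "\<beta> x * h x0 > 0" by (simp add: \<beta>_def algebra_simps)
  thus ?thesis by auto
 qed (use nz in "simp add: \<beta>_def")
 show ?thesis
 proof (intro exI[of _ "%x. 1 / \<beta> x"] exI[of _ "r/2"] conjI ballI)
  show "smooth_fun m (%x. 1 / \<beta> x)"
   using \<beta> unfolding \<beta>_def by (intro smooth_inverse smooth_intros b h) auto
  fix x assume x: "x \<in> cube m x0 (r/2)"
  hence "x \<in> cube m x0 r" using r cube_mono[of "r/2" r m x0] by auto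
  from r(2)[OF this] show "h x \<noteq> 0" by auto
  show "1 / \<beta> x = 1 / h x" using b(3) x by (simp add: \<beta>_def)
 qed (use r in auto)
qed

text \<open>The local change of coordinates that puts \<open>H\<close> in place of coordinate i.
  Along the field with i-th component 1/\<partial>_i H and all others 0, \<open>H\<close> grows at
  unit speed and the other coordinates rest; flowing until \<open>H\<close> has a prescribed value
  recovers coordinate i smoothly.\<close>

lemma exchange_coordinate:
 assumes H: "smooth_fun m H" and x0: "x0 \<in> Rn m" and i: "i < m" and nz: "pd i H x0 \<noteq> 0"
 shows "\<exists>\<kappa> r. smooth_fun m \<kappa> \<and> r > 0 \<and> (\<forall>y\<in>cube m (x0(i := H x0)) r. H (y(i := \<kappa> y)) = y i) \<and>
  (\<forall>x\<in>cube m x0 r. \<kappa> (x(i := H x)) = x i)"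
proof -
 from smooth_local_inverse[OF smooth_pd[OF H i] x0 nz] obtain w r0 where w: "smooth_fun m w" "r0 > 0"
  "\<forall>x\<in>cube m x0 r0. pd i H x \<noteq> 0 \<and> w x = 1 / pd i H x" by blast
 define f where "f l = (if l = i then w else (%_. 0))" for l
 have f: "smooth_fun m (f l)" for l using w by (simp add: f_def)
 from ode_local[of m f, OF f x0] obtain \<Phi> r1 where P: "\<forall>i<m. smooth_fun (Suc m) (%z. \<Phi> (z 0) (%i. z (Suc i)) i)"
  "\<forall>t. \<forall>x\<in>Rn m. \<Phi> t x \<in> Rn m" "\<forall>x\<in>Rn m. \<Phi> 0 x = x" "r1 > 0"
  "\<forall>x\<in>cube m x0 r1. \<forall>t i. abs t < r1 --> i < m --> ((%s. \<Phi> s x i) has_real_derivative f i (\<Phi> t x)) (at t)"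
  by blast
 have "\<exists>r>0. \<forall>z\<in>cube (Suc m) (scons 0 x0) r. \<Phi> (z 0) (%i. z (Suc i)) i \<in> {x0 i - r0<..<x0 i + r0}"
  by (rule continuous_cube[OF smooth_continuous[OF P(1)[rule_format, OF i]]]) (use x0 P(3) w(2) in auto)
 then obtain r2' where r2': "r2' > 0" "\<And>z. z \<in> cube (Suc m) (scons 0 x0) r2' ==> \<Phi> (z 0) (%i. z (Suc i)) i \<in> {x0 i - r0<..<x0 i + r0}"
  by auto
 define r2 where "r2 = min r2' (min r0 r1)"
 have r2: "r2 > 0" "r2 \<le> r2'" "r2 \<le> r0" "r2 \<le> r1" using r2' w(2) P(4) by (auto simp: r2_def)
 have other: "\<Phi> t x l = x l" if x: "x \<in> cube m x0 r2" and t: "abs t < r2" and l: "l < m" "l \<noteq> i" for x t l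
 proof -
  have xr: "x \<in> cube m x0 r1" using x cube_mono[OF r2(4)] by blast
  have "\<Phi> t x l = \<Phi> 0 x l"
  proof (rule zero_derivative_const[OF _ t])
   show "((%s. \<Phi> s x l) has_real_derivative 0) (at s)" if "abs s < r2" for s
    using P(5)[rule_format, OF xr, of s l] that r2 l by (auto simp: f_def)
  qed
  thus ?thesis using P(3) x by (simp add: cube_def)
 qed
 have stay: "\<Phi> t x \<in> cube m x0 r0" if x: "x \<in> cube m x0 r2" and t: "abs t < r2" for x t
 proof -
  have xR: "x \<in> Rn m" using x by (simp add: cube_def)
  have "scons t x \<in> cube (Suc m) (scons 0 x0) r2'"
   using x t r2(2) by (auto simp: cube_def less_Suc_eq_0_disj)
  from r2'(2)[OF this] have "\<bar>\<Phi> t x i - x0 i\<bar> < r0" by auto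
  moreover have "\<bar>\<Phi> t x l - x0 l\<bar> < r0" if "l < m" "l \<noteq> i" for l
   using other[OF x t that] x that r2(3) by (auto simp: cube_def)
  ultimately show ?thesis using P(2) xR unfolding cube_def by (smt (verit) mem_Collect_eq)
 qed
 have Hflow: "H (\<Phi> t x) = H x + t" if x: "x \<in> cube m x0 r2" and t: "abs t < r2" for x t
 proof -
  have xr: "x \<in> cube m x0 r1" and xR: "x \<in> Rn m" using x cube_mono[OF r2(4)] by (auto simp: cube_def)
  have D: "((%s. H (\<Phi> s x) - s) has_real_derivative 0) (at s)" if s: "abs s < r2" for s
  proof -
   have "((%s. H (\<Phi> s x)) has_real_derivative (\<Sum>l<m. pd l H (\<Phi> s x) * f l (\<Phi> s x))) (at s)"
    by (rule smooth_chain[OF H]) (use P(2) xR P(5) xr s r2 in auto)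
   moreover have "(\<Sum>l<m. pd l H (\<Phi> s x) * f l (\<Phi> s x)) = (\<Sum>l<m. if l = i then pd l H (\<Phi> s x) * f l (\<Phi> s x) else 0)"
    by (rule sum.cong) (auto simp: f_def)
   moreover have "\<dots> = 1" using i w(3) stay[OF x s] by (simp add: f_def)
   ultimately show ?thesis by (auto intro!: derivative_eq_intros)
  qed
  have "H (\<Phi> t x) - t = H (\<Phi> 0 x) - 0"
by (rule zero_derivative_const[OF D t])
  thus ?thesis using P(3) xR by simp
 qed
 \<comment> \<open>The time needed to bring \<open>H\<close> from its value at the base point, where
   coordinate i is \<open>x0 i\<close>, to the prescribed value \<open>y i\<close>.\<close>
 define tm where "tm y = y i - H (y(i := x0 i))" for y :: "nat => real"
 define \<kappa> where "\<kappa> y = \<Phi> (tm y) (y(i := x0 i)) i" for y :: "nat => real"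
 have sc: "smooth_fun m (%y. (y(i := x0 i)) l)" for l
  by (cases "l = i") (auto simp: smooth_coord)
 have tm: "smooth_fun m tm" unfolding tm_def
  by (intro smooth_diff smooth_coord smooth_compose'[OF H sc] Rn_upd i)
 have \<kappa>: "smooth_fun m \<kappa>"
 proof -
  have "smooth_fun m (%y. (%z. \<Phi> (z 0) (%i. z (Suc i)) i) (scons (tm y) (y(i := x0 i))))"
  proof (rule smooth_compose'[where m = "Suc m" and F = "%z. \<Phi> (z 0) (%i. z (Suc i)) i" and g = "%y. scons (tm y) (y(i := x0 i))"])
   show "smooth_fun m (%y. scons (tm y) (y(i := x0 i)) l)" for l
    by (cases l) (use tm sc in auto)
   show "scons (tm y) (y(i := x0 i)) \<in> Rn (Suc m)" if "y \<in> Rn m" for y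
    by (intro scons_Rn Rn_upd that i)
  qed (use P(1) i in auto)
  thus ?thesis by (simp add: \<kappa>_def[abs_def] del: fun_upd_apply)
 qed
 define y0 where "y0 = x0(i := H x0)"
 have y0: "y0 \<in> Rn m" using x0 i by (simp add: y0_def)
 have "tm y0 = 0" by (simp add: tm_def y0_def)
 hence "\<exists>r>0. \<forall>y\<in>cube m y0 r. tm y \<in> {-r2<..<r2}"
  by (intro continuous_cube[OF smooth_continuous[OF tm] y0]) (use r2 in auto)
 then obtain r3' where r3': "r3' > 0" "\<And>y. y \<in> cube m y0 r3' ==> \<bar>tm y\<bar> < r2" by fastforce
 define r3 where "r3 = min r3' r2"
 have r3: "r3 > 0" using r3' r2 by (simp add: r3_def)
 have A: "H (y(i := \<kappa> y)) = y i \<and> y(i := \<kappa> y) \<in> cube m x0 r0" if y: "y \<in> cube m y0 r3" for y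
 proof -
  have yR: "y \<in> Rn m" using y by (simp add: cube_def)
  have t: "\<bar>tm y\<bar> < r2" using r3'(2)[of y] y cube_mono[of r3 r3' m y0] by (auto simp: r3_def)
  have b: "y(i := x0 i) \<in> cube m x0 r2"
   using y i r2(1) by (auto simp: cube_def r3_def y0_def Rn_def)
  have "\<Phi> (tm y) (y(i := x0 i)) = y(i := \<kappa> y)"
   by (rule Rn_eqI[of _ m]) (use P(2) yR i other[OF b t] in "auto simp: \<kappa>_def")
  thus ?thesis using Hflow[OF b t] stay[OF b t] by (simp add: tm_def)
 qed
 have "\<exists>r>0. \<forall>x\<in>cube m x0 r. H x \<in> {H x0 - r3<..<H x0 + r3}"
  by (rule continuous_cube[OF smooth_continuous[OF H] x0]) (use r3 in auto)
 then obtain r4 where r4: "r4 > 0" "\<And>x. x \<in> cube m x0 r4 ==> \<bar>H x - H x0\<bar> < r3" by fastforce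
 show ?thesis
 proof (intro exI[of _ \<kappa>] exI[of _ "min r3 (min r4 r0)"] conjI ballI \<kappa>)
  fix y assume "y \<in> cube m (x0(i := H x0)) (min r3 (min r4 r0))"
  thus "H (y(i := \<kappa> y)) = y i" using A[of y] by (auto simp: y0_def cube_def)
 next
  fix x assume x: "x \<in> cube m x0 (min r3 (min r4 r0))"
  hence xR: "x \<in> Rn m" and xr0: "x \<in> cube m x0 r0" and "\<bar>H x - H x0\<bar> < r3"
   using r4(2)[of x] by (auto simp: cube_def)
  hence "x(i := H x) \<in> cube m y0 r3" using x i by (auto simp: cube_def y0_def)
  from A[OF this] have a: "H (x(i := \<kappa> (x(i := H x)))) = H x" "x(i := \<kappa> (x(i := H x))) \<in> cube m x0 r0" by auto
  \<comment> \<open>Both \<open>s\<close> and \<open>x i\<close>, put in place i, give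
    \<open>H\<close> the same value. Between them \<partial>_i H has no zero, so the mean value
    theorem forces them to be equal.\<close>
  define s where "s = \<kappa> (x(i := H x))"
  have bnd: "x(i := u) \<in> cube m x0 r0" if "min s (x i) \<le> u" "u \<le> max s (x i)" for u
  proof -
   have "\<bar>s - x0 i\<bar> < r0" "\<bar>x i - x0 i\<bar> < r0" using a(2) xr0 i by (auto simp: cube_def s_def)
   hence "\<bar>u - x0 i\<bar> < r0" using that by (auto simp: min_def max_def split: if_splits)
   thus ?thesis using xr0 i by (auto simp: cube_def)
  qed
  have D: "((%t. H (x(i := t))) has_real_derivative pd i H (x(i := u))) (at u)" for u
   by (rule smooth_DERIV[OF H i xR])
  have eq: "H (x(i := s)) = H (x(i := x i))" using a by (simp add: s_def)
  show "\<kappa> (x(i := H x)) = x i"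
  proof (rule ccontr)
   assume "\<kappa> (x(i := H x)) \<noteq> x i"
   then consider "s < x i" | "x i < s" unfolding s_def by linarith
   thus False
   proof cases
    case 1
    then obtain u where u: "s < u" "u < x i" "H (x(i := x i)) - H (x(i := s)) = (x i - s) * pd i H (x(i := u))"
     using MVT2[OF 1, of "%t. H (x(i := t))" "%u. pd i H (x(i := u))"] D by blast
    thus False using eq 1 w(3) bnd[of u] by auto
   next
    case 2
    then obtain u where u: "x i < u" "u < s" "H (x(i := s)) - H (x(i := x i)) = (s - x i) * pd i H (x(i := u))"
     using MVT2[OF 2, of "%t. H (x(i := t))" "%u. pd i H (x(i := u))"] D by blast
    thus False using eq 2 w(3) bnd[of u] by auto
   qed
  qed
 qed (use r3 r4 w in auto)
qed

section \<open>Germs of smooth functions and maps\<close>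

lemma topspace_init_top [simp]: "topspace (init_top S A) = S"
 by (auto simp: init_top_def)

lemma topspace_dtop [simp]: "topspace (dtop X) = pts X"
 by (simp add: dtop_def)

lemma pts_gen [simp]: "pts (gen S A) = S"
 by (simp add: gen_def)

lemma pts_sub [simp]: "pts (sub X S) = S"
 by (simp add: sub_def)

lemma init_top_basis_union:
 assumes "a1 ` {..<k1::nat} \<subseteq> A" "r1 > 0" "a2 ` {..<k2::nat} \<subseteq> A" "(r2::real) > 0"
 shows "\<exists>k a r. a ` {..<k::nat} \<subseteq> A \<and> r > 0 \<and>
  (\<forall>y. (\<forall>i<k. \<bar>a i y - a i x\<bar> < r) --> (\<forall>i<k1. \<bar>a1 i y - a1 i x\<bar> < r1) \<and> (\<forall>i<k2. \<bar>a2 i y - a2 i x\<bar> < r2))"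
proof (intro exI[of _ "k1 + k2"] exI[of _ "%i. if i < k1 then a1 i else a2 (i - k1)"] exI[of _ "min r1 r2"] conjI allI impI)
 show "(%i. if i < k1 then a1 i else a2 (i - k1)) ` {..<k1 + k2} \<subseteq> A"
  using assms by (auto simp: image_subset_iff)
next
 fix y i assume *: "\<forall>i<k1 + k2. \<bar>(if i < k1 then a1 i else a2 (i - k1)) y - (if i < k1 then a1 i else a2 (i - k1)) x\<bar> < min r1 r2"
 show "\<bar>a1 i y - a1 i x\<bar> < r1" if "i < k1" using *[rule_format, of i] that by simp
 show "\<bar>a2 i y - a2 i x\<bar> < r2" if "i < k2" using *[rule_format, of "k1 + i"] that by simp
qed (use assms in auto)

text \<open>Finitely many generators and a common radius describe all neighbourhoods. Continuity and
  locality arguments thereby become statements about finitely many real functions.\<close>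

lemma openin_init_top:
 "openin (init_top S A) U \<longleftrightarrow> U \<subseteq> S \<and> (\<forall>x\<in>U. \<exists>k a r. a ` {..<k::nat} \<subseteq> A \<and> r > 0 \<and>
   (\<forall>y\<in>S. (\<forall>i<k. \<bar>a i y - a i x\<bar> < r) --> y \<in> U))" (is "?L = ?R")
proof
 assume L: ?L
 have "U \<subseteq> S" using openin_subset[OF L] by simp
 moreover have "\<forall>x\<in>U. \<exists>k a r. a ` {..<k::nat} \<subseteq> A \<and> r > 0 \<and> (\<forall>y\<in>S. (\<forall>i<k. \<bar>a i y - a i x\<bar> < r) --> y \<in> U)"
  using L unfolding init_top_def openin_topology_generated_by_iff
 proof (induction rule: generate_topology_on.induct)
  case (Int U V)
  show ?case
  proof
   fix x assume "x \<in> U \<inter> V"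
   hence xU: "x \<in> U" and xV: "x \<in> V" by auto
   from bspec[OF Int.IH(1) xU] obtain k1 a1 r1 where 1: "a1 ` {..<k1::nat} \<subseteq> A" "r1 > 0"
    "\<forall>y\<in>S. (\<forall>i<k1. \<bar>a1 i y - a1 i x\<bar> < r1) --> y \<in> U" by (elim exE conjE) (rule that)
   from bspec[OF Int.IH(2) xV] obtain k2 a2 r2 where 2: "a2 ` {..<k2::nat} \<subseteq> A" "r2 > 0"
    "\<forall>y\<in>S. (\<forall>i<k2. \<bar>a2 i y - a2 i x\<bar> < r2) --> y \<in> V" by (elim exE conjE) (rule that)
   from init_top_basis_union[OF 1(1,2) 2(1,2), of x] obtain k a r where 3: "a ` {..<k::nat} \<subseteq> A" "r > 0"
    "\<forall>y. (\<forall>i<k. \<bar>a i y - a i x\<bar> < r) --> (\<forall>i<k1. \<bar>a1 i y - a1 i x\<bar> < r1) \<and> (\<forall>i<k2. \<bar>a2 i y - a2 i x\<bar> < r2)"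
    by (elim exE conjE) (rule that)
   have "\<forall>y\<in>S. (\<forall>i<k. \<bar>a i y - a i x\<bar> < r) --> y \<in> U \<inter> V"
    using 1(3) 2(3) 3(3) by simp
   with 3(1,2) show "\<exists>k a r. a ` {..<k::nat} \<subseteq> A \<and> r > 0 \<and> (\<forall>y\<in>S. (\<forall>i<k. \<bar>a i y - a i x\<bar> < r) --> y \<in> U \<inter> V)"
    by blast
  qed
 next
  case (UN K)
  show ?case
  proof
   fix x assume "x \<in> \<Union>K"
   then obtain U where U: "U \<in> K" "x \<in> U" by blast
   from UN.IH[OF U(1)] U(2) show "\<exists>k a r. a ` {..<k::nat} \<subseteq> A \<and> r > 0 \<and> (\<forall>y\<in>S. (\<forall>i<k. \<bar>a i y - a i x\<bar> < r) --> y \<in> \<Union>K)"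
    using U(1) by (meson UnionI)
  qed
 next
  case (Basis s)
  then consider "s = S" | a T where "s = {x\<in>S. a x \<in> T}" "a \<in> A" "open T" by blast
  thus ?case
  proof cases
   case 1
   thus ?thesis by (intro ballI exI[of _ 0] exI[of _ "%_ _. 0"] exI[of _ 1]) auto
  next
   case 2
   show ?thesis
   proof
    fix x assume "x \<in> s"
    then obtain r where r: "r > 0" "\<And>u. \<bar>u - a x\<bar> < r ==> u \<in> T"
     using 2 unfolding open_dist by (auto simp: dist_real_def)
    show "\<exists>k a r. a ` {..<k::nat} \<subseteq> A \<and> r > 0 \<and> (\<forall>y\<in>S. (\<forall>i<k. \<bar>a i y - a i x\<bar> < r) --> y \<in> s)"
     by (rule exI[of _ 1], rule exI[of _ "%_. a"], rule exI[of _ r]) (use 2 r in auto)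
   qed
  qed
 qed simp
 ultimately show ?R by blast
next
 assume R: ?R
 show ?L
 proof (subst openin_subopen, intro ballI)
  fix x assume x: "x \<in> U"
  then obtain k a r where kar: "a ` {..<k::nat} \<subseteq> A" "r > 0" "\<forall>y\<in>S. (\<forall>i<k. \<bar>a i y - a i x\<bar> < r) --> y \<in> U"
   using R by blast
  have g: "openin (init_top S A) {y\<in>S. a i y \<in> {a i x - r<..<a i x + r}}" if "i < k" for i
   unfolding init_top_def
  proof (rule topology_generated_by_Basis, rule insertI2, rule CollectI, intro exI conjI)
   show "a i \<in> A" using kar(1) that by auto
  qed (rule refl, simp)
  have S: "openin (init_top S A) S" using openin_topspace[of "init_top S A"] by simp
  define T where "T = \<Inter>(insert S ((%i. {y\<in>S. a i y \<in> {a i x - r<..<a i x + r}}) ` {..<k}))"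
  have "openin (init_top S A) T"
   unfolding T_def by (rule openin_Inter) (use g S in auto)
  moreover have "x \<in> T" using R x kar(2) by (auto simp: T_def)
  moreover have "T \<subseteq> U"
  proof
   fix y assume y: "y \<in> T"
   hence "y \<in> S" "\<forall>i<k. \<bar>a i y - a i x\<bar> < r" by (auto simp: T_def abs_less_iff less_diff_eq diff_less_eq add.commute)
   thus "y \<in> U" using kar(3) by blast
  qed
  ultimately show "\<exists>T. openin (init_top S A) T \<and> x \<in> T \<and> T \<subseteq> U" by blast
 qed
qed

lemma eventually_init_top:
 assumes "x \<in> S"
 shows "eventually P (nhdsin (init_top S A) x) \<longleftrightarrow> (\<exists>k a r. a ` {..<k::nat} \<subseteq> A \<and> r > 0 \<and>
   (\<forall>y\<in>S. (\<forall>i<k. \<bar>a i y - a i x\<bar> < r) --> P y))" (is "?L = ?R")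
proof
 assume ?L
 then obtain U where U: "openin (init_top S A) U" "x \<in> U" "\<And>y. y \<in> U ==> P y"
  using assms by (auto simp: eventually_nhdsin)
 then obtain k a r where "a ` {..<k::nat} \<subseteq> A" "r > 0" "\<forall>y\<in>S. (\<forall>i<k. \<bar>a i y - a i x\<bar> < r) --> y \<in> U"
  unfolding openin_init_top by blast
 with U(3) show ?R by blast
next
 assume ?R
 then obtain k a r where kar: "a ` {..<k::nat} \<subseteq> A" "r > 0" "\<forall>y\<in>S. (\<forall>i<k. \<bar>a i y - a i x\<bar> < r) --> P y"
  by blast
 define U where "U = {y\<in>S. \<forall>i<k. \<bar>a i y - a i x\<bar> < r}"
 have "openin (init_top S A) U"
  unfolding openin_init_top
 proof (intro conjI ballI)
  fix z assume z: "z \<in> U"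
  define d where "d = Min (insert r ((%i. r - \<bar>a i z - a i x\<bar>) ` {..<k}))"
  have d: "d > 0" "\<And>i. i < k ==> d \<le> r - \<bar>a i z - a i x\<bar>"
   using z kar(2) by (auto simp: d_def U_def)
  show "\<exists>k a r. a ` {..<k::nat} \<subseteq> A \<and> r > 0 \<and> (\<forall>y\<in>S. (\<forall>i<k. \<bar>a i y - a i z\<bar> < r) --> y \<in> U)"
  proof (intro exI[of _ k] exI[of _ a] exI[of _ d] conjI ballI impI)
   fix y assume "y \<in> S" "\<forall>i<k. \<bar>a i y - a i z\<bar> < d"
   thus "y \<in> U" using d(2) unfolding U_def by fastforce
  qed (use d kar in auto)
 qed (auto simp: U_def)
 thus ?L using assms kar(2,3) by (auto simp: eventually_nhdsin U_def intro!: exI[of _ U])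
qed

text \<open>Locality is expressed by filters, so that intersecting and shrinking neighbourhoods
  becomes combining eventual properties.\<close>

abbreviation nb :: "'a smooth_space => 'a => 'a filter" where
 "nb X w \<equiv> nhdsin (dtop X) w"

abbreviation "near X w P \<equiv> eventually P (nb X w)"

lemma nhdsin_ev: "eventually P (nhdsin T x) ==> eventually (%y. eventually P (nhdsin T y)) (nhdsin T x)"
 by (auto simp: eventually_nhdsin)

lemma nhdsin_self: "eventually P (nhdsin T x) ==> x \<in> topspace T ==> P x"
 by (auto simp: eventually_nhdsin)

lemma nb_pts: "eventually (%y. y \<in> pts X) (nb X w)"
 using openin_topspace[of "dtop X"] by (auto simp: eventually_nhdsin intro!: exI[of _ "pts X"])

lemma nb_open: "openin (dtop X) V ==> w \<in> V ==> eventually (%y. y \<in> V) (nb X w)"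
 by (auto simp: eventually_nhdsin)

definition loc_smooth :: "('a => real) set => 'a filter => ('a => real) => bool" where
 "loc_smooth A Fl h \<longleftrightarrow> (\<exists>n a F. a ` {..<n} \<subseteq> A \<and> smooth_fun n F \<and>
   eventually (%y. h y = F (trunc n (%i. a i y))) Fl)"

lemma loc_smooth_cong: "loc_smooth A Fl h ==> eventually (%y. h' y = h y) Fl ==> loc_smooth A Fl h'"
 unfolding loc_smooth_def by (elim exE conjE, intro exI conjI, assumption, assumption) (auto elim: eventually_elim2)

lemma loc_smooth_base: "a \<in> A ==> loc_smooth A Fl a"
 unfolding loc_smooth_def
 by (intro exI[of _ 1] exI[of _ "%_. a"] exI[of _ "%x. x 0"]) (auto simp: smooth_coord)

text \<open>To be arguments of one outer function, the inner functions must be expressed through the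
  same generators; their lists of generators are concatenated.\<close>

lemma loc_smooth_family:
 assumes "\<And>i. i < (m::nat) ==> loc_smooth A Fl (h i)"
 shows "\<exists>N b H. b ` {..<N} \<subseteq> A \<and> (\<forall>i<m. smooth_fun N (H i) \<and>
   eventually (%y. h i y = H i (trunc N (%j. b j y))) Fl)"
 using assms
proof (induction m)
 case 0
 thus ?case by (intro exI[of _ 0]) auto
next
 case (Suc m)
 have "\<exists>N b H. b ` {..<N} \<subseteq> A \<and> (\<forall>i<m. smooth_fun N (H i) \<and>
   eventually (%y. h i y = H i (trunc N (%j. b j y))) Fl)"
  by (rule Suc.IH) (use Suc.prems in simp)
 then obtain N b H where IH0: "b ` {..<N} \<subseteq> A" "\<forall>i<m. smooth_fun N (H i) \<and>
   eventually (%y. h i y = H i (trunc N (%j. b j y))) Fl"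
  by (elim exE conjE) (rule that)
 have IH: "b ` {..<N} \<subseteq> A" "\<And>i. i < m ==> smooth_fun N (H i)"
   "\<And>i. i < m ==> eventually (%y. h i y = H i (trunc N (%j. b j y))) Fl"
  using IH0 by simp_all
 obtain n a F where a: "a ` {..<n} \<subseteq> A" "smooth_fun n F" "eventually (%y. h m y = F (trunc n (%i. a i y))) Fl"
  using Suc.prems[of m] by (auto simp: loc_smooth_def)
 define c where "c j = (if j < N then b j else a (j - N))" for j
 define K where "K i z = (if i < m then H i (trunc N z) else F (trunc n (%j. z (N + j))))" for i and z :: "nat => real"
 have e1: "trunc N (trunc (N + n) (%j. c j y)) = trunc N (%j. b j y)" for y
  by (rule trunc_cong) (simp add: c_def)
 have e2: "trunc n (%j. trunc (N + n) (%j. c j y) (N + j)) = trunc n (%i. a i y)" for y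
  by (rule trunc_cong) (simp add: c_def)
 show ?case
 proof (intro exI[of _ "N + n"] exI[of _ c] exI[of _ K] conjI allI impI)
  show "c ` {..<N + n} \<subseteq> A" using IH(1) a(1) by (auto simp: c_def image_subset_iff)
  fix i assume i: "i < Suc m"
  show "smooth_fun (N + n) (K i)"
   using IH(2) a(2) by (cases "i < m") (auto simp: K_def[abs_def] intro!: smooth_compose smooth_coord)
  show "\<forall>\<^sub>F y in Fl. h i y = K i (trunc (N + n) (%j. c j y))"
   using IH(3)[of i] a(3) i by (cases "i < m") (auto simp: K_def e1 e2 less_Suc_eq)
 qed
qed

lemma loc_smooth_comp:
 assumes "\<And>i. i < (m::nat) ==> loc_smooth A Fl (h i)" "smooth_fun m G"
 shows "loc_smooth A Fl (%y. G (trunc m (%i. h i y)))"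
proof -
 have "\<exists>N b H. b ` {..<N} \<subseteq> A \<and> (\<forall>i<m. smooth_fun N (H i) \<and>
   eventually (%y. h i y = H i (trunc N (%j. b j y))) Fl)"
  by (rule loc_smooth_family) (rule assms(1))
 then obtain N b H where H: "b ` {..<N} \<subseteq> A" "\<forall>i<m. smooth_fun N (H i) \<and>
   eventually (%y. h i y = H i (trunc N (%j. b j y))) Fl" by (elim exE conjE) (rule that)
 show ?thesis unfolding loc_smooth_def
 proof (intro exI[of _ N] exI[of _ b] exI[of _ "%z. G (trunc m (%i. H i z))"] conjI)
  show "smooth_fun N (%z. G (trunc m (%i. H i z)))" by (rule smooth_compose[OF assms(2)]) (use H in auto)
  have "\<forall>\<^sub>F y in Fl. \<forall>i\<in>{..<m}. h i y = H i (trunc N (%j. b j y))"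
   using H(2) by (intro eventually_ball_finite) auto
  thus "\<forall>\<^sub>F y in Fl. G (trunc m (%i. h i y)) = G (trunc m (%i. H i (trunc N (%j. b j y))))"
  proof eventually_elim
   case (elim y)
   thus ?case by (intro arg_cong[of _ _ G] trunc_cong) auto
  qed
 qed (use H in auto)
qed

lemma loc_smooth_trans:
 assumes "loc_smooth B Fl h" "\<And>b. b \<in> B ==> loc_smooth A Fl b"
 shows "loc_smooth A Fl h"
proof -
 obtain n a F where a: "a ` {..<n} \<subseteq> B" "smooth_fun n F" "eventually (%y. h y = F (trunc n (%i. a i y))) Fl"
  using assms(1) by (auto simp: loc_smooth_def)
 have "loc_smooth A Fl (%y. F (trunc n (%i. a i y)))"
  by (rule loc_smooth_comp[OF _ a(2)]) (use a(1) assms(2) in auto)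
 thus ?thesis by (rule loc_smooth_cong[OF _ a(3)])
qed

lemma cinf_gen: "cinf (gen S A) = {f. (\<forall>x. x \<notin> S --> f x = 0) \<and> (\<forall>x\<in>S. loc_smooth A (nhdsin (init_top S A) x) f)}"
proof -
 have "loc_smooth A (nhdsin (init_top S A) x) f \<longleftrightarrow>
  (\<exists>V n a F. openin (init_top S A) V \<and> x \<in> V \<and> (\<forall>i<n. a i \<in> A) \<and> smooth_fun n F \<and>
     (\<forall>y\<in>V. f y = F (%i::nat. if i < n then a i y else 0)))" if "x \<in> S" for x f
  using that unfolding loc_smooth_def eventually_nhdsin trunc_def image_subset_iff lessThan_iff Ball_def topspace_init_top
  by blast
 thus ?thesis by (auto simp: gen_def)
qed

lemma loc_smooth_continuous:
 assumes "loc_smooth A (nhdsin (init_top S A) x) h" "x \<in> S" "e > 0"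
 shows "\<forall>\<^sub>F y in nhdsin (init_top S A) x. \<bar>h y - h x\<bar> < e"
proof -
 obtain n a F where a: "a ` {..<n} \<subseteq> A" "smooth_fun n F"
  and ev: "\<forall>\<^sub>F y in nhdsin (init_top S A) x. h y = F (trunc n (%i. a i y))"
  using assms(1) by (auto simp: loc_smooth_def)
 define z where "z y = trunc n (%i. a i y)" for y
 have "\<exists>r>0. \<forall>w\<in>cube n (z x) r. F w \<in> {F (z x) - e<..<F (z x) + e}"
  by (rule continuous_cube[OF smooth_continuous[OF a(2)]]) (use assms in "auto simp: z_def")
 then obtain r where r: "r > 0" "\<And>w. w \<in> cube n (z x) r ==> \<bar>F w - F (z x)\<bar> < e" by fastforce
 have "\<forall>\<^sub>F y in nhdsin (init_top S A) x. \<forall>i<n. \<bar>a i y - a i x\<bar> < r"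
  unfolding eventually_init_top[OF assms(2)]
  by (intro exI[of _ n] exI[of _ a] exI[of _ r]) (use a(1) r(1) in auto)
 with ev show ?thesis
 proof eventually_elim
  case (elim y)
  have "z y \<in> cube n (z x) r" using elim by (simp add: cube_def z_def)
  from r(2)[OF this] show ?case using elim(1) nhdsin_self[OF ev] assms(2) by (simp add: z_def)
 qed
qed

lemma restrict_cinf_gen: "a \<in> A ==> (%x. if x \<in> S then a x else 0) \<in> cinf (gen S A)"
proof -
 assume a: "a \<in> A"
 have "\<forall>\<^sub>F y in nhdsin (init_top S A) x. y \<in> S" for x
  using openin_topspace[of "init_top S A"] by (auto simp: eventually_nhdsin intro!: exI[of _ S])
 hence "\<forall>\<^sub>F y in nhdsin (init_top S A) x. (if y \<in> S then a y else 0) = a y" for x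
  by (rule eventually_mono) simp
 hence "loc_smooth A (nhdsin (init_top S A) x) (%x. if x \<in> S then a x else 0)" for x
  by (rule loc_smooth_cong[OF loc_smooth_base[OF a]])
 thus ?thesis by (simp add: cinf_gen)
qed

lemma init_top_gen: "init_top S (cinf (gen S A)) = init_top S A"
proof (rule topology_eq[THEN iffD2], intro allI iffI)
 fix U assume L: "openin (init_top S (cinf (gen S A))) U"
 hence US: "U \<subseteq> S" using openin_subset by fastforce
 show "openin (init_top S A) U"
 proof (subst openin_subopen, intro ballI)
  fix x assume x: "x \<in> U"
  then obtain k b r where b: "b ` {..<k::nat} \<subseteq> cinf (gen S A)" "r > 0"
   "\<forall>y\<in>S. (\<forall>i<k. \<bar>b i y - b i x\<bar> < r) --> y \<in> U"
   using L unfolding openin_init_top by blast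
  have "\<forall>\<^sub>F y in nhdsin (init_top S A) x. \<forall>i\<in>{..<k}. \<bar>b i y - b i x\<bar> < r"
   using b(1,2) x US by (intro eventually_ball_finite ballI loc_smooth_continuous) (auto simp: cinf_gen)
  moreover have "\<forall>\<^sub>F y in nhdsin (init_top S A) x. y \<in> S"
   using openin_topspace[of "init_top S A"] by (auto simp: eventually_nhdsin intro!: exI[of _ S])
  ultimately have "\<forall>\<^sub>F y in nhdsin (init_top S A) x. y \<in> U"
   by eventually_elim (use b(3) in auto)
  thus "\<exists>T. openin (init_top S A) T \<and> x \<in> T \<and> T \<subseteq> U"
   using x US by (auto simp: eventually_nhdsin)
 qed
next
 fix U assume L: "openin (init_top S A) U"
 show "openin (init_top S (cinf (gen S A))) U"
  unfolding openin_init_top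
 proof (intro conjI ballI)
  show US: "U \<subseteq> S" using openin_subset[OF L] by simp
  fix x assume x: "x \<in> U"
  then obtain k b r where b: "b ` {..<k::nat} \<subseteq> A" "r > 0"
   "\<forall>y\<in>S. (\<forall>i<k. \<bar>b i y - b i x\<bar> < r) --> y \<in> U"
   using L unfolding openin_init_top by blast
  show "\<exists>k a r. a ` {..<k::nat} \<subseteq> cinf (gen S A) \<and> r > 0 \<and> (\<forall>y\<in>S. (\<forall>i<k. \<bar>a i y - a i x\<bar> < r) --> y \<in> U)"
  proof (intro exI conjI ballI impI)
   show "(%i x. if x \<in> S then b i x else 0) ` {..<k} \<subseteq> cinf (gen S A)"
    using b(1) restrict_cinf_gen by (auto simp: image_subset_iff)
   fix y assume y: "y \<in> S" "\<forall>i<k. \<bar>(if y \<in> S then b i y else 0) - (if x \<in> S then b i x else 0)\<bar> < r"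
   moreover have "x \<in> S" using x US by blast
   ultimately show "y \<in> U" using b(3) by simp
  qed (rule b(2))
 qed
qed

lemma dtop_gen [simp]: "dtop (gen S A) = init_top S A"
 by (simp add: dtop_def init_top_gen)

lemma gen_idem: "gen S (cinf (gen S A)) = gen S A"
proof -
 have "cinf (gen S (cinf (gen S A))) = cinf (gen S A)"
 proof (rule Set.set_eqI)
  fix f
  have "loc_smooth (cinf (gen S A)) (nhdsin (init_top S A) x) f \<longleftrightarrow> loc_smooth A (nhdsin (init_top S A) x) f"
   if x: "x \<in> S" for x
  proof
   assume "loc_smooth (cinf (gen S A)) (nhdsin (init_top S A) x) f"
   thus "loc_smooth A (nhdsin (init_top S A) x) f"
    by (rule loc_smooth_trans) (use x in "auto simp: cinf_gen")
  next
   assume "loc_smooth A (nhdsin (init_top S A) x) f"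
   thus "loc_smooth (cinf (gen S A)) (nhdsin (init_top S A) x) f"
   proof (rule loc_smooth_trans)
    fix a assume "a \<in> A"
    from loc_smooth_base[OF restrict_cinf_gen[OF this]]
    show "loc_smooth (cinf (gen S A)) (nhdsin (init_top S A) x) a"
     by (rule loc_smooth_cong)
      (use openin_topspace[of "init_top S A"] x in "auto simp: eventually_nhdsin intro!: exI[of _ S]")
   qed
  qed
  moreover have c: "f \<in> cinf (gen S B) \<longleftrightarrow> (\<forall>x. x \<notin> S --> f x = 0) \<and> (\<forall>x\<in>S. loc_smooth B (nhdsin (init_top S B) x) f)" for B
   by (simp add: cinf_gen)
  ultimately show "f \<in> cinf (gen S (cinf (gen S A))) \<longleftrightarrow> f \<in> cinf (gen S A)"
   unfolding c[of "cinf (gen S A)"] c[of A] init_top_gen by simp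
 qed
 thus ?thesis by (simp add: gen_def[of S "cinf (gen S A)"] smooth_space.equality)
qed

text \<open>The manifold axioms without topology and charts. This is what remains available for
  compositions and pullbacks, whose total spaces are generated by functions.\<close>

definition dspace :: "'a smooth_space => bool" where
 "dspace X \<longleftrightarrow> X = gen (pts X) (cinf X)"

lemma dspace_gen [simp]: "dspace (gen S A)"
 by (simp add: dspace_def gen_idem)

lemma dspace_sub [simp]: "dspace (sub X V)"
 by (simp add: sub_def)

lemma manifold_dspace: "manifold X ==> dspace X"
 by (simp add: manifold_def dspace_def)

text \<open>Smoothness of the germ at one point; \<open>h\<close> may be arbitrary elsewhere, which
  permits formulas in charts without restricting their domain.\<close>

definition fsm :: "'a smooth_space => ('a => real) => 'a => bool" where
 "fsm X h w \<longleftrightarrow> w \<in> pts X \<and> loc_smooth (cinf X) (nb X w) h"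

lemma fsm_gen: "fsm (gen S A) h w \<longleftrightarrow> w \<in> S \<and> loc_smooth A (nhdsin (init_top S A) w) h"
proof -
 have "loc_smooth (cinf (gen S A)) (nhdsin (init_top S A) w) h \<longleftrightarrow> loc_smooth A (nhdsin (init_top S A) w) h"
  if w: "w \<in> S"
 proof
  assume "loc_smooth (cinf (gen S A)) (nhdsin (init_top S A) w) h"
  thus "loc_smooth A (nhdsin (init_top S A) w) h"
   by (rule loc_smooth_trans) (use w in "auto simp: cinf_gen")
 next
  assume "loc_smooth A (nhdsin (init_top S A) w) h"
  thus "loc_smooth (cinf (gen S A)) (nhdsin (init_top S A) w) h"
  proof (rule loc_smooth_trans)
   fix a assume "a \<in> A"
   from loc_smooth_base[OF restrict_cinf_gen[OF this]]
   show "loc_smooth (cinf (gen S A)) (nhdsin (init_top S A) w) a"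
    by (rule loc_smooth_cong)
     (use openin_topspace[of "init_top S A"] w in "auto simp: eventually_nhdsin intro!: exI[of _ S]")
  qed
 qed
 thus ?thesis by (auto simp: fsm_def)
qed

lemma cinf_iff: "dspace X ==> f \<in> cinf X \<longleftrightarrow> (\<forall>x. x \<notin> pts X --> f x = 0) \<and> (\<forall>x\<in>pts X. fsm X f x)"
 unfolding dspace_def
proof -
 assume X: "X = gen (pts X) (cinf X)"
 have "f \<in> cinf X \<longleftrightarrow> f \<in> cinf (gen (pts X) (cinf X))" using X by simp
 also have "\<dots> \<longleftrightarrow> (\<forall>x. x \<notin> pts X --> f x = 0) \<and> (\<forall>x\<in>pts X. fsm (gen (pts X) (cinf X)) f x)"
  by (auto simp: cinf_gen fsm_gen)
 finally show ?thesis using X by simp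
qed

lemma cinf_fsm: "f \<in> cinf X ==> x \<in> pts X ==> fsm X f x"
 by (simp add: fsm_def loc_smooth_base)

lemma fsm_cong: "fsm X h w ==> eventually (%y. h' y = h y) (nb X w) ==> fsm X h' w"
 by (auto simp: fsm_def intro: loc_smooth_cong)

lemma fsm_pts: "fsm X h w ==> w \<in> pts X"
 by (simp add: fsm_def)

lemma fsm_ev: "fsm X h w ==> eventually (fsm X h) (nb X w)"
proof -
 assume h: "fsm X h w"
 then obtain n a F where a: "a ` {..<n} \<subseteq> cinf X" "smooth_fun n F" "eventually (%y. h y = F (trunc n (%i. a i y))) (nb X w)"
  by (auto simp: fsm_def loc_smooth_def)
 from nhdsin_ev[OF a(3)] nb_pts[of X w] show ?thesis
  by eventually_elim (use a in "auto simp: fsm_def loc_smooth_def")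
qed

lemma fsm_comp:
 "(\<And>i. i < m ==> fsm X (h i) w) ==> smooth_fun m G ==> w \<in> pts X ==> fsm X (%y. G (trunc m (%i. h i y))) w"
 unfolding fsm_def by (auto intro: loc_smooth_comp)

lemma fsm_const: "w \<in> pts X ==> fsm X (%_. c) w"
 using fsm_comp[of 0 X undefined w "%_. c"] by simp

lemma fsm_add: "fsm X f w ==> fsm X g w ==> fsm X (%y. f y + g y) w"
 using fsm_comp[of 2 X "%i. if i = 0 then f else g" w "%z. z 0 + z 1"] fsm_pts[of X f w]
 by (auto simp: smooth_intros)

lemma fsm_mult: "fsm X f w ==> fsm X g w ==> fsm X (%y. f y * g y) w"
 using fsm_comp[of 2 X "%i. if i = 0 then f else g" w "%z. z 0 * z 1"] fsm_pts[of X f w]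
 by (auto simp: smooth_intros)

lemma fsm_sum: "w \<in> pts X ==> (\<And>i. i \<in> I ==> fsm X (f i) w) ==> fsm X (%y. \<Sum>i\<in>I. f i y) w"
 by (induction I rule: infinite_finite_induct) (auto intro: fsm_add fsm_const)

lemma fsm_diff: "fsm X f w ==> fsm X g w ==> fsm X (%y. f y - g y) w"
 using fsm_add[OF _ fsm_mult[OF fsm_const, of w X g "-1"], of f] fsm_pts[of X f w] by simp

lemma fsm_if: "fsm X f w ==> fsm X g w ==> fsm X (%y. if b then f y else g y) w"
 by (cases b) simp_all

text \<open>The local expression of a germ is itself global.\<close>

lemma fsm_extend:
 assumes "dspace X" "fsm X h w"
 shows "\<exists>h'\<in>cinf X. eventually (%y. h' y = h y) (nb X w)"
proof -
 obtain n a F where a: "a ` {..<n} \<subseteq> cinf X" "smooth_fun n F" "eventually (%y. h y = F (trunc n (%i. a i y))) (nb X w)"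
  using assms by (auto simp: fsm_def loc_smooth_def)
 define h' where "h' y = (if y \<in> pts X then F (trunc n (%i. a i y)) else 0)" for y
 have "fsm X h' x" if "x \<in> pts X" for x
 proof (rule fsm_cong)
  show "fsm X (%y. F (trunc n (%i. a i y))) x"
   by (rule fsm_comp) (use a(1,2) that in "auto intro: cinf_fsm")
  show "near X x (%y. h' y = F (trunc n (%i. a i y)))"
   using nb_pts by eventually_elim (simp add: h'_def)
 qed
 hence "h' \<in> cinf X" using assms(1) by (auto simp: cinf_iff h'_def)
 moreover have "eventually (%y. h' y = h y) (nb X w)"
  using a(3) nb_pts[of X w] by eventually_elim (simp add: h'_def)
 ultimately show ?thesis by blast
qed

lemma eventually_nb:
 "w \<in> pts X ==> eventually P (nb X w) \<longleftrightarrow> (\<exists>k a r. a ` {..<k::nat} \<subseteq> cinf X \<and> r > 0 \<and>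
   (\<forall>y\<in>pts X. (\<forall>i<k. \<bar>a i y - a i w\<bar> < r) --> P y))"
 unfolding dtop_def by (rule eventually_init_top)

lemma fsm_cont: "fsm X h w ==> e > 0 ==> near X w (%y. \<bar>h y - h w\<bar> < e)"
 using loc_smooth_continuous[of "cinf X" "pts X" w h e] by (simp add: fsm_def dtop_def)

lemma nb_ev: "eventually P (nb X w) ==> eventually (%y. eventually P (nb X y)) (nb X w)"
 by (rule nhdsin_ev)

lemma nb_self: "eventually P (nb X w) ==> w \<in> pts X ==> P w"
 using nhdsin_self[of P "dtop X" w] by simp

lemma nb_openE:
 assumes "eventually P (nb X w)" "w \<in> pts X"
 obtains V where "openin (dtop X) V" "w \<in> V" "V \<subseteq> pts X" "\<And>y. y \<in> V ==> P y"
proof -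
 from assms obtain V where V: "openin (dtop X) V" "w \<in> V" "\<And>y. y \<in> V ==> P y"
  unfolding eventually_nhdsin by auto
 thus thesis using that openin_subset[OF V(1)] by simp
qed

section \<open>Germs of smooth maps\<close>

definition msm :: "'a smooth_space => 'b smooth_space => ('a => 'b) => 'a => bool" where
 "msm X Y f w \<longleftrightarrow> w \<in> pts X \<and> (near X w (%y. f y \<in> pts Y \<and> (\<forall>b\<in>cinf Y. fsm X (%z. b (f z)) y)))"

lemma msm_src: "msm X Y f w ==> w \<in> pts X"
 by (simp add: msm_def)

lemma msm_tgt: "msm X Y f w ==> f w \<in> pts Y"
 using nb_self by (fastforce simp: msm_def)

lemma msm_ev: "msm X Y f w ==> near X w (%y. msm X Y f y)"
proof -
 assume a: "msm X Y f w"
 hence "near X w (%y. near X y (%y. f y \<in> pts Y \<and> (\<forall>b\<in>cinf Y. fsm X (%z. b (f z)) y)))"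
  unfolding msm_def by (intro nb_ev) auto
 with nb_pts show ?thesis by eventually_elim (simp add: msm_def)
qed

lemma msm_pts_ev: "msm X Y f w ==> near X w (%y. f y \<in> pts Y)"
 by (drule msm_ev) (auto elim: eventually_mono dest: msm_tgt)

text \<open>Continuity is not part of \<open>msm\<close>: the topology of the target is generated by
  its smooth functions, and their pullbacks are smooth, hence continuous.\<close>

lemma msm_lim:
 assumes f: "msm X Y f w" and P: "eventually P (nb Y (f w))"
 shows "near X w (%y. P (f y))"
proof -
 have fw: "f w \<in> pts Y" by (rule msm_tgt[OF f])
 from P obtain k a r where a: "a ` {..<k::nat} \<subseteq> cinf Y" "r > 0"
   "\<forall>y\<in>pts Y. (\<forall>i<k. \<bar>a i y - a i (f w)\<bar> < r) --> P y"
  unfolding eventually_nb[OF fw] by (elim exE conjE) (rule that)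
 have "fsm X (%z. a i (f z)) w" if "i < k" for i
 proof -
  have "a i \<in> cinf Y" using a(1) that by auto
  thus ?thesis using f nb_self[of _ X w] unfolding msm_def by blast
 qed
 hence "near X w (%y. \<forall>i\<in>{..<k}. \<bar>a i (f y) - a i (f w)\<bar> < r)"
  by (intro eventually_ball_finite ballI fsm_cont) (use a in auto)
 with msm_pts_ev[OF f] show ?thesis by eventually_elim (use a(3) in auto)
qed

lemma msm_fsm:
 assumes h: "fsm Y h (f w)" and f: "msm X Y f w"
 shows "fsm X (%y. h (f y)) w"
proof -
 obtain n a F where a: "a ` {..<n} \<subseteq> cinf Y" "smooth_fun n F" "near Y (f w) (%y. h y = F (trunc n (%i. a i y)))"
  using h unfolding fsm_def loc_smooth_def by blast
 have "fsm X (%z. a i (f z)) w" if "i < n" for i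
 proof -
  have "a i \<in> cinf Y" using a(1) that by auto
  thus ?thesis using f nb_self[of _ X w] unfolding msm_def by blast
 qed
 hence "fsm X (%y. F (trunc n (%i. a i (f y)))) w"
  by (rule fsm_comp) (use a f msm_src in auto)
 thus ?thesis by (rule fsm_cong) (rule msm_lim[OF f a(3)])
qed

lemma msm_cinf: "msm X Y f w ==> b \<in> cinf Y ==> fsm X (%y. b (f y)) w"
proof -
 assume f: "msm X Y f w" and b: "b \<in> cinf Y"
 show ?thesis by (rule msm_fsm[OF cinf_fsm[OF b msm_tgt[OF f]] f])
qed

lemma msm_comp:
 assumes f: "msm X Y f w" and g: "msm Y Z g (f w)"
 shows "msm X Z (%y. g (f y)) w"
 unfolding msm_def
proof
 show "w \<in> pts X" by (rule msm_src[OF f])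
 from msm_ev[OF f] msm_lim[OF f msm_ev[OF g]]
 show "near X w (%y. g (f y) \<in> pts Z \<and> (\<forall>b\<in>cinf Z. fsm X (%z. b (g (f z))) y))"
 proof eventually_elim
  case (elim y)
  show ?case
  proof (intro conjI ballI)
   show "g (f y) \<in> pts Z" using elim(2) by (rule msm_tgt)
   fix b assume "b \<in> cinf Z"
   with elim(2) have "fsm Y (%z. b (g z)) (f y)" by (rule msm_cinf)
   thus "fsm X (%z. b (g (f z))) y" by (rule msm_fsm) (rule elim(1))
  qed
 qed
qed

lemma msm_cong:
 assumes f: "msm X Y f w" and e: "near X w (%y. g y = f y)"
 shows "msm X Y g w"
 unfolding msm_def
proof
 show "w \<in> pts X" by (rule msm_src[OF f])
 from msm_ev[OF f] nb_ev[OF e] e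
 show "near X w (%y. g y \<in> pts Y \<and> (\<forall>b\<in>cinf Y. fsm X (%z. b (g z)) y))"
 proof eventually_elim
  case (elim y)
  show ?case
  proof (intro conjI ballI)
   show "g y \<in> pts Y" using msm_tgt[OF elim(1)] elim(3) by simp
   fix b assume "b \<in> cinf Y"
   with elim(1) have "fsm X (%z. b (f z)) y" by (rule msm_cinf)
   thus "fsm X (%z. b (g z)) y"
    by (rule fsm_cong) (use elim(2) in "auto elim: eventually_mono")
  qed
 qed
qed

lemma msm_id: "w \<in> pts X ==> msm X X (%y. y) w"
 unfolding msm_def by (auto intro: eventually_mono[OF nb_pts] cinf_fsm)

lemma msm_const: "w \<in> pts X ==> c \<in> pts Y ==> msm X Y (%_. c) w"
 unfolding msm_def by (auto intro: eventually_mono[OF nb_pts] fsm_const)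

text \<open>Generators suffice for testing, since a smooth function on \<open>gen S A\<close> is
  locally a smooth expression in them. Continuity of the map also has to be tested on
  generators.\<close>

lemma msm_gen:
 assumes w: "w \<in> pts X" and S: "near X w (%y. f y \<in> S)" and A: "near X w (%y. \<forall>a\<in>A. fsm X (%z. a (f z)) y)"
 shows "msm X (gen S A) f w"
 unfolding msm_def
proof
 from nb_ev[OF S] nb_pts[of X w] S A
 show "near X w (%y. f y \<in> pts (gen S A) \<and> (\<forall>b\<in>cinf (gen S A). fsm X (%z. b (f z)) y))"
 proof eventually_elim
  case (elim y)
  have "fsm X (%z. b (f z)) y" if b: "b \<in> cinf (gen S A)" for b
  proof -
   have "loc_smooth A (nhdsin (init_top S A) (f y)) b" using b elim(3) by (simp add: cinf_gen)
   then obtain n a F where a: "a ` {..<n} \<subseteq> A" "smooth_fun n F"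
     "\<forall>\<^sub>F z in nhdsin (init_top S A) (f y). b z = F (trunc n (%i. a i z))"
    unfolding loc_smooth_def by blast
   have lim: "near X y (%z. P (f z))" if P: "eventually P (nhdsin (init_top S A) (f y))" for P
   proof -
    from P obtain k c r where c: "c ` {..<k::nat} \<subseteq> A" "r > 0"
     "\<forall>z\<in>S. (\<forall>i<k. \<bar>c i z - c i (f y)\<bar> < r) --> P z"
     unfolding eventually_init_top[OF elim(3)] by (elim exE conjE) (rule that)
    have "near X y (%z. \<forall>i\<in>{..<k}. \<bar>c i (f z) - c i (f y)\<bar> < r)"
     by (intro eventually_ball_finite ballI fsm_cont[of X "%z. c _ (f z)"]) (use c elim(4) in auto)
    with elim(1) show ?thesis by eventually_elim (use c(3) in auto)
   qed
   have "fsm X (%z. F (trunc n (%i. a i (f z)))) y"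
    by (rule fsm_comp) (use a elim in auto)
   thus ?thesis by (rule fsm_cong) (rule lim[OF a(3)])
  qed
  thus ?case using elim(3) by simp
 qed
qed (rule w)

lemma fsm_base: "a \<in> A ==> w \<in> S ==> fsm (gen S A) a w"
 by (simp add: fsm_gen loc_smooth_base)

subsection \<open>Open subspaces\<close>

lemma openin_sub:
 assumes V: "openin (dtop X) V"
 shows "openin (dtop (sub X V)) U \<longleftrightarrow> openin (dtop X) U \<and> U \<subseteq> V"
proof -
 have V': "V \<subseteq> pts X" using openin_subset[OF V] by simp
 have *: "openin (init_top V (cinf X)) U \<longleftrightarrow> openin (init_top (pts X) (cinf X)) U \<and> U \<subseteq> V"
 proof safe
  assume U: "openin (init_top V (cinf X)) U"
  thus UV: "\<And>x. x \<in> U ==> x \<in> V" using openin_subset by fastforce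
  show "openin (init_top (pts X) (cinf X)) U"
   unfolding openin_init_top
  proof (intro conjI ballI)
   show "U \<subseteq> pts X" using UV V' by blast
   fix x assume x: "x \<in> U"
   obtain k1 a1 r1 where 1: "a1 ` {..<k1::nat} \<subseteq> cinf X" "r1 > 0"
    "\<forall>y\<in>V. (\<forall>i<k1. \<bar>a1 i y - a1 i x\<bar> < r1) --> y \<in> U"
    using U x unfolding openin_init_top by blast
   obtain k2 a2 r2 where 2: "a2 ` {..<k2::nat} \<subseteq> cinf X" "r2 > 0"
    "\<forall>y\<in>pts X. (\<forall>i<k2. \<bar>a2 i y - a2 i x\<bar> < r2) --> y \<in> V"
    using V UV[OF x] unfolding dtop_def openin_init_top by blast
   from init_top_basis_union[OF 1(1,2) 2(1,2), of x] obtain k a r where 3: "a ` {..<k::nat} \<subseteq> cinf X" "r > 0"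
    "\<forall>y. (\<forall>i<k. \<bar>a i y - a i x\<bar> < r) --> (\<forall>i<k1. \<bar>a1 i y - a1 i x\<bar> < r1) \<and> (\<forall>i<k2. \<bar>a2 i y - a2 i x\<bar> < r2)"
    by (elim exE conjE) (rule that)
   have "\<forall>y\<in>pts X. (\<forall>i<k. \<bar>a i y - a i x\<bar> < r) --> y \<in> U" using 1(3) 2(3) 3(3) by blast
   with 3(1,2) show "\<exists>k a r. a ` {..<k::nat} \<subseteq> cinf X \<and> r > 0 \<and> (\<forall>y\<in>pts X. (\<forall>i<k. \<bar>a i y - a i x\<bar> < r) --> y \<in> U)"
    by blast
  qed
 next
  assume U: "openin (init_top (pts X) (cinf X)) U" "U \<subseteq> V"
  show "openin (init_top V (cinf X)) U"
   unfolding openin_init_top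
  proof (intro conjI ballI U(2))
   fix x assume x: "x \<in> U"
   then obtain k a r where 3: "a ` {..<k::nat} \<subseteq> cinf X" "r > 0"
    "\<forall>y\<in>pts X. (\<forall>i<k. \<bar>a i y - a i x\<bar> < r) --> y \<in> U" using U(1) unfolding openin_init_top by blast
   have "\<forall>y\<in>V. (\<forall>i<k. \<bar>a i y - a i x\<bar> < r) --> y \<in> U" using 3(3) V' by blast
   with 3(1,2) show "\<exists>k a r. a ` {..<k::nat} \<subseteq> cinf X \<and> r > 0 \<and> (\<forall>y\<in>V. (\<forall>i<k. \<bar>a i y - a i x\<bar> < r) --> y \<in> U)"
    by blast
  qed
 qed
 thus ?thesis unfolding sub_def dtop_gen by (simp add: dtop_def)
qed

lemma nb_sub:
 assumes V: "openin (dtop X) V" "w \<in> V"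
 shows "nb (sub X V) w = nb X w"
proof -
 have wX: "w \<in> pts X" using openin_subset[OF V(1)] V(2) by auto
 have "eventually P (nb (sub X V) w) \<longleftrightarrow> eventually P (nb X w)" for P
 proof
  assume "eventually P (nb (sub X V) w)"
  thus "eventually P (nb X w)"
   unfolding eventually_nhdsin openin_sub[OF V(1)] using V(2) wX by auto
 next
  assume "eventually P (nb X w)"
  then obtain U where "openin (dtop X) U" "w \<in> U" "\<forall>x\<in>U. P x"
   unfolding eventually_nhdsin using wX by auto
  thus "eventually P (nb (sub X V) w)"
   unfolding eventually_nhdsin openin_sub[OF V(1)] using V
   by (intro disjI2 exI[of _ "U \<inter> V"]) auto
 qed
 thus ?thesis by (simp add: filter_eq_iff)
qed

lemma fsm_sub:
 assumes V: "openin (dtop X) V" "w \<in> V"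
 shows "fsm (sub X V) h w \<longleftrightarrow> fsm X h w"
proof -
 have "nhdsin (init_top V (cinf X)) w = nb X w" using nb_sub[OF V] unfolding sub_def dtop_gen .
 moreover have "w \<in> pts X" using openin_subset[OF V(1)] V(2) by auto
 ultimately show ?thesis unfolding sub_def fsm_gen using V by (simp add: fsm_def)
qed

lemma cinf_sub:
 assumes V: "openin (dtop X) V"
 shows "f \<in> cinf (sub X V) \<longleftrightarrow> (\<forall>x. x \<notin> V --> f x = 0) \<and> (\<forall>x\<in>V. fsm X f x)"
 using fsm_sub[OF V] by (simp add: cinf_iff)

lemma msm_sub_src:
 assumes V: "openin (dtop X) V" "w \<in> V"
 shows "msm (sub X V) Y f w \<longleftrightarrow> msm X Y f w"
proof -
 have wX: "w \<in> pts X" using openin_subset[OF V(1)] V(2) by auto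
 have ev: "near X w (%y. y \<in> V)" by (rule nb_open[OF V])
 have "(near X w (%y. f y \<in> pts Y \<and> (\<forall>b\<in>cinf Y. fsm (sub X V) (%z. b (f z)) y))) \<longleftrightarrow>
   (near X w (%y. f y \<in> pts Y \<and> (\<forall>b\<in>cinf Y. fsm X (%z. b (f z)) y)))"
  by (rule eventually_cong[OF ev]) (use fsm_sub[OF V(1)] in auto)
 thus ?thesis unfolding msm_def nb_sub[OF V] using V(2) wX by simp
qed

lemma msm_sub_tgt:
 assumes V: "openin (dtop Y) V" and f: "msm X Y f w" "f w \<in> V"
 shows "msm X (sub Y V) f w"
 unfolding sub_def
proof (rule msm_gen)
 show "w \<in> pts X" by (rule msm_src[OF f(1)])
 show "near X w (%y. f y \<in> V)" by (rule msm_lim[OF f(1) nb_open[OF V f(2)]])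
 show "near X w (%y. \<forall>a\<in>cinf Y. fsm X (%z. a (f z)) y)"
  using msm_ev[OF f(1)] by eventually_elim (auto intro: msm_cinf)
qed

lemma msm_incl:
 assumes V: "openin (dtop Y) V" and f: "msm X (sub Y V) f w"
 shows "msm X Y f w"
proof -
 have "f w \<in> V" using msm_tgt[OF f] by simp
 hence "msm (sub Y V) Y (%y. y) (f w)"
  using msm_sub_src[OF V] msm_id openin_subset[OF V] by fastforce
 from msm_comp[OF f this] show ?thesis .
qed

lemma smooth_map_sub:
 assumes V: "openin (dtop X) V"
 shows "smooth_map (sub X V) Y f \<longleftrightarrow> (\<forall>w\<in>V. msm X Y f w)"
proof
 assume L: "smooth_map (sub X V) Y f"
 show "\<forall>w\<in>V. msm X Y f w"
 proof
  fix w assume w: "w \<in> V"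
  have "near X w (%y. y \<in> V)" by (rule nb_open[OF V w])
  hence "near X w (%y. f y \<in> pts Y \<and> (\<forall>b\<in>cinf Y. fsm X (%z. b (f z)) y))"
  proof eventually_elim
   case (elim y)
   show ?case
   proof (intro conjI ballI)
    show "f y \<in> pts Y" using L elim by (auto simp: smooth_map_def)
    fix b assume "b \<in> cinf Y"
    hence "pull V f b \<in> cinf (sub X V)" using L by (auto simp: smooth_map_def)
    hence "fsm X (pull V f b) y" using cinf_sub[OF V] elim by blast
    thus "fsm X (%z. b (f z)) y"
     by (rule fsm_cong) (use nb_open[OF V elim] in "auto elim!: eventually_mono simp: pull_def")
   qed
  qed
  thus "msm X Y f w" using w openin_subset[OF V] by (auto simp: msm_def)
 qed
next
 assume R: "\<forall>w\<in>V. msm X Y f w"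
 show "smooth_map (sub X V) Y f"
  unfolding smooth_map_def
 proof (intro conjI ballI)
  show "f ` pts (sub X V) \<subseteq> pts Y" using R msm_tgt[of X Y f] by auto
  fix b assume b: "b \<in> cinf Y"
  have "fsm X (pull V f b) w" if w: "w \<in> V" for w
  proof (rule fsm_cong)
   show "fsm X (%z. b (f z)) w" by (rule msm_cinf[OF bspec[OF R w] b])
   show "near X w (%y. pull V f b y = b (f y))"
    using nb_open[OF V w] by eventually_elim (simp add: pull_def)
  qed
  thus "pull (pts (sub X V)) f b \<in> cinf (sub X V)" by (auto simp: cinf_sub[OF V]) (simp add: pull_def)
 qed
qed

lemma sub_self: "dspace X ==> sub X (pts X) = X"
 by (simp add: sub_def dspace_def)

lemma smooth_map_iff: "dspace X ==> smooth_map X Y f \<longleftrightarrow> (\<forall>w\<in>pts X. msm X Y f w)"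
 using smooth_map_sub[of X "pts X" Y f] openin_topspace[of "dtop X"] by (simp add: sub_self)

lemma equiv_pt_iff:
 assumes "u \<in> pts (total B)"
 shows "equiv_pt M B u C v \<longleftrightarrow> (\<exists>f. msm (total B) (total C) f u \<and> f u = v \<and>
   (near (total B) u (%w. tgt C (f w) = tgt B w \<and> src C (f w) = src B w)))"
proof
 assume "equiv_pt M B u C v"
 then obtain V f where V: "openin (dtop (total B)) V" "u \<in> V" "smooth_map (sub (total B) V) (total C) f" "f u = v"
   "\<forall>w\<in>V. tgt C (f w) = tgt B w \<and> src C (f w) = src B w" unfolding equiv_pt_def by blast
 have "near (total B) u (%w. tgt C (f w) = tgt B w \<and> src C (f w) = src B w)"
  using nb_open[OF V(1,2)] by eventually_elim (use V(5) in auto)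
 thus "\<exists>f. msm (total B) (total C) f u \<and> f u = v \<and>
   (near (total B) u (%w. tgt C (f w) = tgt B w \<and> src C (f w) = src B w))"
  using V smooth_map_sub[OF V(1)] by blast
next
 assume "\<exists>f. msm (total B) (total C) f u \<and> f u = v \<and>
   (near (total B) u (%w. tgt C (f w) = tgt B w \<and> src C (f w) = src B w))"
 then obtain f where f: "msm (total B) (total C) f u" "f u = v"
   "near (total B) u (%w. tgt C (f w) = tgt B w \<and> src C (f w) = src B w)" by blast
 have "near (total B) u (%w. msm (total B) (total C) f w \<and> tgt C (f w) = tgt B w \<and> src C (f w) = src B w)"
  using msm_ev[OF f(1)] f(3) by eventually_elim auto
 then obtain V where V: "openin (dtop (total B)) V" "u \<in> V" "V \<subseteq> pts (total B)"
  "\<And>w. w \<in> V ==> msm (total B) (total C) f w \<and> tgt C (f w) = tgt B w \<and> src C (f w) = src B w"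
  using nb_openE[OF _ assms] by blast
 thus "equiv_pt M B u C v"
  unfolding equiv_pt_def using smooth_map_sub[OF V(1), THEN iffD2, of "total C" f] f(2)
  by (intro exI[of _ V] exI[of _ f]) auto
qed

subsection \<open>Euclidean spaces and products\<close>

lemma pts_euclid [simp]: "pts (euclid n) = Rn n"
 by (simp add: euclid_def)

lemma dspace_euclid [simp]: "dspace (euclid n)"
 by (simp add: euclid_def)

lemma finite_radius:
 assumes "\<And>i. i < k ==> \<exists>r>0. \<forall>y\<in>cube n w r. P i y"
 shows "\<exists>r>0. \<forall>i<(k::nat). \<forall>y\<in>cube n w r. P i y"
 using assms
proof (induction k)
 case 0
 show ?case by (intro exI[of _ 1]) auto
next
 case (Suc k)
 hence "\<exists>r>0. \<forall>i<k. \<forall>y\<in>cube n w r. P i y" by simp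
 then obtain r where r: "r > 0" "\<forall>i<k. \<forall>y\<in>cube n w r. P i y" by blast
 obtain s where s: "s > 0" "\<forall>y\<in>cube n w s. P k y" using Suc.prems by blast
 show ?case
  by (rule exI[of _ "min r s"]) (use r s cube_mono[of "min r s" r n w] cube_mono[of "min r s" s n w] in "auto simp: less_Suc_eq")
qed

lemma eventually_euclid:
 assumes w: "w \<in> Rn n"
 shows "eventually P (nb (euclid n) w) \<longleftrightarrow> (\<exists>r>0. \<forall>y\<in>cube n w r. P y)"
proof -
 have "eventually P (nb (euclid n) w) \<longleftrightarrow> (\<exists>k a r. a ` {..<k::nat} \<subseteq> {f. smooth_fun n f} \<and> r > 0 \<and>
   (\<forall>y\<in>Rn n. (\<forall>i<k. \<bar>a i y - a i w\<bar> < r) --> P y))"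
  unfolding euclid_def dtop_gen by (rule eventually_init_top[OF w])
 also have "\<dots> \<longleftrightarrow> (\<exists>r>0. \<forall>y\<in>cube n w r. P y)"
 proof
  assume "\<exists>k a r. a ` {..<k::nat} \<subseteq> {f. smooth_fun n f} \<and> r > 0 \<and>
   (\<forall>y\<in>Rn n. (\<forall>i<k. \<bar>a i y - a i w\<bar> < r) --> P y)"
  then obtain k a r where a: "a ` {..<k::nat} \<subseteq> {f. smooth_fun n f}" "r > 0"
   "\<forall>y\<in>Rn n. (\<forall>i<k. \<bar>a i y - a i w\<bar> < r) --> P y" by (elim exE conjE) (rule that)
  have "\<exists>s>0. \<forall>i<k. \<forall>y\<in>cube n w s. a i y \<in> {a i w - r<..<a i w + r}"
   by (rule finite_radius, rule continuous_cube[OF smooth_continuous w]) (use a in auto)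
  then obtain s where s: "s > 0" "\<forall>i<k. \<forall>y\<in>cube n w s. a i y \<in> {a i w - r<..<a i w + r}" by blast
  have "P y" if y: "y \<in> cube n w s" for y
  proof -
   have "\<forall>i<k. \<bar>a i y - a i w\<bar> < r" using s(2) y by (fastforce simp: abs_less_iff)
   thus ?thesis using a(3) y by (simp add: cube_def)
  qed
  thus "\<exists>r>0. \<forall>y\<in>cube n w r. P y" using s(1) by blast
 next
  assume "\<exists>r>0. \<forall>y\<in>cube n w r. P y"
  then obtain r where r: "r > 0" "\<forall>y\<in>cube n w r. P y" by blast
  show "\<exists>k a r. a ` {..<k::nat} \<subseteq> {f. smooth_fun n f} \<and> r > 0 \<and>
   (\<forall>y\<in>Rn n. (\<forall>i<k. \<bar>a i y - a i w\<bar> < r) --> P y)"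
   by (intro exI[of _ n] exI[of _ "%i x. x i"] exI[of _ r])
    (use r in "auto simp: smooth_coord cube_def")
 qed
 finally show ?thesis .
qed

lemma fsm_smooth: "smooth_fun n F ==> w \<in> Rn n ==> fsm (euclid n) F w"
 unfolding euclid_def by (rule fsm_base) auto

lemma fsm_euclid:
 "fsm (euclid n) h w \<longleftrightarrow> w \<in> Rn n \<and> (\<exists>F. smooth_fun n F \<and> (near (euclid n) w (%y. h y = F y)))"
proof
 assume h: "fsm (euclid n) h w"
 hence w: "w \<in> Rn n" using fsm_pts by fastforce
 have "loc_smooth {f. smooth_fun n f} (nb (euclid n) w) h"
  using h unfolding euclid_def fsm_gen dtop_gen by simp
 then obtain m a F where a: "a ` {..<m} \<subseteq> {f. smooth_fun n f}" "smooth_fun m F"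
  "near (euclid n) w (%y. h y = F (trunc m (%i. a i y)))" unfolding loc_smooth_def by blast
 have "smooth_fun n (%y. F (trunc m (%i. a i y)))" by (rule smooth_compose[OF a(2)]) (use a(1) in auto)
 thus "w \<in> Rn n \<and> (\<exists>F. smooth_fun n F \<and> (near (euclid n) w (%y. h y = F y)))" using a(3) w by blast
next
 assume "w \<in> Rn n \<and> (\<exists>F. smooth_fun n F \<and> (near (euclid n) w (%y. h y = F y)))"
 then obtain F where "w \<in> Rn n" "smooth_fun n F" "near (euclid n) w (%y. h y = F y)" by blast
 thus "fsm (euclid n) h w" using fsm_cong[OF fsm_smooth] by blast
qed

lemma msm_euclidI:
 assumes "\<And>i. i < n ==> fsm X (%y. f y i) w" "near X w (%y. f y \<in> Rn n)" "w \<in> pts X"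
 shows "msm X (euclid n) f w"
 unfolding euclid_def
proof (rule msm_gen[OF assms(3,2)])
 have "near X w (%y. \<forall>i\<in>{..<n}. fsm X (%y. f y i) y)"
  using assms(1) by (intro eventually_ball_finite ballI fsm_ev[of X "%y. f y _"]) auto
 with nb_ev[OF assms(2)] nb_pts[of X w]
 show "near X w (%y. \<forall>a\<in>{f. smooth_fun n f}. fsm X (%z. a (f z)) y)"
 proof eventually_elim
  case (elim y)
  show ?case
  proof
   fix F assume "F \<in> {f. smooth_fun n f}"
   hence "fsm X (%z. F (trunc n (%i. f z i))) y" by (intro fsm_comp) (use elim in auto)
   thus "fsm X (%z. F (f z)) y"
    by (rule fsm_cong) (use elim(1) in "auto elim!: eventually_mono")
  qed
 qed
qed

lemma msm_euclidD: "msm X (euclid n) f w ==> fsm X (%y. f y i) w"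
 using msm_fsm[OF fsm_smooth[OF smooth_coord, of _ n i], of f w X] msm_tgt[of X "euclid n" f w] by simp

lemma pts_sprod [simp]: "pts (sprod X Y) = pts X \<times> pts Y"
 by (simp add: sprod_def)

lemma msm_sprodI:
 assumes f: "msm Z X f w" and g: "msm Z Y g w"
 shows "msm Z (sprod X Y) (%z. (f z, g z)) w"
 unfolding sprod_def
proof (rule msm_gen)
 show "w \<in> pts Z" by (rule msm_src[OF f])
 show "near Z w (%y. (f y, g y) \<in> pts X \<times> pts Y)"
  using msm_pts_ev[OF f] msm_pts_ev[OF g] by eventually_elim auto
 show "near Z w (%y. \<forall>a\<in>{a \<circ> fst |a. a \<in> cinf X} \<union> {b \<circ> snd |b. b \<in> cinf Y}. fsm Z (%z. a (f z, g z)) y)"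
  using msm_ev[OF f] msm_ev[OF g]
  by eventually_elim (auto intro: msm_cinf)
qed

lemma msm_fst: "w \<in> pts X \<times> pts Y ==> msm (sprod X Y) X fst w"
 unfolding msm_def
proof
 show "near (sprod X Y) w (%y. fst y \<in> pts X \<and> (\<forall>b\<in>cinf X. fsm (sprod X Y) (%z. b (fst z)) y))"
  using nb_pts
 proof eventually_elim
  case (elim y)
  have "fsm (sprod X Y) (b \<circ> fst) y" if "b \<in> cinf X" for b
   unfolding sprod_def by (rule fsm_base) (use that elim in auto)
  thus ?case using elim by (auto simp: o_def)
 qed
qed auto

lemma msm_snd: "w \<in> pts X \<times> pts Y ==> msm (sprod X Y) Y snd w"
 unfolding msm_def
proof
 show "near (sprod X Y) w (%y. snd y \<in> pts Y \<and> (\<forall>b\<in>cinf Y. fsm (sprod X Y) (%z. b (snd z)) y))"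
  using nb_pts
 proof eventually_elim
  case (elim y)
  have "fsm (sprod X Y) (b \<circ> snd) y" if "b \<in> cinf Y" for b
   unfolding sprod_def by (rule fsm_base) (use that elim in auto)
  thus ?case using elim by (auto simp: o_def)
 qed
qed auto

section \<open>Families over time and a parameter space\<close>

definition RX :: "'q smooth_space => (real \<times> 'q) smooth_space" where
 "RX Q = gen (UNIV \<times> pts Q) (insert fst {b \<circ> snd | b. b \<in> cinf Q})"

lemma pts_RX [simp]: "pts (RX Q) = UNIV \<times> pts Q"
 by (simp add: RX_def)

lemma dspace_RX [simp]: "dspace (RX Q)"
 by (simp add: RX_def)

lemma fsm_RX_fst: "w \<in> UNIV \<times> pts Q ==> fsm (RX Q) fst w"
 unfolding RX_def by (rule fsm_base) auto

lemma msm_RX_snd: "w \<in> UNIV \<times> pts Q ==> msm (RX Q) Q snd w"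
 unfolding msm_def
proof
 show "near (RX Q) w (%y. snd y \<in> pts Q \<and> (\<forall>b\<in>cinf Q. fsm (RX Q) (%z. b (snd z)) y))"
  using nb_pts
 proof eventually_elim
  case (elim y)
  have "fsm (RX Q) (b \<circ> snd) y" if "b \<in> cinf Q" for b
   unfolding RX_def by (rule fsm_base) (use that elim in auto)
  thus ?case using elim by (auto simp: o_def)
 qed
qed auto

lemma msm_RXI:
 assumes f: "fsm Z f w" and g: "msm Z Q g w"
 shows "msm Z (RX Q) (%z. (f z, g z)) w"
 unfolding RX_def
proof (rule msm_gen)
 show "w \<in> pts Z" by (rule msm_src[OF g])
 show "near Z w (%y. (f y, g y) \<in> UNIV \<times> pts Q)"
  using msm_pts_ev[OF g] by eventually_elim auto
 show "near Z w (%y. \<forall>a\<in>insert fst {b \<circ> snd |b. b \<in> cinf Q}. fsm Z (%z. a (f z, g z)) y)"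
  using fsm_ev[OF f] msm_ev[OF g]
  by eventually_elim (auto intro: msm_cinf)
qed

text \<open>The length of the time interval is common to all nearby parameters; later this supplies
  uniform times of existence and uniqueness.\<close>

lemma eventually_RX:
 assumes w: "th \<in> pts Q"
 shows "eventually P (nb (RX Q) (\<tau>, th)) \<longleftrightarrow> (\<exists>e>0. near Q th (%q. \<forall>r. \<bar>r - \<tau>\<bar> < e --> P (r, q)))"
proof
 assume "eventually P (nb (RX Q) (\<tau>, th))"
 hence "\<exists>k a r. a ` {..<k::nat} \<subseteq> insert fst {b \<circ> snd | b. b \<in> cinf Q} \<and> r > 0 \<and>
   (\<forall>y\<in>UNIV \<times> pts Q. (\<forall>i<k. \<bar>a i y - a i (\<tau>, th)\<bar> < r) --> P y)"
  unfolding RX_def dtop_gen using w by (subst (asm) eventually_init_top) auto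
 then obtain k a r where a: "a ` {..<k::nat} \<subseteq> insert fst {b \<circ> snd | b. b \<in> cinf Q}" "r > 0"
   "\<forall>y\<in>UNIV \<times> pts Q. (\<forall>i<k. \<bar>a i y - a i (\<tau>, th)\<bar> < r) --> P y" by (elim exE conjE) (rule that)
 have "near Q th (%q. a i \<noteq> fst --> \<bar>a i (\<tau>, q) - a i (\<tau>, th)\<bar> < r)" if "i \<in> {..<k}" for i
 proof (cases "a i = fst")
  case False
  then obtain b where b: "b \<in> cinf Q" "a i = b \<circ> snd" using a(1) \<open>i \<in> {..<k}\<close> by (auto simp: image_subset_iff)
  from fsm_cont[OF cinf_fsm[OF b(1) w] a(2)] show ?thesis by eventually_elim (simp add: b)
 qed simp
 hence "near Q th (%q. \<forall>i\<in>{..<k}. a i \<noteq> fst --> \<bar>a i (\<tau>, q) - a i (\<tau>, th)\<bar> < r)"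
  by (intro eventually_ball_finite) auto
 with nb_pts[of Q th] have "near Q th (%q. \<forall>s. \<bar>s - \<tau>\<bar> < r --> P (s, q))"
 proof eventually_elim
  case (elim q)
  show ?case
  proof (intro allI impI)
   fix s assume s: "\<bar>s - \<tau>\<bar> < r"
   have "\<bar>a i (s, q) - a i (\<tau>, th)\<bar> < r" if i: "i < k" for i
   proof (cases "a i = fst")
    case False
    then obtain b where b: "b \<in> cinf Q" "a i = b \<circ> snd" using a(1) i by (auto simp: image_subset_iff)
    have "\<bar>a i (\<tau>, q) - a i (\<tau>, th)\<bar> < r" using elim(2) i False by blast
    thus ?thesis by (simp add: b)
   qed (use s in simp)
   thus "P (s, q)" using a(3) elim(1) by auto
  qed
 qed
 thus "\<exists>e>0. near Q th (%q. \<forall>r. \<bar>r - \<tau>\<bar> < e --> P (r, q))" using a(2) by blast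
next
 assume "\<exists>e>0. near Q th (%q. \<forall>r. \<bar>r - \<tau>\<bar> < e --> P (r, q))"
 then obtain e where e: "e > 0" "near Q th (%q. \<forall>r. \<bar>r - \<tau>\<bar> < e --> P (r, q))" by blast
 have 1: "near (RX Q) (\<tau>, th) (%y. \<forall>r. \<bar>r - \<tau>\<bar> < e --> P (r, snd y))"
  by (rule msm_lim[OF msm_RX_snd]) (use w e in auto)
 have 2: "near (RX Q) (\<tau>, th) (%y. \<bar>fst y - fst (\<tau>, th)\<bar> < e)"
  by (rule fsm_cont[OF fsm_RX_fst]) (use w e in auto)
 from 1 2 show "eventually P (nb (RX Q) (\<tau>, th))" by eventually_elim auto
qed

definition tder :: "(real \<times> 'q => real) => real \<times> 'q => real" where
 "tder h = (%(\<tau>, th). deriv (%r. h (r, th)) \<tau>)"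

lemma RX_slice:
 assumes "eventually P (nb (RX Q) (\<tau>, th))" "th \<in> pts Q"
 obtains e where "e > 0" "\<And>r. \<bar>r - \<tau>\<bar> < e ==> P (r, th)"
proof -
 from assms(1)[unfolded eventually_RX[OF assms(2)]] obtain e where e: "e > 0" "near Q th (%q. \<forall>r. \<bar>r - \<tau>\<bar> < e --> P (r, q))"
  by blast
 show thesis by (rule that[OF e(1)]) (use nb_self[OF e(2) assms(2)] in blast)
qed

text \<open>A generator of \<open>RX Q\<close> is either time or independent of time, so its time
  derivative is the constant 1 or 0. The chain rule for a local expression then gives the
  derivative, again as a local expression.\<close>

lemma RX_deriv:
 assumes h: "fsm (RX Q) h (\<tau>, th)"
 shows "fsm (RX Q) (tder h) (\<tau>, th)"
  "near (RX Q) (\<tau>, th) (%y. ((%r. h (r, snd y)) has_real_derivative tder h y) (at (fst y)))"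
proof -
 let ?A = "insert fst {b \<circ> snd | b. b \<in> cinf Q}"
 have th: "th \<in> pts Q" using fsm_pts[OF h] by simp
 have "loc_smooth ?A (nb (RX Q) (\<tau>, th)) h"
  using h unfolding RX_def fsm_gen dtop_gen by simp
 then obtain n a F where a: "a ` {..<n} \<subseteq> ?A" "smooth_fun n F"
   and ev: "near (RX Q) (\<tau>, th) (%y. h y = F (trunc n (%i. a i y)))" unfolding loc_smooth_def by blast
 define d where "d i = (if a i = fst then 1 else 0 :: real)" for i
 have ad: "((%r. a i (r, q)) has_real_derivative d i) (at s)" if "i < n" for i s q
 proof (cases "a i = fst")
  case False
  then obtain b where "a i = b \<circ> snd" using a(1) \<open>i < n\<close> by (auto simp: image_subset_iff)
  thus ?thesis using False by (simp add: d_def)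
 qed (simp add: d_def)
 define D where "D y = (\<Sum>i<n. pd i F (trunc n (%i. a i y)) * d i)" for y
 have DD: "((%r. F (trunc n (%i. a i (r, q)))) has_real_derivative D (s, q)) (at s)" for s q
  unfolding D_def by (rule smooth_chain[OF a(2)]) (auto simp: ad)
 have main: "near (RX Q) (\<tau>, th) (%y. ((%r. h (r, snd y)) has_real_derivative D y) (at (fst y)))"
  using nb_ev[OF ev] nb_pts[of "RX Q" "(\<tau>, th)"]
 proof eventually_elim
  case (elim y)
  obtain s q where y: "y = (s, q)" by (cases y)
  have q: "q \<in> pts Q" using elim(2) y by simp
  obtain e where e: "e > 0" "\<And>r. \<bar>r - s\<bar> < e ==> h (r, q) = F (trunc n (%i. a i (r, q)))"
   using RX_slice[OF elim(1)[unfolded y] q] by blast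
  have "((%r. h (r, q)) has_real_derivative D (s, q)) (at s)"
   by (rule has_field_derivative_transform_within_open[OF DD, of "{s - e<..<s + e}"])
    (use e in "auto simp: abs_less_iff")
  thus ?case by (simp add: y)
 qed
 have eq: "near (RX Q) (\<tau>, th) (%y. tder h y = D y)"
  using main by eventually_elim (auto simp: tder_def DERIV_imp_deriv split: prod.split)
 from main eq show "near (RX Q) (\<tau>, th) (%y. ((%r. h (r, snd y)) has_real_derivative tder h y) (at (fst y)))"
  by eventually_elim simp
 have "fsm (RX Q) D (\<tau>, th)"
  unfolding D_def
 proof (intro fsm_sum fsm_mult fsm_const fsm_comp)
  show "fsm (RX Q) (a i) (\<tau>, th)" if "i < n" for i
   unfolding RX_def by (rule fsm_base) (use a(1) that th in auto)
 qed (use a(2) th in "auto intro: smooth_pd")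
 thus "fsm (RX Q) (tder h) (\<tau>, th)" by (rule fsm_cong) (rule eq)
qed

section \<open>Tangent vectors and charts\<close>

text \<open>The bump is a function of the finitely many smooth functions that cut out the
  neighbourhood, so no chart is involved. \<open>K\<close> is closed but need not be
  compact.\<close>

lemma cinf_bump:
 assumes "eventually P (nb X u)" "dspace X" "u \<in> pts X"
 shows "\<exists>\<rho>\<in>cinf X. (near X u (%y. \<rho> y = 1)) \<and> (\<exists>K. closedin (dtop X) K \<and> (\<forall>y\<in>K. P y) \<and> (\<forall>y. \<rho> y \<noteq> 0 --> y \<in> K))"
proof -
 from assms(1)[unfolded eventually_nb[OF assms(3)]] obtain k a r where a: "a ` {..<k::nat} \<subseteq> cinf X" "r > 0"
  "\<forall>y\<in>pts X. (\<forall>i<k. \<bar>a i y - a i u\<bar> < r) --> P y" by (elim exE conjE) (rule that)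
 have af: "fsm X (a i) y" if "i < k" "y \<in> pts X" for i y using a(1) that by (intro cinf_fsm) auto
 from bump_exists[OF a(2), of k "%i. a i u"] obtain b where b: "smooth_fun k b"
  "\<forall>x\<in>cube k (%i. a i u) (r/2). b x = 1" "\<forall>x. b x \<noteq> 0 --> (\<forall>i<k. \<bar>x i - a i u\<bar> < 3 * r / 4)" by blast
 define \<rho> where "\<rho> y = (if y \<in> pts X then b (trunc k (%i. a i y)) else 0)" for y
 define K where "K = {y\<in>pts X. \<forall>i<k. \<bar>a i y - a i u\<bar> \<le> 3 * r / 4}"
 have \<rho>: "\<rho> \<in> cinf X"
  unfolding cinf_iff[OF assms(2)]
 proof (intro conjI allI ballI impI)
  fix x assume x: "x \<in> pts X"
  show "fsm X \<rho> x"
  proof (rule fsm_cong)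
   show "fsm X (%y. b (trunc k (%i. a i y))) x" by (rule fsm_comp[OF _ b(1) x]) (use af x in auto)
   show "near X x (%y. \<rho> y = b (trunc k (%i. a i y)))" using nb_pts by eventually_elim (simp add: \<rho>_def)
  qed
 qed (simp add: \<rho>_def)
 have "near X u (%y. \<forall>i\<in>{..<k}. \<bar>a i y - a i u\<bar> < r / 2)"
  by (intro eventually_ball_finite ballI fsm_cont af) (use a(2) assms in auto)
 with nb_pts[of X u] have 1: "near X u (%y. \<rho> y = 1)"
  by eventually_elim (use b(2) in "auto simp: \<rho>_def cube_def")
 have "openin (dtop X) (pts X - K)"
 proof (subst openin_subopen, intro ballI)
  fix y assume "y \<in> pts X - K"
  then obtain i where i: "i < k" "\<bar>a i y - a i u\<bar> > 3 * r / 4" and y: "y \<in> pts X" by (auto simp: K_def not_le)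
  have "near X y (%z. \<bar>a i z - a i y\<bar> < \<bar>a i y - a i u\<bar> - 3 * r / 4)"
   by (rule fsm_cont[OF af]) (use i y in auto)
  with nb_pts[of X y] have "near X y (%z. z \<in> pts X - K)"
  proof eventually_elim
   case (elim z)
   hence "\<bar>a i z - a i u\<bar> > 3 * r / 4" by linarith
   thus ?case using elim(1) i(1) by (auto simp: K_def)
  qed
  thus "\<exists>T. openin (dtop X) T \<and> y \<in> T \<and> T \<subseteq> pts X - K" using y unfolding eventually_nhdsin by auto
 qed
 hence "closedin (dtop X) K" by (auto simp: closedin_def K_def)
 moreover have "\<forall>y\<in>K. P y" using a(2,3) by (fastforce simp: K_def)
 moreover have "y \<in> K" if "\<rho> y \<noteq> 0" for y
 proof -
  have "y \<in> pts X" "b (trunc k (%i. a i y)) \<noteq> 0" using that by (auto simp: \<rho>_def split: if_splits)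
  thus ?thesis using b(3) by (force simp: K_def less_imp_le)
 qed
 ultimately show ?thesis using \<rho> 1 by blast
qed

lemma cinf_add: "dspace X ==> f \<in> cinf X ==> g \<in> cinf X ==> (%y. f y + g y) \<in> cinf X"
 and cinf_mult: "dspace X ==> f \<in> cinf X ==> g \<in> cinf X ==> (%y. f y * g y) \<in> cinf X"
 and cinf_scale: "dspace X ==> f \<in> cinf X ==> (%y. c * f y) \<in> cinf X"
 and cinf_sum: "dspace X ==> (\<And>i. i \<in> I ==> h i \<in> cinf X) ==> (%y. \<Sum>i\<in>I. h i y) \<in> cinf X"
 by (auto simp: cinf_iff intro: fsm_add fsm_mult fsm_const fsm_sum)

lemma cinf_const: "dspace X ==> (%y. if y \<in> pts X then c else 0) \<in> cinf X"
proof -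
 have "fsm X (%y. if y \<in> pts X then c else 0) x" if "x \<in> pts X" for x
 proof (rule fsm_cong[OF fsm_const[OF that]])
  show "near X x (%y. (if y \<in> pts X then c else 0) = c)" using nb_pts by eventually_elim simp
 qed
 thus "dspace X ==> ?thesis" by (simp add: cinf_iff)
qed

lemma tvec_add: "D \<in> tvec X u ==> a \<in> cinf X ==> b \<in> cinf X ==> D (%y. a y + b y) = D a + D b"
 and tvec_scale: "D \<in> tvec X u ==> a \<in> cinf X ==> D (%y. c * a y) = c * D a"
 and tvec_mult: "D \<in> tvec X u ==> a \<in> cinf X ==> b \<in> cinf X ==> D (%y. a y * b y) = D a * b u + a u * D b"
 by (auto simp: tvec_def)

lemma tvec_0: "D \<in> tvec X u ==> dspace X ==> D (%_. 0) = 0"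
 using tvec_scale[of D X u "%y. if y \<in> pts X then 0 else 0" 0] cinf_const[of X 0] by simp

lemma tvec_const:
 assumes "D \<in> tvec X u" "dspace X" "u \<in> pts X"
 shows "D (%y. if y \<in> pts X then c else 0) = 0"
proof -
 let ?one = "%y. if y \<in> pts X then 1 else 0 :: real"
 have 1: "?one \<in> cinf X" by (rule cinf_const[OF assms(2)])
 have "D (%y. ?one y * ?one y) = D ?one * ?one u + ?one u * D ?one" by (rule tvec_mult[OF assms(1) 1 1])
 moreover have "(%y. ?one y * ?one y) = ?one" by auto
 ultimately have "D ?one = 0" using assms(3) by simp
 hence "D (%y. c * ?one y) = 0" using tvec_scale[OF assms(1) 1] by simp
 moreover have "(%y. c * ?one y) = (%y. if y \<in> pts X then c else 0)" by auto
 ultimately show ?thesis by simp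
qed

lemma tvec_sum:
 assumes "D \<in> tvec X u" "dspace X"
 shows "finite I ==> (\<And>i. i \<in> I ==> h i \<in> cinf X) ==> D (%y. \<Sum>i\<in>I. h i y) = (\<Sum>i\<in>I. D (h i))"
proof (induction I rule: finite_induct)
 case empty
 thus ?case using tvec_0[OF assms] by simp
next
 case (insert i I)
 have "(%y. \<Sum>i\<in>I. h i y) \<in> cinf X" by (rule cinf_sum[OF assms(2)]) (use insert in auto)
 thus ?case using insert tvec_add[OF assms(1), of "h i" "%y. \<Sum>i\<in>I. h i y"] by simp
qed

text \<open>Derivations act on global functions only. With a bump \<rho> inside the region of
  agreement, \<rho> h and \<rho> h' are the same function, and the product rule at a point where
  \<rho> is 1 compares the values of D.\<close>

lemma tvec_local:
 assumes D: "D \<in> tvec X u" "dspace X" "u \<in> pts X" and h: "h \<in> cinf X" "h' \<in> cinf X"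
  and e: "near X u (%y. h y = h' y)"
 shows "D h = D h'"
proof -
 obtain \<rho> K where \<rho>: "\<rho> \<in> cinf X" "near X u (%y. \<rho> y = 1)" "\<forall>y\<in>K. h y = h' y" "\<forall>y. \<rho> y \<noteq> 0 --> y \<in> K"
  using cinf_bump[OF e D(2,3)] by blast
 have u: "\<rho> u = 1" "h u = h' u" using nb_self[OF \<rho>(2) D(3)] nb_self[OF e D(3)] by auto
 have "(%y. \<rho> y * h y) = (%y. \<rho> y * h' y)" using \<rho>(3,4) by (intro ext) (metis mult_eq_0_iff)
 hence "D \<rho> * h u + \<rho> u * D h = D \<rho> * h' u + \<rho> u * D h'"
  using tvec_mult[OF D(1) \<rho>(1) h(1)] tvec_mult[OF D(1) \<rho>(1) h(2)] by simp
 thus ?thesis using u by simp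
qed

text \<open>Hadamard's formula at the value of the coordinates writes h near u as a constant plus a
  sum of products (c_j - c_j(u)) \<gamma>_j. The first factors vanish at u, so the product rule
  leaves \<gamma>_j(u) D(c_j), and \<gamma>_j(u) is the partial derivative.\<close>

lemma tvec_chain:
 assumes D: "D \<in> tvec X u" "dspace X" "u \<in> pts X" and c: "\<And>j. j < n ==> c j \<in> cinf X" and H: "smooth_fun n H"
  and h: "h \<in> cinf X" and e: "near X u (%y. h y = H (trunc n (%j. c j y)))"
 shows "D h = (\<Sum>j<n. pd j H (trunc n (%j. c j u)) * D (c j))"
proof -
 define x0 where "x0 = trunc n (%j. c j u)"
 obtain g where g: "\<And>j. j < n ==> smooth_fun (n + n) (g j)"
  "\<And>x y. x \<in> Rn n ==> y \<in> Rn n ==> H y - H x = (\<Sum>j<n. (y j - x j) * g j (cat n x y))"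
  "\<And>j x. j < n ==> x \<in> Rn n ==> g j (cat n x x) = pd j H x" by (rule hadamard[OF H]) blast
 have "fsm X (%y. g j (cat n x0 (trunc n (%j. c j y)))) u" if j: "j < n" for j
 proof -
  have "smooth_fun n (%z. g j (cat n x0 z))"
  proof (rule smooth_compose'[OF g(1)[OF j]])
   show "smooth_fun n (%z. cat n x0 z i)" for i by (auto simp: cat_def intro!: smooth_if smooth_coord)
  qed simp
  from fsm_comp[of n X c u, OF cinf_fsm[OF c D(3)] this D(3)] show ?thesis by simp
 qed
 hence "\<forall>j. \<exists>\<gamma>. j < n --> \<gamma> \<in> cinf X \<and> (near X u (%y. \<gamma> y = g j (cat n x0 (trunc n (%j. c j y)))))"
  using fsm_extend[OF D(2)] by meson
 from choice[OF this] obtain \<gamma> where \<gamma>: "\<And>j. j < n ==> \<gamma> j \<in> cinf X"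
  "\<And>j. j < n ==> near X u (%y. \<gamma> j y = g j (cat n x0 (trunc n (%j. c j y))))" by blast
 \<comment> \<open>Smooth functions vanish outside the carrier, so constants have to be cut off
   there.\<close>
 let ?k = "%c y. if y \<in> pts X then c else 0 :: real"
 have t: "(%y. c j y + ?k (- x0 j) y) \<in> cinf X" if "j < n" for j using cinf_add[OF D(2) c[OF that] cinf_const[OF D(2)]] .
 define e' where "e' y = (\<Sum>j<n. (c j y + ?k (- x0 j) y) * \<gamma> j y) + ?k (H x0) y" for y
 have tj: "(%y. (c j y + ?k (- x0 j) y) * \<gamma> j y) \<in> cinf X" if "j < n" for j
  using cinf_mult[OF D(2) t[OF that] \<gamma>(1)[OF that]] .
 have S: "(%y. \<Sum>j<n. (c j y + ?k (- x0 j) y) * \<gamma> j y) \<in> cinf X" using cinf_sum[OF D(2), of "{..<n}"] tj by simp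
 hence e'c: "e' \<in> cinf X" unfolding e'_def using cinf_add[OF D(2) S cinf_const[OF D(2)]] by simp
 have "near X u (%y. \<forall>j\<in>{..<n}. \<gamma> j y = g j (cat n x0 (trunc n (%j. c j y))))"
  using \<gamma>(2) by (intro eventually_ball_finite) auto
 with e nb_pts[of X u] have "near X u (%y. h y = e' y)"
 proof eventually_elim
  case (elim y)
  thus ?case using g(2)[of x0 "trunc n (%j. c j y)"] by (auto simp: e'_def x0_def)
 qed
 hence "D h = D e'" by (rule tvec_local[OF D h e'c])
 also have "\<dots> = D (%y. \<Sum>j<n. (c j y + ?k (- x0 j) y) * \<gamma> j y) + D (?k (H x0))"
  unfolding e'_def by (rule tvec_add[OF D(1) S cinf_const[OF D(2)]])
 also have "\<dots> = (\<Sum>j<n. D (%y. (c j y + ?k (- x0 j) y) * \<gamma> j y))"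
  using tvec_const[OF D] tvec_sum[OF D(1,2), of "{..<n}"] tj by simp
 also have "\<dots> = (\<Sum>j<n. pd j H x0 * D (c j))"
 proof (rule sum.cong)
  fix j assume "j \<in> {..<n}"
  hence j: "j < n" by simp
  have "\<gamma> j u = pd j H x0" using nb_self[OF \<gamma>(2)[OF j] D(3)] g(3)[OF j, of x0] by (simp add: x0_def)
  thus "D (%y. (c j y + ?k (- x0 j) y) * \<gamma> j y) = pd j H x0 * D (c j)"
   using tvec_mult[OF D(1) t[OF j] \<gamma>(1)[OF j]] tvec_add[OF D(1) c[OF j] cinf_const[OF D(2)]] tvec_const[OF D]
    D(3) j by (simp add: x0_def)
 qed simp
 finally show ?thesis unfolding x0_def .
qed

subsection \<open>Charts\<close>

definition is_chart where
 "is_chart X u n ch Th \<longleftrightarrow> msm X (euclid n) ch u \<and> msm (euclid n) X Th (ch u) \<and>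
  (near X u (%w. Th (ch w) = w)) \<and> (near (euclid n) (ch u) (%x. ch (Th x) = x))"

lemma is_chart_ev: "is_chart X u n ch Th ==> near X u (%w. is_chart X w n ch Th)"
proof -
 assume c: "is_chart X u n ch Th"
 hence m: "msm X (euclid n) ch u" by (simp add: is_chart_def)
 from c have 1: "near X u (%w. msm X (euclid n) ch w)" "near X u (%w. near X w (%w. Th (ch w) = w))"
  "near X u (%w. msm (euclid n) X Th (ch w))" "near X u (%w. near (euclid n) (ch w) (%x. ch (Th x) = x))"
  unfolding is_chart_def by (auto intro: msm_ev nb_ev msm_lim[OF m msm_ev] msm_lim[OF m nb_ev])
 thus ?thesis by eventually_elim (simp add: is_chart_def)
qed

lemma is_chartD:
 assumes "is_chart X u n ch Th"
 shows "msm X (euclid n) ch u" "msm (euclid n) X Th (ch u)" "Th (ch u) = u" "u \<in> pts X" "ch u \<in> Rn n"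
  "near X u (%w. Th (ch w) = w)" "near (euclid n) (ch u) (%x. ch (Th x) = x)"
proof -
 show *: "msm X (euclid n) ch u" "msm (euclid n) X Th (ch u)" "near X u (%w. Th (ch w) = w)"
  "near (euclid n) (ch u) (%x. ch (Th x) = x)" using assms by (auto simp: is_chart_def)
 show "u \<in> pts X" "ch u \<in> Rn n" using msm_src[OF *(1)] msm_tgt[OF *(1)] by auto
 thus "Th (ch u) = u" using nb_self[OF *(3)] by simp
qed

lemma manifold_chart:
 assumes "manifold X" "u \<in> pts X"
 shows "\<exists>n ch Th. is_chart X u n ch Th"
proof -
 from assms obtain n V W where V: "openin (dtop X) V" "u \<in> V" and W: "openin (dtop (euclid n)) W"
  and "diffeomorphic (sub X V) (sub (euclid n) W)" unfolding manifold_def by blast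
 then obtain f g where fg: "smooth_map (sub X V) (sub (euclid n) W) f" "smooth_map (sub (euclid n) W) (sub X V) g"
  "\<forall>x\<in>V. g (f x) = x" "\<forall>y\<in>W. f (g y) = y" unfolding diffeomorphic_def by auto
 have f: "msm X (sub (euclid n) W) f u" using fg(1) smooth_map_sub[OF V(1)] V(2) by blast
 hence fu: "f u \<in> W" using msm_tgt by fastforce
 have g: "msm (euclid n) (sub X V) g (f u)" using fg(2) smooth_map_sub[OF W] fu by blast
 have "is_chart X u n f g" unfolding is_chart_def
 proof (intro conjI)
  show "msm X (euclid n) f u" by (rule msm_incl[OF W f])
  show "msm (euclid n) X g (f u)" by (rule msm_incl[OF V(1) g])
  show "near X u (%w. g (f w) = w)" using nb_open[OF V] by eventually_elim (use fg in auto)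
  show "near (euclid n) (f u) (%x. f (g x) = x)" using nb_open[OF W fu] by eventually_elim (use fg in auto)
 qed
 thus ?thesis by blast
qed

lemma chart_compose:
 assumes c: "is_chart X u n ch Th" and d: "is_chart (euclid n) (ch u) m e S"
 shows "is_chart X u m (%w. e (ch w)) (%x. Th (S x))"
proof -
 note C = is_chartD[OF c] and D = is_chartD[OF d]
 have T: "msm (euclid n) X Th (S (e (ch u)))" using C(2) D(3) by simp
 show ?thesis unfolding is_chart_def
 proof (intro conjI)
  show "msm X (euclid m) (%w. e (ch w)) u" by (rule msm_comp[OF C(1) D(1)])
  show "msm (euclid m) X (%x. Th (S x)) (e (ch u))" by (rule msm_comp[where Y = "euclid n"]) (use D(2) T in auto)
  show "near X u (%w. Th (S (e (ch w))) = w)"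
   using C(6) msm_lim[OF C(1) D(6)] by eventually_elim simp
  have "near (euclid n) (S (e (ch u))) (%x. ch (Th x) = x)" using C(7) D(3) by simp
  from D(7) msm_lim[where f = S, OF D(2) this] show "near (euclid m) (e (ch u)) (%x. e (ch (Th (S x))) = x)"
   by eventually_elim simp
 qed
qed

lemma exchange_chart:
 assumes c: "is_chart X u n ch Th" and h: "fsm X h u" and i: "i < n"
  and H: "smooth_fun n H" "near (euclid n) (ch u) (%x. h (Th x) = H x)" "pd i H (ch u) \<noteq> 0"
 shows "\<exists>ch' Th'. is_chart X u n ch' Th' \<and> (near X u (%w. ch' w = (ch w)(i := h w)))"
proof -
 note C = is_chartD[OF c]
 from exchange_coordinate[OF H(1) C(5) i H(3)] obtain \<kappa> r where \<kappa>: "smooth_fun n \<kappa>" "r > 0"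
  "\<forall>y\<in>cube n ((ch u)(i := H (ch u))) r. H (y(i := \<kappa> y)) = y i"
  "\<forall>x\<in>cube n (ch u) r. \<kappa> (x(i := H x)) = x i" by blast
 have up: "msm (euclid n) (euclid n) (%x. x(i := G x)) x" if "smooth_fun n G" "x \<in> Rn n" for G x
 proof (rule msm_euclidI)
  show "fsm (euclid n) (%y. (y(i := G y)) j) x" for j
   using that by (cases "j = i") (auto intro: fsm_smooth smooth_coord)
  show "near (euclid n) x (%y. y(i := G y) \<in> Rn n)" using nb_pts by eventually_elim (use i in simp)
 qed (use that in auto)
 have y0: "(ch u)(i := H (ch u)) \<in> Rn n" using C(5) i by simp
 have "is_chart (euclid n) (ch u) n (%x. x(i := H x)) (%y. y(i := \<kappa> y))" unfolding is_chart_def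
 proof (intro conjI up H \<kappa> C(5) y0)
  show "near (euclid n) (ch u) (%x. (x(i := H x))(i := \<kappa> (x(i := H x))) = x)"
   unfolding eventually_euclid[OF C(5)] using \<kappa> by (intro exI[of _ r]) auto
  show "near (euclid n) ((ch u)(i := H (ch u))) (%y. (y(i := \<kappa> y))(i := H (y(i := \<kappa> y))) = y)"
   unfolding eventually_euclid[OF y0] using \<kappa> by (intro exI[of _ r]) auto
 qed
 from chart_compose[OF c this] have "is_chart X u n (%w. (ch w)(i := H (ch w))) (%x. Th (x(i := \<kappa> x)))" .
 moreover have "near X u (%w. (ch w)(i := H (ch w)) = (ch w)(i := h w))"
  using C(6) msm_lim[OF C(1) H(2)] by eventually_elim simp
 ultimately show ?thesis by blast
qed

lemma swap_chart:
 assumes c: "is_chart X u n ch Th" and ij: "i < n" "j < n"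
 shows "\<exists>Th'. is_chart X u n (%w l. if l = i then ch w j else if l = j then ch w i else ch w l) Th'"
proof -
 let ?s = "%x l. if l = i then x j else if l = j then x i else x l :: real"
 have s: "msm (euclid n) (euclid n) ?s x" if "x \<in> Rn n" for x
 proof (rule msm_euclidI)
  show "fsm (euclid n) (%y. ?s y l) x" for l by (intro fsm_if fsm_smooth smooth_coord that)
  show "near (euclid n) x (%y. ?s y \<in> Rn n)" using nb_pts by eventually_elim (use ij in "auto simp: Rn_def")
 qed (use that in auto)
 note C = is_chartD[OF c]
 have sR: "?s (ch u) \<in> Rn n" using C(5) ij by (auto simp: Rn_def)
 have "is_chart (euclid n) (ch u) n ?s ?s" unfolding is_chart_def
  by (intro conjI s C(5) sR always_eventually) (auto simp: fun_eq_iff)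
 from chart_compose[OF c this] show ?thesis by blast
qed

text \<open>The coordinate vector \<partial>/\<partial>x_i at the point with coordinates
  \<open>x\<close>.\<close>

definition chart_tvec where
 "chart_tvec X Th x i = (%a. if a \<in> cinf X then pd i (%y. a (Th y)) x else 0)"

lemma fsm_euclid_DERIV:
 assumes h: "fsm (euclid n) h x" and i: "i < n"
 shows "((%t. h (x(i := t))) has_real_derivative pd i h x) (at (x i))"
  "\<And>H. smooth_fun n H ==> near (euclid n) x (%y. h y = H y) ==> pd i h x = pd i H x"
proof -
 have x: "x \<in> Rn n" using fsm_pts[OF h] by simp
 have *: "((%t. h (x(i := t))) has_real_derivative pd i H x) (at (x i))"
  if H: "smooth_fun n H" "near (euclid n) x (%y. h y = H y)" for H
 proof -
  from H(2)[unfolded eventually_euclid[OF x]] obtain r where r: "r > 0" "\<forall>y\<in>cube n x r. h y = H y" by blast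
  have "((%t. H (x(i := t))) has_real_derivative pd i H x) (at (x i))" using smooth_DERIV[OF H(1) i x, of "x i"] by (simp only: fun_upd_triv)
  thus ?thesis
   by (rule has_field_derivative_transform_within_open[of _ _ _ "{x i - r<..<x i + r}"])
    (use r x i in "auto simp: cube_def")
 qed
 obtain H where H: "smooth_fun n H" "near (euclid n) x (%y. h y = H y)" using h fsm_euclid by blast
 show 2: "pd i h x = pd i H x" if "smooth_fun n H" "near (euclid n) x (%y. h y = H y)" for H
  by (rule pd_eqI[OF *[OF that]])
 show "((%t. h (x(i := t))) has_real_derivative pd i h x) (at (x i))" using *[OF H] 2[OF H] by simp
qed

lemma fsm_pd: "fsm (euclid n) h x ==> i < n ==> fsm (euclid n) (pd i h) x"
proof -
 assume h: "fsm (euclid n) h x" and i: "i < n"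
 then obtain H where H: "smooth_fun n H" "near (euclid n) x (%y. h y = H y)" using fsm_euclid by blast
 have "near (euclid n) x (%y. pd i h y = pd i H y)"
  using nb_ev[OF H(2)] fsm_ev[OF h] by eventually_elim (use fsm_euclid_DERIV(2)[OF _ i _ ] H(1) in blast)
 thus ?thesis using fsm_cong[OF fsm_smooth[OF smooth_pd[OF H(1) i]]] fsm_pts[OF h] by simp
qed

lemma pd_algebra:
 assumes "fsm (euclid n) f x" "fsm (euclid n) g x" "i < n"
 shows "pd i (%y. f y + g y) x = pd i f x + pd i g x" "pd i (%y. c * f y) x = c * pd i f x"
  "pd i (%y. f y * g y) x = pd i f x * g x + f x * pd i g x"
proof -
 note f = fsm_euclid_DERIV(1)[OF assms(1,3)] and g = fsm_euclid_DERIV(1)[OF assms(2,3)]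
 show "pd i (%y. f y + g y) x = pd i f x + pd i g x" by (rule pd_eqI[OF DERIV_add[OF f g]])
 show "pd i (%y. c * f y) x = c * pd i f x" by (rule pd_eqI[OF DERIV_cmult[OF f]])
 show "pd i (%y. f y * g y) x = pd i f x * g x + f x * pd i g x"
  using pd_eqI[OF DERIV_mult'[OF f g]] by (simp only: fun_upd_triv add.commute)
qed

lemma chart_tvec:
 assumes c: "is_chart X u n ch Th" and i: "i < n" and ds: "dspace X"
 shows "chart_tvec X Th (ch u) i \<in> tvec X u"
proof -
 note C = is_chartD[OF c]
 have f: "fsm (euclid n) (%y. a (Th y)) (ch u)" if "a \<in> cinf X" for a by (rule msm_cinf[OF C(2) that])
 show ?thesis
  unfolding tvec_def
 proof (intro CollectI conjI allI ballI impI)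
  fix a b c assume a: "a \<in> cinf X" and b: "b \<in> cinf X"
  note pd_algebra[OF f[OF a] f[OF b] i]
  thus "chart_tvec X Th (ch u) i (%y. a y + b y) = chart_tvec X Th (ch u) i a + chart_tvec X Th (ch u) i b"
   "chart_tvec X Th (ch u) i (%y. c * a y) = c * chart_tvec X Th (ch u) i a"
   "chart_tvec X Th (ch u) i (%y. a y * b y) = chart_tvec X Th (ch u) i a * b u + a u * chart_tvec X Th (ch u) i b"
   using a b C(3) cinf_add[OF ds a b] cinf_mult[OF ds a b] cinf_scale[OF ds a] by (simp_all add: chart_tvec_def)
 qed (simp add: chart_tvec_def)
qed

text \<open>Derivations cannot be applied to the coordinates of a chart, which are smooth only near
  u; global functions with the same germs stand in for them.\<close>

lemma chart_coords:
 assumes "is_chart X u n ch Th" "dspace X"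
 shows "\<exists>c. (\<forall>j. c j \<in> cinf X) \<and> (near X u (%w. trunc n (%j. c j w) = ch w))"
proof -
 note C = is_chartD[OF assms(1)]
 have "\<forall>j. \<exists>c. c \<in> cinf X \<and> (near X u (%w. c w = ch w j))"
  using fsm_extend[OF assms(2) msm_euclidD[OF C(1)]] by blast
 from choice[OF this] obtain c where c: "\<And>j. c j \<in> cinf X" "\<And>j. near X u (%w. c j w = ch w j)" by blast
 have "near X u (%w. \<forall>j\<in>{..<n}. c j w = ch w j)" using c(2) by (intro eventually_ball_finite) auto
 with msm_pts_ev[OF C(1)] have "near X u (%w. trunc n (%j. c j w) = ch w)"
  by eventually_elim (rule Rn_eqI[of _ n], auto)
 thus ?thesis using c(1) by blast
qed

text \<open>The derivative of a submersion being onto, a coordinate not yet used can be exchanged for the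
 next component of the submersion.\<close>

lemma adapted_chart:
 assumes X: "manifold X" and f: "submersion X N f" and u: "u \<in> pts X" and c: "is_chart N (f u) k \<psi> T" and ds: "dspace N"
 shows "\<exists>n ch Th. is_chart X u n ch Th \<and> k \<le> n \<and> (near X u (%w. \<forall>j<k. ch w j = \<psi> (f w) j))"
proof -
 have dX: "dspace X" by (rule manifold_dspace[OF X])
 note C = is_chartD[OF c]
 have fs: "msm X N f u" using f u smooth_map_iff[OF dX] by (auto simp: submersion_def)
 have \<psi>f: "fsm X (%w. \<psi> (f w) j) u" for j using msm_euclidD[OF msm_comp[OF fs C(1)]] .
 obtain n ch0 Th0 where n: "is_chart X u n ch0 Th0" using manifold_chart[OF X u] by blast
 have "m \<le> k ==> m \<le> n \<and> (\<exists>ch Th. is_chart X u n ch Th \<and> (near X u (%w. \<forall>j<m. ch w j = \<psi> (f w) j)))" for m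
 proof (induction m)
  case 0
  thus ?case using n by auto
 next
  case (Suc m)
  then obtain ch Th where mn: "m \<le> n" and ch: "is_chart X u n ch Th" and e: "near X u (%w. \<forall>j<m. ch w j = \<psi> (f w) j)" by auto
  have mk: "m < k" using Suc.prems by simp
  note D = is_chartD[OF ch]
  have "chart_tvec N T (\<psi> (f u)) m \<in> dmap X N f ` tvec X u"
   using chart_tvec[OF c mk ds] f u by (auto simp: submersion_def)
  \<comment> \<open>\<open>E\<close> lifts the coordinate vector of the next coordinate m. It
    annihilates the first m pulled back coordinates and takes the value 1 on the pulled back
    coordinate m.\<close>
  then obtain E where E: "E \<in> tvec X u" "chart_tvec N T (\<psi> (f u)) m = dmap X N f E" by blast
  have ext: "\<exists>g. g \<in> cinf N \<and> (near N (f u) (%y. g y = \<psi> y j))" for j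
   using fsm_extend[OF ds msm_euclidD[OF C(1)], of j] by blast
  then obtain g where g: "\<And>j. g j \<in> cinf N" "\<And>j. near N (f u) (%y. g j y = \<psi> y j)" by metis
  have gf: "pull (pts X) f (g j) \<in> cinf X" for j using f g(1) by (auto simp: submersion_def smooth_map_def)
  have gfe: "near X u (%w. pull (pts X) f (g j) w = \<psi> (f w) j)" for j
   using nb_pts msm_lim[OF fs g(2)] by eventually_elim (simp add: pull_def)
  have Eg: "E (pull (pts X) f (g j)) = (if j = m then 1 else 0)" if j: "j < k" for j
  proof -
   have "near (euclid k) (\<psi> (f u)) (%y. g j (T y) = y j)"
   proof -
    have "near N (T (\<psi> (f u))) (%y. g j y = \<psi> y j)" using g(2) C(3) by simp
    from C(7) msm_lim[where f = T, OF C(2) this] show ?thesis by eventually_elim simp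
   qed
   from fsm_euclid_DERIV(2)[OF msm_cinf[OF C(2) g(1)] mk smooth_coord this]
   have "pd m (%y. g j (T y)) (\<psi> (f u)) = pd m (%y. y j) (\<psi> (f u))" .
   also have "\<dots> = (if j = m then 1 else 0)" by (rule pd_eqI) (auto intro!: derivative_eq_intros)
   finally show ?thesis using E(2)[THEN fun_cong, of "g j"] g(1) by (simp add: chart_tvec_def dmap_def)
  qed
  obtain c where c: "\<And>j. c j \<in> cinf X" and ct: "near X u (%w. trunc n (%j. c j w) = ch w)"
   using chart_coords[OF ch dX] by blast
  define h where "h = pull (pts X) f (g m)"
  have h: "h \<in> cinf X" using gf by (simp add: h_def)
  obtain H where H: "smooth_fun n H" "near (euclid n) (ch u) (%x. h (Th x) = H x)"
   using msm_cinf[OF D(2) h] unfolding fsm_euclid by blast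
  have "near X u (%w. h w = H (trunc n (%j. c j w)))"
   using ct D(6) msm_lim[OF D(1) H(2)] by eventually_elim simp
  from tvec_chain[OF E(1) dX u c H(1) h this]
  have "1 = (\<Sum>j<n. pd j H (ch u) * E (c j))" using Eg[OF mk] nb_self[OF ct u] by (simp add: h_def)
  then obtain i where i: "i < n" "pd i H (ch u) * E (c i) \<noteq> 0"
   by (metis (no_types, lifting) lessThan_iff sum.neutral zero_neq_one)
  \<comment> \<open>The coordinates below m already come from the target and are annihilated by
    \<open>E\<close>; the coordinate to be exchanged, on which \<open>E\<close> does not vanish, is
    therefore one not yet used.\<close>
  have im: "m \<le> i"
  proof (rule ccontr)
   assume "\<not> m \<le> i"
   have "near X u (%w. c i w = pull (pts X) f (g i) w)"
    using ct e gfe[of i]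
   proof eventually_elim
    case (elim w)
    thus ?case using trunc_apply[OF i(1), of "%j. c j w"] \<open>\<not> m \<le> i\<close> by (simp del: trunc_apply)
   qed
   from tvec_local[OF E(1) dX u c gf this] have "E (c i) = 0" using Eg[of i] \<open>\<not> m \<le> i\<close> mk by simp
   thus False using i by simp
  qed
  obtain ch' Th' where ch': "is_chart X u n ch' Th'" "near X u (%w. ch' w = (ch w)(i := h w))"
   using exchange_chart[OF ch cinf_fsm[OF h u] i(1) H] i(2) by auto
  obtain Th'' where "is_chart X u n (%w l. if l = i then ch' w m else if l = m then ch' w i else ch' w l) Th''"
   using swap_chart[OF ch'(1) i(1), of m] im i(1) by auto
  moreover have "near X u (%w. \<forall>j<Suc m. (if j = i then ch' w m else if j = m then ch' w i else ch' w j) = \<psi> (f w) j)"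
   using ch'(2) e gfe[of m] by eventually_elim (use im in "auto simp: h_def less_Suc_eq")
  ultimately show ?case using im i(1) by (intro conjI exI) auto
 qed
 from this[of k] show ?thesis by blast
qed

section \<open>Differential equations on manifolds\<close>

lemma vfield_tvec: "X \<in> vfields M ==> (%a. X a y) \<in> tvec M y"
 unfolding vfields_def tvec_def by (simp add: fun_eq_iff)

lemma vfield_cinf: "X \<in> vfields M ==> X a \<in> cinf M"
 by (simp add: vfields_def)

text \<open>The coefficients are chosen once for a whole neighbourhood and for all test functions.
  As globally smooth functions of the coordinates they can enter a differential equation
  directly.\<close>

lemma vf_coord:
 assumes c: "is_chart M y0 n ch Th" and M: "dspace M" and X: "X \<in> vfields M"
 shows "\<exists>\<alpha>. (\<forall>j. smooth_fun n (\<alpha> j)) \<and> (near M y0 (%y. \<forall>a\<in>cinf M.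
  X a y = (\<Sum>j<n. pd j (%x. a (Th x)) (ch y) * \<alpha> j (ch y))))"
proof -
 note C = is_chartD[OF c]
 obtain k where k: "\<And>j. k j \<in> cinf M" and kt: "near M y0 (%w. trunc n (%j. k j w) = ch w)"
  using chart_coords[OF c M] by blast
 have "\<forall>j. \<exists>\<alpha>. smooth_fun n \<alpha> \<and> (near (euclid n) (ch y0) (%x. X (k j) (Th x) = \<alpha> x))"
  using msm_cinf[OF C(2) vfield_cinf[OF X]] unfolding fsm_euclid by blast
 from choice[OF this] obtain \<alpha> where \<alpha>: "\<And>j. smooth_fun n (\<alpha> j)"
  "\<And>j. near (euclid n) (ch y0) (%x. X (k j) (Th x) = \<alpha> j x)" by blast
 have "near M y0 (%y. \<forall>j\<in>{..<n}. X (k j) (Th (ch y)) = \<alpha> j (ch y))"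
  using msm_lim[OF C(1) \<alpha>(2)] by (intro eventually_ball_finite) auto
 with is_chart_ev[OF c] nb_ev[OF kt] have "near M y0 (%y. \<forall>a\<in>cinf M.
  X a y = (\<Sum>j<n. pd j (%x. a (Th x)) (ch y) * \<alpha> j (ch y)))"
 proof eventually_elim
  case (elim y)
  note D = is_chartD[OF elim(1)]
  show ?case
  proof
   fix a assume a: "a \<in> cinf M"
   obtain H where H: "smooth_fun n H" "near (euclid n) (ch y) (%x. a (Th x) = H x)"
    using msm_cinf[OF D(2) a] unfolding fsm_euclid by blast
   have "near M y (%w. a w = H (trunc n (%j. k j w)))"
    using elim(2) D(6) msm_lim[OF D(1) H(2)] by eventually_elim simp
   from tvec_chain[OF vfield_tvec[OF X] M D(4) k H(1) a this]
   have "X a y = (\<Sum>j<n. pd j H (ch y) * X (k j) y)" using nb_self[OF elim(2) D(4)] by simp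
   also have "\<dots> = (\<Sum>j<n. pd j (%x. a (Th x)) (ch y) * \<alpha> j (ch y))"
    using fsm_euclid_DERIV(2)[OF msm_cinf[OF D(2) a] _ H] elim(3) D(3) by (intro sum.cong) auto
   finally show "X a y = (\<Sum>j<n. pd j (%x. a (Th x)) (ch y) * \<alpha> j (ch y))" .
  qed
 qed
 thus ?thesis using \<alpha>(1) by blast
qed

lemma pd_coord: "is_chart M y n ch Th ==> i < n ==> (near M y (%w. k w = ch w j)) ==>
  pd i (%x. k (Th x)) (ch y) = (if i = j then 1 else 0)"
proof -
 assume c: "is_chart M y n ch Th" and i: "i < n" and e: "near M y (%w. k w = ch w j)"
 note C = is_chartD[OF c]
 have "near M (Th (ch y)) (%w. k w = ch w j)" using e C(3) by simp
 from C(7) msm_lim[where f = Th, OF C(2) this] have ev: "near (euclid n) (ch y) (%x. k (Th x) = x j)" by eventually_elim simp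
 have "fsm (euclid n) (%x. k (Th x)) (ch y)"
  by (rule fsm_cong[OF fsm_smooth[OF smooth_coord C(5)] ev])
 from fsm_euclid_DERIV(2)[OF this i smooth_coord ev] show ?thesis
  by (simp add: pd_def)
qed

text \<open>Velocities are kept as lists of coefficients and fields. This separates the dependence
  on time and parameters, which is in the coefficients, from membership in the foliation, which
  concerns the fields.\<close>

abbreviation vel :: "(('t => real) \<times> 'a vfield) list => ('a => real) => 't => 'a => real" where
 "vel L a t y \<equiv> (\<Sum>(g, X)\<leftarrow>L. g t * X a y)"

lemma abs_sum_list_le: "\<bar>\<Sum>x\<leftarrow>L. f x :: real\<bar> \<le> (\<Sum>x\<leftarrow>L. \<bar>f x\<bar>)"
 by (induction L) auto

lemma sum_list_le_const: "(\<And>x. x \<in> set L ==> f x \<le> (K::real)) ==> sum_list (map f L) \<le> real (length L) * K"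
 by (induction L) (auto simp: distrib_right intro: add_mono)

text \<open>The neighbourhood \<open>P\<close> depends only on the finite set of fields, and is
  fixed before coefficients, curves and time interval. One neighbourhood thus serves all members of
  a family.\<close>

lemma curve_unique:
 assumes c: "is_chart M y0 n ch Th" and M: "dspace M" and XX: "finite \<X>" "\<X> \<subseteq> vfields M"
 shows "\<exists>P. eventually P (nb M y0) \<and> (\<forall>L c d T B. snd ` set L \<subseteq> \<X> -->
  (\<forall>(g, X)\<in>set L. \<forall>\<tau>. abs \<tau> < T --> \<bar>g \<tau>\<bar> \<le> B) -->
  (\<forall>\<tau>. abs \<tau> < T --> P (c \<tau>) \<and> P (d \<tau>) \<and> (\<forall>a\<in>cinf M.
   ((%r. a (c r)) has_real_derivative vel L a \<tau> (c \<tau>)) (at \<tau>) \<and>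
   ((%r. a (d r)) has_real_derivative vel L a \<tau> (d \<tau>)) (at \<tau>))) -->
  c 0 = d 0 --> (\<forall>\<tau>. abs \<tau> < T --> c \<tau> = d \<tau>))"
proof -
 note C = is_chartD[OF c]
 obtain k where k: "\<And>j. k j \<in> cinf M" and kt: "near M y0 (%w. trunc n (%j. k j w) = ch w)"
  using chart_coords[OF c M] by blast
 have "\<forall>X. \<forall>j. \<exists>\<alpha>. X \<in> \<X> --> smooth_fun n \<alpha> \<and> (near (euclid n) (ch y0) (%x. X (k j) (Th x) = \<alpha> x))"
  using msm_cinf[OF C(2) vfield_cinf] XX(2) unfolding fsm_euclid by blast
 then obtain \<alpha> where \<alpha>: "\<And>X j. X \<in> \<X> ==> smooth_fun n (\<alpha> X j)"
  "\<And>X j. X \<in> \<X> ==> near (euclid n) (ch y0) (%x. X (k j) (Th x) = \<alpha> X j x)" unfolding choice_iff by blast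
 define R where "R = (\<Sum>i<n. \<bar>ch y0 i\<bar>) + 1"
 define P where "P y \<longleftrightarrow> y \<in> pts M \<and> Th (ch y) = y \<and> trunc n (%j. k j y) = ch y \<and> ch y \<in> ccube n R \<and>
   (\<forall>X\<in>\<X>. \<forall>j\<in>{..<n}. X (k j) (Th (ch y)) = \<alpha> X j (ch y))" for y
 have "near M y0 (%y. \<forall>i\<in>{..<n}. \<bar>ch y i - ch y0 i\<bar> < 1)"
  by (intro eventually_ball_finite ballI fsm_cont[of M "%y. ch y _"] msm_euclidD[OF C(1)]) auto
 with msm_pts_ev[OF C(1)] have "near M y0 (%y. ch y \<in> ccube n R)"
 proof eventually_elim
  case (elim y)
  have "\<bar>ch y i\<bar> \<le> R" if "i < n" for i
  proof -
   have "\<bar>ch y0 i\<bar> \<le> (\<Sum>i<n. \<bar>ch y0 i\<bar>)" by (rule member_le_sum) (use that in auto)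
   moreover have "\<bar>ch y i - ch y0 i\<bar> < 1" using elim(2) that by simp
   ultimately show ?thesis unfolding R_def by linarith
  qed
  thus ?case using elim(1) by (simp add: ccube_def)
 qed
 moreover have "near M y0 (%y. \<forall>X\<in>\<X>. \<forall>j\<in>{..<n}. X (k j) (Th (ch y)) = \<alpha> X j (ch y))"
  using msm_lim[OF C(1) \<alpha>(2)] XX(1) by (intro eventually_ball_finite ballI) auto
 ultimately have Pe: "eventually P (nb M y0)"
  using nb_pts C(6) kt unfolding P_def by eventually_elim blast
 have "\<forall>X. \<exists>K. X \<in> \<X> --> K \<ge> 0 \<and> (\<forall>i x y. i < n --> x \<in> ccube n R --> y \<in> ccube n R -->
  \<bar>\<alpha> X i x - \<alpha> X i y\<bar> \<le> K * (\<Sum>j<n. \<bar>x j - y j\<bar>))" using lipschitz_ccube[OF \<alpha>(1)] by meson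
 from choice[OF this] obtain K where K: "\<And>X. X \<in> \<X> ==> K X \<ge> 0"
  "\<And>X i x y. X \<in> \<X> ==> i < n ==> x \<in> ccube n R ==> y \<in> ccube n R ==>
  \<bar>\<alpha> X i x - \<alpha> X i y\<bar> \<le> K X * (\<Sum>j<n. \<bar>x j - y j\<bar>)" by blast
 define KK where "KK = sum K \<X>"
 have KK: "K X \<le> KK" "KK \<ge> 0" if "X \<in> \<X>" for X
  unfolding KK_def using that K(1) XX(1) by (auto intro: member_le_sum sum_nonneg)
 show ?thesis
 proof (intro exI[of _ P] conjI Pe allI impI)
  fix L c d T B \<tau>
  assume L: "snd ` set L \<subseteq> \<X>" and B: "\<forall>(g, X)\<in>set L. \<forall>\<tau>. abs \<tau> < T --> \<bar>g \<tau>\<bar> \<le> B"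
   and cd: "\<forall>\<tau>. abs \<tau> < T --> P (c \<tau>) \<and> P (d \<tau>) \<and> (\<forall>a\<in>cinf M.
   ((%r. a (c r)) has_real_derivative vel L a \<tau> (c \<tau>)) (at \<tau>) \<and>
   ((%r. a (d r)) has_real_derivative vel L a \<tau> (d \<tau>)) (at \<tau>))" and 0: "c 0 = d 0" and \<tau>: "abs \<tau> < T"
  define f where "f j t x = (\<Sum>(g, X)\<leftarrow>L. g t * \<alpha> X j x)" for j t x
  have D: "((%s. ch (e s) j) has_real_derivative f j t (ch (e t))) (at t)"
   if e: "\<And>\<tau>. abs \<tau> < T ==> P (e \<tau>) \<and> (\<forall>a\<in>cinf M. ((%r. a (e r)) has_real_derivative vel L a \<tau> (e \<tau>)) (at \<tau>))"
    and t: "abs t \<le> abs \<tau>" and j: "j < n" for e t j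
  proof -
   have tT: "abs t < T" using t \<tau> by simp
   have "vel L (k j) t (e t) = f j t (ch (e t))"
    unfolding f_def using e[OF tT] L j by (intro arg_cong[of _ _ sum_list] map_cong) (auto simp: P_def)
   hence "((%s. k j (e s)) has_real_derivative f j t (ch (e t))) (at t)" using e[OF tT] k by metis
   thus ?thesis
   proof (rule has_field_derivative_transform_within_open[of _ _ _ "{-T<..<T}"])
    show "k j (e s) = ch (e s) j" if "s \<in> {-T<..<T}" for s
    proof -
     have "trunc n (%j. k j (e s)) = ch (e s)" using e[of s] that by (auto simp: P_def)
     from fun_cong[OF this, of j] show ?thesis using j by simp
    qed
   qed (use tT in auto)
  qed
  have "sqd n (ch (c \<tau>)) (ch (d \<tau>)) \<le> sqd n (ch (c 0)) (ch (d 0)) * exp (2 * (length L * (abs B * KK)) * n * abs \<tau>)"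
  proof (rule ode_gronwall[of "abs \<tau>" n "%t. ch (c t)" f "%t. ch (d t)" "ccube n R"])
   show "ch (c t) \<in> ccube n R \<and> ch (d t) \<in> ccube n R" if "abs t \<le> abs \<tau>" for t
    using cd that \<tau> by (auto simp: P_def)
   fix i t x y assume a: "abs t \<le> abs \<tau>" "i < n" "x \<in> ccube n R" "y \<in> ccube n R"
   have "f i t x - f i t y = (\<Sum>(g, X)\<leftarrow>L. g t * (\<alpha> X i x - \<alpha> X i y))"
    unfolding f_def by (induction L) (auto simp: algebra_simps)
   hence "\<bar>f i t x - f i t y\<bar> = \<bar>\<Sum>(g, X)\<leftarrow>L. g t * (\<alpha> X i x - \<alpha> X i y)\<bar>" by simp
   also have "\<dots> \<le> (\<Sum>p\<leftarrow>L. \<bar>fst p t * (\<alpha> (snd p) i x - \<alpha> (snd p) i y)\<bar>)"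
    unfolding case_prod_beta by (rule abs_sum_list_le)
   also have "\<dots> \<le> length L * (abs B * (KK * (\<Sum>j<n. \<bar>x j - y j\<bar>)))"
   proof (rule sum_list_le_const[where f = "%p. \<bar>fst p t * (\<alpha> (snd p) i x - \<alpha> (snd p) i y)\<bar>"])
    fix p assume p: "p \<in> set L"
    hence X: "snd p \<in> \<X>" using L by auto
    have "abs t < T" using a(1) \<tau> by simp
    hence "\<bar>fst p t\<bar> \<le> B" using bspec[OF B p] by (simp add: case_prod_beta)
    hence "\<bar>fst p t\<bar> \<le> abs B" by simp
    moreover have "\<bar>\<alpha> (snd p) i x - \<alpha> (snd p) i y\<bar> \<le> KK * (\<Sum>j<n. \<bar>x j - y j\<bar>)"
     using K(2)[OF X a(2-4)] mult_right_mono[OF KK(1)[OF X], of "\<Sum>j<n. \<bar>x j - y j\<bar>"] by (force intro: sum_nonneg)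
    ultimately show "\<bar>fst p t * (\<alpha> (snd p) i x - \<alpha> (snd p) i y)\<bar> \<le> abs B * (KK * (\<Sum>j<n. \<bar>x j - y j\<bar>))"
     unfolding abs_mult by (intro mult_mono) auto
   qed
   finally show "\<bar>f i t x - f i t y\<bar> \<le> length L * (abs B * KK) * (\<Sum>j<n. \<bar>x j - y j\<bar>)" by (simp add: mult_ac)
  next
   show "0 \<le> length L * (abs B * KK)" using K(1) by (auto simp: KK_def intro!: mult_nonneg_nonneg sum_nonneg)
  qed (use D cd in auto)
  hence "ch (c \<tau>) = ch (d \<tau>)" using 0 cd \<tau> by (intro sqd_0[of _ n]) (auto simp: sqd_def P_def ccube_def)
  thus "c \<tau> = d \<tau>" using cd \<tau> unfolding P_def by metis
 qed
qed

lemma chain_tder: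
 assumes x: "msm (RX Q) (euclid n) x w" and h: "fsm (euclid n) h (x w)"
 shows "tder (%w. h (x w)) w = (\<Sum>j<n. pd j h (x w) * tder (%w. x w j) w)"
proof -
 obtain \<tau> th where w: "w = (\<tau>, th)" by fastforce
 have th: "th \<in> pts Q" using msm_src[OF x] w by simp
 obtain H where H: "smooth_fun n H" "near (euclid n) (x w) (%y. h y = H y)" using h unfolding fsm_euclid by blast
 have "near (RX Q) (\<tau>, th) (%y. h (x y) = H (x y) \<and> x y \<in> Rn n)"
  using msm_lim[OF x H(2)] msm_pts_ev[OF x] unfolding w by eventually_elim simp
 then obtain e where e: "e > 0" "\<And>r. \<bar>r - \<tau>\<bar> < e ==> h (x (r, th)) = H (x (r, th)) \<and> x (r, th) \<in> Rn n"
  using RX_slice[OF _ th] by blast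
 have xd: "((%r. x (r, th) j) has_real_derivative tder (%w. x w j) w) (at \<tau>)" for j
  using nb_self[OF RX_deriv(2)[OF msm_euclidD[OF x[unfolded w]]]] th by (simp add: w)
 \<comment> \<open>\<open>smooth_chain\<close> asks for values in n-space at all times, so the curve
   is frozen outside the interval where this is known.\<close>
 define c where "c r = (if \<bar>r - \<tau>\<bar> < e then x (r, th) else x (\<tau>, th))" for r
 have c\<tau>: "c \<tau> = x w" using e(1) by (simp add: c_def w)
 have "((%r. H (c r)) has_real_derivative (\<Sum>j<n. pd j H (c \<tau>) * tder (%w. x w j) w)) (at \<tau>)"
 proof (rule smooth_chain[OF H(1)])
  show "c s \<in> Rn n" for s using e by (auto simp: c_def)
  show "((%r. c r j) has_real_derivative tder (%w. x w j) w) (at \<tau>)" for j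
   by (rule has_field_derivative_transform_within_open[OF xd, of "{\<tau>-e<..<\<tau>+e}"]) (use e(1) in "auto simp: c_def")
 qed
 hence "((%r. h (x (r, th))) has_real_derivative (\<Sum>j<n. pd j H (c \<tau>) * tder (%w. x w j) w)) (at \<tau>)"
  by (rule has_field_derivative_transform_within_open[of _ _ _ "{\<tau>-e<..<\<tau>+e}"]) (use e in "auto simp: c_def")
 from DERIV_imp_deriv[OF this] show ?thesis
  using fsm_euclid_DERIV(2)[OF h _ H] c\<tau> by (simp add: tder_def w)
qed

text \<open>\<open>Q\<close> need not have charts. Locally the coefficients are smooth functions of
  finitely many generators \<open>b\<close> of \<open>RX Q\<close>; these become extra state
  variables with derivative 1 (time) or 0. The system is then autonomous on K + n variables, and
  dependence on the parameter becomes dependence on initial values.\<close>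

lemma manifold_ode:
 assumes N: "manifold N" and z0: "msm Q N z0 th0"
  and L: "\<And>g X. (g, X) \<in> set L ==> fsm (RX Q) g (0, th0) \<and> X \<in> vfields N"
 shows "\<exists>z. msm (RX Q) N z (0, th0) \<and> (near Q th0 (%th. z (0, th) = z0 th)) \<and>
  (near (RX Q) (0, th0) (%w. \<forall>a\<in>cinf N. tder (%w. a (z w)) w = vel L a w (z w)))"
proof -
 have dN: "dspace N" by (rule manifold_dspace[OF N])
 have th0: "th0 \<in> pts Q" by (rule msm_src[OF z0])
 obtain n ch Th where c: "is_chart N (z0 th0) n ch Th" using manifold_chart[OF N msm_tgt[OF z0]] by blast
 note C = is_chartD[OF c]
 let ?A = "insert fst {b \<circ> snd | b. b \<in> cinf Q}"
 define m where "m = length L"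
 have Lm: "L ! i \<in> set L" if "i < m" for i using that by (simp add: m_def)
 have "\<exists>K b G. b ` {..<K} \<subseteq> ?A \<and> (\<forall>i<m. smooth_fun K (G i) \<and>
   eventually (%y. fst (L ! i) y = G i (trunc K (%j. b j y))) (nb (RX Q) (0, th0)))"
 proof (rule loc_smooth_family)
  fix i assume "i < m"
  hence "fsm (RX Q) (fst (L ! i)) (0, th0)" using L[of "fst (L ! i)" "snd (L ! i)"] Lm by simp
  thus "loc_smooth ?A (nb (RX Q) (0, th0)) (fst (L ! i))" unfolding RX_def fsm_gen dtop_gen by simp
 qed
 then obtain K b G where bA: "b ` {..<K} \<subseteq> ?A" and G: "\<forall>i<m. smooth_fun K (G i) \<and>
   eventually (%y. fst (L ! i) y = G i (trunc K (%j. b j y))) (nb (RX Q) (0, th0))" by (elim exE conjE) (rule that)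
 have "\<forall>i. \<exists>\<alpha>. i < m --> (\<forall>j. smooth_fun n (\<alpha> j)) \<and> (near N (z0 th0) (%y. \<forall>a\<in>cinf N.
  snd (L ! i) a y = (\<Sum>j<n. pd j (%x. a (Th x)) (ch y) * \<alpha> j (ch y))))"
 proof
  fix i
  show "\<exists>\<alpha>. i < m --> (\<forall>j. smooth_fun n (\<alpha> j)) \<and> (near N (z0 th0) (%y. \<forall>a\<in>cinf N.
   snd (L ! i) a y = (\<Sum>j<n. pd j (%x. a (Th x)) (ch y) * \<alpha> j (ch y))))"
  proof (cases "i < m")
   case True
   hence "snd (L ! i) \<in> vfields N" using L[of "fst (L ! i)" "snd (L ! i)"] Lm by simp
   from vf_coord[OF c dN this] show ?thesis by blast
  qed simp
 qed
 from choice[OF this] obtain \<alpha> where \<alpha>: "\<And>i j. i < m ==> smooth_fun n (\<alpha> i j)"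
  "\<And>i. i < m ==> near N (z0 th0) (%y. \<forall>a\<in>cinf N. snd (L ! i) a y = (\<Sum>j<n. pd j (%x. a (Th x)) (ch y) * \<alpha> i j (ch y)))"
  by blast
 \<comment> \<open>The first K components drive the generators, the remaining n the coordinates of
   the point.\<close>
 define F where "F l s = (if l < K then (if b l = fst then 1 else 0)
   else (\<Sum>i<m. G i (trunc K s) * \<alpha> i (l - K) (trunc n (%j. s (K + j)))))" for l and s :: "nat => real"
 have F: "smooth_fun (K + n) (F l)" for l
  unfolding F_def[abs_def]
 proof (intro smooth_if smooth_sum smooth_mult smooth_const)
  fix i assume "i \<in> {..<m}"
  hence i: "i < m" by simp
  show "smooth_fun (K + n) (%s. G i (trunc K s))" by (rule smooth_compose) (use G i in "auto intro: smooth_coord")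
  show "smooth_fun (K + n) (%s. \<alpha> i (l - K) (trunc n (%j. s (K + j))))"
   by (rule smooth_compose[OF \<alpha>(1)[OF i]]) (rule smooth_coord)
 qed
 \<comment> \<open>The initial state for the parameter \<open>th\<close>: the generators at time 0,
   followed by the coordinates of the initial point.\<close>
 define S where "S th = cat K (trunc K (%l. b l (0, th))) (trunc n (ch (z0 th)))" for th
 have SR: "S th \<in> Rn (K + n)" for th unfolding S_def by simp
 obtain \<Phi> r where P: "\<And>i. i < K + n ==> smooth_fun (Suc (K + n)) (%z. \<Phi> (z 0) (%i. z (Suc i)) i)"
  "\<And>x. x \<in> Rn (K + n) ==> \<Phi> 0 x = x" "r > 0"
  "\<And>x t i. x \<in> cube (K + n) (S th0) r ==> abs t < r ==> i < K + n ==> ((%s. \<Phi> s x i) has_real_derivative F i (\<Phi> t x)) (at t)"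
  using ode_local[of "K + n" F, OF F SR[of th0]] by blast
 have bf: "fsm (RX Q) (b l) w" if "l < K" "w \<in> UNIV \<times> pts Q" for l w
  unfolding RX_def by (rule fsm_base) (use bA that in auto)
 have b0f: "fsm Q (%th. b l (0, th)) th" if "l < K" "th \<in> pts Q" for l th
 proof (cases "b l = fst")
  case False
  then obtain a where "a \<in> cinf Q" "b l = a \<circ> snd" using bA \<open>l < K\<close> by (auto simp: image_subset_iff)
  thus ?thesis using that by (simp add: cinf_fsm)
 qed (use that in "simp add: fsm_const")
 have chz: "msm Q (euclid n) (%th. ch (z0 th)) th0" by (rule msm_comp[OF z0 C(1)])
 have Sf: "fsm Q (%th. S th l) th0" if "l < K + n" for l
 proof (cases "l < K")
  case True
  thus ?thesis using b0f[OF True th0] by (simp add: S_def)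
 next
  case False
  hence "(%th. S th l) = (%th. ch (z0 th) (l - K))" using that by (auto simp: S_def cat_def)
  thus ?thesis using msm_euclidD[OF chz] by simp
 qed
 define x where "x w = trunc n (%j. \<Phi> (fst w) (S (snd w)) (K + j))" for w
 have w0: "(0, th0) \<in> UNIV \<times> pts Q" using th0 by simp
 have xm: "msm (RX Q) (euclid n) x (0, th0)"
 proof (rule msm_euclidI)
  fix j assume j: "j < n"
  have "fsm (RX Q) (%w. (%z. \<Phi> (z 0) (%i. z (Suc i)) (K + j)) (trunc (Suc (K + n)) (%i. case i of 0 => fst w | Suc l => S (snd w) l))) (0, th0)"
  proof (rule fsm_comp[OF _ P(1)])
   fix i assume i: "i < Suc (K + n)"
   show "fsm (RX Q) (%w. case i of 0 => fst w | Suc l => S (snd w) l) (0, th0)"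
   proof (cases i)
    case (Suc l)
    thus ?thesis using msm_fsm[OF _ msm_RX_snd[OF w0], of "%th. S th l"] Sf i by simp
   qed (use fsm_RX_fst[OF w0] in simp)
  qed (use j w0 in auto)
  moreover have "(%i. trunc (Suc (K + n)) (%i. case i of 0 => fst w | Suc l => S (snd w) l) (Suc i)) = S (snd w)" for w
   using SR[of "snd w"] by (auto simp: trunc_def Rn_def)
  ultimately show "fsm (RX Q) (%w. x w j) (0, th0)" using j by (simp add: x_def)
 qed (use w0 in "auto simp: x_def")
 have x0: "x (0, th) = trunc n (ch (z0 th))" for th
  unfolding x_def using P(2)[OF SR] by (auto simp: S_def intro: trunc_cong)
 have x00: "x (0, th0) = ch (z0 th0)" using x0 C(5) by simp
 have zm: "msm (RX Q) N (%w. Th (x w)) (0, th0)" by (rule msm_comp[OF xm]) (use C(2) x00 in simp)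
 have "near Q th0 (%th. \<forall>l\<in>{..<K + n}. \<bar>S th l - S th0 l\<bar> < r)"
  using Sf P(3) by (intro eventually_ball_finite ballI fsm_cont[of Q "%th. S th _"]) auto
 with nb_pts have "near Q th0 (%th. \<forall>\<tau>. \<bar>\<tau> - 0\<bar> < r --> th \<in> pts Q \<and> S th \<in> cube (K + n) (S th0) r \<and> abs \<tau> < r)"
  by eventually_elim (use SR in "auto simp: cube_def")
 hence ev1: "near (RX Q) (0, th0) (%w. snd w \<in> pts Q \<and> S (snd w) \<in> cube (K + n) (S th0) r \<and> \<bar>fst w\<bar> < r)"
  unfolding eventually_RX[OF th0] using P(3) by (intro exI[of _ r]) auto
 have ev2: "near (RX Q) (0, th0) (%w. \<forall>i\<in>{..<m}. fst (L ! i) w = G i (trunc K (%j. b j w)))"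
  using G by (intro eventually_ball_finite) auto
 have "near N (z0 th0) (%y. \<forall>i\<in>{..<m}. \<forall>a\<in>cinf N. snd (L ! i) a y = (\<Sum>j<n. pd j (%x. a (Th x)) (ch y) * \<alpha> i j (ch y)))"
  using \<alpha>(2) by (intro eventually_ball_finite) auto
 hence "near N (Th (x (0, th0))) (%y. \<forall>i\<in>{..<m}. \<forall>a\<in>cinf N. snd (L ! i) a y = (\<Sum>j<n. pd j (%x. a (Th x)) (ch y) * \<alpha> i j (ch y)))"
  using x00 C(3) by simp
 from msm_lim[where f = "%w. Th (x w)", OF zm this]
 have ev3: "near (RX Q) (0, th0) (%w. \<forall>i\<in>{..<m}. \<forall>a\<in>cinf N.
   snd (L ! i) a (Th (x w)) = (\<Sum>j<n. pd j (%x. a (Th x)) (ch (Th (x w))) * \<alpha> i j (ch (Th (x w)))))" .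
 have ev4: "near (RX Q) (0, th0) (%w. ch (Th (x w)) = x w)" using msm_lim[OF xm] C(7) x00 by simp
 have ev5: "near (RX Q) (0, th0) (%w. msm (euclid n) N Th (x w))" using msm_lim[OF xm] msm_ev[OF C(2)] x00 by simp
 have ode: "tder (%w. x w j) w = (\<Sum>i<m. G i (trunc K (%l. b l w)) * \<alpha> i j (x w))"
  if w: "snd w \<in> pts Q" "S (snd w) \<in> cube (K + n) (S th0) r" "\<bar>fst w\<bar> < r" and j: "j < n" for w j
 proof -
  obtain \<tau> th where wt: "w = (\<tau>, th)" by fastforce
  \<comment> \<open>The extra variables and the generators have equal constant derivatives and equal
    initial values, so the auxiliary system reproduces the intended coefficients.\<close>
  have "\<Phi> \<tau> (S th) l = b l (\<tau>, th)" if l: "l < K" for l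
  proof -
   have bd: "((%r. b l (r, th)) has_real_derivative (if b l = fst then 1 else 0)) (at s)" for s
   proof (cases "b l = fst")
    case False
    then obtain a where "b l = a \<circ> snd" using bA l by (auto simp: image_subset_iff)
    thus ?thesis using False by simp
   qed simp
   have "\<Phi> \<tau> (S th) l - b l (\<tau>, th) = \<Phi> 0 (S th) l - b l (0, th)"
   proof (rule zero_derivative_const[of r])
    show "((%s. \<Phi> s (S th) l - b l (s, th)) has_real_derivative 0) (at s)" if "abs s < r" for s
     using DERIV_diff[OF P(4)[OF _ that, of "S th" l] bd] w l wt by (simp add: F_def)
   qed (use w wt in auto)
   thus ?thesis using P(2)[OF SR] l by (simp add: S_def)
  qed
  hence e: "trunc K (\<Phi> \<tau> (S th)) = trunc K (%l. b l w)" by (intro trunc_cong) (simp add: wt)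
  have "((%s. \<Phi> s (S th) (K + j)) has_real_derivative F (K + j) (\<Phi> \<tau> (S th))) (at \<tau>)"
   by (rule P(4)) (use w wt j in auto)
  moreover have "F (K + j) (\<Phi> \<tau> (S th)) = (\<Sum>i<m. G i (trunc K (%l. b l w)) * \<alpha> i j (x w))"
   by (simp add: F_def e x_def wt)
  ultimately show ?thesis using DERIV_imp_deriv j by (simp add: tder_def wt x_def)
 qed
 show ?thesis
 proof (intro exI[of _ "%w. Th (x w)"] conjI zm)
  show "near Q th0 (%th. Th (x (0, th)) = z0 th)"
   using msm_lim[OF z0 C(6)] msm_pts_ev[OF chz] by eventually_elim (simp add: x0)
  show "near (RX Q) (0, th0) (%w. \<forall>a\<in>cinf N. tder (%w. a (Th (x w))) w = vel L a w (Th (x w)))"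
   using ev1 ev2 ev3 ev4 ev5 msm_ev[OF xm]
  proof eventually_elim
   case (elim w)
   show ?case
   proof
    fix a assume a: "a \<in> cinf N"
    have "tder (%w. a (Th (x w))) w = (\<Sum>j<n. pd j (%x. a (Th x)) (x w) * tder (%w. x w j) w)"
     by (rule chain_tder[OF elim(6) msm_cinf[OF elim(5) a]])
    also have "\<dots> = (\<Sum>j<n. \<Sum>i<m. fst (L ! i) w * (pd j (%x. a (Th x)) (x w) * \<alpha> i j (x w)))"
     using ode elim(1,2) by (intro sum.cong refl) (simp add: sum_distrib_left mult_ac)
    also have "\<dots> = (\<Sum>i<m. fst (L ! i) w * snd (L ! i) a (Th (x w)))"
     using elim(3,4) a by (subst sum.swap) (simp add: sum_distrib_left)
    also have "\<dots> = vel L a w (Th (x w))"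
     by (simp add: sum_list_sum_nth m_def case_prod_beta atLeast0LessThan)
    finally show "tder (%w. a (Th (x w))) w = vel L a w (Th (x w))" .
   qed
  qed
 qed
qed

lemma msm_DERIV:
 assumes "msm (RX Q) N z (\<tau>, th)" "a \<in> cinf N"
 shows "((%r. a (z (r, th))) has_real_derivative tder (%w. a (z w)) (\<tau>, th)) (at \<tau>)"
 using nb_self[OF RX_deriv(2)[OF msm_cinf[OF assms]]] msm_src[OF assms(1)] by simp

text \<open>Uniqueness is applied for each parameter separately. The common neighbourhood,
  coefficient bound and time interval make the conclusion hold near (0, th0) and not merely on the
  curve over th0.\<close>

lemma family_unique:
 assumes N: "manifold N" and z: "msm (RX Q) N z (0, th0)" "msm (RX Q) N z' (0, th0)"
  and L: "\<And>g X. (g, X) \<in> set L ==> fsm (RX Q) g (0, th0) \<and> X \<in> vfields N"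
  and v: "near (RX Q) (0, th0) (%w. \<forall>a\<in>cinf N. tder (%w. a (z w)) w = vel L a w (z w))"
   "near (RX Q) (0, th0) (%w. \<forall>a\<in>cinf N. tder (%w. a (z' w)) w = vel L a w (z' w))"
  and e0: "near Q th0 (%th. z (0, th) = z' (0, th))"
 shows "near (RX Q) (0, th0) (%w. z w = z' w)"
proof -
 have th0: "th0 \<in> pts Q" using msm_src[OF z(1)] by simp
 have z0: "z (0, th0) = z' (0, th0)" by (rule nb_self[OF e0 th0])
 obtain n ch Th where c: "is_chart N (z (0, th0)) n ch Th" using manifold_chart[OF N msm_tgt[OF z(1)]] by blast
 have X: "finite (snd ` set L)" "snd ` set L \<subseteq> vfields N" using L by auto
 from curve_unique[OF c manifold_dspace[OF N] X] obtain P where P: "eventually P (nb N (z (0, th0)))"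
  and U: "\<And>L' c d T B \<tau>. snd ` set L' \<subseteq> snd ` set L ==>
  (\<forall>(g, X)\<in>set L'. \<forall>\<tau>. abs \<tau> < T --> \<bar>g \<tau>\<bar> \<le> B) ==>
  (\<forall>\<tau>. abs \<tau> < T --> P (c \<tau>) \<and> P (d \<tau>) \<and> (\<forall>a\<in>cinf N.
   ((%r. a (c r)) has_real_derivative vel L' a \<tau> (c \<tau>)) (at \<tau>) \<and>
   ((%r. a (d r)) has_real_derivative vel L' a \<tau> (d \<tau>)) (at \<tau>))) ==>
  c 0 = d 0 ==> abs \<tau> < T ==> c \<tau> = d \<tau>" by blast
 define B where "B = (\<Sum>p\<in>set L. \<bar>fst p (0, th0)\<bar>) + 1"
 have "near (RX Q) (0, th0) (%w. \<forall>p\<in>set L. \<bar>fst p w - fst p (0, th0)\<bar> < 1)"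
  using L by (intro eventually_ball_finite ballI fsm_cont) auto
 moreover have "\<bar>fst p (0, th0)\<bar> \<le> B - 1" if "p \<in> set L" for p
  unfolding B_def using member_le_sum[of p "set L" "%p. \<bar>fst p (0, th0)\<bar>"] that by simp
 ultimately have "near (RX Q) (0, th0) (%w. \<forall>p\<in>set L. \<bar>fst p w\<bar> \<le> B)"
  by (elim eventually_mono) fastforce
 with msm_ev[OF z(1)] msm_ev[OF z(2)] v msm_lim[OF z(1) P] msm_lim[OF z(2) P[unfolded z0]]
 have "near (RX Q) (0, th0) (%w. msm (RX Q) N z w \<and> msm (RX Q) N z' w \<and> P (z w) \<and> P (z' w) \<and>
  (\<forall>a\<in>cinf N. tder (%w. a (z w)) w = vel L a w (z w) \<and> tder (%w. a (z' w)) w = vel L a w (z' w)) \<and>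
  (\<forall>p\<in>set L. \<bar>fst p w\<bar> \<le> B))"
  by eventually_elim simp
 then obtain e where e: "e > 0" "near Q th0 (%th. \<forall>r. \<bar>r - 0\<bar> < e --> msm (RX Q) N z (r, th) \<and> msm (RX Q) N z' (r, th) \<and> P (z (r, th)) \<and> P (z' (r, th)) \<and>
  (\<forall>a\<in>cinf N. tder (%w. a (z w)) (r, th) = vel L a (r, th) (z (r, th)) \<and> tder (%w. a (z' w)) (r, th) = vel L a (r, th) (z' (r, th))) \<and>
  (\<forall>p\<in>set L. \<bar>fst p (r, th)\<bar> \<le> B))" unfolding eventually_RX[OF th0] by blast
 show ?thesis unfolding eventually_RX[OF th0]
 proof (intro exI conjI)
  show "near Q th0 (%th. \<forall>r. \<bar>r - 0\<bar> < e --> z (r, th) = z' (r, th))"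
   using e(2) e0
  proof eventually_elim
   case (elim th)
   define L' where "L' = map (%(g, X). (%r. g (r, th), X)) L"
   have vL: "vel L' a r y = vel L a (r, th) y" for a r y
    unfolding L'_def by (induction L) auto
   show ?case
   proof (intro allI impI, rule U[of L' e B "%r. z (r, th)" "%r. z' (r, th)"])
    show "\<forall>(g, X)\<in>set L'. \<forall>\<tau>. abs \<tau> < e --> \<bar>g \<tau>\<bar> \<le> B"
    proof safe
     fix g X \<tau> assume "(g, X) \<in> set L'" and \<tau>: "abs \<tau> < e"
     then obtain p where "p \<in> set L" "g = (%r. fst p (r, th))" by (auto simp: L'_def)
     thus "\<bar>g \<tau>\<bar> \<le> B" using elim(1)[rule_format, of \<tau>] \<tau> by simp
    qed
    show "snd ` set L' \<subseteq> snd ` set L" by (force simp: L'_def)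
    show "\<forall>\<tau>. abs \<tau> < e --> P (z (\<tau>, th)) \<and> P (z' (\<tau>, th)) \<and> (\<forall>a\<in>cinf N.
     ((%r. a (z (r, th))) has_real_derivative vel L' a \<tau> (z (\<tau>, th))) (at \<tau>) \<and>
     ((%r. a (z' (r, th))) has_real_derivative vel L' a \<tau> (z' (\<tau>, th))) (at \<tau>))"
     unfolding vL using elim(1) msm_DERIV[of Q N] by (metis diff_0_right)
   qed (use elim(2) in auto)
  qed
 qed (rule e(1))
qed

section \<open>Integral curves and flows of compactly supported fields\<close>

lemma cinf_separates:
 assumes N: "manifold N" and xy: "x \<in> pts N" "y \<in> pts N" "\<And>a. a \<in> cinf N ==> a x = a y"
 shows "x = y"
proof (rule ccontr)
 assume "x \<noteq> y"
 \<comment> \<open>In the topology generated by the smooth functions, points with equal values have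
   the same neighbourhoods; the Hausdorff axiom excludes this for distinct points.\<close>
 have "Hausdorff_space (dtop N)" using N by (simp add: manifold_def)
 from this[unfolded Hausdorff_space_def topspace_dtop, rule_format, of x y] \<open>x \<noteq> y\<close> xy(1,2)
 obtain U V where UV: "openin (dtop N) U" "openin (dtop N) V" "x \<in> U" "y \<in> V" "disjnt U V"
  by auto
 from nb_open[OF UV(1,3), unfolded eventually_nb[OF xy(1)]] obtain k a r where
  a: "a ` {..<k::nat} \<subseteq> cinf N" "r > 0" "\<forall>y\<in>pts N. (\<forall>i<k. \<bar>a i y - a i x\<bar> < r) --> y \<in> U"
  by (elim exE conjE) (rule that)
 have "a i y = a i x" if "i < k" for i using a(1) that xy(3)[of "a i"] by auto
 hence "y \<in> U" using a(2,3) xy(2) by simp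
 thus False using UV by (auto simp: disjnt_def)
qed

definition icurve where
 "icurve M X T c \<longleftrightarrow> (\<forall>\<tau>. abs \<tau> < T --> c \<tau> \<in> pts M \<and>
   (\<forall>a\<in>cinf M. ((%r. a (c r)) has_real_derivative X a (c \<tau>)) (at \<tau>)))"

lemma icurve_lim:
 assumes c: "icurve M X T c" and \<tau>: "abs \<tau> < T" and P: "eventually P (nb M (c \<tau>))"
 shows "\<forall>\<^sub>F s in nhds \<tau>. abs s < T \<and> P (c s)"
proof -
 have c\<tau>: "c \<tau> \<in> pts M" using c \<tau> by (simp add: icurve_def)
 from P[unfolded eventually_nb[OF c\<tau>]] obtain k a r where
  a: "a ` {..<k::nat} \<subseteq> cinf M" "r > 0" "\<forall>y\<in>pts M. (\<forall>i<k. \<bar>a i y - a i (c \<tau>)\<bar> < r) --> P y"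
  by (elim exE conjE) (rule that)
 have "\<forall>\<^sub>F s in nhds \<tau>. s \<in> {-T<..<T}" by (rule eventually_nhds_in_open) (use \<tau> in auto)
 moreover have "\<forall>\<^sub>F s in nhds \<tau>. \<forall>i\<in>{..<k}. \<bar>a i (c s) - a i (c \<tau>)\<bar> < r"
 proof (intro eventually_ball_finite ballI)
  fix i assume "i \<in> {..<k}"
  hence "isCont (%s. a i (c s)) \<tau>" using c \<tau> a(1) DERIV_isCont by (fastforce simp: icurve_def)
  hence "((%s. a i (c s)) \<longlongrightarrow> a i (c \<tau>)) (nhds \<tau>)" using tendsto_at_iff_tendsto_nhds[of "%s. a i (c s)" \<tau>] by (simp add: isCont_def)
  from tendstoD[OF this a(2)] show "\<forall>\<^sub>F s in nhds \<tau>. \<bar>a i (c s) - a i (c \<tau>)\<bar> < r" by (simp add: dist_real_def)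
 qed simp
 ultimately show ?thesis
 proof eventually_elim
  case (elim s)
  hence s: "abs s < T" by auto
  hence "c s \<in> pts M" using c by (simp add: icurve_def)
  thus ?case using s a(3) elim(2) by simp
 qed
qed

lemma icurve_shift: "icurve M X T c ==> abs s + T' \<le> T ==> icurve M X T' (%r. c (r + s))"
 unfolding icurve_def
proof (intro allI impI conjI ballI; elim allE[of _ "_ + s"] impE conjE)
 fix \<tau> a assume "\<forall>a\<in>cinf M. ((%r. a (c r)) has_real_derivative X a (c (\<tau> + s))) (at (\<tau> + s))" "a \<in> cinf M"
 thus "((%r. a (c (r + s))) has_real_derivative X a (c (\<tau> + s))) (at \<tau>)"
  using DERIV_shift[of "%r. a (c r)" "X a (c (\<tau> + s))" \<tau> s] by simp
qed auto

text \<open>The times of agreement form an open set by local uniqueness, those of disagreement by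
  functions separating the points; the interval is connected.\<close>

lemma icurve_unique:
 assumes M: "manifold M" and X: "X \<in> vfields M" and c: "icurve M X T c" "icurve M X T d" and "c 0 = d 0" and \<tau>: "abs \<tau> < T"
 shows "c \<tau> = d \<tau>"
proof -
 define U where "U = {t. abs t < T \<and> c t = d t}"
 define V where "V = {t. abs t < T \<and> c t \<noteq> d t}"
 have cp: "c t \<in> pts M" "d t \<in> pts M" if "abs t < T" for t using c that by (auto simp: icurve_def)
 have "open U"
  unfolding open_subopen[of U]
 proof
  fix t assume "t \<in> U"
  hence t: "abs t < T" "c t = d t" by (auto simp: U_def)
  obtain n ch Th where chart: "is_chart M (c t) n ch Th" using manifold_chart[OF M cp(1)[OF t(1)]] by blast
  have X': "finite {X}" "{X} \<subseteq> vfields M" using X by auto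
  from curve_unique[OF chart manifold_dspace[OF M] X'] obtain P where P: "eventually P (nb M (c t))"
   and U: "\<And>L c d T B \<tau>. snd ` set L \<subseteq> {X} ==> (\<forall>(g, X)\<in>set L. \<forall>\<tau>. abs \<tau> < T --> \<bar>g \<tau>\<bar> \<le> B) ==>
   (\<forall>\<tau>. abs \<tau> < T --> P (c \<tau>) \<and> P (d \<tau>) \<and> (\<forall>a\<in>cinf M.
    ((%r. a (c r)) has_real_derivative vel L a \<tau> (c \<tau>)) (at \<tau>) \<and>
    ((%r. a (d r)) has_real_derivative vel L a \<tau> (d \<tau>)) (at \<tau>))) ==>
   c 0 = d 0 ==> abs \<tau> < T ==> c \<tau> = d \<tau>" by blast
  have "\<forall>\<^sub>F s in nhds t. abs s < T \<and> P (c s) \<and> P (d s)"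
   using icurve_lim[OF c(1) t(1) P] icurve_lim[OF c(2) t(1) P[unfolded t(2)]] by eventually_elim simp
  then obtain e where e: "e > 0" "\<And>s. \<bar>s - t\<bar> < e ==> abs s < T \<and> P (c s) \<and> P (d s)"
   unfolding eventually_nhds_metric dist_real_def by blast
  have "c (s + t) = d (s + t)" if s: "abs s < e" for s
  proof (rule U[of "[(%_. 1, X)]" e 1 "%r. c (r + t)" "%r. d (r + t)"])
   show "\<forall>\<tau>. abs \<tau> < e --> P (c (\<tau> + t)) \<and> P (d (\<tau> + t)) \<and> (\<forall>a\<in>cinf M.
    ((%r. a (c (r + t))) has_real_derivative vel [(%_. 1, X)] a \<tau> (c (\<tau> + t))) (at \<tau>) \<and>
    ((%r. a (d (r + t))) has_real_derivative vel [(%_. 1, X)] a \<tau> (d (\<tau> + t))) (at \<tau>))"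
   proof (intro allI impI)
    fix \<tau> assume "abs \<tau> < e"
    hence "\<bar>(\<tau> + t) - t\<bar> < e" by simp
    from e(2)[OF this] show "P (c (\<tau> + t)) \<and> P (d (\<tau> + t)) \<and> (\<forall>a\<in>cinf M.
     ((%r. a (c (r + t))) has_real_derivative vel [(%_. 1, X)] a \<tau> (c (\<tau> + t))) (at \<tau>) \<and>
     ((%r. a (d (r + t))) has_real_derivative vel [(%_. 1, X)] a \<tau> (d (\<tau> + t))) (at \<tau>))"
     using c unfolding icurve_def by (auto simp: DERIV_shift)
   qed
  qed (use t s in auto)
  hence "{t-e<..<t+e} \<subseteq> U" using e by (auto simp: U_def abs_less_iff) (metis abs_less_iff diff_add_cancel minus_diff_eq diff_less_eq add.commute less_diff_eq)
  thus "\<exists>W. open W \<and> t \<in> W \<and> W \<subseteq> U" using e(1) by (intro exI[of _ "{t-e<..<t+e}"]) auto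
 qed
 moreover have "open V"
  unfolding open_subopen[of V]
 proof
  fix t assume "t \<in> V"
  hence t: "abs t < T" "c t \<noteq> d t" by (auto simp: V_def)
  then obtain a where a: "a \<in> cinf M" "a (c t) \<noteq> a (d t)" using cinf_separates[OF M cp[OF t(1)]] by blast
  define e where "e = \<bar>a (c t) - a (d t)\<bar> / 2"
  have e: "e > 0" using a by (simp add: e_def)
  have "\<forall>\<^sub>F s in nhds t. s \<in> V"
   using icurve_lim[OF c(1) t(1) fsm_cont[OF cinf_fsm[OF a(1) cp(1)[OF t(1)]] e]]
    icurve_lim[OF c(2) t(1) fsm_cont[OF cinf_fsm[OF a(1) cp(2)[OF t(1)]] e]]
  proof eventually_elim
   case (elim s)
   hence "a (c s) \<noteq> a (d s)" unfolding e_def by (smt (verit) field_sum_of_halves)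
   thus ?case using elim(1) by (auto simp: V_def)
  qed
  thus "\<exists>W. open W \<and> t \<in> W \<and> W \<subseteq> V" unfolding eventually_nhds by blast
 qed
 moreover have "connected {-T<..<T}" "{-T<..<T} \<subseteq> U \<union> V" "U \<inter> V \<inter> {-T<..<T} = {}"
  by (auto simp: U_def V_def)
 ultimately have "U \<inter> {-T<..<T} = {} \<or> V \<inter> {-T<..<T} = {}" by (metis connectedD)
 moreover have "0 \<in> U \<inter> {-T<..<T}" using \<tau> \<open>c 0 = d 0\<close> by (auto simp: U_def)
 moreover have "\<tau> \<in> {-T<..<T}" using \<tau> by auto
 ultimately have "\<tau> \<notin> V" by blast
 thus ?thesis using \<tau> by (simp add: V_def)
qed

lemma local_flow:
 assumes M: "manifold M" and X: "X \<in> vfields M" and y0: "y0 \<in> pts M"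
 shows "\<exists>\<phi> e. e > 0 \<and> msm (RX M) M \<phi> (0, y0) \<and> (near M y0 (%x. \<phi> (0, x) = x \<and> icurve M X e (%r. \<phi> (r, x))))"
proof -
 have "\<exists>z. msm (RX M) M z (0, y0) \<and> (near M y0 (%th. z (0, th) = th)) \<and>
  (near (RX M) (0, y0) (%w. \<forall>a\<in>cinf M. tder (%w. a (z w)) w = vel [(%_. 1, X)] a w (z w)))"
  by (rule manifold_ode[OF M msm_id[OF y0]]) (use X y0 in "auto intro: fsm_const")
 then obtain z where z: "msm (RX M) M z (0, y0)" "near M y0 (%th. z (0, th) = th)"
  "near (RX M) (0, y0) (%w. \<forall>a\<in>cinf M. tder (%w. a (z w)) w = vel [(%_. 1, X)] a w (z w))" by blast
 from msm_ev[OF z(1)] z(3) have "near (RX M) (0, y0) (%w. z w \<in> pts M \<and> (\<forall>a\<in>cinf M.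
   ((%r. a (z (r, snd w))) has_real_derivative X a (z w)) (at (fst w))))"
 proof eventually_elim
  case (elim w)
  thus ?case using msm_tgt[OF elim(1)] msm_DERIV[of M M z "fst w" "snd w"] by simp
 qed
 then obtain e where e: "e > 0" "near M y0 (%x. \<forall>r. \<bar>r - 0\<bar> < e --> z (r, x) \<in> pts M \<and> (\<forall>a\<in>cinf M.
   ((%r. a (z (r, x))) has_real_derivative X a (z (r, x))) (at r)))" unfolding eventually_RX[OF y0] by auto
 from e(2) z(2) have "near M y0 (%x. z (0, x) = x \<and> icurve M X e (%r. z (r, x)))"
  by eventually_elim (simp add: icurve_def)
 thus ?thesis using e(1) z(1) by blast
qed

text \<open>The compact support is covered by finitely many sets with positive existence times, and
  outside it curves rest. Every point thus has a curve for one common time, which is then doubled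
  indefinitely; uniqueness makes the resulting curves agree.\<close>

lemma complete_vfield:
 assumes M: "manifold M" and X: "X \<in> vfields_c M" and x: "x \<in> pts M"
 shows "\<exists>c. integral_curve M X c \<and> c 0 = x"
proof -
 have Xv: "X \<in> vfields M" and Xc: "compactin (dtop M) (supp M X)" using X by (auto simp: vfields_c_def)
 have supp: "\<exists>a. X a y \<noteq> 0 ==> y \<in> supp M X" if "y \<in> pts M" for y
  unfolding supp_def using that closure_of_subset[of "{x \<in> pts M. \<exists>a. X a x \<noteq> 0}" "dtop M"] by auto
 define good where "good e U \<longleftrightarrow> (\<forall>x\<in>U. \<exists>c. icurve M X e c \<and> c 0 = x)" for e U
 have "\<exists>\<F>. finite \<F> \<and> \<F> \<subseteq> {U. openin (dtop M) U \<and> (\<exists>e>0. good e U)} \<and> supp M X \<subseteq> \<Union>\<F>"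
 proof -
  have "supp M X \<subseteq> \<Union>{U. openin (dtop M) U \<and> (\<exists>e>0. good e U)}"
  proof
   fix y assume "y \<in> supp M X"
   hence y: "y \<in> pts M" using closure_of_subset_topspace[of "dtop M"] by (auto simp: supp_def)
   obtain \<phi> e where "e > 0" and ev: "near M y (%x. \<phi> (0, x) = x \<and> icurve M X e (%r. \<phi> (r, x)))"
    using local_flow[OF M Xv y] by blast
   from ev[unfolded eventually_nhdsin] y obtain V where V: "openin (dtop M) V" "y \<in> V"
    "\<forall>x\<in>V. \<phi> (0, x) = x \<and> icurve M X e (%r. \<phi> (r, x))" by auto
   hence "good e V" unfolding good_def by blast
   thus "y \<in> \<Union>{U. openin (dtop M) U \<and> (\<exists>e>0. good e U)}"
    using \<open>e > 0\<close> V by blast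
  qed
  moreover have "\<forall>\<U>. (\<forall>U\<in>\<U>. openin (dtop M) U) \<and> supp M X \<subseteq> \<Union>\<U> --> (\<exists>\<F>. finite \<F> \<and> \<F> \<subseteq> \<U> \<and> supp M X \<subseteq> \<Union>\<F>)"
   using Xc unfolding compactin_def by blast
  ultimately show ?thesis by simp
 qed
 then obtain \<F> where F: "finite \<F>" "\<And>U. U \<in> \<F> ==> \<exists>e>0. good e U" "supp M X \<subseteq> \<Union>\<F>" by blast
 then obtain E where E: "\<And>U. U \<in> \<F> ==> E U > 0 \<and> good (E U) U" by metis
 define e where "e = Min (insert 1 (E ` \<F>))"
 have e: "e > 0" "\<And>U. U \<in> \<F> ==> e \<le> E U" using F(1) E by (auto simp: e_def)
 have base: "\<exists>c. icurve M X e c \<and> c 0 = y" if y: "y \<in> pts M" for y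
 proof (cases "y \<in> supp M X")
  case True
  then obtain U where U: "U \<in> \<F>" "y \<in> U" using F(3) by blast
  then obtain c where "icurve M X (E U) c" "c 0 = y" using E[OF U(1)] unfolding good_def by blast
  thus ?thesis using e(2)[OF U(1)] by (auto simp: icurve_def intro!: exI[of _ c])
 next
  case False
  hence "X a y = 0" for a using supp[OF y] by blast
  thus ?thesis using y by (intro exI[of _ "%_. y"]) (simp add: icurve_def)
 qed
 text \<open>Doubling the time of existence.\<close>
 have double: "\<exists>c. icurve M X (2 * T) c \<and> c 0 = y" if y: "y \<in> pts M" and T: "\<And>y. y \<in> pts M ==> \<exists>c. icurve M X T c \<and> c 0 = y" for T y
 proof -
  from T obtain k where k: "\<And>y. y \<in> pts M ==> icurve M X T (k y) \<and> k y 0 = y" by metis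
  \<comment> \<open>Two steps of half the time each. Near a given time this is a shift of the single
    curve through \<open>y1\<close>, so nothing has to be glued at the end of the old
    interval.\<close>
  define c where "c \<tau> = k (k y (\<tau>/2)) (\<tau>/2)" for \<tau>
  have kp: "k y s \<in> pts M" if "abs s < T" "y \<in> pts M" for y s using k[OF that(2)] that(1) by (simp add: icurve_def)
  have add: "k (k y s) t = k y (t + s)" if y: "y \<in> pts M" and st: "abs s + \<bar>t\<bar> < T" for y s t
  proof (rule icurve_unique[OF M Xv, of "T - \<bar>s\<bar>" "k (k y s)" "%t. k y (t + s)"])
   have ys: "k y s \<in> pts M" using kp y st by simp
   show "icurve M X (T - \<bar>s\<bar>) (k (k y s))" using k[OF ys] by (simp add: icurve_def)
   show "icurve M X (T - \<bar>s\<bar>) (%t. k y (t + s))" by (rule icurve_shift[where T = T]) (use k[OF y] in auto)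
  qed (use k kp y st in auto)
  have "icurve M X (2 * T) c"
   unfolding icurve_def
  proof (intro allI impI)
   fix \<tau> assume \<tau>: "abs \<tau> < 2 * T"
   define y1 where "y1 = k y (\<tau>/2)"
   have y1: "y1 \<in> pts M" using kp y \<tau> by (simp add: y1_def)
   define d where "d = (T - \<bar>\<tau>\<bar> / 2) / 2"
   have d: "d > 0" using \<tau> by (simp add: d_def)
   have eq: "c s = k y1 (s - \<tau>/2)" if s: "\<bar>s - \<tau>\<bar> < d" for s
   proof -
    have "c s = k (k y (\<tau>/2 + (s-\<tau>)/2)) (s/2)" by (simp add: c_def diff_divide_distrib)
    also have "k y (\<tau>/2 + (s-\<tau>)/2) = k y1 ((s-\<tau>)/2)"
     unfolding y1_def by (subst add[OF y]) (use s \<tau> in "auto simp: d_def add.commute abs_if field_simps split: if_splits")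
    also have "k (k y1 ((s-\<tau>)/2)) (s/2) = k y1 (s/2 + (s-\<tau>)/2)"
     by (rule add[OF y1]) (use s \<tau> in "auto simp: d_def abs_if field_simps split: if_splits")
    also have "s/2 + (s-\<tau>)/2 = s - \<tau>/2" by (simp add: field_simps)
    finally show ?thesis .
   qed
   have c\<tau>: "c \<tau> = k y1 (\<tau>/2)" by (simp add: c_def y1_def)
   show "c \<tau> \<in> pts M \<and> (\<forall>a\<in>cinf M. ((%r. a (c r)) has_real_derivative X a (c \<tau>)) (at \<tau>))"
   proof (intro conjI ballI)
    show "c \<tau> \<in> pts M" using kp y1 \<tau> by (simp add: c\<tau>)
    fix a assume a: "a \<in> cinf M"
    have "((%r. a (k y1 r)) has_real_derivative X a (c \<tau>)) (at (\<tau> + - (\<tau>/2)))"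
     using k[OF y1] \<tau> a by (simp add: icurve_def c\<tau>)
    hence "((%r. a (k y1 (r - \<tau>/2))) has_real_derivative X a (c \<tau>)) (at \<tau>)" by (simp only: DERIV_shift) simp
    thus "((%r. a (c r)) has_real_derivative X a (c \<tau>)) (at \<tau>)"
     by (rule has_field_derivative_transform_within_open[of _ _ _ "{\<tau>-d<..<\<tau>+d}"]) (use d eq in auto)
   qed
  qed
  moreover have "c 0 = y" using k y by (simp add: c_def)
  ultimately show ?thesis by blast
 qed
 have pow: "\<forall>y\<in>pts M. \<exists>c. icurve M X (2 ^ n * e) c \<and> c 0 = y" for n
  by (induction n) (use base double in "auto simp: mult.assoc")
 have "\<forall>n. \<exists>c. icurve M X (2 ^ n * e) c \<and> c 0 = x" using pow x by blast
 from choice[OF this] obtain c where c: "\<And>n. icurve M X (2 ^ n * e) (c n) \<and> c n 0 = x" by blast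
 have agree: "c n \<tau> = c m \<tau>" if "abs \<tau> < 2 ^ n * e" "abs \<tau> < 2 ^ m * e" for n m \<tau>
  by (rule icurve_unique[OF M Xv, of "min (2 ^ n * e) (2 ^ m * e)"]) (use c that in "auto simp: icurve_def")
 have big: "\<exists>n. abs \<tau> < 2 ^ n * e" for \<tau>
 proof -
  obtain n where "abs \<tau> / e < 2 ^ n" using real_arch_pow[of 2 "abs \<tau> / e"] by auto
  thus ?thesis using e(1) by (auto simp: field_simps)
 qed
 define g where "g \<tau> = c (SOME n. abs \<tau> < 2 ^ n * e) \<tau>" for \<tau>
 have g: "g \<tau> = c n \<tau>" if "abs \<tau> < 2 ^ n * e" for n \<tau>
  unfolding g_def using someI_ex[OF big[of \<tau>]] that by (rule agree)
 have "integral_curve M X g"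
  unfolding integral_curve_def
 proof (intro conjI ballI allI)
  show "range g \<subseteq> pts M" using big g c unfolding icurve_def by (metis (no_types, lifting) image_subsetI)
  fix a \<tau> assume a: "a \<in> cinf M"
  obtain n where n: "abs \<tau> < 2 ^ n * e" using big by blast
  have "((%r. a (c n r)) has_real_derivative X a (g \<tau>)) (at \<tau>)" using c[of n] n a by (simp add: icurve_def g)
  thus "((%r. a (g r)) has_real_derivative X a (g \<tau>)) (at \<tau>)"
   by (rule has_field_derivative_transform_within_open[of _ _ _ "{- (2 ^ n * e)<..<2 ^ n * e}"]) (use n in "auto simp: g[of _ n] abs_less_iff")
 qed
 moreover have "g 0 = x" using g[of 0 0] c[of 0] e(1) by simp
 ultimately show ?thesis by blast
qed

definition iflow :: "'a smooth_space => 'a vfield => real => 'a => 'a" where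
 "iflow M X \<tau> x = (SOME c. integral_curve M X c \<and> c 0 = x) \<tau>"

lemma integral_icurve: "integral_curve M X c ==> icurve M X T c"
 by (auto simp: integral_curve_def icurve_def)

lemma iflow_curve:
 assumes "manifold M" "X \<in> vfields_c M" "x \<in> pts M"
 shows "integral_curve M X (%\<tau>. iflow M X \<tau> x)" "iflow M X 0 x = x" "iflow M X \<tau> x \<in> pts M"
proof -
 show *: "integral_curve M X (%\<tau>. iflow M X \<tau> x)" "iflow M X 0 x = x"
  using someI_ex[OF complete_vfield[OF assms]] by (auto simp: iflow_def)
 show "iflow M X \<tau> x \<in> pts M" using *(1) by (auto simp: integral_curve_def)
qed

lemma iflow_eqI:
 assumes M: "manifold M" and X: "X \<in> vfields_c M" and x: "c 0 \<in> pts M" and c: "icurve M X T c" "abs \<tau> < T"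
 shows "iflow M X \<tau> (c 0) = c \<tau>"
 by (rule icurve_unique[OF M _ integral_icurve c(1) _ c(2)]) (use iflow_curve[OF M X x] X in "auto simp: vfields_c_def")

lemma vexp_iflow:
 assumes "manifold M" "X \<in> vfields_c M" "x \<in> pts M"
 shows "vexp M X x = iflow M X 1 x"
 unfolding vexp_def
proof (rule the_equality)
 show "\<exists>c. integral_curve M X c \<and> c 0 = x \<and> c 1 = iflow M X 1 x" using iflow_curve[OF assms] by blast
 fix y assume "\<exists>c. integral_curve M X c \<and> c 0 = x \<and> c 1 = y"
 then obtain c where c: "integral_curve M X c" "c 0 = x" "c 1 = y" by blast
 thus "y = iflow M X 1 x" using iflow_eqI[OF assms(1,2) _ integral_icurve[OF c(1), of 2], of 1] assms(3) by simp
qed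

lemma iflow_add:
 assumes "manifold M" "X \<in> vfields_c M" "x \<in> pts M"
 shows "iflow M X (s + t) x = iflow M X s (iflow M X t x)"
 using iflow_eqI[OF assms(1,2), of "%r. iflow M X (r + t) x" "abs s + 1" s] iflow_curve[OF assms]
  icurve_shift[OF integral_icurve[OF iflow_curve(1)[OF assms]], of t "abs s + 1" "abs t + (abs s + 1)"] by simp

text \<open>Joint smoothness near time 0 only, where the flow agrees with a local solution by
  uniqueness; larger times are reached later by composing small ones.\<close>

lemma iflow_msm:
 assumes M: "manifold M" and X: "X \<in> vfields_c M" and y0: "y0 \<in> pts M"
 shows "msm (RX M) M (%w. iflow M X (fst w) (snd w)) (0, y0)"
proof -
 have Xv: "X \<in> vfields M" using X by (simp add: vfields_c_def)
 obtain \<phi> e where \<phi>: "e > 0" "msm (RX M) M \<phi> (0, y0)" "near M y0 (%x. \<phi> (0, x) = x \<and> icurve M X e (%r. \<phi> (r, x)))"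
  using local_flow[OF M Xv y0] by blast
 have "near (RX M) (0, y0) (%w. iflow M X (fst w) (snd w) = \<phi> w)"
  unfolding eventually_RX[OF y0]
 proof (intro exI[of _ e] conjI \<phi>(1))
  show "near M y0 (%x. \<forall>r. \<bar>r - 0\<bar> < e --> iflow M X (fst (r, x)) (snd (r, x)) = \<phi> (r, x))"
   using \<phi>(3) nb_pts
  proof eventually_elim
   case (elim x)
   thus ?case using iflow_eqI[OF M X, of "%r. \<phi> (r, x)" e] by auto
  qed
 qed
 thus ?thesis by (rule msm_cong[OF \<phi>(2)])
qed

section \<open>Vector fields adapted to a submersion\<close>

lemma compactin_chart_image:
 assumes "\<And>x. x \<in> C ==> msm (euclid n) X Th x" "compact C"
 shows "compactin (dtop X) (Th ` C)"
 unfolding compactin_def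
proof (intro conjI allI impI)
 show "Th ` C \<subseteq> topspace (dtop X)" using assms(1) msm_tgt by fastforce
 fix \<U> assume U: "Ball \<U> (openin (dtop X)) \<and> Th ` C \<subseteq> \<Union>\<U>"
 have "\<forall>x. \<exists>U r. x \<in> C --> U \<in> \<U> \<and> r > 0 \<and> (\<forall>y\<in>cube n x r. Th y \<in> U)"
 proof
  fix x
  show "\<exists>U r. x \<in> C --> U \<in> \<U> \<and> r > 0 \<and> (\<forall>y\<in>cube n x r. Th y \<in> U)"
  proof (cases "x \<in> C")
   case True
   then obtain U' where U': "U' \<in> \<U>" "Th x \<in> U'" using U by blast
   hence "near (euclid n) x (%y. Th y \<in> U')"
    using U by (intro msm_lim[OF assms(1)[OF True]] nb_open) auto
   thus ?thesis using U'(1) msm_src[OF assms(1)[OF True]] by (auto simp: eventually_euclid)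
  qed simp
 qed
 then obtain U' r where r: "\<And>x. x \<in> C ==> U' x \<in> \<U> \<and> r x > 0 \<and> (\<forall>y\<in>cube n x (r x). Th y \<in> U' x)" by metis
 define O' where "O' x = (\<Inter>i<n. {y. \<bar>y i - x i\<bar> < r x})" for x :: "nat => real"
 have "open (O' x)" for x
  unfolding O'_def
 proof (intro open_INT ballI)
  fix i
  have "continuous_on UNIV (%y :: nat => real. \<bar>y i - x i\<bar>)"
   using continuous_on_product_coordinates[of i] by (intro continuous_intros) auto
  from open_vimage[OF _ this, of "{..<r x}"] show "open {y :: nat => real. \<bar>y i - x i\<bar> < r x}"
   by (simp add: vimage_def)
 qed simp
 moreover have "C \<subseteq> (\<Union>x\<in>C. O' x)" using r by (auto simp: O'_def)
 ultimately obtain D where D: "D \<subseteq> C" "finite D" "C \<subseteq> (\<Union>x\<in>D. O' x)"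
  using compactE_image[OF assms(2), of C O'] by blast
 have "Th ` C \<subseteq> \<Union>(U' ` D)"
 proof
  fix y assume "y \<in> Th ` C"
  then obtain x d where x: "x \<in> C" "y = Th x" "d \<in> D" "x \<in> O' d" using D(3) by blast
  hence "x \<in> cube n d (r d)" using msm_src[OF assms(1)] by (auto simp: cube_def O'_def)
  thus "y \<in> \<Union>(U' ` D)" using r D(1) x by blast
 qed
 thus "\<exists>\<F>. finite \<F> \<and> \<F> \<subseteq> \<U> \<and> Th ` C \<subseteq> \<Union>\<F>" using D r by (intro exI[of _ "U' ` D"]) auto
qed

text \<open>Membership in the image of a compact cube of the chart is added to the property that the
  bump respects. The closed set carrying the bump then lies in a compact set.\<close>

lemma compact_bump:
 assumes X: "manifold X" and P: "eventually P (nb X u)" and u: "u \<in> pts X"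
 shows "\<exists>\<rho> K. \<rho> \<in> cinf_c X \<and> (near X u (%w. \<rho> w = 1)) \<and> compactin (dtop X) K \<and> closedin (dtop X) K \<and>
  (\<forall>w\<in>K. P w) \<and> (\<forall>w. \<rho> w \<noteq> 0 --> w \<in> K)"
proof -
 have dX: "dspace X" by (rule manifold_dspace[OF X])
 obtain n ch Th where c: "is_chart X u n ch Th" using manifold_chart[OF X u] by blast
 note C = is_chartD[OF c]
 from msm_ev[OF C(2)] obtain r where r: "r > 0" "\<forall>x\<in>cube n (ch u) r. msm (euclid n) X Th x"
  unfolding eventually_euclid[OF C(5)] by blast
 define C0 where "C0 = {x\<in>Rn n. \<forall>i<n. \<bar>x i - ch u i\<bar> \<le> r / 2}"
 have "C0 = (%x i. x i + ch u i) ` ccube n (r / 2)"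
 proof (intro equalityI subsetI)
  fix x assume "x \<in> C0"
  thus "x \<in> (%x i. x i + ch u i) ` ccube n (r / 2)"
   using C(5) by (intro image_eqI[of _ _ "%i. x i - ch u i"]) (auto simp: C0_def ccube_def Rn_def)
 qed (use C(5) in "auto simp: C0_def ccube_def Rn_def")
 moreover have "continuous_on (ccube n (r / 2)) (%x i. x i + ch u i)"
  by (intro continuous_on_coordinatewise_then_product continuous_intros
    continuous_on_subset[OF continuous_on_product_coordinates]) auto
 ultimately have C0: "compact C0" by (simp add: compact_continuous_image compact_ccube)
 have C0c: "compactin (dtop X) (Th ` C0)"
  by (rule compactin_chart_image[OF _ C0]) (use r in "force simp: C0_def cube_def")
 have "near X u (%w. ch w \<in> cube n (ch u) (r / 2))"
  by (rule msm_lim[OF C(1)]) (use C(5) r in \<open>auto simp: eventually_euclid intro!: exI[of _ "r / 2"]\<close>)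
 with P C(6) have "near X u (%w. P w \<and> w \<in> Th ` C0)"
  by eventually_elim (force simp: C0_def cube_def less_imp_le)
 from cinf_bump[OF this dX u] obtain \<rho> K where \<rho>: "\<rho> \<in> cinf X" "near X u (%w. \<rho> w = 1)" "closedin (dtop X) K"
  "\<forall>w\<in>K. P w \<and> w \<in> Th ` C0" "\<forall>w. \<rho> w \<noteq> 0 --> w \<in> K" by blast
 have K: "compactin (dtop X) K" by (rule closed_compactin[OF C0c _ \<rho>(3)]) (use \<rho> in blast)
 have "dtop X closure_of {x \<in> pts X. \<rho> x \<noteq> 0} \<subseteq> K" by (rule closure_of_minimal) (use \<rho> in auto)
 hence "\<rho> \<in> cinf_c X" unfolding cinf_c_def using \<rho>(1) closed_compactin[OF K _ closedin_closure_of] by blast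
 thus ?thesis using \<rho> K by blast
qed

text \<open>A field with prescribed coefficients near u, extended by 0. The property
  \<open>R\<close> holds wherever the cut-off \<rho> is nonzero, which lets local identities become
  global ones.\<close>

lemma chart_vfield:
 assumes X: "manifold X" and c: "is_chart X u n ch Th" and g: "\<And>i. i < n ==> fsm X (g i) u" and R: "eventually R (nb X u)"
 shows "\<exists>A \<rho>. A \<in> vfields_c X \<and> \<rho> \<in> cinf_c X \<and> (near X u (%w. \<rho> w = 1)) \<and> (\<forall>w. \<rho> w \<noteq> 0 --> R w) \<and>
  (\<forall>a\<in>cinf X. \<forall>w. A a w = \<rho> w * (\<Sum>i<n. g i w * pd i (%x. a (Th x)) (ch w)))"
proof -
 have dX: "dspace X" by (rule manifold_dspace[OF X])
 note C = is_chartD[OF c]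
 have "near X u (%w. \<forall>i\<in>{..<n}. fsm X (g i) w)" using g by (intro eventually_ball_finite ballI fsm_ev) auto
 with is_chart_ev[OF c] R have "near X u (%w. is_chart X w n ch Th \<and> (\<forall>i<n. fsm X (g i) w) \<and> R w)"
  by eventually_elim auto
 from compact_bump[OF X this C(4)] obtain \<rho> K where \<rho>: "\<rho> \<in> cinf_c X" "near X u (%w. \<rho> w = 1)"
  "compactin (dtop X) K" "closedin (dtop X) K" "\<forall>w\<in>K. is_chart X w n ch Th \<and> (\<forall>i<n. fsm X (g i) w) \<and> R w"
  "\<forall>w. \<rho> w \<noteq> 0 --> w \<in> K" by blast
 define A where "A a w = (if a \<in> cinf X then \<rho> w * (\<Sum>i<n. g i w * pd i (%x. a (Th x)) (ch w)) else 0)" for a w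
 have Kc: "is_chart X w n ch Th" "\<And>i. i < n ==> fsm X (g i) w" if "w \<in> K" for w using \<rho>(5) that by auto
 have fT: "fsm (euclid n) (%x. a (Th x)) (ch w)" if "a \<in> cinf X" "w \<in> K" for a w
  by (rule msm_cinf[OF is_chartD(2)[OF Kc(1)[OF that(2)]] that(1)])
 have \<rho>c: "\<rho> \<in> cinf X" using \<rho>(1) by (simp add: cinf_c_def)
 have Ac: "A a \<in> cinf X" for a
 proof (cases "a \<in> cinf X")
  case True
  have "fsm X (A a) w" if w: "w \<in> pts X" for w
  proof (cases "w \<in> K")
   case wK: True
   have "fsm X (%w. \<rho> w * (\<Sum>i<n. g i w * pd i (%x. a (Th x)) (ch w))) w"
   proof (intro fsm_mult fsm_sum cinf_fsm[OF \<rho>c w] w Kc(2)[OF wK])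
    fix i assume "i \<in> {..<n}"
    thus "fsm X (%w. pd i (%x. a (Th x)) (ch w)) w"
     by (intro msm_fsm[OF fsm_pd[OF fT[OF True wK]] is_chartD(1)[OF Kc(1)[OF wK]]]) simp
   qed simp
   thus ?thesis using True by (simp add: A_def[abs_def])
  next
   case False
   have "openin (dtop X) (pts X - K)" using \<rho>(4) by (simp add: closedin_def)
   hence "near X w (%y. y \<in> pts X - K)" using False w by (intro nb_open) auto
   hence "near X w (%y. A a y = 0)" by eventually_elim (use \<rho>(6) in "auto simp: A_def")
   thus ?thesis by (rule fsm_cong[OF fsm_const[OF w]])
  qed
  moreover have "A a w = 0" if "w \<notin> pts X" for w
  proof -
   have "\<rho> w = 0" using \<rho>c that dX by (simp add: cinf_iff)
   thus ?thesis by (simp add: A_def)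
  qed
  ultimately show ?thesis by (simp add: cinf_iff[OF dX])
 next
  case False
  hence "A a = (%y. if y \<in> pts X then 0 else 0)" by (auto simp: A_def)
  thus ?thesis using cinf_const[OF dX, of 0] by simp
 qed
 have Av: "A \<in> vfields X"
  unfolding vfields_def
 proof (intro CollectI conjI allI ballI impI)
  fix a b c assume a: "a \<in> cinf X" and b: "b \<in> cinf X"
  note ab = cinf_add[OF dX a b] cinf_mult[OF dX a b] cinf_scale[OF dX a]
  have K0: "w \<in> K \<or> \<rho> w = 0" for w using \<rho>(6) by auto
  have pa: "pd i (%x. a (Th x) + b (Th x)) (ch w) = pd i (%x. a (Th x)) (ch w) + pd i (%x. b (Th x)) (ch w)"
   "pd i (%x. c * a (Th x)) (ch w) = c * pd i (%x. a (Th x)) (ch w)"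
   "pd i (%x. a (Th x) * b (Th x)) (ch w) = pd i (%x. a (Th x)) (ch w) * b w + a w * pd i (%x. b (Th x)) (ch w)"
   if "w \<in> K" "i < n" for w i
   using pd_algebra[OF fT[OF a that(1)] fT[OF b that(1)] that(2)] is_chartD(3)[OF Kc(1)[OF that(1)]] by auto
  show "A (%y. a y + b y) = (%y. A a y + A b y)"
  proof
   show "A (%y. a y + b y) w = A a w + A b w" for w
    using K0[of w] by (auto simp: A_def a b ab pa algebra_simps sum.distrib)
  qed
  show "A (%y. c * a y) = (%y. c * A a y)"
  proof
   show "A (%y. c * a y) w = c * A a w" for w
    using K0[of w] by (auto simp: A_def a b ab pa algebra_simps sum_distrib_left)
  qed
  show "A (%y. a y * b y) = (%y. A a y * b y + a y * A b y)"
  proof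
   show "A (%y. a y * b y) w = A a w * b w + a w * A b w" for w
    using K0[of w] by (auto simp: A_def a b ab pa algebra_simps sum.distrib sum_distrib_left)
  qed
 qed (use Ac in "auto simp: A_def")
 have "supp X A \<subseteq> K" unfolding supp_def
  by (rule closure_of_minimal[OF _ \<rho>(4)]) (use \<rho>(6) in "auto simp: A_def split: if_splits")
 hence "compactin (dtop X) (supp X A)" unfolding supp_def
  by (intro closed_compactin[OF \<rho>(3) _ closedin_closure_of])
 hence "A \<in> vfields_c X" using Av by (simp add: vfields_c_def)
 thus ?thesis using \<rho> by (intro exI[of _ A] exI[of _ \<rho>]) (auto simp: A_def)
qed

text \<open>In adapted coordinates a function pulled back along f depends only on the first k
  coordinates, and on these as the function does on the target coordinates.\<close>

lemma adapted_pd: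
 assumes c: "is_chart X w n ch Th" and d: "is_chart N (f w) k \<psi> T" and kn: "k \<le> n" and f: "msm X N f w"
  and e: "near X w (%w. \<forall>j<k. ch w j = \<psi> (f w) j)" and a: "a \<in> cinf N" and h: "near X w (%w. h w = a (f w))" and i: "i < n"
 shows "pd i (%x. h (Th x)) (ch w) = (if i < k then pd i (%x. a (T x)) (\<psi> (f w)) else 0)"
proof -
 note C = is_chartD[OF c] and D = is_chartD[OF d]
 obtain H where H: "smooth_fun k H" "near (euclid k) (\<psi> (f w)) (%x. a (T x) = H x)"
  using msm_cinf[OF D(2) a] unfolding fsm_euclid by blast
 have "near X w (%w. h w = H (trunc k (ch w)))"
  using h e msm_lim[OF f D(6)] msm_lim[OF f msm_lim[OF D(1) H(2)]] msm_lim[OF f msm_pts_ev[OF D(1)]]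
 proof eventually_elim
  case (elim w)
  have "trunc k (ch w) = \<psi> (f w)" using elim(2,5) by (intro Rn_eqI[of _ k]) auto
  thus ?case using elim by simp
 qed
 hence "near X (Th (ch w)) (%w. h w = H (trunc k (ch w)))" using C(3) by simp
 from msm_lim[where f = Th, OF C(2) this] C(7)
 have ev: "near (euclid n) (ch w) (%x. h (Th x) = H (trunc k x))" by eventually_elim simp
 have sm: "smooth_fun n (%x. H (trunc k x))" by (rule smooth_compose[OF H(1)]) (rule smooth_coord)
 have tk: "trunc k (ch w) = \<psi> (f w)" using nb_self[OF e C(4)] D(5) by (intro Rn_eqI[of _ k]) auto
 have "pd i (%x. h (Th x)) (ch w) = pd i (%x. H (trunc k x)) (ch w)"
  by (rule fsm_euclid_DERIV(2)[OF fsm_cong[OF fsm_smooth[OF sm C(5)] ev] i sm ev])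
 also have "\<dots> = (\<Sum>l<k. pd l H (trunc k (ch w)) * pd i (%x. x l) (ch w))"
  by (rule pd_compose[OF H(1) smooth_coord i C(5)])
 also have "\<dots> = (\<Sum>l<k. if l = i then pd l H (\<psi> (f w)) else 0)"
  by (rule sum.cong) (auto simp: tk pd_def)
 also have "\<dots> = (if i < k then pd i H (\<psi> (f w)) else 0)" by simp
 also have "\<dots> = (if i < k then pd i (%x. a (T x)) (\<psi> (f w)) else 0)"
  using fsm_euclid_DERIV(2)[OF msm_cinf[OF D(2) a] _ H] by simp
 finally show ?thesis .
qed

lemma zero_vfield: "manifold X ==> (%_ _. 0) \<in> ker_c X N f"
 using cinf_const[of X 0] manifold_dspace[of X]
 by (auto simp: ker_c_def vfields_c_def vfields_def supp_def)

locale subm =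
 fixes X :: "'u smooth_space" and N :: "'n smooth_space" and f u k \<psi> T n ch Th
 assumes X: "manifold X" and N: "manifold N" and sub: "submersion X N f" and u: "u \<in> pts X" and d: "is_chart N (f u) k \<psi> T"
  and c: "is_chart X u n ch Th" and kn: "k \<le> n" and e: "near X u (%w. \<forall>j<k. ch w j = \<psi> (f w) j)"
begin

lemma fm: "w \<in> pts X ==> msm X N f w"
 using sub smooth_map_iff[OF manifold_dspace[OF X]] by (auto simp: submersion_def)

lemma pull_f: "a \<in> cinf N ==> pull (pts X) f a \<in> cinf X"
 using sub by (auto simp: submersion_def smooth_map_def)

lemma pull_ev: "near X w (%w. pull (pts X) f a w = a (f w))"
 using nb_pts by eventually_elim (simp add: pull_def)

lemma ad_ev: "near X u (%w. \<forall>a\<in>cinf N. \<forall>i<n. pd i (%x. pull (pts X) f a (Th x)) (ch w) =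
  (if i < k then pd i (%x. a (T x)) (\<psi> (f w)) else 0))"
 using is_chart_ev[OF c] msm_lim[OF fm[OF u] is_chart_ev[OF d]] nb_ev[OF e] nb_pts
proof eventually_elim
 case (elim w)
 show ?case by (intro ballI allI impI adapted_pd[OF elim(1,2) kn fm[OF elim(4)] elim(3) _ pull_ev])
qed

text \<open>The cut-off is supported where the charts stay adapted, so the truncated coordinate
  field annihilates pulled back functions everywhere and lies in \<open>ker_c\<close>.\<close>

lemma vertical: "k \<le> i ==> i < n ==> \<exists>V\<in>ker_c X N f. near X u (%w. \<forall>a\<in>cinf X. V a w = pd i (%x. a (Th x)) (ch w))"
proof -
 assume ki: "k \<le> i" and i: "i < n"
 obtain A \<rho> where A: "A \<in> vfields_c X" "near X u (%w. \<rho> w = 1)" "\<forall>w. \<rho> w \<noteq> 0 --> (\<forall>a\<in>cinf N. \<forall>i<n.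
   pd i (%x. pull (pts X) f a (Th x)) (ch w) = (if i < k then pd i (%x. a (T x)) (\<psi> (f w)) else 0))"
  "\<forall>a\<in>cinf X. \<forall>w. A a w = \<rho> w * (\<Sum>l<n. (if l = i then 1 else 0) * pd l (%x. a (Th x)) (ch w))"
  using chart_vfield[OF X c _ ad_ev, of "%l _. if l = i then 1 else 0"] fsm_const[OF u] by blast
 have Aw: "A a w = \<rho> w * pd i (%x. a (Th x)) (ch w)" if "a \<in> cinf X" for a w
 proof -
  have "(\<Sum>l<n. (if l = i then 1 else 0) * pd l (%x. a (Th x)) (ch w)) = (\<Sum>l<n. if l = i then pd l (%x. a (Th x)) (ch w) else 0)"
   by (rule sum.cong) auto
  thus ?thesis using A(4) that i by simp
 qed
 have "A (pull (pts X) f a) w = 0" if "a \<in> cinf N" for a w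
  using Aw[OF pull_f[OF that]] A(3) that i ki by (cases "\<rho> w = 0") auto
 hence "A \<in> ker_c X N f" using A(1) by (auto simp: ker_c_def)
 moreover have "near X u (%w. \<forall>a\<in>cinf X. A a w = pd i (%x. a (Th x)) (ch w))"
  using A(2) by eventually_elim (simp add: Aw)
 ultimately show ?thesis by blast
qed

text \<open>The horizontal lift takes the coefficients of \<open>Y\<close> in the first k
  coordinates and 0 in the others. After the cut-off it projects to \<rho> times \<open>Y\<close>, a
  single term of the required form.\<close>

lemma lift:
 assumes Y: "Y \<in> F" "Y \<in> vfields N" and \<alpha>: "\<And>j. smooth_fun k (\<alpha> j)"
  "near N (f u) (%y. \<forall>a\<in>cinf N. Y a y = (\<Sum>j<k. pd j (%x. a (T x)) (\<psi> y) * \<alpha> j (\<psi> y)))"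
 shows "\<exists>A\<in>pullback_fol X N f F. (near X u (%w. \<forall>a\<in>cinf N. A (pull (pts X) f a) w = Y a (f w))) \<and>
  (near X u (%w. \<forall>a\<in>cinf X. A a w = (\<Sum>j<k. \<alpha> j (\<psi> (f w)) * pd j (%x. a (Th x)) (ch w))))"
proof -
 let ?g = "%i w. if i < k then \<alpha> i (\<psi> (f w)) else 0"
 have g: "fsm X (?g i) u" for i
  using msm_fsm[OF fsm_smooth[OF \<alpha>(1)] msm_comp[OF fm[OF u] is_chartD(1)[OF d]]] is_chartD(5)[OF d] fsm_const[OF u] by (intro fsm_if) auto
 have R: "near X u (%w. (\<forall>a\<in>cinf N. \<forall>i<n. pd i (%x. pull (pts X) f a (Th x)) (ch w) =
  (if i < k then pd i (%x. a (T x)) (\<psi> (f w)) else 0)) \<and> (\<forall>a\<in>cinf N. Y a (f w) = (\<Sum>j<k. pd j (%x. a (T x)) (\<psi> (f w)) * \<alpha> j (\<psi> (f w)))))"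
  using ad_ev msm_lim[OF fm[OF u] \<alpha>(2)] by eventually_elim blast
 obtain A \<rho> where A: "A \<in> vfields_c X" "\<rho> \<in> cinf_c X" "near X u (%w. \<rho> w = 1)" "\<forall>w. \<rho> w \<noteq> 0 --> ((\<forall>a\<in>cinf N. \<forall>i<n.
   pd i (%x. pull (pts X) f a (Th x)) (ch w) = (if i < k then pd i (%x. a (T x)) (\<psi> (f w)) else 0)) \<and>
   (\<forall>a\<in>cinf N. Y a (f w) = (\<Sum>j<k. pd j (%x. a (T x)) (\<psi> (f w)) * \<alpha> j (\<psi> (f w)))))"
  "\<forall>a\<in>cinf X. \<forall>w. A a w = \<rho> w * (\<Sum>i<n. ?g i w * pd i (%x. a (Th x)) (ch w))"
  using chart_vfield[where g = ?g, OF X c g R] by blast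
 have sk: "(\<Sum>i<n. ?g i w * h i) = (\<Sum>j<k. \<alpha> j (\<psi> (f w)) * h j)" for w h
  by (rule sum.mono_neutral_cong_right) (use kn in auto)
 have Af: "A (pull (pts X) f a) w = \<rho> w * Y a (f w)" if a: "a \<in> cinf N" for a w
 proof (cases "\<rho> w = 0")
  case False
  have "(\<Sum>j<k. \<alpha> j (\<psi> (f w)) * pd j (%x. pull (pts X) f a (Th x)) (ch w)) = Y a (f w)"
   using A(4)[rule_format, OF False] a kn by (auto intro!: sum.cong)
  thus ?thesis using A(5) pull_f[OF a] sk by simp
 qed (use A(5) pull_f[OF a] in simp)
 have "A \<in> pullback_fol X N f F"
  unfolding pullback_fol_def
  by (intro CollectI conjI A(1) exI[of _ 1] exI[of _ "%_. \<rho>"] exI[of _ "%_. Y"]) (use A Y Af in auto)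
 moreover have "near X u (%w. \<forall>a\<in>cinf N. A (pull (pts X) f a) w = Y a (f w))" using A(3) by eventually_elim (simp add: Af)
 moreover have "near X u (%w. \<forall>a\<in>cinf X. A a w = (\<Sum>j<k. \<alpha> j (\<psi> (f w)) * pd j (%x. a (Th x)) (ch w)))"
  using A(3) by eventually_elim (use A(5) sk in simp)
 ultimately show ?thesis by blast
qed

end

lemma subm_exists:
 assumes "manifold X" "manifold N" "submersion X N f" "u \<in> pts X"
 shows "\<exists>k \<psi> T n ch Th. subm X N f u k \<psi> T n ch Th"
proof -
 have "f u \<in> pts N" using assms by (auto simp: submersion_def smooth_map_def)
 then obtain k \<psi> T where d: "is_chart N (f u) k \<psi> T" using manifold_chart[OF assms(2)] by blast
 from adapted_chart[OF assms(1,3,4) d manifold_dspace[OF assms(2)]] show ?thesis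
  using assms d unfolding subm_def by blast
qed

section \<open>Lifting properties of bisubmersions\<close>

text \<open>The map is locally a product projection, with fibre coordinates \<open>l\<close> and
  inverse \<Theta>. Unlike surjectivity on tangent spaces, this passes directly to fibre products,
  whatever their structure.\<close>

definition striv where
 "striv X N f u \<longleftrightarrow> msm X N f u \<and> (\<exists>k l \<Theta>. msm X (euclid k) l u \<and> msm (sprod (euclid k) N) X \<Theta> (l u, f u) \<and>
  (near X u (%w. \<Theta> (l w, f w) = w)) \<and> (near (sprod (euclid k) N) (l u, f u) (%p. f (\<Theta> p) = snd p)))"

text \<open>A family moving along the foliation, with its velocity exhibited by the list.\<close>

definition vel_fam where
 "vel_fam F N Q y w L \<longleftrightarrow> msm (RX Q) N y w \<and> (\<forall>(g, X)\<in>set L. fsm (RX Q) g w \<and> X \<in> F) \<and>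
  (near (RX Q) w (%w'. \<forall>a\<in>cinf N. tder (%x. a (y x)) w' = vel L a w' (y w')))"

text \<open>The target follows the given motion while the source keeps its initial value. The last
  clause, rest of the lift when all coefficients vanish at \<open>th0\<close>, later identifies the
  image point of a constructed morphism.\<close>

definition is_lift where
 "is_lift B Q y z0 th0 L z \<longleftrightarrow> msm (RX Q) (total B) z (0, th0) \<and> (near Q th0 (%th. z (0, th) = z0 th)) \<and>
  (near (RX Q) (0, th0) (%w. tgt B (z w) = y w \<and> src B (z w) = src B (z0 (snd w)))) \<and>
  ((\<forall>(g, X)\<in>set L. \<forall>\<tau>. g (\<tau>, th0) = 0) --> (\<forall>\<^sub>F \<tau> in nhds 0. z (\<tau>, th0) = z0 th0))"

text \<open>The properties of a bisubmersion that are used; unlike the definition they are visibly stable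
 under composition and pullback. The type argument is that of the parameter space of families.\<close>

definition good :: "'q itself => 'n smooth_space => 'n vfield set => ('u, 'n) bisub => bool" where
 "good _ N F B \<longleftrightarrow> dspace (total B) \<and>
  (\<forall>u\<in>pts (total B). msm (total B) N (tgt B) u \<and> striv (total B) N (src B) u) \<and>
  (\<forall>(Q :: 'q smooth_space) z w L. msm (RX Q) (total B) z w --> vel_fam F N Q (%x. src B (z x)) w L -->
    (\<exists>L'. vel_fam F N Q (%x. tgt B (z x)) w L')) \<and>
  (\<forall>(Q :: 'q smooth_space) y z0 th0 L. vel_fam F N Q y (0, th0) L --> msm Q (total B) z0 th0 -->
    (near Q th0 (%th. tgt B (z0 th) = y (0, th))) --> (\<exists>z. is_lift B Q y z0 th0 L z))"

lemma tder_cong: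
 assumes "near (RX Q) w (%x. f x = g x)" "w \<in> pts (RX Q)"
 shows "tder f w = tder g w"
proof -
 obtain \<tau> th where w: "w = (\<tau>, th)" "th \<in> pts Q" using assms(2) by auto
 obtain e where e: "e > 0" "\<And>r. \<bar>r - \<tau>\<bar> < e ==> f (r, th) = g (r, th)" using RX_slice[OF assms(1)[unfolded w(1)] w(2)] by blast
 have "\<forall>\<^sub>F r in nhds \<tau>. f (r, th) = g (r, th)" unfolding eventually_nhds_metric dist_real_def using e by blast
 thus ?thesis by (simp add: tder_def w(1) deriv_cong_ev)
qed

lemma vel_concat:
 "vel (concat (map (%(g, A). map (%(u, Y). (%w. g w * u (z w), Y)) (S A)) M)) a w y =
  (\<Sum>(g, A)\<leftarrow>M. g w * vel (S A) a (z w) y)"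
proof (induction M)
 case (Cons m M)
 obtain g A where m: "m = (g, A)" by fastforce
 have "vel (map (%(u, Y). (%w. g w * u (z w), Y)) l) a w y = g w * vel l a (z w) y" for l
  by (induction l) (auto simp: algebra_simps)
 thus ?case using Cons m by simp
qed simp

lemma (in subm) striv: "striv X N f u"
proof -
 note C = is_chartD[OF c] and D = is_chartD[OF d]
 define m where "m = n - k"
 have n: "n = k + m" using kn by (simp add: m_def)
 define l where "l w = trunc m (%j. ch w (k + j))" for w
 define \<Theta> where "\<Theta> p = Th (cat k (\<psi> (snd p)) (fst p))" for p :: "(nat => real) \<times> 'n"
 let ?S = "sprod (euclid m) N"
 have p0: "(l u, f u) \<in> Rn m \<times> pts N" using msm_tgt[OF fm[OF u]] by (simp add: l_def)
 have lm: "msm X (euclid m) l u"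
  by (rule msm_euclidI) (use msm_euclidD[OF C(1)] u in "auto simp: l_def")
 have cl: "cat k (\<psi> (f w)) (l w) = ch w" if "\<forall>j<k. ch w j = \<psi> (f w) j" "ch w \<in> Rn n" for w
  by (rule Rn_eqI[of _ n]) (use that n in "auto simp: cat_def l_def Rn_def trunc_def")
 have clu: "cat k (\<psi> (f u)) (l u) = ch u" by (rule cl) (use nb_self[OF e u] C(5) in auto)
 have s0: "msm ?S N snd (l u, f u)" and f0: "msm ?S (euclid m) fst (l u, f u)" using p0 by (auto intro: msm_snd msm_fst)
 have \<psi>0: "msm ?S (euclid k) (%p. \<psi> (snd p)) (l u, f u)" by (rule msm_comp[OF s0]) (use D(1) in simp)
 have cm: "msm ?S (euclid n) (%p. cat k (\<psi> (snd p)) (fst p)) (l u, f u)"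
 proof (rule msm_euclidI)
  show "fsm ?S (%p. cat k (\<psi> (snd p)) (fst p) i) (l u, f u)" for i
   using msm_euclidD[OF \<psi>0] msm_euclidD[OF f0] by (auto simp: cat_def intro!: fsm_if)
  show "near ?S (l u, f u) (%p. cat k (\<psi> (snd p)) (fst p) \<in> Rn n)"
   using nb_pts by eventually_elim (auto simp: n)
 qed (use p0 in auto)
 have \<Theta>m: "msm ?S X \<Theta> (l u, f u)" unfolding \<Theta>_def by (rule msm_comp[OF cm]) (use C(2) clu in simp)
 have \<Theta>u: "\<Theta> (l u, f u) = u" by (simp add: \<Theta>_def clu C)
 have "near X u (%w. \<Theta> (l w, f w) = w)"
  using e C(6) msm_pts_ev[OF C(1)] by eventually_elim (simp add: \<Theta>_def cl)
 moreover have "near ?S (l u, f u) (%p. f (\<Theta> p) = snd p)"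
 proof -
  have 1: "near ?S (l u, f u) (%p. ch (\<Theta> p) = cat k (\<psi> (snd p)) (fst p))"
   using msm_lim[OF cm] C(7) by (simp add: \<Theta>_def clu)
  have 2: "near ?S (l u, f u) (%p. (\<forall>j<k. ch (\<Theta> p) j = \<psi> (f (\<Theta> p)) j) \<and> T (\<psi> (f (\<Theta> p))) = f (\<Theta> p) \<and> \<psi> (f (\<Theta> p)) \<in> Rn k)"
  proof (rule msm_lim[OF \<Theta>m])
   from e msm_lim[OF fm[OF u] D(6)] msm_lim[OF fm[OF u] msm_pts_ev[OF D(1)]]
   show "near X (\<Theta> (l u, f u)) (%w. (\<forall>j<k. ch w j = \<psi> (f w) j) \<and> T (\<psi> (f w)) = f w \<and> \<psi> (f w) \<in> Rn k)"
    unfolding \<Theta>u by eventually_elim simp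
  qed
  have 3: "near ?S (l u, f u) (%p. T (\<psi> (snd p)) = snd p)" by (rule msm_lim[OF s0]) (use D(6) in simp)
  have 4: "near ?S (l u, f u) (%p. \<psi> (snd p) \<in> Rn k)" using msm_pts_ev[OF \<psi>0] by simp
  from 1 2 3 4 show ?thesis
  proof eventually_elim
   case (elim p)
   have "\<psi> (f (\<Theta> p)) = \<psi> (snd p)" by (rule Rn_eqI[of _ k]) (use elim in auto)
   thus ?case using elim(2,3) by metis
  qed
 qed
 ultimately show ?thesis using lm \<Theta>m fm[OF u] unfolding striv_def by blast
qed

lemma family_const:
 assumes N: "manifold N" and z: "\<And>r. abs r < e ==> msm (RX Q) N z (r, th) \<and> (\<forall>a\<in>cinf N. tder (%w. a (z w)) (r, th) = 0)" and r: "abs r < e"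
 shows "z (r, th) = z (0, th)"
proof (rule cinf_separates[OF N])
 show "z (r, th) \<in> pts N" "z (0, th) \<in> pts N" using msm_tgt[of "RX Q" N z] z[OF r] z[of 0] r by auto
 fix a assume a: "a \<in> cinf N"
 show "a (z (r, th)) = a (z (0, th))"
  by (rule zero_derivative_const[OF _ r, of "%r. a (z (r, th))"]) (use msm_DERIV[OF _ a] z a in metis)
qed

lemma pullback_list:
 assumes "A \<in> pullback_fol P N f F"
 shows "\<exists>S. (\<forall>(u, Y)\<in>set S. u \<in> cinf P \<and> Y \<in> F) \<and> (\<forall>a\<in>cinf N. \<forall>p\<in>pts P. A (pull (pts P) f a) p = vel S a p (f p))"
proof -
 from assms obtain k u Y where A: "\<forall>i<k. u i \<in> cinf_c P \<and> Y i \<in> F"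
  "\<forall>a\<in>cinf N. \<forall>p\<in>pts P. A (pull (pts P) f a) p = (\<Sum>i<(k::nat). u i p * Y i a (f p))" unfolding pullback_fol_def by blast
 show ?thesis
  by (rule exI[of _ "map (%i. (u i, Y i)) [0..<k]"])
   (use A in "auto simp: cinf_c_def o_def interv_sum_list_conv_sum_set_nat atLeast0LessThan")
qed

lemma vadd_0: "vadd A (%_ _. 0) = A"
 by (simp add: vadd_def)

lemma vel_fam_mono: "vel_fam F N Q y w L ==> F \<subseteq> F' ==> vel_fam F' N Q y w L"
 unfolding vel_fam_def by auto

lemma vel_fam_cong:
 assumes L: "vel_fam F N Q y w L" and e: "near (RX Q) w (%x. y' x = y x)"
 shows "vel_fam F N Q y' w L"
proof -
 have m: "msm (RX Q) N y w" using L by (simp add: vel_fam_def)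
 have "near (RX Q) w (%x. \<forall>a\<in>cinf N. tder (%x. a (y x)) x = vel L a x (y x))" using L by (simp add: vel_fam_def)
 from this nb_ev[OF e] nb_pts have "near (RX Q) w (%x. \<forall>a\<in>cinf N. tder (%x. a (y' x)) x = vel L a x (y' x))"
 proof eventually_elim
  case (elim x)
  have "tder (%x. a (y' x)) x = tder (%x. a (y x)) x" for a
   by (rule tder_cong[OF _ elim(3)]) (use elim(2) in "auto elim: eventually_mono")
  thus ?case using elim(1) nb_self[OF elim(2,3)] by simp
 qed
 thus ?thesis using L msm_cong[OF m e] by (simp add: vel_fam_def)
qed

lemma submersion_msm: "dspace X ==> submersion X N f ==> w \<in> pts X ==> msm X N f w"
 by (simp add: submersion_def smooth_map_iff)

text \<open>Replacing each field by its expression in pulled back form multiplies the coefficients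
  along the family. Vanishing coefficients stay zero, which is recorded for the rest clause of
  \<open>is_lift\<close>.\<close>

lemma vel_fam_push:
 assumes dX: "dspace X" and t: "submersion X N f" and M: "vel_fam (pullback_fol X N f F) X Q z w M"
 shows "\<exists>L. vel_fam F N Q (%x. f (z x)) w L \<and> (\<forall>x. (\<forall>(g, X)\<in>set M. g x = 0) --> (\<forall>(g, X)\<in>set L. g x = 0))"
proof -
 from M have z: "msm (RX Q) X z w" and MA: "\<And>g A. (g, A) \<in> set M ==> fsm (RX Q) g w \<and> A \<in> pullback_fol X N f F"
  and main: "near (RX Q) w (%x. \<forall>a\<in>cinf X. tder (%x. a (z x)) x = vel M a x (z x))"
  unfolding vel_fam_def by auto
 have "\<forall>A. \<exists>S. A \<in> pullback_fol X N f F --> (\<forall>(u, Y)\<in>set S. u \<in> cinf X \<and> Y \<in> F) \<and>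
   (\<forall>a\<in>cinf N. \<forall>p\<in>pts X. A (pull (pts X) f a) p = vel S a p (f p))" using pullback_list by blast
 from choice[OF this] obtain S where S: "\<And>A. A \<in> pullback_fol X N f F ==> (\<forall>(u, Y)\<in>set (S A). u \<in> cinf X \<and> Y \<in> F) \<and>
   (\<forall>a\<in>cinf N. \<forall>p\<in>pts X. A (pull (pts X) f a) p = vel (S A) a p (f p))" by blast
 define L where "L = concat (map (%(g, A). map (%(u, Y). (%x. g x * u (z x), Y)) (S A)) M)"
 have "vel_fam F N Q (%x. f (z x)) w L"
  unfolding vel_fam_def
 proof (intro conjI)
  show "msm (RX Q) N (%x. f (z x)) w" by (rule msm_comp[OF z submersion_msm[OF dX t msm_tgt[OF z]]])
  show "\<forall>(g, Y)\<in>set L. fsm (RX Q) g w \<and> Y \<in> F"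
   using MA S by (fastforce simp: L_def intro!: fsm_mult msm_cinf[OF z])
  from main msm_ev[OF z] show "near (RX Q) w (%x. \<forall>a\<in>cinf N. tder (%x. a (f (z x))) x = vel L a x (f (z x)))"
  proof eventually_elim
   case (elim x)
   show ?case
   proof
    fix a assume a: "a \<in> cinf N"
    have pc: "pull (pts X) f a \<in> cinf X" using t a by (auto simp: submersion_def smooth_map_def)
    have zx: "z x \<in> pts X" by (rule msm_tgt[OF elim(2)])
    have "tder (%x. a (f (z x))) x = tder (%x. pull (pts X) f a (z x)) x"
     by (rule tder_cong) (use msm_pts_ev[OF elim(2)] msm_src[OF elim(2)] in "auto simp: pull_def elim: eventually_mono")
    also have "\<dots> = vel M (pull (pts X) f a) x (z x)" using elim(1) pc by blast
    also have "\<dots> = (\<Sum>(g, A)\<leftarrow>M. g x * vel (S A) a (z x) (f (z x)))"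
     by (intro arg_cong[of _ _ sum_list] map_cong refl) (use MA S a zx in fastforce)
    also have "\<dots> = vel L a x (f (z x))" unfolding L_def vel_concat ..
    finally show "tder (%x. a (f (z x))) x = vel L a x (f (z x))" .
   qed
  qed
 qed
 thus ?thesis by (intro exI[of _ L]) (auto simp: L_def)
qed

text \<open>Downstairs only the first k coordinates of the velocity are known; they are produced by
  the lifts of the fields. The others are arbitrary and are absorbed by vertical fields.\<close>

lemma vel_fam_lift:
 assumes X: "manifold X" and N: "manifold N" and s: "submersion X N f" and F: "F \<subseteq> vfields N"
  and z: "msm (RX Q) X z w" and L: "vel_fam F N Q (%x. f (z x)) w L"
 shows "\<exists>M. vel_fam (pullback_fol X N f F \<union> ker_c X N f) X Q z w M"
proof -
 note dN = manifold_dspace[OF N] and Fv = subsetD[OF F]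
 have u: "z w \<in> pts X" by (rule msm_tgt[OF z])
 have wp: "w \<in> pts (RX Q)" by (rule msm_src[OF z])
 from subm_exists[OF X N s u] obtain k \<psi> T n ch Th where sb: "subm X N f (z w) k \<psi> T n ch Th" by blast
 interpret subm X N f "z w" k \<psi> T n ch Th by (rule sb)
 note C = is_chartD[OF c] and D = is_chartD[OF d]
 from L have LF: "\<And>g Y. (g, Y) \<in> set L ==> fsm (RX Q) g w \<and> Y \<in> F"
  and Lv: "near (RX Q) w (%w'. \<forall>a\<in>cinf N. tder (%x. a (f (z x))) w' = vel L a w' (f (z w')))"
  unfolding vel_fam_def by auto
 have "\<forall>Y. \<exists>\<alpha>. Y \<in> F --> (\<forall>j. smooth_fun k (\<alpha> j)) \<and> (near N (f (z w)) (%y. \<forall>a\<in>cinf N.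
  Y a y = (\<Sum>j<k. pd j (%x. a (T x)) (\<psi> y) * \<alpha> j (\<psi> y))))" using vf_coord[OF d dN Fv] by blast
 from choice[OF this] obtain \<alpha> where \<alpha>: "\<And>Y j. Y \<in> F ==> smooth_fun k (\<alpha> Y j)"
  "\<And>Y. Y \<in> F ==> near N (f (z w)) (%y. \<forall>a\<in>cinf N. Y a y = (\<Sum>j<k. pd j (%x. a (T x)) (\<psi> y) * \<alpha> Y j (\<psi> y)))" by blast
 have "\<forall>Y. \<exists>A. Y \<in> F --> A \<in> pullback_fol X N f F \<and>
  (near X (z w) (%x. \<forall>a\<in>cinf X. A a x = (\<Sum>j<k. \<alpha> Y j (\<psi> (f x)) * pd j (%x. a (Th x)) (ch x))))"
  using lift[OF _ Fv \<alpha>] by blast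
 from choice[OF this] obtain A where A: "\<And>Y. Y \<in> F ==> A Y \<in> pullback_fol X N f F"
  "\<And>Y. Y \<in> F ==> near X (z w) (%x. \<forall>a\<in>cinf X. A Y a x = (\<Sum>j<k. \<alpha> Y j (\<psi> (f x)) * pd j (%x. a (Th x)) (ch x)))" by blast
 have "\<forall>i. \<exists>V. k \<le> i \<and> i < n --> V \<in> ker_c X N f \<and> (near X (z w) (%x. \<forall>a\<in>cinf X. V a x = pd i (%x. a (Th x)) (ch x)))"
  using vertical by blast
 from choice[OF this] obtain V where V: "\<And>i. k \<le> i ==> i < n ==> V i \<in> ker_c X N f"
  "\<And>i. k \<le> i ==> i < n ==> near X (z w) (%x. \<forall>a\<in>cinf X. V i a x = pd i (%x. a (Th x)) (ch x))" by blast
 \<comment> \<open>The lifted fields keep their coefficients; the vertical coordinate fields get the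
   time derivatives of the remaining coordinates of the family.\<close>
 define M where "M = map (%(g, Y). (g, A Y)) L @ map (%i. (tder (%x. ch (z x) i), V i)) [k..<n]"
 have chz: "msm (RX Q) (euclid n) (%x. ch (z x)) w" by (rule msm_comp[OF z C(1)])
 have main: "near (RX Q) w (%x. \<forall>a\<in>cinf X. tder (%x. a (z x)) x = vel M a x (z x))"
 proof -
  obtain kc where kc: "\<And>j. kc j \<in> cinf N" "near N (f (z w)) (%y. trunc k (%j. kc j y) = \<psi> y)"
   using chart_coords[OF d dN] by blast
  have sz: "msm (RX Q) N (%x. f (z x)) w" by (rule msm_comp[OF z submersion_msm[OF manifold_dspace[OF X] s u]])
  have E1: "near (RX Q) w (%x. \<forall>p\<in>set L. \<forall>a\<in>cinf X. A (snd p) a (z x) = (\<Sum>j<k. \<alpha> (snd p) j (\<psi> (f (z x))) * pd j (%x. a (Th x)) (ch (z x))))"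
   using LF by (intro eventually_ball_finite ballI msm_lim[OF z A(2)]) auto
  have E2: "near (RX Q) w (%x. \<forall>i\<in>{k..<n}. \<forall>a\<in>cinf X. V i a (z x) = pd i (%x. a (Th x)) (ch (z x)))"
   by (intro eventually_ball_finite ballI msm_lim[OF z V(2)]) auto
  have E3: "near (RX Q) w (%x. \<forall>p\<in>set L. \<forall>a\<in>cinf N. (snd p) a (f (z x)) = (\<Sum>j<k. pd j (%x. a (T x)) (\<psi> (f (z x))) * \<alpha> (snd p) j (\<psi> (f (z x)))))"
   using LF by (intro eventually_ball_finite ballI msm_lim[OF sz \<alpha>(2)]) auto
  have E4: "near (RX Q) w (%x. near (RX Q) x (%x. \<forall>j<k. ch (z x) j = \<psi> (f (z x)) j))" by (rule nb_ev[OF msm_lim[OF z e]])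
  have E5: "near (RX Q) w (%x. is_chart X (z x) n ch Th)" by (rule msm_lim[OF z is_chart_ev[OF c]])
  have E6: "near (RX Q) w (%x. is_chart N (f (z x)) k \<psi> T)" by (rule msm_lim[OF sz is_chart_ev[OF d]])
  have E7: "near (RX Q) w (%x. near N (f (z x)) (%y. trunc k (%j. kc j y) = \<psi> y))" by (rule msm_lim[OF sz nb_ev[OF kc(2)]])
  show ?thesis
   using E1 E2 E3 E4 E5 E6 E7 Lv msm_ev[OF z] msm_ev[OF sz]
  proof eventually_elim
   case (elim x)
   note C' = is_chartD[OF elim(5)] and D' = is_chartD[OF elim(6)]
   have xp: "x \<in> pts (RX Q)" by (rule msm_src[OF elim(9)])
   have t1: "tder (%x. ch (z x) i) x = (\<Sum>(g, Y)\<leftarrow>L. g x * \<alpha> Y i (\<psi> (f (z x))))" if i: "i < k" for i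
   proof -
    have kn': "near N (f (z x)) (%y. kc i y = \<psi> y i)"
     using elim(7) by eventually_elim (metis i trunc_apply)
    have "tder (%x. ch (z x) i) x = tder (%x. kc i (f (z x))) x"
     by (rule tder_cong[OF _ xp]) (use elim(4) msm_lim[OF elim(10) kn'] i in "auto elim: eventually_elim2")
    also have "\<dots> = vel L (kc i) x (f (z x))" using elim(8) kc(1) by blast
    also have "\<dots> = (\<Sum>(g, Y)\<leftarrow>L. g x * \<alpha> Y i (\<psi> (f (z x))))"
    proof (intro arg_cong[of _ _ sum_list] map_cong refl)
     fix p assume p: "p \<in> set L"
     have "snd p (kc i) (f (z x)) = (\<Sum>j<k. (if j = i then 1 else 0) * \<alpha> (snd p) j (\<psi> (f (z x))))"
      using elim(3) p kc(1) pd_coord[OF elim(6) _ kn'] by auto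
     also have "\<dots> = (\<Sum>j<k. if j = i then \<alpha> (snd p) j (\<psi> (f (z x))) else 0)" by (intro sum.cong) auto
     finally have "snd p (kc i) (f (z x)) = (\<Sum>j<k. if j = i then \<alpha> (snd p) j (\<psi> (f (z x))) else 0)" .
     thus "(case p of (g, Y) => g x * Y (kc i) (f (z x))) = (case p of (g, Y) => g x * \<alpha> Y i (\<psi> (f (z x))))"
      using i by (simp add: case_prod_beta)
    qed
    finally show ?thesis .
   qed
   show ?case
   proof
    fix a assume a: "a \<in> cinf X"
    let ?p = "%i. pd i (%x. a (Th x)) (ch (z x))"
    have "tder (%x. a (z x)) x = tder (%x. a (Th (ch (z x)))) x"
     by (rule tder_cong[OF _ xp]) (use msm_lim[OF elim(9) C'(6)] in "auto elim: eventually_mono")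
    also have "\<dots> = (\<Sum>i<n. ?p i * tder (%x. ch (z x) i) x)"
     by (rule chain_tder[OF msm_comp[OF elim(9) C'(1)] msm_cinf[OF C'(2) a]])
    also have "\<dots> = (\<Sum>i<k. ?p i * tder (%x. ch (z x) i) x) + (\<Sum>i=k..<n. ?p i * tder (%x. ch (z x) i) x)"
     using kn by (simp add: lessThan_atLeast0 sum.atLeastLessThan_concat)
    also have "(\<Sum>i<k. ?p i * tder (%x. ch (z x) i) x) = (\<Sum>(g, Y)\<leftarrow>L. g x * A Y a (z x))"
    proof -
     have "(\<Sum>i<k. ?p i * tder (%x. ch (z x) i) x) = (\<Sum>i<k. \<Sum>p\<leftarrow>L. fst p x * (\<alpha> (snd p) i (\<psi> (f (z x))) * ?p i))"
      by (rule sum.cong) (auto simp: t1 sum_list_const_mult[symmetric] case_prod_beta mult_ac)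
     also have "\<dots> = (\<Sum>p\<leftarrow>L. \<Sum>i<k. fst p x * (\<alpha> (snd p) i (\<psi> (f (z x))) * ?p i))"
      by (induction L) (simp_all add: sum.distrib)
     also have "\<dots> = (\<Sum>(g, Y)\<leftarrow>L. g x * A Y a (z x))"
      by (intro arg_cong[of _ _ sum_list] map_cong refl) (use elim(1) a in "auto simp: sum_distrib_left case_prod_beta")
     finally show ?thesis .
    qed
    also have "(\<Sum>i=k..<n. ?p i * tder (%x. ch (z x) i) x) = (\<Sum>i\<leftarrow>[k..<n]. tder (%x. ch (z x) i) x * V i a (z x))"
     using elim(2) a by (simp add: interv_sum_list_conv_sum_set_nat mult.commute)
    finally show "tder (%x. a (z x)) x = vel M a x (z x)"
     by (simp add: M_def o_def case_prod_beta)
   qed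
  qed
 qed
 have "fsm (RX Q) g w \<and> A' \<in> pullback_fol X N f F \<union> ker_c X N f" if "(g, A') \<in> set M" for g A'
  using that LF A(1) V(1) RX_deriv(1)[of Q _ "fst w" "snd w"] msm_euclidD[OF chz] by (auto simp: M_def)
 thus ?thesis using z main unfolding vel_fam_def by (intro exI[of _ M]) auto
qed

text \<open>Velocities pass from source to target because the two pullbacks coincide and contain the
  fields vertical for the source. Motions of the target lift because each field of the foliation has
  a lift tangent to the source fibres.\<close>

lemma bisub_good:
 assumes N: "manifold N" and F: "F \<subseteq> vfields_c N" and B: "bisubmersion N F B"
 shows "good TYPE('q) N F B"
 unfolding good_def
proof (intro conjI ballI allI impI)
 let ?X = "total B"
 have X: "manifold ?X" and t: "submersion ?X N (tgt B)" and s: "submersion ?X N (src B)"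
  and st: "pullback_fol ?X N (src B) F = pullback_fol ?X N (tgt B) F"
  and pf: "pullback_fol ?X N (src B) F = {vadd A A' | A A'. A \<in> ker_c ?X N (src B) \<and> A' \<in> ker_c ?X N (tgt B)}"
  using B unfolding bisubmersion_def by auto
 have dX: "dspace ?X" and dN: "dspace N" using X N by (auto intro: manifold_dspace)
 have Fv: "Y \<in> vfields N" if "Y \<in> F" for Y using F that by (auto simp: vfields_c_def)
 note tm = submersion_msm[OF dX t] and sm = submersion_msm[OF dX s]
 show "dspace ?X" by (rule dX)
 show "msm ?X N (tgt B) u" if "u \<in> pts ?X" for u by (rule tm[OF that])
 show "striv ?X N (src B) u" if "u \<in> pts ?X" for u using subm_exists[OF X N s that] subm.striv by metis
 \<comment> \<open>In the decomposition of the pullback the summand vertical for the target may be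
   0.\<close>
 have vt: "V \<in> pullback_fol ?X N (tgt B) F" if "V \<in> ker_c ?X N (src B)" for V
  using that zero_vfield[OF X, of N "tgt B"] vadd_0[of V] unfolding st[symmetric] pf by (metis (mono_tags, lifting) mem_Collect_eq)
 show "\<exists>L'. vel_fam F N Q (%x. tgt B (z x)) w L'"
  if z: "msm (RX Q) ?X z w" and L: "vel_fam F N Q (%x. src B (z x)) w L" for Q :: "'q smooth_space" and z w L
 proof -
  obtain M where M: "vel_fam (pullback_fol ?X N (src B) F \<union> ker_c ?X N (src B)) ?X Q z w M"
   using vel_fam_lift[OF X N s _ z L] Fv by blast
  have "vel_fam (pullback_fol ?X N (tgt B) F) ?X Q z w M" by (rule vel_fam_mono[OF M]) (use vt st in auto)
  from vel_fam_push[OF dX t this] show ?thesis by blast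
 qed
 show "\<exists>z. is_lift B Q y z0 th0 L z"
  if L: "vel_fam F N Q y (0, th0) L" and z0: "msm Q ?X z0 th0" and ty: "near Q th0 (%th. tgt B (z0 th) = y (0, th))"
  for Q :: "'q smooth_space" and y z0 th0 L
 proof -
  have u: "z0 th0 \<in> pts ?X" by (rule msm_tgt[OF z0])
  have th0: "th0 \<in> pts Q" by (rule msm_src[OF z0])
  from subm_exists[OF X N t u] obtain k \<psi> T n ch Th where sb: "subm ?X N (tgt B) (z0 th0) k \<psi> T n ch Th" by blast
  interpret subm ?X N "tgt B" "z0 th0" k \<psi> T n ch Th by (rule sb)
  from L have ym: "msm (RX Q) N y (0, th0)" and LF: "\<And>g Y. (g, Y) \<in> set L ==> fsm (RX Q) g (0, th0) \<and> Y \<in> F"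
   and Lv: "near (RX Q) (0, th0) (%w'. \<forall>a\<in>cinf N. tder (%x. a (y x)) w' = vel L a w' (y w'))"
   unfolding vel_fam_def by auto
  have "\<exists>A. A \<in> ker_c ?X N (src B) \<and> (near ?X (z0 th0) (%w. \<forall>a\<in>cinf N. A (pull (pts ?X) (tgt B) a) w = Y a (tgt B w)))"
   if Y: "Y \<in> F" for Y
  proof -
   obtain \<alpha> where \<alpha>: "\<And>j. smooth_fun k (\<alpha> j)"
    "near N (tgt B (z0 th0)) (%y. \<forall>a\<in>cinf N. Y a y = (\<Sum>j<k. pd j (%x. a (T x)) (\<psi> y) * \<alpha> j (\<psi> y)))"
    using vf_coord[OF d dN Fv[OF Y]] by blast
   obtain C where C: "C \<in> pullback_fol ?X N (tgt B) F" "near ?X (z0 th0) (%w. \<forall>a\<in>cinf N. C (pull (pts ?X) (tgt B) a) w = Y a (tgt B w))"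
    using lift[OF Y Fv[OF Y] \<alpha>] by blast
   \<comment> \<open>\<open>A'\<close> is annihilated by the target map, so \<open>A\<close> alone
     still projects to \<open>Y\<close>, and it is tangent to the source fibres.\<close>
   then obtain A A' where A: "C = vadd A A'" "A \<in> ker_c ?X N (src B)" "A' \<in> ker_c ?X N (tgt B)" using st pf by blast
   have "A (pull (pts ?X) (tgt B) a) w = C (pull (pts ?X) (tgt B) a) w" if "a \<in> cinf N" for a w
    using A(3) that by (simp add: A(1) vadd_def ker_c_def)
   hence "near ?X (z0 th0) (%w. \<forall>a\<in>cinf N. A (pull (pts ?X) (tgt B) a) w = Y a (tgt B w))" using C(2) by simp
   thus ?thesis using A(2) by blast
  qed
  hence "\<forall>Y. \<exists>A. Y \<in> F --> A \<in> ker_c ?X N (src B) \<and>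
   (near ?X (z0 th0) (%w. \<forall>a\<in>cinf N. A (pull (pts ?X) (tgt B) a) w = Y a (tgt B w)))" by blast
  from choice[OF this] obtain A where A: "\<And>Y. Y \<in> F ==> A Y \<in> ker_c ?X N (src B)"
   "\<And>Y. Y \<in> F ==> near ?X (z0 th0) (%w. \<forall>a\<in>cinf N. A Y (pull (pts ?X) (tgt B) a) w = Y a (tgt B w))" by blast
  define L' where "L' = map (%(g, Y). (g, A Y)) L"
  have vL: "vel L' a w x = (\<Sum>(g, Y)\<leftarrow>L. g w * A Y a x)" for a w x unfolding L'_def by (induction L) auto
  have "\<exists>z. msm (RX Q) ?X z (0, th0) \<and> (near Q th0 (%th. z (0, th) = z0 th)) \<and>
   (near (RX Q) (0, th0) (%w. \<forall>a\<in>cinf ?X. tder (%w. a (z w)) w = vel L' a w (z w)))"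
   by (rule manifold_ode[OF X z0]) (use LF A(1) in "auto simp: L'_def ker_c_def vfields_c_def")
  then obtain z where z: "msm (RX Q) ?X z (0, th0)" and zz: "near Q th0 (%th. z (0, th) = z0 th)"
   and zv: "near (RX Q) (0, th0) (%w. \<forall>a\<in>cinf ?X. tder (%w. a (z w)) w = vel L' a w (z w))" by blast
  have z00: "z (0, th0) = z0 th0" by (rule nb_self[OF zz th0])
  have tz: "msm (RX Q) N (%w. tgt B (z w)) (0, th0)" by (rule msm_comp[OF z tm]) (use z00 u in simp)
  have pt: "tder (%w. a (f (z w))) w = vel L' (pull (pts ?X) f a) w (z w)"
   if "smooth_map ?X N f" "a \<in> cinf N" "msm (RX Q) ?X z w" "\<forall>a\<in>cinf ?X. tder (%w. a (z w)) w = vel L' a w (z w)" for f a w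
  proof -
   have "tder (%w. a (f (z w))) w = tder (%w. pull (pts ?X) f a (z w)) w"
    by (rule tder_cong) (use msm_pts_ev[OF that(3)] msm_src[OF that(3)] in "auto simp: pull_def elim: eventually_mono")
   thus ?thesis using that by (simp add: smooth_map_def)
  qed
  have A2: "near (RX Q) (0, th0) (%w. \<forall>p\<in>set L. \<forall>a\<in>cinf N. A (snd p) (pull (pts ?X) (tgt B) a) (z w) = snd p a (tgt B (z w)))"
   using LF by (intro eventually_ball_finite[OF finite_set] ballI msm_lim[OF z A(2)[folded z00]]) auto
  have tv: "near (RX Q) (0, th0) (%w. \<forall>a\<in>cinf N. tder (%w. a (tgt B (z w))) w = vel L a w (tgt B (z w)))"
   using A2 msm_ev[OF z] zv
  proof eventually_elim
   case (elim w)
   show ?case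
   proof
    fix a assume a: "a \<in> cinf N"
    have "tder (%w. a (tgt B (z w))) w = vel L' (pull (pts ?X) (tgt B) a) w (z w)"
     by (rule pt[OF _ a elim(2,3)]) (use t in "simp add: submersion_def")
    also have "\<dots> = vel L a w (tgt B (z w))"
     unfolding vL by (intro arg_cong[of _ _ sum_list] map_cong refl) (use elim(1) a in auto)
    finally show "tder (%w. a (tgt B (z w))) w = vel L a w (tgt B (z w))" .
   qed
  qed
  have ty': "near (RX Q) (0, th0) (%w. tgt B (z w) = y w)"
   by (rule family_unique[OF N tz ym _ tv Lv]) (use LF Fv ty zz in "auto elim: eventually_elim2")
  have "near (RX Q) (0, th0) (%w. msm (RX Q) N (%w. src B (z w)) w \<and> (\<forall>a\<in>cinf N. tder (%w. a (src B (z w))) w = 0))"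
   using msm_ev[OF z] zv
  proof eventually_elim
   case (elim w)
   have "vel L' (pull (pts ?X) (src B) a) w (z w) = 0" if "a \<in> cinf N" for a
    unfolding vL using A(1) LF that by (intro sum_list_0[of L, THEN trans[rotated]] arg_cong[of _ _ sum_list] map_cong) (auto simp: ker_c_def)
   thus ?case using pt[OF _ _ elim] s msm_comp[OF elim(1) sm[OF msm_tgt[OF elim(1)]]] by (simp add: submersion_def)
  qed
  then obtain e where e: "e > 0" "near Q th0 (%th. \<forall>r. \<bar>r - 0\<bar> < e --> msm (RX Q) N (%w. src B (z w)) (r, th) \<and> (\<forall>a\<in>cinf N. tder (%w. a (src B (z w))) (r, th) = 0))"
   unfolding eventually_RX[OF th0] by blast
  have "near Q th0 (%th. \<forall>r. \<bar>r - 0\<bar> < e --> src B (z (r, th)) = src B (z0 (snd (r, th))))"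
   using e(2) zz by eventually_elim (use family_const[OF N, of e Q "%w. src B (z w)"] in auto)
  hence sy: "near (RX Q) (0, th0) (%w. src B (z w) = src B (z0 (snd w)))"
   unfolding eventually_RX[OF th0] using e(1) by blast
  have "\<forall>\<^sub>F \<tau> in nhds 0. z (\<tau>, th0) = z0 th0" if g0: "\<forall>(g, X)\<in>set L. \<forall>\<tau>. g (\<tau>, th0) = 0"
  proof -
   have "near (RX Q) (0, th0) (%w. msm (RX Q) ?X z w \<and> (\<forall>a\<in>cinf ?X. tder (%w. a (z w)) w = vel L' a w (z w)))"
    using msm_ev[OF z] zv by eventually_elim simp
   then obtain e where e: "e > 0" "\<And>r. \<bar>r - 0\<bar> < e ==> msm (RX Q) ?X z (r, th0) \<and> (\<forall>a\<in>cinf ?X. tder (%w. a (z w)) (r, th0) = vel L' a (r, th0) (z (r, th0)))"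
    using RX_slice[OF _ th0] by blast
   have "vel L' a (r, th0) x = 0" for a r x
    unfolding vL using g0 by (induction L) auto
   hence "z (r, th0) = z0 th0" if "abs r < e" for r
    using family_const[OF X _ that, of Q z] e(2) z00 by simp
   thus ?thesis unfolding eventually_nhds_metric dist_real_def using e(1) by auto
  qed
  thus ?thesis unfolding is_lift_def using z zz ty' sy by (intro exI[of _ z]) (auto elim: eventually_elim2)
 qed
qed

lemma goodD:
 assumes "good TYPE('q) N F B"
 shows good_dspace: "dspace (total B)"
  and good_tgt: "u \<in> pts (total B) ==> msm (total B) N (tgt B) u"
  and good_src: "u \<in> pts (total B) ==> msm (total B) N (src B) u"
  and good_striv: "u \<in> pts (total B) ==> striv (total B) N (src B) u"
  and good_vel: "msm (RX Q) (total B) z w ==> vel_fam F N (Q :: 'q smooth_space) (%x. src B (z x)) w L ==>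
   \<exists>L'. vel_fam F N Q (%x. tgt B (z x)) w L'"
  and good_lift: "vel_fam F N (Q :: 'q smooth_space) y (0, th0) L ==> msm Q (total B) z0 th0 ==>
    near Q th0 (%th. tgt B (z0 th) = y (0, th)) ==> \<exists>z. is_lift B Q y z0 th0 L z"
 using assms unfolding good_def striv_def by blast+

text \<open>A line in direction \<eta> is reduced to the k coordinate shifts, which do not involve
  \<eta>; the direction remains only as coefficients, so the velocity visibly vanishes with
  \<eta>.\<close>

lemma deriv_affine:
 assumes H: "fsm (sprod (euclid k) N) H ((%j. c j + \<tau> * \<eta> j), x)" and c: "c \<in> Rn k" "\<eta> \<in> Rn k"
 shows "deriv (%r. H ((%j. c j + r * \<eta> j), x)) \<tau> =
  (\<Sum>j<k. \<eta> j * tder (%w. H ((fst (snd w))(j := fst (snd w) j + fst w), snd (snd w))) (0, ((%j. c j + \<tau> * \<eta> j), x)))"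
proof -
 let ?h = "%\<zeta>. H (\<zeta>, x)" and ?\<zeta> = "%j. c j + \<tau> * \<eta> j" and ?x = "%w j. c j + fst w * \<eta> j"
 have x: "x \<in> pts N" and \<zeta>: "?\<zeta> \<in> Rn k" using fsm_pts[OF H] by auto
 have h: "fsm (euclid k) ?h ?\<zeta>"
  by (rule msm_fsm[where f="%\<zeta>. (\<zeta>, x)" and h=H, OF H]) (use \<zeta> x in "auto intro!: msm_sprodI msm_id msm_const")
 have xm: "msm (RX N) (euclid k) ?x (\<tau>, x)"
 proof (rule msm_euclidI)
  show "fsm (RX N) (%w. c i + fst w * \<eta> i) (\<tau>, x)" for i
   using x by (auto intro!: fsm_add fsm_mult fsm_const fsm_RX_fst)
 qed (use x c in "auto simp: Rn_def")
 have "deriv (%r. H ((%j. c j + r * \<eta> j), x)) \<tau> = tder (%w. ?h (?x w)) (\<tau>, x)" by (simp add: tder_def)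
 also have "\<dots> = (\<Sum>j<k. pd j ?h ?\<zeta> * tder (%w. ?x w j) (\<tau>, x))"
  using chain_tder[OF xm, of ?h] h by simp
 also have "\<dots> = (\<Sum>j<k. \<eta> j * tder (%w. H ((fst (snd w))(j := fst (snd w) j + fst w), snd (snd w))) (0, (?\<zeta>, x)))"
 proof (rule sum.cong[OF refl])
  fix j assume j: "j \<in> {..<k}"
  have "((%t. ?h (?\<zeta>(j := t))) has_real_derivative pd j ?h ?\<zeta>) (at (?\<zeta> j + 0))"
   using fsm_euclid_DERIV(1)[OF h, of j] j by (simp del: fun_upd_apply)
  hence "((%r. ?h (?\<zeta>(j := ?\<zeta> j + r))) has_real_derivative pd j ?h ?\<zeta>) (at 0)"
   unfolding DERIV_shift[of _ 0 "?\<zeta> j", symmetric, simplified] by (subst (asm) add.commute, subst (asm) DERIV_shift) (simp add: add.commute)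
  hence "tder (%w. H ((fst (snd w))(j := fst (snd w) j + fst w), snd (snd w))) (0, (?\<zeta>, x)) = pd j ?h ?\<zeta>"
   by (simp add: tder_def DERIV_imp_deriv)
  moreover have "tder (%w. ?x w j) (\<tau>, x) = \<eta> j"
   unfolding tder_def by (auto intro!: DERIV_imp_deriv derivative_eq_intros)
  ultimately show "pd j ?h ?\<zeta> * tder (%w. ?x w j) (\<tau>, x) =
   \<eta> j * tder (%w. H ((fst (snd w))(j := fst (snd w) j + fst w), snd (snd w))) (0, (?\<zeta>, x))" by simp
 qed
 finally show ?thesis .
qed

section \<open>Sections of the source map and construction of morphisms\<close>

definition sect where
 "sect N B x u s \<longleftrightarrow> msm N (total B) s x \<and> s x = u \<and> (near N x (%y. src B (s y) = y))"

lemma sectD: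
 assumes "sect N B x u s"
 shows "msm N (total B) s x" "s x = u" "near N x (%y. src B (s y) = y)" "src B u = x" "x \<in> pts N" "u \<in> pts (total B)"
 using assms nb_self[of "%y. src B (s y) = y" N x] msm_src[of N "total B" s x] msm_tgt[of N "total B" s x]
 unfolding sect_def by auto

lemma sect_exists:
 assumes B: "good TYPE('q) N F B" and u: "u \<in> pts (total B)"
 shows "\<exists>s. sect N B (src B u) u s"
proof -
 let ?f = "src B"
 from good_striv[OF B u] obtain k l \<Theta> where l: "msm (total B) (euclid k) l u"
  and T: "msm (sprod (euclid k) N) (total B) \<Theta> (l u, ?f u)" "near (total B) u (%w. \<Theta> (l w, ?f w) = w)"
   "near (sprod (euclid k) N) (l u, ?f u) (%p. ?f (\<Theta> p) = snd p)" unfolding striv_def by blast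
 have x: "?f u \<in> pts N" by (rule msm_tgt[OF good_src[OF B u]])
 have m: "msm N (sprod (euclid k) N) (%y. (l u, y)) (?f u)"
  using x msm_tgt[OF l] by (intro msm_sprodI msm_const msm_id) auto
 have "sect N B (?f u) u (%y. \<Theta> (l u, y))"
  unfolding sect_def using msm_comp[OF m T(1)] nb_self[OF T(2) u] msm_lim[OF m T(3)] by simp
 thus ?thesis by blast
qed

lemma sect_equiv:
 assumes e: "equiv_pt N B u C v" and s: "sect N B x u s"
 shows "\<exists>s'. sect N C x v s' \<and> (near N x (%y. tgt C (s' y) = tgt B (s y)))"
proof -
 note S = sectD[OF s]
 from e obtain f where f: "msm (total B) (total C) f (s x)" "f (s x) = v"
  "near (total B) (s x) (%w. tgt C (f w) = tgt B w \<and> src C (f w) = src B w)"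
  unfolding equiv_pt_iff[OF S(6)] S(2) by blast
 have "near N x (%y. tgt C (f (s y)) = tgt B (s y) \<and> src C (f (s y)) = y)"
  using msm_lim[OF S(1) f(3)] S(3) by eventually_elim simp
 thus ?thesis
  using msm_comp[OF S(1) f(1)] f(2) unfolding sect_def
  by (intro exI[of _ "%y. f (s y)"]) (auto elim: eventually_mono)
qed

text \<open>Two points carrying a common germ are joined by a morphism: in the trivialisation of the source
 map of \<open>B\<close> move linearly from the section to a given point, and lift this motion to \<open>C\<close>.\<close>

lemma equiv_ptI:
 fixes N :: "'n smooth_space"
 assumes B: "good TYPE((nat => real) \<times> 'n) N F B" and C: "good TYPE((nat => real) \<times> 'n) N F C"
  and s: "sect N B x0 u s" and s': "sect N C x0 v s'" and t: "near N x0 (%y. tgt B (s y) = tgt C (s' y))"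
 shows "equiv_pt N B u C v"
proof -
 let ?f = "src B" and ?B = "total B" and ?C = "total C"
 note S = sectD[OF s] and S' = sectD[OF s']
 note u = S(6) and x0 = S(5) and su = S(4)
 from good_striv[OF B u] obtain k l \<Theta> where l: "msm ?B (euclid k) l u"
  and T: "msm (sprod (euclid k) N) ?B \<Theta> (l u, x0)" "near ?B u (%w. \<Theta> (l w, ?f w) = w)"
   "near (sprod (euclid k) N) (l u, x0) (%p. ?f (\<Theta> p) = snd p)" unfolding striv_def su by blast
 \<comment> \<open>A parameter is a direction in the source fibre together with a base point; the
   type of these pairs is the parameter type in the goodness assumptions.\<close>
 define Q where "Q = sprod (euclid k) N"
 have pQ: "pts Q = Rn k \<times> pts N" by (simp add: Q_def)
 have lu: "l u \<in> Rn k" using msm_tgt[OF l] by simp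
 have \<Theta>u: "\<Theta> (l u, x0) = u" using nb_self[OF T(2) u] su by simp
 let ?w = "(0::real, (l u, x0))" and ?th = "((%_. 0) :: nat => real, x0)"
 have zR: "(%_. 0) \<in> Rn k" by (simp add: Rn_def)
 have th: "?th \<in> pts Q" using x0 zR by (simp add: pQ)
 have w: "?w \<in> pts (RX Q)" using x0 lu by (simp add: pQ)
 have eta: "msm (RX Q) (euclid k) (%w. fst (snd w)) w" and ex: "msm (RX Q) N (%w. snd (snd w)) w" and er: "fsm (RX Q) fst w"
  if "w \<in> UNIV \<times> pts Q" for w
  by (rule msm_comp[OF msm_RX_snd], use that in "auto simp: Q_def intro!: msm_fst msm_snd fsm_RX_fst")+
 \<comment> \<open>The shift of fibre coordinate i by the time, at an arbitrary point of the
   trivialisation.\<close>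
 define z where "z i w = \<Theta> ((fst (snd w))(i := fst (snd w) i + fst w), snd (snd w))" for i and w :: "real \<times> (nat => real) \<times> 'n"
 have sh: "msm (RX Q) Q (%w. ((fst (snd w))(i := fst (snd w) i + fst w), snd (snd w))) ?w" if i: "i < k" for i
  unfolding Q_def
 proof (intro msm_sprodI msm_euclidI)
  show "fsm (RX (sprod (euclid k) N)) (%w. ((fst (snd w))(i := fst (snd w) i + fst w)) j) ?w" for j
   using msm_euclidD[OF eta] er w by (auto simp: fun_upd_def Q_def intro!: fsm_if fsm_add)
  show "near (RX (sprod (euclid k) N)) ?w (%w. (fst (snd w))(i := fst (snd w) i + fst w) \<in> Rn k)"
   using nb_pts by eventually_elim (use i in "auto simp: Rn_def")
 qed (use ex w in "auto simp: Q_def")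
 have TQ: "msm Q ?B \<Theta> (l u, x0)" using T(1) by (simp add: Q_def)
 have zm: "msm (RX Q) ?B (z i) ?w" if i: "i < k" for i
  unfolding z_def by (rule msm_comp[OF sh[OF i]]) (use TQ in simp)
 have zs: "near (RX Q) ?w (%w. ?f (z i w) = snd (snd w))" if i: "i < k" for i
  using msm_lim[OF sh[OF i], of "%p. ?f (\<Theta> p) = snd p"] T(3) by (simp add: z_def Q_def)
 \<comment> \<open>Shifts stay inside a source fibre, so the source moves with no velocity at all;
   goodness of \<open>B\<close> then shows that the target moves along the foliation.\<close>
 have "vel_fam F N Q (%w. ?f (z i w)) ?w []" if i: "i < k" for i
  unfolding vel_fam_def
 proof (intro conjI)
  show "msm (RX Q) N (%w. ?f (z i w)) ?w" by (rule msm_comp[OF zm[OF i] good_src[OF B msm_tgt[OF zm[OF i]]]])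
  from nb_ev[OF zs[OF i]] nb_pts
  show "near (RX Q) ?w (%w'. \<forall>a\<in>cinf N. tder (%w. a (?f (z i w))) w' = vel [] a w' (?f (z i w')))"
  proof eventually_elim
   case (elim w')
   have "tder (%w. a (?f (z i w))) w' = tder (%w. a (snd (snd w))) w'" for a
    by (rule tder_cong[OF _ elim(2)]) (use elim(1) in "auto elim: eventually_mono")
   thus ?case by (simp add: tder_def case_prod_beta)
  qed
 qed simp
 hence "\<forall>i. \<exists>L. i < k --> vel_fam F N Q (%w. tgt B (z i w)) ?w L" using good_vel[OF B zm] by blast
 from choice[OF this] obtain L where L: "\<And>i. i < k ==> vel_fam F N Q (%w. tgt B (z i w)) ?w (L i)" by blast
 \<comment> \<open>The fibre coordinates at a given time on the line that starts at the section over
   x with direction \<eta>.\<close>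
 define \<zeta> where "\<zeta> w = (%j. l (s (snd (snd w))) j + fst w * fst (snd w) j)" for w :: "real \<times> (nat => real) \<times> 'n"
 have lsm: "msm (RX Q) (euclid k) (%w. l (s (snd (snd w)))) (r, ?th)" for r
  using msm_comp[OF msm_comp[OF ex, of "(r, ?th)" ?B s] , of "euclid k" l] S l th by simp
 have \<zeta>m: "msm (RX Q) (euclid k) \<zeta> (r, ?th)" for r
  unfolding \<zeta>_def
 proof (rule msm_euclidI)
  show "fsm (RX Q) (%w. l (s (snd (snd w))) i + fst w * fst (snd w) i) (r, ?th)" for i
   using msm_euclidD[OF lsm] msm_euclidD[OF eta] er th by (intro fsm_add fsm_mult) auto
  from msm_pts_ev[OF lsm[of r]] nb_pts
  show "near (RX Q) (r, ?th) (%w. (%j. l (s (snd (snd w))) j + fst w * fst (snd w) j) \<in> Rn k)"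
   by eventually_elim (auto simp: Rn_def pQ)
 qed (use th in simp)
 have \<zeta>0: "\<zeta> (r, ?th) = l u" for r by (simp add: \<zeta>_def S)
 let ?y = "%w. tgt B (\<Theta> (\<zeta> w, snd (snd w)))"
 have pm: "msm (RX Q) Q (%w. (\<zeta> w, snd (snd w))) (r, ?th)" for r
  unfolding Q_def by (rule msm_sprodI) (use \<zeta>m ex th in "auto simp: Q_def")
 have Tm: "msm (RX Q) ?B (%w. \<Theta> (\<zeta> w, snd (snd w))) (0, ?th)"
  by (rule msm_comp[OF pm]) (use \<zeta>0 TQ in simp)
 have Gm: "msm (RX Q) (RX Q) (%w. (0, \<zeta> w, snd (snd w))) (0, ?th)"
  by (rule msm_RXI[OF fsm_const pm]) (use th in simp)
 define M where "M = map (%i. (%w :: real \<times> (nat => real) \<times> 'n. fst (snd w) i, i)) [0..<k]"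
 \<comment> \<open>The velocities of the coordinate shifts, evaluated at the moving point and
   weighted by the components of the direction.\<close>
 define L' where "L' = concat (map (%(g, i). map (%(h, Y). (%w. g w * h (0, \<zeta> w, snd (snd w)), Y)) (L i)) M)"
 have vy: "vel_fam F N Q ?y (0, ?th) L'"
  unfolding vel_fam_def
 proof (intro conjI)
  show "msm (RX Q) N ?y (0, ?th)" by (rule msm_comp[OF Tm]) (use good_tgt[OF B u] \<zeta>0 \<Theta>u in simp)
  have c: "fsm (RX Q) (%w. fst (snd w) i * h (0, \<zeta> w, snd (snd w))) (0, ?th) \<and> Y \<in> F" if "i < k" "(h, Y) \<in> set (L i)" for i h Y
  proof -
   have h: "fsm (RX Q) h ?w" and Y: "Y \<in> F" using L[OF that(1)] that(2) unfolding vel_fam_def by auto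
   have "fsm (RX Q) (%w. h (0, \<zeta> w, snd (snd w))) (0, ?th)" by (rule msm_fsm[OF _ Gm]) (use h \<zeta>0 in simp)
   thus ?thesis using msm_euclidD[OF eta] th Y by (auto intro!: fsm_mult)
  qed
  thus "\<forall>(g, X)\<in>set L'. fsm (RX Q) g (0, ?th) \<and> X \<in> F" by (auto simp: L'_def M_def)
  have e1: "near (RX Q) (0, ?th) (%w. \<forall>i\<in>{..<k}. \<forall>a\<in>cinf N.
    tder (%w. a (tgt B (z i w))) (0, \<zeta> w, snd (snd w)) = vel (L i) a (0, \<zeta> w, snd (snd w)) (tgt B (z i (0, \<zeta> w, snd (snd w)))))"
  proof (intro eventually_ball_finite[OF finite_lessThan] ballI)
   fix i assume "i \<in> {..<k}"
   hence "near (RX Q) (0, \<zeta> (0, ?th), snd (snd (0, ?th))) (%w'. \<forall>a\<in>cinf N. tder (%w. a (tgt B (z i w))) w' = vel (L i) a w' (tgt B (z i w')))"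
    using L[of i] by (simp add: vel_fam_def \<zeta>0)
   from msm_lim[OF Gm this] show "near (RX Q) (0, ?th) (%w. \<forall>a\<in>cinf N.
    tder (%w. a (tgt B (z i w))) (0, \<zeta> w, snd (snd w)) = vel (L i) a (0, \<zeta> w, snd (snd w)) (tgt B (z i (0, \<zeta> w, snd (snd w)))))" .
  qed
  have "near Q (\<zeta> (0, ?th), snd (snd (0, ?th))) (%p. msm Q N (%p. tgt B (\<Theta> p)) p)"
   using msm_ev[OF msm_comp[OF TQ good_tgt[OF B msm_tgt[OF TQ]]]] by (simp add: \<zeta>0)
  from e1 msm_lim[OF pm this] nb_pts msm_pts_ev[OF lsm[of 0]]
  show "near (RX Q) (0, ?th) (%w'. \<forall>a\<in>cinf N. tder (%w. a (?y w)) w' = vel L' a w' (?y w'))"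
  proof eventually_elim
   case (elim w')
   obtain \<tau> \<eta> x where w': "w' = (\<tau>, \<eta>, x)" "\<eta> \<in> Rn k" "x \<in> pts N" using elim(3) by (auto simp: pQ)
   show ?case
   proof
    fix a assume a: "a \<in> cinf N"
    have "tder (%w. a (?y w)) w' = deriv (%r. a (tgt B (\<Theta> ((%j. l (s x) j + r * \<eta> j), x)))) \<tau>"
     by (simp add: tder_def w' \<zeta>_def)
    also have "\<dots> = (\<Sum>i<k. \<eta> i * tder (%w. a (tgt B (z i w))) (0, ((%j. l (s x) j + \<tau> * \<eta> j), x)))"
     unfolding z_def by (rule deriv_affine) (use msm_cinf[OF elim(2) a] elim(4) w' in "simp_all add: \<zeta>_def Q_def")
    also have "\<dots> = (\<Sum>i<k. \<eta> i * vel (L i) a (0, \<zeta> w', x) (?y w'))"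
    proof (rule sum.cong[OF refl])
     fix i assume i: "i \<in> {..<k}"
     have "z i (0, \<zeta> w', x) = \<Theta> (\<zeta> w', x)" by (simp add: z_def)
     thus "\<eta> i * tder (%w. a (tgt B (z i w))) (0, ((%j. l (s x) j + \<tau> * \<eta> j), x)) = \<eta> i * vel (L i) a (0, \<zeta> w', x) (?y w')"
      using elim(1) i a by (simp add: w' \<zeta>_def)
    qed
    also have "\<dots> = vel L' a w' (?y w')"
     unfolding L'_def vel_concat by (simp add: M_def o_def w' interv_sum_list_conv_sum_set_nat atLeast0LessThan)
    finally show "tder (%w. a (?y w)) w' = vel L' a w' (?y w')" .
   qed
  qed
 qed
 have z0: "msm Q ?C (%th. s' (snd th)) ?th"
  by (rule msm_comp[where Y=N]) (use th S'(1) in "auto simp: Q_def intro: msm_snd")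
 have sQ: "msm Q N snd ?th" using th by (auto simp: Q_def intro: msm_snd)
 have T2: "near N x0 (%y. \<Theta> (l (s y), y) = s y)"
  using msm_lim[OF S(1)[THEN msm_comp[where Y=N, OF msm_id[OF x0]]], of "%w. \<Theta> (l w, ?f w) = w"] T(2) S(2,3)
  by (auto elim: eventually_elim2)
 have "near Q ?th (%th. tgt C (s' (snd th)) = ?y (0, th))"
  using msm_lim[OF sQ, of "%y. \<Theta> (l (s y), y) = s y"] msm_lim[OF sQ, of "%y. tgt B (s y) = tgt C (s' y)"] T2 t
  by (auto simp: \<zeta>_def elim: eventually_elim2)
 from good_lift[OF C vy z0 this, unfolded is_lift_def snd_conv] obtain c where c: "msm (RX Q) ?C c (0, ?th)"
  "near (RX Q) (0, ?th) (%w. tgt C (c w) = ?y w \<and> src C (c w) = src C (s' (snd (snd w))))"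
  and c0: "(\<forall>(g, X)\<in>set L'. \<forall>\<tau>. g (\<tau>, ?th) = 0) --> (\<forall>\<^sub>F \<tau> in nhds 0. c (\<tau>, ?th) = s' x0)"
  by (elim exE conjE) (rule that)
 \<comment> \<open>At direction 0 every coefficient of \<open>L'\<close> vanishes, so the lift rests
   at \<open>v\<close>; this makes the morphism send \<open>u\<close> to \<open>v\<close>.\<close>
 have c0: "\<forall>\<^sub>F \<tau> in nhds 0. c (\<tau>, ?th) = v"
  using c0 S'(2) by (auto simp: L'_def M_def)
 have cs: "near (RX Q) (0, ?th) (%w. src C (s' (snd (snd w))) = snd (snd w))"
  using msm_lim[OF ex[of "(0, ?th)"], of "%y. src C (s' y) = y"] S'(3) th by simp
 have "near (RX Q) (0, ?th) (%w. msm (RX Q) ?C c w \<and> (near (RX Q) w (%w. tgt C (c w) = ?y w \<and> src C (c w) = snd (snd w))))"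
  using msm_ev[OF c(1)] nb_ev[OF eventually_conj[OF c(2) cs]] by eventually_elim (auto elim: eventually_mono)
 then obtain e where e: "e > 0" "\<And>r. \<bar>r - 0\<bar> < e ==> msm (RX Q) ?C c (r, ?th) \<and>
   (near (RX Q) (r, ?th) (%w. tgt C (c w) = ?y w \<and> src C (c w) = snd (snd w)))" using RX_slice[OF _ th] by blast
 from c0 obtain d where d: "d > 0" "\<And>r. abs r < d ==> c (r, ?th) = v" unfolding eventually_nhds_metric dist_real_def by auto
 \<comment> \<open>A fixed positive time inside both intervals, where the lift is smooth and where
   it rests at direction 0. Division by it is possible, while time 0 would reach only the
   section.\<close>
 define r where "r = min d e / 2"
 have r: "r > 0" "abs r < d" "\<bar>r - 0\<bar> < e" using e(1) d(1) by (auto simp: r_def)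
 \<comment> \<open>The direction is scaled so that the line from the section over
   \<open>src B w\<close> arrives at \<open>w\<close> at time \<open>r\<close>; following the lift
   to that time defines the morphism.\<close>
 define h where "h w = (r, (%j. (l w j - l (s (?f w)) j) / r), ?f w)" for w
 have fm: "msm ?B N ?f u" by (rule good_src[OF B u])
 have lsf: "msm ?B (euclid k) (%w. l (s (?f w))) u"
  using msm_comp[OF fm, of ?B s] msm_comp[of ?B ?B "%w. s (?f w)" u "euclid k" l] S l su by simp
 have hm: "msm ?B (RX Q) h u"
  unfolding h_def
 proof (intro msm_RXI fsm_const u)
  show "msm ?B Q (%w. ((%j. (l w j - l (s (?f w)) j) / r), ?f w)) u"
   unfolding Q_def
  proof (intro msm_sprodI fm msm_euclidI u)
   have "fsm ?B (%w. (1 / r) * (l w i - l (s (?f w)) i)) u" for i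
    using msm_euclidD[OF l] msm_euclidD[OF lsf] by (intro fsm_mult fsm_const fsm_diff u)
   thus "fsm ?B (%w. (l w i - l (s (?f w)) i) / r) u" for i by simp
   from msm_pts_ev[OF l] msm_pts_ev[OF lsf]
   show "near ?B u (%w. (%j. (l w j - l (s (?f w)) j) / r) \<in> Rn k)" by eventually_elim (auto simp: Rn_def)
  qed
 qed
 have hu: "h u = (r, ?th)" by (simp add: h_def S su)
 have "near ?B u (%w. tgt C (c (h w)) = ?y (h w) \<and> src C (c (h w)) = snd (snd (h w)))"
  by (rule msm_lim[OF hm]) (use e(2)[OF r(3)] hu in simp)
 moreover have "?y (h w) = tgt B (\<Theta> (l w, ?f w))" for w using r(1) by (simp add: h_def \<zeta>_def)
 ultimately have "near ?B u (%w. tgt C (c (h w)) = tgt B w \<and> src C (c (h w)) = ?f w)"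
  using T(2) by (auto simp: h_def elim: eventually_elim2)
 moreover have "msm ?B ?C (%w. c (h w)) u" by (rule msm_comp[OF hm]) (use e(2)[OF r(3)] hu in simp)
 ultimately show ?thesis unfolding equiv_pt_iff[OF u] using hu d(2)[OF r(2)] by (intro exI[of _ "%w. c (h w)"]) simp
qed

section \<open>Stability under composition and pullback\<close>

lemma msm_gen_src:
 assumes "w \<in> S" "\<And>x. x \<in> S ==> f x \<in> pts Y" "\<And>b. b \<in> cinf Y ==> (%x. b (f x)) \<in> A"
 shows "msm (gen S A) Y f w"
 unfolding msm_def
proof
 show "near (gen S A) w (%y. f y \<in> pts Y \<and> (\<forall>b\<in>cinf Y. fsm (gen S A) (%z. b (f z)) y))"
  using nb_pts by eventually_elim (use assms in "auto intro: fsm_base")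
qed (use assms in simp)

lemma bisubmersion_binv:
 fixes B :: "('a, 'n) bisub"
 shows "bisubmersion N F B ==> bisubmersion N F (binv B)"
proof -
 have c: "{vadd X Y | X Y. X \<in> K \<and> Y \<in> K'} = {vadd X Y | X Y. X \<in> K' \<and> Y \<in> K}" for K K' :: "'a vfield set"
  unfolding vadd_def by (subst add.commute) blast
 show "bisubmersion N F B ==> bisubmersion N F (binv B)"
  unfolding bisubmersion_def binv_def bisub.select_convs c[of "ker_c (total B) N (tgt B)" "ker_c (total B) N (src B)"]
  by (elim conjE, intro conjI) simp_all
qed

text \<open>Trivialise the second factor over N, then the first over the point it must match; the
  fibre coordinates are concatenated. The pairing is abstract so that it covers both
  \<open>Comp\<close> and ordinary pairs.\<close>

lemma striv_fibre:
 fixes N :: "'n smooth_space"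
 assumes a: "msm Z A a w" and b: "msm Z B b w" and f: "striv A K f (a w)" and s: "striv B N s (b w)" and t: "msm B K t (b w)"
  and pt: "\<And>w. w \<in> pts Z ==> f (a w) = t (b w) \<and> pair (a w) (b w) = w"
  and inv: "\<And>x y. a (pair x y) = x" "\<And>x y. b (pair x y) = y"
  and pr: "\<And>(X :: ((nat => real) \<times> 'n) smooth_space) g h p. msm X A g p ==> msm X B h p ==>
   near X p (%x. f (g x) = t (h x)) ==> msm X Z (%x. pair (g x) (h x)) p"
 shows "striv Z N (%w. s (b w)) w"
proof -
 have w: "w \<in> pts Z" by (rule msm_src[OF a])
 from f obtain k l \<Theta> where f1: "msm A K f (a w)" and l: "msm A (euclid k) l (a w)" and T: "msm (sprod (euclid k) K) A \<Theta> (l (a w), f (a w))"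
  "near A (a w) (%w. \<Theta> (l w, f w) = w)" "near (sprod (euclid k) K) (l (a w), f (a w)) (%p. f (\<Theta> p) = snd p)"
  unfolding striv_def by blast
 from s obtain k' l' \<Theta>' where s1: "msm B N s (b w)" and l': "msm B (euclid k') l' (b w)"
  and T': "msm (sprod (euclid k') N) B \<Theta>' (l' (b w), s (b w))"
  "near B (b w) (%w. \<Theta>' (l' w, s w) = w)" "near (sprod (euclid k') N) (l' (b w), s (b w)) (%p. s (\<Theta>' p) = snd p)"
  unfolding striv_def by blast
 let ?E = "sprod (euclid (k + k')) N" and ?l = "%w. cat k (l (a w)) (l' (b w))"
 let ?p = "(?l w, s (b w))"
 define g where "g p = \<Theta>' ((%j. fst p (k + j)), snd p)" for p :: "(nat => real) \<times> 'n"
 define h where "h p = \<Theta> (trunc k (fst p), t (g p))" for p :: "(nat => real) \<times> 'n"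
 have la: "msm Z (euclid k) (%w. l (a w)) w" and lb: "msm Z (euclid k') (%w. l' (b w)) w" and sb: "msm Z N (%w. s (b w)) w"
  using msm_comp[OF a l] msm_comp[OF b l'] msm_comp[OF b s1] by auto
 have tc: "trunc k (cat k x y) = x" "(%j. cat k x y (k + j)) = y" if "x \<in> Rn k" for x y
  using that by (auto simp: trunc_def Rn_def cat_def)
 have lm: "msm Z (euclid (k + k')) ?l w"
 proof (rule msm_euclidI[OF _ _ w])
  show "fsm Z (%w. cat k (l (a w)) (l' (b w)) i) w" for i
   unfolding cat_def by (intro fsm_if msm_euclidD[OF la] msm_euclidD[OF lb])
  show "near Z w (%w. ?l w \<in> Rn (k + k'))" using msm_pts_ev[OF lb] by eventually_elim simp
 qed
 have lw: "l (a w) \<in> Rn k" using msm_tgt[OF la] by simp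
 have p: "?p \<in> Rn (k + k') \<times> pts N" using msm_tgt[OF lm] msm_tgt[OF sb] by simp
 have ef: "msm ?E (euclid (k + k')) fst ?p" and es: "msm ?E N snd ?p" using p by (auto intro: msm_fst msm_snd)
 have 1: "msm ?E (sprod (euclid k') N) (%p. ((%j. fst p (k + j)), snd p)) ?p"
 proof (intro msm_sprodI es msm_euclidI)
  show "fsm ?E (%p. fst p (k + i)) ?p" for i by (rule msm_euclidD[OF ef])
  show "near ?E ?p (%p. (%j. fst p (k + j)) \<in> Rn k')" using nb_pts by eventually_elim (auto simp: Rn_def)
 qed (use p in simp)
 have gm: "msm ?E B g ?p" unfolding g_def by (rule msm_comp[OF 1]) (use T'(1) tc lw in simp)
 have gw: "g ?p = b w" using nb_self[OF T'(2) msm_tgt[OF b]] tc lw by (simp add: g_def)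
 have 2: "msm ?E (sprod (euclid k) K) (%p. (trunc k (fst p), t (g p))) ?p"
 proof (intro msm_sprodI msm_euclidI)
  show "fsm ?E (%p. trunc k (fst p) i) ?p" if "i < k" for i using msm_euclidD[OF ef] that by (simp add: trunc_def)
  show "msm ?E K (%p. t (g p)) ?p" by (rule msm_comp[OF gm]) (use t gw in simp)
 qed (use p in auto)
 have ta: "(trunc k (fst ?p), t (g ?p)) = (l (a w), f (a w))" using pt[OF w] gw tc(1)[OF lw] by simp
 have hm: "msm ?E A h ?p" unfolding h_def by (rule msm_comp[OF 2]) (use T(1) ta in simp)
 have fh: "near ?E ?p (%p. f (h p) = t (g p))"
  using msm_lim[OF 2, of "%p. f (\<Theta> p) = snd p"] T(3) ta by (simp add: h_def)
 have "near Z w (%x. pair (h (?l x, s (b x))) (g (?l x, s (b x))) = x)"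
  using msm_lim[OF a T(2)] msm_lim[OF b T'(2)] nb_pts msm_pts_ev[OF la]
  by eventually_elim (use pt in "simp add: g_def h_def tc")
 moreover have "near ?E ?p (%p. s (b (pair (h p) (g p))) = snd p)"
  using msm_lim[OF 1, of "%p. s (\<Theta>' p) = snd p"] T'(3) tc(2)[OF lw] by (simp add: inv g_def)
 ultimately show ?thesis using lm sb pr[OF hm gm fh] unfolding striv_def
  by (intro conjI exI[of _ "k + k'"] exI[of _ ?l] exI[of _ "%p. pair (h p) (g p)"]) auto
qed

lemma striv_id: "x \<in> pts N ==> striv N N (%x. x) x"
 unfolding striv_def
 by (intro conjI exI[of _ "0::nat"] exI[of _ "%_ _. 0"] exI[of _ snd] msm_id msm_const msm_snd) (auto simp: Rn_def)

lemma pts_bcomp [simp]: "pts (total (bcomp B C)) = {Comp u v | u v. u \<in> pts (total B) \<and> v \<in> pts (total C) \<and> src B u = tgt C v}"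
 and tgt_bcomp [simp]: "tgt (bcomp B C) = (%w. tgt B (outer w))" and src_bcomp [simp]: "src (bcomp B C) = (%w. src C (inner w))"
 by (auto simp: bcomp_def)

lemma msm_outer: "w \<in> pts (total (bcomp B C)) ==> msm (total (bcomp B C)) (total B) outer w"
 and msm_inner: "w \<in> pts (total (bcomp B C)) ==> msm (total (bcomp B C)) (total C) inner w"
 unfolding bcomp_def by (auto intro!: msm_gen_src simp: o_def)

lemma msm_Comp:
 assumes g: "msm X (total B) g p" and h: "msm X (total C) h p" and e: "near X p (%x. src B (g x) = tgt C (h x))"
 shows "msm X (total (bcomp B C)) (%x. Comp (g x) (h x)) p"
 unfolding bcomp_def bisub.select_convs
proof (rule msm_gen)
 show "p \<in> pts X" by (rule msm_src[OF g])
 show "near X p (%x. Comp (g x) (h x) \<in> {Comp u v |u v. u \<in> pts (total B) \<and> v \<in> pts (total C) \<and> src B u = tgt C v})"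
  using msm_pts_ev[OF g] msm_pts_ev[OF h] e by eventually_elim auto
 show "near X p (%x. \<forall>a\<in>{a \<circ> outer |a. a \<in> cinf (total B)} \<union> {b \<circ> inner |b. b \<in> cinf (total C)}. fsm X (%z. a (Comp (g z) (h z))) x)"
  using msm_ev[OF g] msm_ev[OF h] by eventually_elim (auto intro: msm_cinf)
qed

text \<open>Velocities pass through the inner factor and then the outer one, which meet where the
  source of one is the target of the other. A motion of the target is lifted in the outer factor
  only, because its lift keeps the source fixed and the inner factor can rest.\<close>

lemma good_bcomp:
 fixes B C :: "('n hpt, 'n) bisub"
 assumes B: "good TYPE('q) N F B" and C: "good TYPE('q) N F C"
 shows "good TYPE('q) N F (bcomp B C)"
 unfolding good_def
proof (intro conjI ballI allI impI)
 let ?Z = "total (bcomp B C)"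
 show "dspace ?Z" by (simp add: bcomp_def)
 have pt: "src B (outer w) = tgt C (inner w) \<and> Comp (outer w) (inner w) = w" if "w \<in> pts ?Z" for w using that by auto
 show "msm ?Z N (tgt (bcomp B C)) u" "striv ?Z N (src (bcomp B C)) u" if u: "u \<in> pts ?Z" for u
 proof -
  note o = msm_outer[OF u] and i = msm_inner[OF u]
  show "msm ?Z N (tgt (bcomp B C)) u" using msm_comp[OF o good_tgt[OF B msm_tgt[OF o]]] by simp
  have "striv ?Z N (%w. src C (inner w)) u"
   by (rule striv_fibre[OF o i good_striv[OF B msm_tgt[OF o]] good_striv[OF C msm_tgt[OF i]] good_tgt[OF C msm_tgt[OF i]] pt])
    (auto intro: msm_Comp)
  thus "striv ?Z N (src (bcomp B C)) u" by simp
 qed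
 show "\<exists>L'. vel_fam F N Q (%x. tgt (bcomp B C) (z x)) w L'"
  if z: "msm (RX Q) ?Z z w" and L: "vel_fam F N Q (%x. src (bcomp B C) (z x)) w L" for Q :: "'q smooth_space" and z w L
 proof -
  note o = msm_comp[OF z msm_outer[OF msm_tgt[OF z]]] and i = msm_comp[OF z msm_inner[OF msm_tgt[OF z]]]
  obtain L1 where "vel_fam F N Q (%x. tgt C (inner (z x))) w L1" using good_vel[OF C i] L by auto
  hence "vel_fam F N Q (%x. src B (outer (z x))) w L1"
   by (rule vel_fam_cong) (use msm_pts_ev[OF z] in eventually_elim, auto)
  from good_vel[OF B o this] show ?thesis by simp
 qed
 show "\<exists>z. is_lift (bcomp B C) Q y z0 th0 L z"
  if L: "vel_fam F N Q y (0, th0) L" and z0: "msm Q ?Z z0 th0" and ty: "near Q th0 (%th. tgt (bcomp B C) (z0 th) = y (0, th))"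
  for Q :: "'q smooth_space" and y z0 th0 L
 proof -
  note o = msm_comp[OF z0 msm_outer[OF msm_tgt[OF z0]]] and i = msm_comp[OF z0 msm_inner[OF msm_tgt[OF z0]]]
  have th: "(0, th0) \<in> UNIV \<times> pts Q" using msm_src[OF z0] by simp
  obtain b where b: "msm (RX Q) (total B) b (0, th0)" "near Q th0 (%th. b (0, th) = outer (z0 th))"
     "near (RX Q) (0, th0) (%w. tgt B (b w) = y w \<and> src B (b w) = src B (outer (z0 (snd w))))"
     "(\<forall>(g, X)\<in>set L. \<forall>\<tau>. g (\<tau>, th0) = 0) --> (\<forall>\<^sub>F \<tau> in nhds 0. b (\<tau>, th0) = outer (z0 th0))"
   using good_lift[OF B L o ty[unfolded tgt_bcomp], unfolded is_lift_def] by (elim exE conjE) (rule that)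
  have i': "msm (RX Q) (total C) (%w. inner (z0 (snd w))) (0, th0)" by (rule msm_comp[OF msm_RX_snd[OF th]]) (use i in simp)
  have zp: "near (RX Q) (0, th0) (%w. z0 (snd w) \<in> pts ?Z)"
   by (rule msm_lim[OF msm_RX_snd[OF th]]) (use msm_pts_ev[OF z0] in simp)
  have "msm (RX Q) ?Z (%w. Comp (b w) (inner (z0 (snd w)))) (0, th0)"
   by (rule msm_Comp[OF b(1) i']) (use b(3) zp in eventually_elim, auto)
  moreover have "near Q th0 (%th. Comp (b (0, th)) (inner (z0 (snd (0, th)))) = z0 th)"
   using b(2) msm_pts_ev[OF z0] by eventually_elim auto
  moreover have "(\<forall>(g, X)\<in>set L. \<forall>\<tau>. g (\<tau>, th0) = 0) --> (\<forall>\<^sub>F \<tau> in nhds 0. Comp (b (\<tau>, th0)) (inner (z0 th0)) = z0 th0)"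
   using b(4) msm_tgt[OF z0] by (auto elim: eventually_mono)
  moreover have "near (RX Q) (0, th0) (%w. tgt B (b w) = y w)" using b(3) by eventually_elim simp
  ultimately show ?thesis unfolding is_lift_def by (intro exI[of _ "%w. Comp (b w) (inner (z0 (snd w)))"]) simp
 qed
qed

lemma pts_bpullback [simp]: "pts (total (bpullback P \<pi> B)) =
  {(p, u, q). p \<in> pts P \<and> u \<in> pts (total B) \<and> q \<in> pts P \<and> \<pi> p = tgt B u \<and> src B u = \<pi> q}"
 and tgt_bpullback [simp]: "tgt (bpullback P \<pi> B) = fst"
 and src_bpullback [simp]: "src (bpullback P \<pi> B) = (%w. snd (snd w))"
 by (auto simp: bpullback_def case_prod_beta)

lemma msm_bpullback:
 fixes P :: "'p smooth_space" and B :: "('u, 'm) bisub"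
 assumes w: "w \<in> pts (total (bpullback P \<pi> B))"
 shows msm_left: "msm (total (bpullback P \<pi> B)) P fst w"
  and msm_middle: "msm (total (bpullback P \<pi> B)) (total B) (%w. fst (snd w)) w"
  and msm_right: "msm (total (bpullback P \<pi> B)) P (%w. snd (snd w)) w"
proof -
 have c: "(%w. a (fst w)) = (%(p, u, q). a p)" "(%w. b (fst (snd w))) = (%(p, u, q). b u)" "(%w. c (snd (snd w))) = (%(p, u, q). c q)"
  for a :: "'p => real" and b :: "'u => real" and c :: "'p => real" by auto
 show "msm (total (bpullback P \<pi> B)) P fst w" "msm (total (bpullback P \<pi> B)) (total B) (%w. fst (snd w)) w"
  "msm (total (bpullback P \<pi> B)) P (%w. snd (snd w)) w"
  using w unfolding bpullback_def by (auto intro!: msm_gen_src simp: c)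
qed

lemma msm_triple:
 assumes f: "msm X P f p" and g: "msm X (total B) g p" and h: "msm X P h p"
  and e: "near X p (%x. \<pi> (f x) = tgt B (g x) \<and> src B (g x) = \<pi> (h x))"
 shows "msm X (total (bpullback P \<pi> B)) (%x. (f x, g x, h x)) p"
 unfolding bpullback_def bisub.select_convs
proof (rule msm_gen)
 show "p \<in> pts X" by (rule msm_src[OF g])
 show "near X p (%x. (f x, g x, h x) \<in> {(p, u, q). p \<in> pts P \<and> u \<in> pts (total B) \<and> q \<in> pts P \<and> \<pi> p = tgt B u \<and> src B u = \<pi> q})"
  using msm_pts_ev[OF f] msm_pts_ev[OF g] msm_pts_ev[OF h] e by eventually_elim auto
 show "near X p (%x. \<forall>a\<in>{%(p, u, q). a p |a. a \<in> cinf P} \<union> {%(p, u, q). b u |b. b \<in> cinf (total B)} \<union> {%(p, u, q). a q |a. a \<in> cinf P}.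
   fsm X (%z. a (f z, g z, h z)) x)"
  using msm_ev[OF f] msm_ev[OF g] msm_ev[OF h] by eventually_elim (auto intro: msm_cinf)
qed

definition fib where
 "fib A f B g = gen {(x, y). x \<in> pts A \<and> y \<in> pts B \<and> f x = g y} ({a \<circ> fst | a. a \<in> cinf A} \<union> {b \<circ> snd | b. b \<in> cinf B})"

lemma pts_fib [simp]: "pts (fib A f B g) = {(x, y). x \<in> pts A \<and> y \<in> pts B \<and> f x = g y}"
 by (simp add: fib_def)

lemma msm_fib_fst: "y \<in> pts (fib A f B g) ==> msm (fib A f B g) A fst y"
 and msm_fib_snd: "y \<in> pts (fib A f B g) ==> msm (fib A f B g) B snd y"
 by (auto simp: fib_def o_def intro!: msm_gen_src)

lemma msm_fib:
 assumes g: "msm X A c x" and h: "msm X B d x" and e: "near X x (%x. f (c x) = g (d x))"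
 shows "msm X (fib A f B g) (%x. (c x, d x)) x"
 unfolding fib_def
proof (rule msm_gen)
 show "near X x (%x. (c x, d x) \<in> {(x, y). x \<in> pts A \<and> y \<in> pts B \<and> f x = g y})"
  using msm_pts_ev[OF g] msm_pts_ev[OF h] e by eventually_elim auto
 show "near X x (%x. \<forall>a\<in>{a \<circ> fst | a. a \<in> cinf A} \<union> {b \<circ> snd | b. b \<in> cinf B}. fsm X (%z. a (c z, d z)) x)"
  using msm_ev[OF g] msm_ev[OF h] by eventually_elim (auto intro: msm_cinf)
qed (rule msm_src[OF g])

lemma msm_pair:
 assumes f: "msm X P f p" and y: "msm X (fib (total B) (src B) P \<pi>) h p" and e: "near X p (%x. \<pi> (f x) = tgt B (fst (h x)))"
 shows "msm X (total (bpullback P \<pi> B)) (%x. (f x, h x)) p"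
proof -
 note m = msm_fib_fst[OF msm_tgt[OF y]] msm_fib_snd[OF msm_tgt[OF y]]
 have "msm X (total (bpullback P \<pi> B)) (%x. (f x, fst (h x), snd (h x))) p"
  by (rule msm_triple[OF f msm_comp[OF y m(1)] msm_comp[OF y m(2)]])
   (use e msm_pts_ev[OF y] in eventually_elim, auto)
 thus ?thesis by simp
qed

text \<open>The source of the pullback is trivialised in two steps, via the fibre product of \<open>B\<close> and \<open>P\<close>.\<close>

lemma good_bpullback:
 fixes P :: "'p smooth_space" and M :: "'m smooth_space"
 assumes P: "manifold P" and M: "manifold M" and \<pi>: "submersion P M \<pi>" and F: "F \<subseteq> vfields M"
  and k: "ker_c P M \<pi> \<subseteq> pullback_fol P M \<pi> F" and B: "good TYPE('q) M F B"
 shows "good TYPE('q) P (pullback_fol P M \<pi> F) (bpullback P \<pi> B)"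
 unfolding good_def
proof (intro conjI ballI allI impI)
 let ?Z = "total (bpullback P \<pi> B)" and ?F = "pullback_fol P M \<pi> F"
 note \<pi>m = submersion_msm[OF manifold_dspace[OF P] \<pi>]
 show "dspace ?Z" by (simp add: bpullback_def)
 show "msm ?Z P (tgt (bpullback P \<pi> B)) u" if "u \<in> pts ?Z" for u
  using msm_left[OF that] by simp
 show "striv ?Z P (src (bpullback P \<pi> B)) w" if w: "w \<in> pts ?Z" for w
 proof -
  let ?Y = "fib (total B) (src B) P \<pi>"
  note l = msm_left[OF w] and i = msm_middle[OF w] and r = msm_right[OF w]
  have b: "msm ?Z ?Y (%x. (fst (snd x), snd (snd x))) w"
   by (rule msm_fib[OF i r]) (use nb_pts in eventually_elim, auto)
  hence b: "msm ?Z ?Y snd w" by simp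
  have y: "snd w \<in> pts ?Y" by (rule msm_tgt[OF b])
  note y1 = msm_fib_fst[OF y] and y2 = msm_fib_snd[OF y]
  have "striv ?Y P snd (snd w)"
   by (rule striv_fibre[OF y1 y2 good_striv[OF B msm_tgt[OF y1]] striv_id[OF msm_tgt[OF y2]] \<pi>m[OF msm_tgt[OF y2]], where pair=Pair])
    (auto intro: msm_fib)
  moreover have "striv P M \<pi> (fst w)" using subm_exists[OF P M \<pi> msm_tgt[OF l]] subm.striv by metis
  moreover have "msm ?Y M (%y. tgt B (fst y)) (snd w)" by (rule msm_comp[OF y1 good_tgt[OF B msm_tgt[OF y1]]])
  ultimately have "striv ?Z P (%w. snd (snd w)) w"
   by (intro striv_fibre[OF l b, where pair=Pair and t="%y. tgt B (fst y)"]) (auto intro!: msm_pair)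
  thus ?thesis by simp
 qed
 show "\<exists>L'. vel_fam ?F P Q (%x. tgt (bpullback P \<pi> B) (z x)) w L'"
  if z: "msm (RX Q) ?Z z w" and L: "vel_fam ?F P Q (%x. src (bpullback P \<pi> B) (z x)) w L" for Q :: "'q smooth_space" and z w L
 proof -
  note m = msm_bpullback[OF msm_tgt[OF z]]
  note l = msm_comp[OF z m(1)] and i = msm_comp[OF z m(2)] and r = msm_comp[OF z m(3)]
  \<comment> \<open>Velocities run down \<pi> from the right leg, across \<open>B\<close>, and up
    \<pi> to the left leg. The vertical part arising at the end lies in the foliation by assumption
    \<open>k\<close>.\<close>
  obtain L1 where "vel_fam F M Q (%x. \<pi> (snd (snd (z x)))) w L1" using vel_fam_push[OF manifold_dspace[OF P] \<pi>] L by fastforce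
  hence "vel_fam F M Q (%x. src B (fst (snd (z x)))) w L1"
   by (rule vel_fam_cong) (use msm_pts_ev[OF z] in eventually_elim, auto)
  then obtain L2 where "vel_fam F M Q (%x. tgt B (fst (snd (z x)))) w L2" using good_vel[OF B i] by blast
  hence "vel_fam F M Q (%x. \<pi> (fst (z x))) w L2"
   by (rule vel_fam_cong) (use msm_pts_ev[OF z] in eventually_elim, auto)
  from vel_fam_lift[OF P M \<pi> F l this] obtain L3 where "vel_fam (?F \<union> ker_c P M \<pi>) P Q (%x. fst (z x)) w L3" by blast
  hence "vel_fam ?F P Q (%x. fst (z x)) w L3" by (rule vel_fam_mono) (use k in auto)
  thus ?thesis by auto
 qed
 show "\<exists>z. is_lift (bpullback P \<pi> B) Q y z0 th0 L z"
  if L: "vel_fam ?F P Q y (0, th0) L" and z0: "msm Q ?Z z0 th0" and ty: "near Q th0 (%th. tgt (bpullback P \<pi> B) (z0 th) = y (0, th))"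
  for Q :: "'q smooth_space" and y z0 th0 L
 proof -
  note m = msm_bpullback[OF msm_tgt[OF z0]]
  note l = msm_comp[OF z0 m(1)] and i = msm_comp[OF z0 m(2)] and r = msm_comp[OF z0 m(3)]
  have th: "(0, th0) \<in> UNIV \<times> pts Q" "th0 \<in> pts Q" using msm_src[OF z0] by auto
  have ym: "msm (RX Q) P y (0, th0)" using L by (simp add: vel_fam_def)
  \<comment> \<open>The prescribed motion becomes the left leg, its projection is lifted to
    \<open>B\<close>, and the right leg rests.\<close>
  obtain L1 where L1: "vel_fam F M Q (%x. \<pi> (y x)) (0, th0) L1"
   "\<forall>x. (\<forall>(g, X)\<in>set L. g x = 0) --> (\<forall>(g, X)\<in>set L1. g x = 0)" using vel_fam_push[OF manifold_dspace[OF P] \<pi> L] by blast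
  have L0: "(\<forall>(g, X)\<in>set L1. \<forall>\<tau>. g (\<tau>, th0) = 0)" if "(\<forall>(g, X)\<in>set L. \<forall>\<tau>. g (\<tau>, th0) = 0)" using that L1(2) by fast
  have "near Q th0 (%th. tgt B (fst (snd (z0 th))) = \<pi> (y (0, th)))"
   using ty msm_pts_ev[OF z0] by eventually_elim auto
  from good_lift[OF B L1(1) i this, unfolded is_lift_def] obtain b where b: "msm (RX Q) (total B) b (0, th0)" "near Q th0 (%th. b (0, th) = fst (snd (z0 th)))"
     "near (RX Q) (0, th0) (%w. tgt B (b w) = \<pi> (y w) \<and> src B (b w) = src B (fst (snd (z0 (snd w)))))"
     "(\<forall>(g, X)\<in>set L1. \<forall>\<tau>. g (\<tau>, th0) = 0) --> (\<forall>\<^sub>F \<tau> in nhds 0. b (\<tau>, th0) = fst (snd (z0 th0)))"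
   by (elim exE conjE) (rule that)
  have r': "msm (RX Q) P (%w. snd (snd (z0 (snd w)))) (0, th0)" by (rule msm_comp[OF msm_RX_snd[OF th(1)]]) (use r in simp)
  have zp: "near (RX Q) (0, th0) (%w. z0 (snd w) \<in> pts ?Z)"
   by (rule msm_lim[OF msm_RX_snd[OF th(1)]]) (use msm_pts_ev[OF z0] in simp)
  have "msm (RX Q) ?Z (%w. (y w, b w, snd (snd (z0 (snd w))))) (0, th0)"
   by (rule msm_triple[OF ym b(1) r']) (use b(3) zp in eventually_elim, auto)
  moreover have "near Q th0 (%th. (y (0, th), b (0, th), snd (snd (z0 (snd (0, th))))) = z0 th)"
   using b(2) ty by eventually_elim (auto simp: prod_eq_iff)
  \<comment> \<open>The left leg is the given motion itself, so its rest has to be deduced from its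
    own vanishing velocity; the middle component rests by the clause for \<open>B\<close>.\<close>
  moreover have "\<forall>\<^sub>F \<tau> in nhds 0. (y (\<tau>, th0), b (\<tau>, th0), snd (snd (z0 th0))) = z0 th0"
   if g0: "\<forall>(g, X)\<in>set L. \<forall>\<tau>. g (\<tau>, th0) = 0"
  proof -
   have v0: "vel L a (\<tau>, th0) x = 0" for a \<tau> x using g0 by (induction L) auto
   have Lv: "near (RX Q) (0, th0) (%w. \<forall>a\<in>cinf P. tder (%w. a (y w)) w = vel L a w (y w))" using L by (simp add: vel_fam_def)
   have "near (RX Q) (0, th0) (%w. msm (RX Q) P y w \<and> (\<forall>a\<in>cinf P. tder (%w. a (y w)) w = vel L a w (y w)))"
    using msm_ev[OF ym] Lv by eventually_elim simp
   then obtain e where e: "e > 0" "\<And>\<tau>. \<bar>\<tau> - 0\<bar> < e ==> msm (RX Q) P y (\<tau>, th0) \<and> (\<forall>a\<in>cinf P. tder (%w. a (y w)) (\<tau>, th0) = vel L a (\<tau>, th0) (y (\<tau>, th0)))"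
    using RX_slice[OF _ th(2)] by blast
   have "y (\<tau>, th0) = y (0, th0)" if "\<bar>\<tau> - 0\<bar> < e" for \<tau>
   proof (rule family_const[OF P _ that[unfolded diff_zero]])
    show "msm (RX Q) P y (r, th0) \<and> (\<forall>a\<in>cinf P. tder (%w. a (y w)) (r, th0) = 0)" if "abs r < e" for r
     using e(2)[of r] that unfolding v0 by simp
   qed
   hence "\<forall>\<^sub>F \<tau> in nhds 0. y (\<tau>, th0) = y (0, th0)" unfolding eventually_nhds_metric dist_real_def using e(1) by blast
   moreover have "fst (z0 th0) = y (0, th0)" using nb_self[OF ty th(2)] by simp
   moreover have "\<forall>\<^sub>F \<tau> in nhds 0. b (\<tau>, th0) = fst (snd (z0 th0))" using b(4) L0[OF g0] by (rule mp)
   ultimately show ?thesis by (auto simp: prod_eq_iff elim: eventually_elim2)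
  qed
  ultimately show ?thesis unfolding is_lift_def by (intro exI[of _ "%w. (y w, b w, snd (snd (z0 (snd w))))"]) simp
 qed
qed

section \<open>Germs carried by points of bisubmersions\<close>

abbreviation "nice N F B \<equiv> good TYPE((nat => real) \<times> 'n) (N :: 'n smooth_space) F B"

text \<open>Transversality is left out and f need not be invertible. Every point of a good
  bisubmersion carries such a germ, which therefore classifies points up to equivalence.\<close>

definition has_germ where
 "has_germ N B u x f \<longleftrightarrow> (\<exists>s. sect N B x u s \<and> (near N x (%y. tgt B (s y) = f y)))"

lemma has_germD:
 assumes "has_germ N B u x f"
 shows "u \<in> pts (total B)" "src B u = x" "tgt B u = f x" "x \<in> pts N"
 using assms nb_self[of "%y. tgt B (_ y) = f y" N x] sectD(2,4,5,6) unfolding has_germ_def by metis+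

lemma has_germ_cong: "has_germ N B u x f ==> near N x (%y. f y = g y) ==> has_germ N B u x g"
 unfolding has_germ_def by (fastforce elim: eventually_elim2)

lemma has_germ_exists:
 assumes "good TYPE('q) N F B" "u \<in> pts (total B)"
 shows "\<exists>f. has_germ N B u (src B u) f"
proof -
 obtain s where "sect N B (src B u) u s" using sect_exists[OF assms] by blast
 hence "has_germ N B u (src B u) (%y. tgt B (s y))" unfolding has_germ_def by (intro exI[of _ s]) simp
 thus ?thesis by blast
qed

lemma has_germ_msm:
 assumes B: "good TYPE('q) N F B" and g: "has_germ N B u x f"
 shows "msm N N f x"
proof -
 from g obtain s where s: "sect N B x u s" and e: "near N x (%y. tgt B (s y) = f y)" unfolding has_germ_def by blast
 have "msm N N (%y. tgt B (s y)) x" by (rule msm_comp[OF sectD(1)[OF s] good_tgt[OF B]]) (use sectD[OF s] in simp)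
 thus ?thesis by (rule msm_cong) (use e in eventually_elim, simp)
qed

lemma has_germ_equiv:
 assumes "nice N F B" "nice N F C" and b: "has_germ N B u x f" and c: "has_germ N C v x f"
 shows "equiv_pt N B u C v"
proof -
 from b c obtain s s' where s: "sect N B x u s" "near N x (%y. tgt B (s y) = f y)"
  and s': "sect N C x v s'" "near N x (%y. tgt C (s' y) = f y)" unfolding has_germ_def by blast
 from s(2) s'(2) have "near N x (%y. tgt B (s y) = tgt C (s' y))" by eventually_elim simp
 from equiv_ptI[OF assms(1,2) s(1) s'(1) this] show ?thesis .
qed

lemma has_germ_transfer:
 assumes e: "equiv_pt N B u C v" and b: "has_germ N B u x f"
 shows "has_germ N C v x f"
proof -
 from b obtain s where s: "sect N B x u s" and t: "near N x (%y. tgt B (s y) = f y)" unfolding has_germ_def by blast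
 from sect_equiv[OF e s] obtain s' where s': "sect N C x v s'" "near N x (%y. tgt C (s' y) = tgt B (s y))" by blast
 from s'(2) t have "near N x (%y. tgt C (s' y) = f y)" by eventually_elim simp
 thus ?thesis using s'(1) unfolding has_germ_def by blast
qed

lemma equiv_pt_tgt: "equiv_pt N B u C v ==> u \<in> pts (total B) ==> v \<in> pts (total C)"
 by (auto simp: equiv_pt_iff dest: msm_tgt)

text \<open>The morphism itself cannot be reversed. It transfers the germ carried at u to v, and
  points with a common germ are equivalent in both directions.\<close>

lemma equiv_pt_sym:
 assumes "nice N F B" "nice N F C" "equiv_pt N B u C v" "u \<in> pts (total B)"
 shows "equiv_pt N C v B u"
 using has_germ_exists[OF assms(1,4)] has_germ_transfer[OF assms(3)] has_germ_equiv[OF assms(2,1)] by blast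

lemma equiv_pt_map:
 assumes u: "u \<in> pts (total B)" and f: "msm (total B) (total C) f u"
  and e: "near (total B) u (%w. tgt C (f w) = tgt B w \<and> src C (f w) = src B w)"
 shows "equiv_pt N B u C (f u)"
 unfolding equiv_pt_iff[OF u] using f e by blast

lemma equiv_pt_trans:
 assumes "equiv_pt N B u C v" "equiv_pt N C v D w" and u: "u \<in> pts (total B)"
 shows "equiv_pt N B u D w"
proof -
 have v: "v \<in> pts (total C)" by (rule equiv_pt_tgt[OF assms(1) u])
 from assms obtain f g where f: "msm (total B) (total C) f u" "f u = v" "near (total B) u (%w. tgt C (f w) = tgt B w \<and> src C (f w) = src B w)"
  and g: "msm (total C) (total D) g (f u)" "g v = w" "near (total C) (f u) (%w. tgt D (g w) = tgt C w \<and> src D (g w) = src C w)"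
  unfolding equiv_pt_iff[OF u] equiv_pt_iff[OF v] by auto
 have "equiv_pt N B u D (g (f u))"
  by (rule equiv_pt_map[OF u msm_comp[OF f(1) g(1)]]) (use msm_lim[OF f(1) g(3)] f(3) in eventually_elim, simp)
 thus ?thesis by (simp add: f g)
qed

lemma equiv_pt_ev:
 assumes e: "equiv_pt N B u C v" and u: "u \<in> pts (total B)"
 shows "near (total B) u (%w. \<exists>v'\<in>pts (total C). equiv_pt N B w C v')"
proof -
 from e obtain f where f: "msm (total B) (total C) f u" "near (total B) u (%w. tgt C (f w) = tgt B w \<and> src C (f w) = src B w)"
  unfolding equiv_pt_iff[OF u] by blast
 from msm_ev[OF f(1)] nb_ev[OF f(2)] nb_pts[of "total B" u] show ?thesis
  by eventually_elim (blast intro: equiv_pt_map msm_tgt)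
qed

lemma has_germ_bcomp:
 assumes C: "good TYPE('q) N F C" and g: "has_germ N B u y g" and f: "has_germ N C v x f" and y: "y = f x"
 shows "has_germ N (bcomp B C) (Comp u v) x (%z. g (f z))"
proof -
 from g obtain s where s: "sect N B (f x) u s" and gs: "near N (f x) (%z. tgt B (s z) = g z)" unfolding has_germ_def y by blast
 from f obtain s' where s': "sect N C x v s'" and fs: "near N x (%z. tgt C (s' z) = f z)" unfolding has_germ_def by blast
 note S = sectD[OF s] and S' = sectD[OF s']
 note fm = has_germ_msm[OF C f]
 have e: "near N x (%z. src B (s (f z)) = tgt C (s' z))" using msm_lim[OF fm S(3)] fs by eventually_elim simp
 have "sect N (bcomp B C) x (Comp u v) (%z. Comp (s (f z)) (s' z))"
  unfolding sect_def using msm_Comp[OF msm_comp[OF fm S(1)] S'(1) e] S S' by simp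
 moreover have "near N x (%z. tgt (bcomp B C) (Comp (s (f z)) (s' z)) = g (f z))" using msm_lim[OF fm gs] by eventually_elim simp
 ultimately show ?thesis unfolding has_germ_def by blast
qed

section \<open>Germs of a path holonomy atlas\<close>

text \<open>The step serves all orbit points near y with one bound on the times, forwards and
  backwards, so \<open>P\<close> is locally constant along the orbit; the real line is
  connected.\<close>

lemma flow_induct:
 assumes N: "manifold N" and X: "X \<in> vfields_c N" and x: "x \<in> pts N" and P0: "P 0"
  and step: "\<And>y. y \<in> pts N ==> \<exists>e>0. near N y (%y'. \<forall>r \<tau>. abs r < e --> iflow N X \<tau> x = y' --> P \<tau> --> P (\<tau> + r))"
 shows "P \<tau>"
proof -
 note I = iflow_curve[OF N X x]
 have "\<forall>\<^sub>F s in at t within UNIV. P t = P s" for t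
 proof -
  obtain e where e: "e > 0" "near N (iflow N X t x) (%y'. \<forall>r \<tau>. abs r < e --> iflow N X \<tau> x = y' --> P \<tau> --> P (\<tau> + r))"
   using step[OF I(3)] by blast
  have "\<forall>\<^sub>F s in nhds t. abs s < abs t + 1 \<and> (\<forall>r \<tau>. abs r < e --> iflow N X \<tau> x = iflow N X s x --> P \<tau> --> P (\<tau> + r))"
   by (rule icurve_lim[OF integral_icurve[OF I(1)] _ e(2)]) simp
  moreover have "\<forall>\<^sub>F s in nhds t. \<bar>s - t\<bar> < e" unfolding eventually_nhds_metric dist_real_def using e(1) by blast
  ultimately have "\<forall>\<^sub>F s in nhds t. P t = P s"
  proof eventually_elim
   case (elim s)
   have "\<forall>r \<tau>. abs r < e --> iflow N X \<tau> x = iflow N X t x --> P \<tau> --> P (\<tau> + r)" using nb_self[OF e(2) I(3)] .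
   from this[rule_format, of "s - t" t] elim(1)[THEN conjunct2, rule_format, of "t - s" s] elim(2) show ?case by auto
  qed
  thus ?thesis by (rule filter_leD[OF at_within_le_nhds])
 qed
 hence "P 0 = P \<tau>" by (intro connected_local_const[OF connected_UNIV]) auto
 thus ?thesis using P0 by simp
qed

lemma path_holonomy_bisubD:
 assumes "\<exists>x0. path_holonomy_bisub N F x0 B"
  and "\<And>n X V. \<forall>i<n. X i \<in> F ==> openin (dtop (exp_space n N)) V ==> total B = sub (exp_space n N) V ==>
   \<forall>v x. Exp v x \<in> V --> src B (Exp v x) = x \<and> tgt B (Exp v x) = vexp N (vlin n (%i _. v i) X) x ==> thesis"
 shows thesis
 using assms(1) unfolding path_holonomy_bisub_def fibre_basis_def by (elim exE conjE) (rule assms(2))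

locale atlas =
 fixes N :: "'n smooth_space" and F and E :: "('n hpt, 'n) bisub set"
 assumes N: "manifold N" and fol: "singular_foliation N F" and E: "\<And>B. B \<in> E ==> \<exists>x0. path_holonomy_bisub N F x0 B"
  and cover: "(\<Union>B\<in>E. src B ` pts (total B)) = pts N"
begin

lemma F: "F \<subseteq> vfields_c N" and Fv: "F \<subseteq> vfields N"
 using fol by (auto simp: singular_foliation_def vfields_c_def)

lemma bisub: "B \<in> E ==> bisubmersion N F B"
 using E by (auto simp: path_holonomy_bisub_def)

lemma atlas_good: "B \<in> finite_comps E ==> good TYPE('q) N F B"
 by (induction rule: finite_comps.induct) (auto intro: bisub_good[OF N F] bisubmersion_binv bisub good_bcomp)

lemma vlin_F: "(\<And>i. i < n ==> X i \<in> F) ==> vlin n (%i _. c i) X \<in> F"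
proof (induction n)
 case 0
 show ?case using fol by (simp add: vlin_def singular_foliation_def)
next
 case (Suc n)
 let ?f = "%y. if y \<in> pts N then c n else 0"
 have d: "dspace N" by (rule manifold_dspace[OF N])
 have Xn: "X n \<in> vfields N" using Suc.prems Fv by auto
 have sc: "\<forall>f\<in>cinf N. \<forall>X\<in>F. (%a x. f x * X a x) \<in> F" and ad: "\<forall>X\<in>F. \<forall>Y\<in>F. vadd X Y \<in> F"
  using fol unfolding singular_foliation_def by simp_all
 have "(%a x. ?f x * X n a x) \<in> F" by (rule sc[rule_format, OF cinf_const[OF d]]) (simp add: Suc.prems)
 moreover have "X n a x = 0" if "x \<notin> pts N" for a x using vfield_cinf[OF Xn, of a] that unfolding cinf_iff[OF d] by blast
 hence "(%a x. ?f x * X n a x) = (%a x. c n * X n a x)" by (auto simp: fun_eq_iff)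
 ultimately have "vadd (vlin n (%i _. c i) X) (%a x. c n * X n a x) \<in> F"
  using Suc ad by simp
 thus ?case by (simp add: vlin_def vadd_def)
qed

lemma iflow_smooth:
 assumes X: "X \<in> F" and x: "x \<in> pts N"
 shows "msm N N (iflow N X \<tau>) x"
proof (rule flow_induct[OF N _ x, where P="%\<tau>. msm N N (iflow N X \<tau>) x"])
 show Xc: "X \<in> vfields_c N" using X F by auto
 show "msm N N (iflow N X 0) x"
  by (rule msm_cong[OF msm_id[OF x]]) (use nb_pts in eventually_elim, simp add: iflow_curve[OF N Xc])
 show "\<exists>e>0. near N y (%y'. \<forall>r \<tau>. abs r < e --> iflow N X \<tau> x = y' --> msm N N (iflow N X \<tau>) x --> msm N N (iflow N X (\<tau> + r)) x)"
  if y: "y \<in> pts N" for y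
 proof -
  obtain e where e: "e > 0" "near N y (%q. \<forall>r. \<bar>r - 0\<bar> < e --> msm (RX N) N (%w. iflow N X (fst w) (snd w)) (r, q))"
   using msm_ev[OF iflow_msm[OF N Xc y]] unfolding eventually_RX[OF y] by blast
  have "msm N N (iflow N X (\<tau> + r)) x"
   if q: "iflow N X \<tau> x = q" "msm N N (iflow N X \<tau>) x" and m: "msm (RX N) N (%w. iflow N X (fst w) (snd w)) (r, q)" for r \<tau> q
  proof -
   have "msm N (RX N) (%z. (r, iflow N X \<tau> z)) x" by (intro msm_RXI fsm_const x q)
   from msm_comp[OF this, of N "%w. iflow N X (fst w) (snd w)"] m q(1) have "msm N N (%z. iflow N X r (iflow N X \<tau> z)) x" by simp
   thus ?thesis
    by (rule msm_cong) (use nb_pts in eventually_elim, simp add: iflow_add[OF N Xc, symmetric] add.commute)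
  qed
  thus ?thesis using e by (intro exI[of _ e]) (auto elim!: eventually_mono)
 qed
qed

text \<open>Keeping the parameter v fixed gives a section of the source map, whose target is the
  time-one flow of the combination of the fields with constant coefficients v. For the inverse
  bisubmersion the section is composed with the backward flow.\<close>

lemma generator:
 assumes B: "B \<in> E" and u: "u \<in> pts (total B)"
 shows "\<exists>X\<in>F. has_germ N B u (src B u) (iflow N X 1) \<and> has_germ N (binv B) u (tgt B u) (iflow N X (- 1))"
proof -
 from E[OF B] obtain n X V where X: "\<forall>i<n. X i \<in> F" and V: "openin (dtop (exp_space n N)) V" "total B = sub (exp_space n N) V"
  and st: "\<forall>v x. Exp v x \<in> V --> src B (Exp v x) = x \<and> tgt B (Exp v x) = vexp N (vlin n (%i _. v i) X) x"
  by (rule path_holonomy_bisubD)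
 have "V \<subseteq> pts (exp_space n N)" using openin_subset[OF V(1)] by simp
 then obtain v x where vx: "u = Exp v x" "v \<in> Rn n" "x \<in> pts N" "Exp v x \<in> V" using u V(2) by (auto simp: exp_space_def)
 define Y where "Y = vlin n (%i _. v i) X"
 have Y: "Y \<in> F" unfolding Y_def by (rule vlin_F) (use X in auto)
 hence Yc: "Y \<in> vfields_c N" using F by auto
 have tgt: "tgt B (Exp v y) = iflow N Y 1 y" and src: "src B (Exp v y) = y" if "Exp v y \<in> V" "y \<in> pts N" for y
  using st[rule_format, OF that(1)] vexp_iflow[OF N Yc that(2)] by (auto simp: Y_def)
 have m: "msm N (exp_space n N) (Exp v) x"
  unfolding exp_space_def
 proof (rule msm_gen[OF vx(3)])
  show "near N x (%y. Exp v y \<in> {Exp v x |v x. v \<in> Rn n \<and> x \<in> pts N})" using nb_pts by eventually_elim (use vx in auto)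
  show "near N x (%y. \<forall>a\<in>{a \<circ> param |a. a \<in> cinf (euclid n)} \<union> {b \<circ> base |b. b \<in> cinf N}. fsm N (%z. a (Exp v z)) y)"
   using nb_pts by eventually_elim (auto intro: fsm_const cinf_fsm)
 qed
 have mB: "msm N (total B) (Exp v) x" unfolding V(2) by (rule msm_sub_tgt[OF V(1) m vx(4)])
 have p: "near N x (%y. Exp v y \<in> V \<and> y \<in> pts N)" using msm_pts_ev[OF mB] nb_pts by eventually_elim (simp add: V(2))
 have "has_germ N B u x (iflow N Y 1)"
  unfolding has_germ_def sect_def using mB p vx(1)
  by (intro exI[of _ "Exp v"]) (auto elim!: eventually_mono simp: tgt src)
 moreover have "has_germ N (binv B) u (iflow N Y 1 x) (iflow N Y (- 1))"
 proof -
  let ?y = "iflow N Y 1 x" and ?s = "%z. Exp v (iflow N Y (- 1) z)"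
  have y: "?y \<in> pts N" by (rule iflow_curve[OF N Yc vx(3)])
  have i: "iflow N Y (- 1) ?y = x" using iflow_add[OF N Yc vx(3), of "- 1" 1] iflow_curve(2)[OF N Yc vx(3)] by simp
  have i': "iflow N Y 1 (iflow N Y (- 1) z) = z" if "z \<in> pts N" for z
   using iflow_add[OF N Yc that, of 1 "- 1"] iflow_curve(2)[OF N Yc that] by simp
  note im = iflow_smooth[OF Y y, of "- 1"]
  have q: "near N ?y (%z. Exp v (iflow N Y (- 1) z) \<in> V \<and> iflow N Y (- 1) z \<in> pts N \<and> z \<in> pts N)"
   by (intro eventually_conj nb_pts msm_lim[OF im]) (use p in "simp_all add: i eventually_conj_iff")
  have "msm N (total B) ?s ?y" by (rule msm_comp[OF im]) (use mB i in simp)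
  hence "sect N (binv B) ?y u ?s"
   unfolding sect_def using q vx(1) i by (auto simp: binv_def tgt i' elim!: eventually_mono)
  moreover have "near N ?y (%z. tgt (binv B) (?s z) = iflow N Y (- 1) z)" using q by eventually_elim (simp add: binv_def src)
  ultimately show ?thesis unfolding has_germ_def by blast
 qed
 ultimately show ?thesis using Y vx tgt src by auto
qed

text \<open>Parameter 0 is known to occur only over the centre of a path holonomy bisubmersion. Over
  other points a unit is obtained by composing a point with itself in the inverse, which carries the
  flow followed by its reverse.\<close>

lemma unit_exists:
 assumes x: "x \<in> pts N"
 shows "\<exists>D\<in>finite_comps E. \<exists>w. has_germ N D w x (%y. y)"
proof -
 have "x \<in> (\<Union>B\<in>E. src B ` pts (total B))" using x cover by simp
 then obtain B u where B: "B \<in> E" "u \<in> pts (total B)" "src B u = x" by blast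
 from generator[OF B(1,2)] obtain X where X: "X \<in> F" "has_germ N B u x (iflow N X 1)" "has_germ N (binv B) u (tgt B u) (iflow N X (- 1))"
  using B(3) by blast
 have Xc: "X \<in> vfields_c N" using X(1) F by auto
 have BE: "B \<in> finite_comps E" "binv B \<in> finite_comps E" using B(1) by (auto intro: finite_comps.intros)
 have "has_germ N (bcomp (binv B) B) (Comp u u) x (%z. iflow N X (- 1) (iflow N X 1 z))"
  by (rule has_germ_bcomp[OF atlas_good[OF BE(1)] X(3,2)]) (rule has_germD(3)[OF X(2)])
 hence "has_germ N (bcomp (binv B) B) (Comp u u) x (%z. z)"
  by (rule has_germ_cong) (use nb_pts in eventually_elim, simp add: iflow_add[OF N Xc, symmetric] iflow_curve[OF N Xc])
 thus ?thesis using BE by (blast intro: finite_comps.intros)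
qed

text \<open>Every element of the atlas is, up to equivalence, a composition of points close to units: move
 along the flows of the generators in small steps, lifting them to neighbourhoods of units.\<close>

lemma atlas_induct:
 assumes eq: "\<And>B u C v. T B u ==> B \<in> finite_comps E ==> C \<in> finite_comps E ==> u \<in> pts (total B) ==> equiv_pt N B u C v ==> T C v"
  and comp: "\<And>B u C v. T B u ==> T C v ==> B \<in> finite_comps E ==> C \<in> finite_comps E ==> u \<in> pts (total B) ==>
   v \<in> pts (total C) ==> src B u = tgt C v ==> T (bcomp B C) (Comp u v)"
  and unit: "\<And>x D w. D \<in> finite_comps E ==> has_germ N D w x (%y. y) ==> near (total D) w (%w'. T D w')"
  and B: "B \<in> finite_comps E" and u: "u \<in> pts (total B)"
 shows "T B u"
proof -
 \<comment> \<open>Along an orbit: an element with the property that carries the flow up to one time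
   is composed with a point near a unit that carries the flow for the remaining short time. That
   point comes from lifting the flow from the section through the unit.\<close>
 have flow: "\<exists>D\<in>finite_comps E. \<exists>w. T D w \<and> has_germ N D w x (iflow N X \<tau>)" if X: "X \<in> F" and x: "x \<in> pts N" for X x \<tau>
 proof (rule flow_induct[OF N _ x, where P="%\<tau>. \<exists>D\<in>finite_comps E. \<exists>w. T D w \<and> has_germ N D w x (iflow N X \<tau>)"])
  show Xc: "X \<in> vfields_c N" using X F by auto
  note I = iflow_curve[OF N Xc]
  obtain D w where D: "D \<in> finite_comps E" "has_germ N D w x (%y. y)" using unit_exists[OF x] by blast
  have "has_germ N D w x (iflow N X 0)"
   by (rule has_germ_cong[OF D(2)]) (use nb_pts in eventually_elim, simp add: I)
  thus "\<exists>D\<in>finite_comps E. \<exists>w. T D w \<and> has_germ N D w x (iflow N X 0)"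
   using D(1) nb_self[OF unit[OF D] has_germD(1)[OF D(2)]] by blast
  show "\<exists>e>0. near N y (%y'. \<forall>r \<tau>. abs r < e --> iflow N X \<tau> x = y' --> (\<exists>D\<in>finite_comps E. \<exists>w. T D w \<and> has_germ N D w x (iflow N X \<tau>)) -->
    (\<exists>D\<in>finite_comps E. \<exists>w. T D w \<and> has_germ N D w x (iflow N X (\<tau> + r))))" if y: "y \<in> pts N" for y
  proof -
   obtain D w where D: "D \<in> finite_comps E" "has_germ N D w y (%y. y)" using unit_exists[OF y] by blast
   from D(2) obtain s where s: "sect N D y w s" "near N y (%z. tgt D (s z) = z)" unfolding has_germ_def by blast
   note S = sectD[OF s(1)]
   have y0: "(0, y) \<in> UNIV \<times> pts N" using y by simp
   have "vel_fam F N N (%w. iflow N X (fst w) (snd w)) (0, y) [(%_. 1, X)]"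
    unfolding vel_fam_def
   proof (intro conjI iflow_msm[OF N Xc y])
    show "\<forall>(g, X)\<in>set [(%_. 1, X)]. fsm (RX N) g (0, y) \<and> X \<in> F" using X y by (auto intro: fsm_const)
    show "near (RX N) (0, y) (%w'. \<forall>a\<in>cinf N. tder (%x. a (iflow N X (fst x) (snd x))) w' =
     vel [(%_. 1, X)] a w' (iflow N X (fst w') (snd w')))" using nb_pts
     by eventually_elim (use I(1) in "auto simp: tder_def integral_curve_def intro: DERIV_imp_deriv")
   qed
   moreover have "near N y (%th. tgt D (s th) = iflow N X (fst (0, th)) (snd (0, th)))"
    using s(2) nb_pts by eventually_elim (simp add: I)
   ultimately obtain z where z: "msm (RX N) (total D) z (0, y)" "near N y (%th. z (0, th) = s th)"
     "near (RX N) (0, y) (%w. tgt D (z w) = iflow N X (fst w) (snd w) \<and> src D (z w) = src D (s (snd w)))"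
    using good_lift[OF atlas_good[OF D(1)] _ S(1)] unfolding is_lift_def by blast
   have sz: "near (RX N) (0, y) (%w. src D (s (snd w)) = snd w)"
    by (rule msm_lim[OF msm_RX_snd[OF y0]]) (use S(3) in simp)
   have "z (0, y) = w" using nb_self[OF z(2) y] S(2) by simp
   hence "near (RX N) (0, y) (%w. T D (z w))" using msm_lim[OF z(1)] unit[OF D] by simp
   hence "near (RX N) (0, y) (%w. T D (z w) \<and> msm (RX N) (total D) z w \<and>
     (near (RX N) w (%w. tgt D (z w) = iflow N X (fst w) (snd w) \<and> src D (z w) = snd w)))"
    using msm_ev[OF z(1)] nb_ev[OF z(3)] nb_ev[OF sz] by eventually_elim (auto elim: eventually_elim2)
   then obtain e where e: "e > 0" "near N y (%q. \<forall>r. \<bar>r - 0\<bar> < e --> T D (z (r, q)) \<and> msm (RX N) (total D) z (r, q) \<and>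
     (near (RX N) (r, q) (%w. tgt D (z w) = iflow N X (fst w) (snd w) \<and> src D (z w) = snd w)))"
    unfolding eventually_RX[OF y] by blast
   have main: "\<exists>D\<in>finite_comps E. \<exists>w. T D w \<and> has_germ N D w x (iflow N X (\<tau> + r))"
    if q: "q \<in> pts N" "iflow N X \<tau> x = q" and zq: "T D (z (r, q))" "msm (RX N) (total D) z (r, q)"
     "near (RX N) (r, q) (%w. tgt D (z w) = iflow N X (fst w) (snd w) \<and> src D (z w) = snd w)"
     and C: "C \<in> finite_comps E" "T C v" "has_germ N C v x (iflow N X \<tau>)" for q r \<tau> C v
   proof -
    have rq: "msm N (RX N) (%p. (r, p)) q" by (intro msm_RXI fsm_const msm_id q)
    have z': "msm N (total D) (%p. z (r, p)) q" by (rule msm_comp[OF rq zq(2)])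
    have g: "has_germ N D (z (r, q)) q (iflow N X r)"
     unfolding has_germ_def sect_def using z' msm_lim[OF rq zq(3)]
     by (intro exI[of _ "%p. z (r, p)"]) (auto elim: eventually_mono)
    have "has_germ N (bcomp D C) (Comp (z (r, q)) v) x (%p. iflow N X r (iflow N X \<tau> p))"
     by (rule has_germ_bcomp[OF atlas_good[OF C(1)] g C(3)]) (use q in simp)
    hence "has_germ N (bcomp D C) (Comp (z (r, q)) v) x (iflow N X (\<tau> + r))"
     by (rule has_germ_cong) (use nb_pts in eventually_elim, simp add: iflow_add[OF N Xc, symmetric] add.commute)
    moreover have "T (bcomp D C) (Comp (z (r, q)) v)"
     using comp[OF zq(1) C(2) D(1) C(1) has_germD(1)[OF g] has_germD(1)[OF C(3)]] has_germD(2)[OF g] has_germD(3)[OF C(3)] q(2) by simp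
    ultimately show ?thesis using finite_comps.intros(3)[OF D(1) C(1)] by blast
   qed
   from e(2) nb_pts[of N y] have "near N y (%q. \<forall>r \<tau>. abs r < e --> iflow N X \<tau> x = q --> (\<exists>D\<in>finite_comps E. \<exists>w. T D w \<and> has_germ N D w x (iflow N X \<tau>)) -->
    (\<exists>D\<in>finite_comps E. \<exists>w. T D w \<and> has_germ N D w x (iflow N X (\<tau> + r))))"
   proof eventually_elim
    case (elim q)
    show ?case
    proof (intro allI impI)
     fix r \<tau> assume r: "abs r < e" and q: "iflow N X \<tau> x = q" and "\<exists>D\<in>finite_comps E. \<exists>w. T D w \<and> has_germ N D w x (iflow N X \<tau>)"
     then obtain C v where C: "C \<in> finite_comps E" "T C v" "has_germ N C v x (iflow N X \<tau>)" by blast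
     have "\<bar>r - 0\<bar> < e" using r by simp
     note z = elim(1)[rule_format, OF this]
     show "\<exists>D\<in>finite_comps E. \<exists>w. T D w \<and> has_germ N D w x (iflow N X (\<tau> + r))"
      by (rule main[OF elim(2) q z[THEN conjunct1] z[THEN conjunct2, THEN conjunct1] z[THEN conjunct2, THEN conjunct2] C])
    qed
   qed
   thus ?thesis using e(1) by blast
  qed
 qed
 \<comment> \<open>A point carrying such a flow is equivalent to the element just constructed, and
   the property is invariant under equivalence. Points of generators and of their inverses carry
   flows at times 1 and -1.\<close>
 have gen: "T B u" if g: "X \<in> F" "has_germ N B u x (iflow N X \<tau>)" and B: "B \<in> finite_comps E" for B u X x \<tau>
 proof -
  obtain D w where D: "D \<in> finite_comps E" "T D w" "has_germ N D w x (iflow N X \<tau>)" using flow[OF g(1) has_germD(4)[OF g(2)]] by blast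
  show ?thesis
   by (rule eq[OF D(2,1) B has_germD(1)[OF D(3)] has_germ_equiv[OF atlas_good[OF D(1)] atlas_good[OF B] D(3) g(2)]])
 qed
 show ?thesis using B u
 proof (induction arbitrary: u rule: finite_comps.induct)
  case (1 B)
  thus ?case using generator[OF 1] gen finite_comps.intros(1)[OF 1(1)] by blast
 next
  case (2 B)
  hence "u \<in> pts (total B)" by (simp add: binv_def)
  thus ?case using generator[OF 2(1)] gen finite_comps.intros(2)[OF 2(1)] by blast
 next
  case (3 B C)
  thus ?case by (auto intro!: comp)
 qed
qed

end

section \<open>Comparison of the two atlases\<close>

lemma connected_locally_const:
 assumes T: "connected_space T" and l: "\<And>x. x \<in> topspace T ==> \<forall>\<^sub>F y in nhdsin T x. Q x = Q y"
  and x: "x \<in> topspace T" "Q x" and y: "y \<in> topspace T"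
 shows "Q y"
proof (rule ccontr)
 assume ny: "\<not> Q y"
 have o: "openin T {x \<in> topspace T. Q x = b}" for b
 proof (subst openin_subopen, intro ballI)
  fix x assume "x \<in> {x \<in> topspace T. Q x = b}"
  hence x: "x \<in> topspace T" "Q x = b" by auto
  obtain V where V: "openin T V" "x \<in> V" "\<forall>y\<in>V. Q x = Q y" using l[OF x(1)] unfolding eventually_nhdsin using x(1) by auto
  thus "\<exists>V. openin T V \<and> x \<in> V \<and> V \<subseteq> {x \<in> topspace T. Q x = b}" using x openin_subset[OF V(1)] by blast
 qed
 have "topspace T \<subseteq> {x \<in> topspace T. Q x = True} \<union> {x \<in> topspace T. Q x = False}" by auto
 moreover have "{x \<in> topspace T. Q x = True} \<inter> {x \<in> topspace T. Q x = False} = {}" by auto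
 ultimately show False using T o[of True] o[of False] x y ny unfolding connected_space_def by blast
qed

lemma equiv_pt_ends:
 "equiv_pt N B u C v ==> u \<in> pts (total B) ==> tgt C v = tgt B u \<and> src C v = src B u"
 using nb_self[of "%w. tgt C (_ w) = tgt B w \<and> src C (_ w) = src B w" "total B" u] by (auto simp: equiv_pt_iff)

locale principal = M: atlas M FM EU + P: atlas P F EW
 for M :: "'m smooth_space" and FM EU and P :: "'p smooth_space" and F EW +
 fixes \<pi> :: "'p => 'm"
 assumes sub: "submersion P M \<pi>" and surj: "\<pi> ` pts P = pts M" and ker: "ker_c P M \<pi> \<subseteq> F" and pull: "pullback_fol P M \<pi> FM = F"
begin

abbreviation "\<U> \<equiv> finite_comps EU"
abbreviation "\<W> \<equiv> finite_comps EW"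
abbreviation "bp \<equiv> bpullback P \<pi>"

lemma \<pi>m: "p \<in> pts P ==> msm P M \<pi> p"
 by (rule submersion_msm[OF manifold_dspace[OF P.N] sub])

lemma bp_good: "C \<in> \<U> ==> good TYPE('q) P F (bp C)"
 using good_bpullback[OF P.N M.N sub M.Fv _ M.atlas_good] ker by (simp add: pull)

lemma local_section:
 assumes q: "q \<in> pts P"
 shows "\<exists>\<sigma>. msm M P \<sigma> (\<pi> q) \<and> \<sigma> (\<pi> q) = q \<and> (near M (\<pi> q) (%x. \<pi> (\<sigma> x) = x))"
proof -
 have "striv P M \<pi> q" using subm_exists[OF P.N M.N sub q] subm.striv by metis
 then obtain k l \<Theta> where l: "msm P (euclid k) l q" and T: "msm (sprod (euclid k) M) P \<Theta> (l q, \<pi> q)" "near P q (%w. \<Theta> (l w, \<pi> w) = w)"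
   "near (sprod (euclid k) M) (l q, \<pi> q) (%p. \<pi> (\<Theta> p) = snd p)" unfolding striv_def by blast
 have m: "msm M (sprod (euclid k) M) (%y. (l q, y)) (\<pi> q)"
  using msm_tgt[OF \<pi>m[OF q]] msm_tgt[OF l] by (intro msm_sprodI msm_const msm_id) auto
 show ?thesis using msm_comp[OF m T(1)] nb_self[OF T(2) q] msm_lim[OF m T(3)] by (intro exI[of _ "%y. \<Theta> (l q, y)"]) simp
qed

lemma bp_germD:
 assumes "has_germ P (bp C) (p, u, q) q f"
 shows "\<exists>c. msm P (total C) c q \<and> c q = u \<and> f q = p \<and> (near P q (%y. tgt C (c y) = \<pi> (f y) \<and> src C (c y) = \<pi> y))"
proof -
 from assms obtain s where s: "sect P (bp C) q (p, u, q) s" and t: "near P q (%y. tgt (bp C) (s y) = f y)" unfolding has_germ_def by blast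
 note S = sectD[OF s]
 have "near P q (%y. tgt C (fst (snd (s y))) = \<pi> (f y) \<and> src C (fst (snd (s y))) = \<pi> y)"
  using msm_pts_ev[OF S(1)] S(3) t by eventually_elim auto
 moreover have "msm P (total C) (%y. fst (snd (s y))) q" by (rule msm_comp[OF S(1)]) (use S in "auto intro: msm_middle")
 ultimately show ?thesis using has_germD(3)[OF assms] S(2) by (intro exI[of _ "%y. fst (snd (s y))"]) auto
qed

lemma bp_germI:
 assumes f: "msm P P f q" and c: "msm P (total C) c q" and e: "near P q (%y. tgt C (c y) = \<pi> (f y) \<and> src C (c y) = \<pi> y)"
 shows "has_germ P (bp C) (f q, c q, q) q f"
proof -
 have "msm P (total (bp C)) (%y. (f y, c y, y)) q"
  by (rule msm_triple[OF f c msm_id[OF msm_src[OF f]]]) (use e in eventually_elim, simp)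
 thus ?thesis unfolding has_germ_def sect_def by (intro exI[of _ "%y. (f y, c y, y)"]) simp
qed

text \<open>The composition is formed downstairs. The intermediate point r is not recorded in the
  result; it only ensures that the two germs can be composed.\<close>

lemma bp_comp:
 assumes C: "C1 \<in> \<U>" "C2 \<in> \<U>" and g: "has_germ P (bp C1) (p, u1, r) r g" and f: "has_germ P (bp C2) (r, u2, q) q f"
 shows "has_germ P (bp (bcomp C1 C2)) (p, Comp u1 u2, q) q (%y. g (f y))"
proof -
 obtain c where c: "msm P (total C1) c r" "c r = u1" "g r = p" "near P r (%y. tgt C1 (c y) = \<pi> (g y) \<and> src C1 (c y) = \<pi> y)" using bp_germD[OF g] by blast
 obtain d where d: "msm P (total C2) d q" "d q = u2" "f q = r" "near P q (%y. tgt C2 (d y) = \<pi> (f y) \<and> src C2 (d y) = \<pi> y)" using bp_germD[OF f] by blast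
 have fm: "msm P P f q" and gm: "msm P P g (f q)"
  using has_germ_msm[OF bp_good[OF C(2)] f] has_germ_msm[OF bp_good[OF C(1)] g] d(3) by auto
 have c': "near P q (%y. tgt C1 (c (f y)) = \<pi> (g (f y)) \<and> src C1 (c (f y)) = \<pi> (f y))" by (rule msm_lim[OF fm]) (use c d in simp)
 have cm: "msm P (total C1) (%y. c (f y)) q" by (rule msm_comp[OF fm]) (use c d in simp)
 have "msm P (total (bcomp C1 C2)) (%y. Comp (c (f y)) (d y)) q"
  by (rule msm_Comp[OF cm d(1)]) (use c' d(4) in eventually_elim, simp)
 moreover have "near P q (%y. tgt (bcomp C1 C2) (Comp (c (f y)) (d y)) = \<pi> (g (f y)) \<and> src (bcomp C1 C2) (Comp (c (f y)) (d y)) = \<pi> y)"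
  using c' d(4) by eventually_elim simp
 ultimately show ?thesis using bp_germI[OF msm_comp[OF fm gm]] c(2,3) d(2,3) by fastforce
qed

lemma bp_map:
 assumes e: "equiv_pt M C u C' v" and pt: "(p, u, q) \<in> pts (total (bp C))"
 shows "equiv_pt P (bp C) (p, u, q) (bp C') (p, v, q)"
proof -
 from pt have u: "u \<in> pts (total C)" by simp
 from e obtain f where f: "msm (total C) (total C') f u" "f u = v" "near (total C) u (%w. tgt C' (f w) = tgt C w \<and> src C' (f w) = src C w)"
  unfolding equiv_pt_iff[OF u] by blast
 note m = msm_bpullback[OF pt]
 have fm: "msm (total (bp C)) (total C') (%w. f (fst (snd w))) (p, u, q)" by (rule msm_comp[OF m(2)]) (use f(1) in simp)
 have "near (total (bp C)) (p, u, q) (%w. tgt C' (f (fst (snd w))) = tgt C (fst (snd w)) \<and> src C' (f (fst (snd w))) = src C (fst (snd w)))"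
  by (rule msm_lim[OF m(2)]) (use f(3) in simp)
 hence "near (total (bp C)) (p, u, q) (%w. \<pi> (fst w) = tgt C' (f (fst (snd w))) \<and> src C' (f (fst (snd w))) = \<pi> (snd (snd w)))"
  using nb_pts by eventually_elim auto
 from equiv_pt_map[OF pt msm_triple[OF m(1) fm m(3) this]] show ?thesis using f(2) by simp
qed

text \<open>A unit downstairs carries, upstairs, any map covering the identity: its middle component
  is the section of units composed with \<pi>. With the identity this gives units upstairs, with a
  group element its translation.\<close>

lemma bp_germ_unit:
 assumes C: "C \<in> \<U>" and c: "has_germ M C c (\<pi> x) (%y. y)" and f: "msm P P f x" "near P x (%y. \<pi> (f y) = \<pi> y)"
 shows "has_germ P (bp C) (f x, c, x) x f"
proof -
 from c obtain s where s: "sect M C (\<pi> x) c s" and t: "near M (\<pi> x) (%y. tgt C (s y) = y)" unfolding has_germ_def by blast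
 note S = sectD[OF s]
 have x: "msm P M \<pi> x" by (rule \<pi>m[OF msm_src[OF f(1)]])
 have "near P x (%y. tgt C (s (\<pi> y)) = \<pi> (f y) \<and> src C (s (\<pi> y)) = \<pi> y)"
  using msm_lim[OF x t] msm_lim[OF x S(3)] f(2) by eventually_elim simp
 from bp_germI[OF f(1) msm_comp[OF x S(1)] this] show ?thesis using S(2) by simp
qed

lemma bp_unit: "C \<in> \<U> ==> has_germ M C c (\<pi> x) (%y. y) ==> x \<in> pts P ==> has_germ P (bp C) (x, c, x) x (%y. y)"
 using bp_germ_unit[of C c x "%y. y"] by (simp add: msm_id)

lemma bp_germ_exists: "C \<in> \<U> ==> (p, u, q) \<in> pts (total (bp C)) ==> \<exists>f. has_germ P (bp C) (p, u, q) q f"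
 using has_germ_exists[OF bp_good] by fastforce

text \<open>The germ upstairs determines the one downstairs: precompose with a local section
  \<sigma> of \<pi> through q and project.\<close>

lemma bp_unique:
 assumes C: "C \<in> \<U>" "C' \<in> \<U>" and pt: "(p, u, q) \<in> pts (total (bp C))" and e: "equiv_pt P (bp C) (p, u, q) (bp C') (p', u', q')"
 shows "p' = p \<and> q' = q \<and> equiv_pt M C u C' u'"
proof -
 have ends: "p' = p" "q' = q" using equiv_pt_ends[OF e pt] by simp_all
 obtain f where f: "has_germ P (bp C) (p, u, q) q f" using bp_germ_exists[OF C(1) pt] by blast
 have f': "has_germ P (bp C') (p, u', q) q f" using has_germ_transfer[OF e f] ends by simp
 have q: "q \<in> pts P" using pt by simp
 from local_section[OF q] obtain \<sigma> where \<sigma>: "msm M P \<sigma> (\<pi> q)" "\<sigma> (\<pi> q) = q" "near M (\<pi> q) (%x. \<pi> (\<sigma> x) = x)" by blast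
 have g: "has_germ M D v (\<pi> q) (%x. \<pi> (f (\<sigma> x)))" if gf: "has_germ P (bp D) (p, v, q) q f" for D v
 proof -
  obtain c where c: "msm P (total D) c q" "c q = v" "near P q (%y. tgt D (c y) = \<pi> (f y) \<and> src D (c y) = \<pi> y)" using bp_germD[OF gf] by blast
  have m: "msm M (total D) (%x. c (\<sigma> x)) (\<pi> q)" by (rule msm_comp[OF \<sigma>(1)]) (use c(1) \<sigma>(2) in simp)
  have "near M (\<pi> q) (%x. tgt D (c (\<sigma> x)) = \<pi> (f (\<sigma> x)) \<and> src D (c (\<sigma> x)) = \<pi> (\<sigma> x))" by (rule msm_lim[OF \<sigma>(1)]) (use c(3) \<sigma>(2) in simp)
  hence "near M (\<pi> q) (%x. tgt D (c (\<sigma> x)) = \<pi> (f (\<sigma> x)) \<and> src D (c (\<sigma> x)) = x)" using \<sigma>(3) by eventually_elim simp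
  thus ?thesis unfolding has_germ_def sect_def using m c(2) \<sigma>(2) by (intro exI[of _ "%x. c (\<sigma> x)"]) (auto elim: eventually_mono)
 qed
 show ?thesis using ends has_germ_equiv[OF M.atlas_good[OF C(1)] M.atlas_good[OF C(2)] g[OF f] g[OF f']] by simp
qed

text \<open>Units upstairs match the points (x, c, x) over units c, and a morphism at a unit equates
  a whole neighbourhood with points of the pullback; the general case follows by
  composition.\<close>

lemma upstairs_pullback:
 assumes "B \<in> \<W>" "w \<in> pts (total B)"
 shows "\<exists>C\<in>\<U>. \<exists>v\<in>pts (total (bp C)). equiv_pt P B w (bp C) v"
 using _ _ _ assms
proof (rule P.atlas_induct[where T="%B w. \<exists>C\<in>\<U>. \<exists>v\<in>pts (total (bp C)). equiv_pt P B w (bp C) v"])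
 fix B u C v assume T: "\<exists>D\<in>\<U>. \<exists>v\<in>pts (total (bp D)). equiv_pt P B u (bp D) v" and BC: "B \<in> \<W>" "C \<in> \<W>"
  and u: "u \<in> pts (total B)" and e: "equiv_pt P B u C v"
 have e': "equiv_pt P C v B u" by (rule equiv_pt_sym[OF P.atlas_good[OF BC(1)] P.atlas_good[OF BC(2)] e u])
 obtain D x where D: "D \<in> \<U>" "x \<in> pts (total (bp D))" "equiv_pt P B u (bp D) x" using T by blast
 have "equiv_pt P C v (bp D) x" by (rule equiv_pt_trans[OF e' D(3) equiv_pt_tgt[OF e u]])
 thus "\<exists>D\<in>\<U>. \<exists>w\<in>pts (total (bp D)). equiv_pt P C v (bp D) w" using D(1,2) by blast
next
 fix B1 w1 B2 w2 assume T1: "\<exists>D\<in>\<U>. \<exists>v\<in>pts (total (bp D)). equiv_pt P B1 w1 (bp D) v"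
  and T2: "\<exists>D\<in>\<U>. \<exists>v\<in>pts (total (bp D)). equiv_pt P B2 w2 (bp D) v" and B: "B1 \<in> \<W>" "B2 \<in> \<W>"
  and w: "w1 \<in> pts (total B1)" "w2 \<in> pts (total B2)" "src B1 w1 = tgt B2 w2"
 obtain C1 p u1 r where 1: "C1 \<in> \<U>" "(p, u1, r) \<in> pts (total (bp C1))" "equiv_pt P B1 w1 (bp C1) (p, u1, r)" using T1 by (metis prod_cases3)
 obtain C2 r' u2 q where 2: "C2 \<in> \<U>" "(r', u2, q) \<in> pts (total (bp C2))" "equiv_pt P B2 w2 (bp C2) (r', u2, q)" using T2 by (metis prod_cases3)
 have e1: "src B1 w1 = r" "tgt B2 w2 = r'" "src B2 w2 = q" using equiv_pt_ends[OF 1(3) w(1)] equiv_pt_ends[OF 2(3) w(2)] by auto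
 have r: "r' = r" using e1 w(3) by simp
 obtain g where g: "has_germ P B1 w1 r g" using has_germ_exists[OF P.atlas_good[OF B(1)] w(1)] e1 by blast
 obtain f where f: "has_germ P B2 w2 q f" using has_germ_exists[OF P.atlas_good[OF B(2)] w(2)] e1 by blast
 have "f q = r" using has_germD(3)[OF f] e1 r by simp
 hence c: "has_germ P (bcomp B1 B2) (Comp w1 w2) q (%y. g (f y))"
  by (intro has_germ_bcomp[OF P.atlas_good[OF B(2)] g f]) simp
 have c': "has_germ P (bp (bcomp C1 C2)) (p, Comp u1 u2, q) q (%y. g (f y))"
  by (rule bp_comp[OF 1(1) 2(1) has_germ_transfer[OF 1(3) g]]) (use has_germ_transfer[OF 2(3) f] r in simp)
 have C12: "bcomp C1 C2 \<in> \<U>" "bcomp B1 B2 \<in> \<W>" using 1(1) 2(1) B by (auto intro: finite_comps.intros)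
 show "\<exists>D\<in>\<U>. \<exists>v\<in>pts (total (bp D)). equiv_pt P (bcomp B1 B2) (Comp w1 w2) (bp D) v"
  using has_germ_equiv[OF P.atlas_good[OF C12(2)] bp_good[OF C12(1)] c c'] has_germD(1)[OF c'] C12(1) by blast
next
 fix x D w assume D: "D \<in> \<W>" and w: "has_germ P D w x (%y. y)"
 have x: "x \<in> pts P" by (rule has_germD(4)[OF w])
 obtain C c where C: "C \<in> \<U>" "has_germ M C c (\<pi> x) (%y. y)" using M.unit_exists[OF msm_tgt[OF \<pi>m[OF x]]] by blast
 have "equiv_pt P D w (bp C) (x, c, x)" by (rule has_germ_equiv[OF P.atlas_good[OF D] bp_good[OF C(1)] w bp_unit[OF C x]])
 from equiv_pt_ev[OF this has_germD(1)[OF w]]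
 show "near (total D) w (%w'. \<exists>C\<in>\<U>. \<exists>v\<in>pts (total (bp C)). equiv_pt P D w' (bp C) v)"
  by eventually_elim (use C(1) in blast)
qed

text \<open>Otherwise the class of the point, formed in the atlas upstairs, would be empty.\<close>

definition reached where
 "reached C v \<longleftrightarrow> (\<exists>B\<in>\<W>. \<exists>w\<in>pts (total B). equiv_pt P (bp C) v B w)"

lemma reached_comp:
 assumes C: "C1 \<in> \<U>" "C2 \<in> \<U>" and pt: "(p, u1, r) \<in> pts (total (bp C1))" "(r, u2, q) \<in> pts (total (bp C2))"
  and R: "reached C1 (p, u1, r)" "reached C2 (r, u2, q)"
 shows "reached (bcomp C1 C2) (p, Comp u1 u2, q)"
proof -
 from R obtain B1 w1 B2 w2 where B: "B1 \<in> \<W>" "B2 \<in> \<W>" and w: "equiv_pt P (bp C1) (p, u1, r) B1 w1" "equiv_pt P (bp C2) (r, u2, q) B2 w2"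
  unfolding reached_def by blast
 obtain g where g: "has_germ P (bp C1) (p, u1, r) r g" using bp_germ_exists[OF C(1) pt(1)] by blast
 obtain f where f: "has_germ P (bp C2) (r, u2, q) q f" using bp_germ_exists[OF C(2) pt(2)] by blast
 have "f q = r" using has_germD(3)[OF f] by simp
 hence c: "has_germ P (bcomp B1 B2) (Comp w1 w2) q (%y. g (f y))"
  by (intro has_germ_bcomp[OF P.atlas_good[OF B(2)] has_germ_transfer[OF w(1) g] has_germ_transfer[OF w(2) f]]) simp
 have CB: "bcomp C1 C2 \<in> \<U>" "bcomp B1 B2 \<in> \<W>" using C B by (auto intro: finite_comps.intros)
 show ?thesis unfolding reached_def
  using has_germ_equiv[OF bp_good[OF CB(1)] P.atlas_good[OF CB(2)] bp_comp[OF C g f] c] has_germD(1)[OF c] CB(2) by blast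
qed

lemma reached_map:
 assumes "reached C v" "equiv_pt P (bp C') v' (bp C) v" "v' \<in> pts (total (bp C'))"
 shows "reached C' v'"
proof -
 from assms(1) obtain B w where B: "B \<in> \<W>" "w \<in> pts (total B)" "equiv_pt P (bp C) v B w" unfolding reached_def by blast
 show ?thesis unfolding reached_def using B(1,2) equiv_pt_trans[OF assms(2) B(3) assms(3)] by blast
qed

lemma reached_ev:
 assumes C: "C \<in> \<U>" and c: "has_germ M C c (\<pi> x) (%y. y)" and x: "x \<in> pts P"
 shows "near (total (bp C)) (x, c, x) (%v. reached C v)"
proof -
 obtain D w where D: "D \<in> \<W>" "has_germ P D w x (%y. y)" using P.unit_exists[OF x] by blast
 note u = bp_unit[OF C c x]
 from equiv_pt_ev[OF has_germ_equiv[OF bp_good[OF C] P.atlas_good[OF D(1)] u D(2)] has_germD(1)[OF u]]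
 show ?thesis by eventually_elim (use D(1) in "auto simp: reached_def")
qed

end

section \<open>The structure group and the pulled back bisubmersions\<close>

locale principal_bundle = principal M FM EU P F EW \<pi>
 for M :: "'m smooth_space" and FM EU and P :: "'p smooth_space" and F EW and \<pi> :: "'p => 'm" +
 fixes G :: "('g, 'x) monoid_scheme" and S :: "'g smooth_space" and act :: "'g => 'p => 'p"
 assumes G: "lie_group G S" and conn: "connected_space (dtop S)" and act: "smooth_action G S P act"
  and orbit: "\<And>p q. p \<in> pts P ==> q \<in> pts P ==> \<pi> p = \<pi> q \<longleftrightarrow> (\<exists>g\<in>carrier G. q = act g p)"
begin

lemma S: "pts S = carrier G" "manifold S" "group G"
 using G by (auto simp: lie_group_def)

lemma act_msm:
 assumes "g \<in> carrier G" "p \<in> pts P"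
 shows "msm (sprod S P) P (%w. act (fst w) (snd w)) (g, p)"
proof -
 have "dspace (sprod S P)" by (simp add: sprod_def)
 moreover have "smooth_map (sprod S P) P (%w. act (fst w) (snd w))" using act by (simp add: smooth_action_def case_prod_beta')
 ultimately show ?thesis using assms by (simp add: smooth_map_iff S)
qed

lemma act_orbit_msm: "g \<in> carrier G ==> p \<in> pts P ==> msm S P (%g. act g p) g"
 using msm_comp[where f="%g. (g, p)", OF msm_sprodI[OF msm_id msm_const] act_msm] by (simp add: S)

lemma act_map_msm: "g \<in> carrier G ==> p \<in> pts P ==> msm P P (act g) p"
 using msm_comp[where f="%p. (g, p)", OF msm_sprodI[OF msm_const msm_id] act_msm] by (simp add: S)

lemma act_pts: "g \<in> carrier G ==> p \<in> pts P ==> act g p \<in> pts P"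
 by (rule msm_tgt[OF act_map_msm])

lemma act_\<pi>: "g \<in> carrier G ==> p \<in> pts P ==> \<pi> (act g p) = \<pi> p"
 by (rule orbit[OF _ act_pts, THEN iffD2, symmetric]) auto

lemma act_one: "p \<in> pts P ==> act \<one>\<^bsub>G\<^esub> p = p"
 and act_mult: "g \<in> carrier G ==> h \<in> carrier G ==> p \<in> pts P ==> act (g \<otimes>\<^bsub>G\<^esub> h) p = act g (act h p)"
 using act by (auto simp: smooth_action_def)

text \<open>If g is close to g0, then (g p, c, g0 p) and (g0 p, c, g p) are close to a unit upstairs
  and so are reached. Composing with one of them passes between g0 and g in both directions, which
  makes the property locally constant on the connected group.\<close>

lemma reached_fibre:
 assumes C: "C \<in> \<U>" and c: "has_germ M C c (\<pi> p) (%y. y)" and p: "p \<in> pts P" and g: "g \<in> carrier G"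
 shows "reached C (act g p, c, p)"
proof (rule connected_locally_const[OF conn, where Q="%g. reached C (act g p, c, p)"])
 interpret group G by (rule S)
 show "\<one>\<^bsub>G\<^esub> \<in> topspace (dtop S)" "g \<in> topspace (dtop S)" using g by (simp_all add: S)
 show "reached C (act \<one>\<^bsub>G\<^esub> p, c, p)"
  using nb_self[OF reached_ev[OF C c p] has_germD(1)[OF bp_unit[OF C c p]]] by (simp add: act_one p)
 show "near S g0 (%g. reached C (act g0 p, c, p) = reached C (act g p, c, p))" if "g0 \<in> topspace (dtop S)" for g0
 proof -
  have g0: "g0 \<in> carrier G" "g0 \<in> pts S" using that by (simp_all add: S)
  let ?r = "act g0 p"
  have r: "?r \<in> pts P" "\<pi> ?r = \<pi> p" using act_pts act_\<pi> g0 p by auto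
  note D = has_germD[OF c]
  have cr: "has_germ M C c (\<pi> ?r) (%y. y)" using c r by simp
  have e: "near S g0 (%g. g \<in> carrier G)" using nb_pts[of S g0] by (simp add: S)
  note am = act_orbit_msm[OF g0(1) p] and cm = msm_const[OF g0(2) D(1)] and rm = msm_const[OF g0(2) r(1)]
  have 1: "msm S (total (bp C)) (%g. (act g p, c, ?r)) g0"
   by (rule msm_triple[OF am cm rm]) (use e in eventually_elim, use D r p in "simp add: act_\<pi>")
  have 2: "msm S (total (bp C)) (%g. (?r, c, act g p)) g0"
   by (rule msm_triple[OF rm cm am]) (use e in eventually_elim, use D r p in "simp add: act_\<pi>")
  have CC: "bcomp C C \<in> \<U>" using C by (auto intro: finite_comps.intros)
  \<comment> \<open>Composing over the unit c puts \<open>Comp c c\<close> in the middle, which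
    carries the same germ as c.\<close>
  have "has_germ M (bcomp C C) (Comp c c) (\<pi> p) (%y. y)" using has_germ_bcomp[OF M.atlas_good[OF C] c c] by simp
  from has_germ_equiv[OF M.atlas_good[OF C] M.atlas_good[OF CC] c this] have cc: "equiv_pt M C c (bcomp C C) (Comp c c)" .
  have step: "reached C (act h p, c, p)" if h: "h \<in> carrier G" "h' \<in> carrier G" and R: "reached C (act h p, c, act h' p)" "reached C (act h' p, c, p)" for h h'
  proof -
   have pt: "(act h p, c, act h' p) \<in> pts (total (bp C))" "(act h' p, c, p) \<in> pts (total (bp C))" "(act h p, c, p) \<in> pts (total (bp C))"
    using h p D by (auto simp: act_pts act_\<pi>)
   from reached_map[OF reached_comp[OF C C pt(1,2) R] bp_map[OF cc pt(3)] pt(3)] show ?thesis .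
  qed
  from msm_lim[OF 1 reached_ev[OF C cr r(1)]] msm_lim[OF 2 reached_ev[OF C cr r(1)]] e
  show ?thesis by eventually_elim (use step g0 in blast)
 qed
qed

text \<open>The property used in the induction concerns all lifts (p, u, q) of u at once. A lift
  close to a unit upstairs is reached directly, and any other lift differs from it by moves inside
  the fibres of \<pi>.\<close>

lemma downstairs_reached:
 assumes "C \<in> \<U>" "(p, u, q) \<in> pts (total (bp C))"
 shows "reached C (p, u, q)"
proof -
 have "\<forall>p q. (p, u, q) \<in> pts (total (bp C)) --> reached C (p, u, q)"
 proof (rule M.atlas_induct[where T="%C u. \<forall>p q. (p, u, q) \<in> pts (total (bp C)) --> reached C (p, u, q)"])
  fix B u C v assume T: "\<forall>p q. (p, u, q) \<in> pts (total (bp B)) --> reached B (p, u, q)" and BC: "B \<in> \<U>" "C \<in> \<U>"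
   and u: "u \<in> pts (total B)" and e: "equiv_pt M B u C v"
  have e': "equiv_pt M C v B u" by (rule equiv_pt_sym[OF M.atlas_good[OF BC(1)] M.atlas_good[OF BC(2)] e u])
  show "\<forall>p q. (p, v, q) \<in> pts (total (bp C)) --> reached C (p, v, q)"
  proof (intro allI impI)
   fix p q assume pt: "(p, v, q) \<in> pts (total (bp C))"
   hence "(p, u, q) \<in> pts (total (bp B))" using equiv_pt_ends[OF e u] u by simp
   thus "reached C (p, v, q)" using T reached_map[OF _ bp_map[OF e' pt] pt] by blast
  qed
 next
  fix C1 u1 C2 u2 assume T: "\<forall>p q. (p, u1, q) \<in> pts (total (bp C1)) --> reached C1 (p, u1, q)" "\<forall>p q. (p, u2, q) \<in> pts (total (bp C2)) --> reached C2 (p, u2, q)"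
   and C: "C1 \<in> \<U>" "C2 \<in> \<U>" and u: "u1 \<in> pts (total C1)" "u2 \<in> pts (total C2)" "src C1 u1 = tgt C2 u2"
  show "\<forall>p q. (p, Comp u1 u2, q) \<in> pts (total (bp (bcomp C1 C2))) --> reached (bcomp C1 C2) (p, Comp u1 u2, q)"
  proof (intro allI impI)
   fix p q assume pt: "(p, Comp u1 u2, q) \<in> pts (total (bp (bcomp C1 C2)))"
   \<comment> \<open>Surjectivity of \<pi> supplies an intermediate point over which the lift of a
     composition splits.\<close>
   have "src C1 u1 \<in> \<pi> ` pts P" unfolding surj by (rule msm_tgt[OF good_src[OF M.atlas_good[OF C(1)] u(1)]])
   then obtain r where r: "r \<in> pts P" "\<pi> r = src C1 u1" by auto
   show "reached (bcomp C1 C2) (p, Comp u1 u2, q)"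
    by (rule reached_comp[OF C, of p u1 r u2 q]) (use pt r u T in auto)
  qed
 next
  fix x D w assume D: "D \<in> \<U>" and w: "has_germ M D w x (%y. y)"
  note W = has_germD[OF w]
  have "x \<in> \<pi> ` pts P" using W(4) surj by simp
  then obtain p0 where p0: "p0 \<in> pts P" "\<pi> p0 = x" by auto
  from local_section[OF p0(1)] obtain \<sigma> where \<sigma>: "msm M P \<sigma> x" "\<sigma> x = p0" "near M x (%x. \<pi> (\<sigma> x) = x)" unfolding p0(2) by blast
  have tm: "msm (total D) M (tgt D) w" and sm: "msm (total D) M (src D) w" using good_tgt[OF M.atlas_good[OF D] W(1)] good_src[OF M.atlas_good[OF D] W(1)] by auto
  have ts: "msm (total D) P (%w. \<sigma> (tgt D w)) w" "msm (total D) P (%w. \<sigma> (src D w)) w"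
   by (rule msm_comp[OF tm], use \<sigma> W in simp) (rule msm_comp[OF sm], use \<sigma> W in simp)
  have te: "near (total D) w (%w. \<pi> (\<sigma> (tgt D w)) = tgt D w)" and se: "near (total D) w (%w. \<pi> (\<sigma> (src D w)) = src D w)"
   by (rule msm_lim[OF tm], use \<sigma> W in simp) (rule msm_lim[OF sm], use \<sigma> W in simp)
  have "msm (total D) (total (bp D)) (%w. (\<sigma> (tgt D w), w, \<sigma> (src D w))) w"
   by (rule msm_triple[OF ts(1) msm_id[OF W(1)] ts(2)]) (use te se in eventually_elim, simp)
  hence "near (total D) w (%w. reached D (\<sigma> (tgt D w), w, \<sigma> (src D w)))"
   by (rule msm_lim) (use reached_ev[OF D _ p0(1)] w W p0 \<sigma> in simp)
  from this te se msm_pts_ev[OF ts(1)] msm_pts_ev[OF ts(2)] nb_pts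
  show "near (total D) w (%w'. \<forall>p q. (p, w', q) \<in> pts (total (bp D)) --> reached D (p, w', q))"
  proof eventually_elim
   case (elim v)
   let ?p = "\<sigma> (tgt D v)" and ?q = "\<sigma> (src D v)"
   have xy: "tgt D v \<in> pts M" "src D v \<in> pts M" using msm_tgt[OF \<pi>m[OF elim(4)]] msm_tgt[OF \<pi>m[OF elim(5)]] elim(2,3) by auto
   obtain C1 c1 where C1: "C1 \<in> \<U>" "has_germ M C1 c1 (tgt D v) (%y. y)" using M.unit_exists[OF xy(1)] by blast
   obtain C2 c2 where C2: "C2 \<in> \<U>" "has_germ M C2 c2 (src D v) (%y. y)" using M.unit_exists[OF xy(2)] by blast
   note d1 = has_germD[OF C1(2)] and d2 = has_germD[OF C2(2)]
   \<comment> \<open>Flanking v by units leaves its germ unchanged and factors (p, v, q) through the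
     lift of v given by \<sigma>. The outer factors lie over units and are reached inside the
     fibres, the middle one is near a unit upstairs.\<close>
   let ?D = "bcomp (bcomp C1 D) C2" and ?v = "Comp (Comp c1 v) c2"
   have D': "bcomp C1 D \<in> \<U>" "?D \<in> \<U>" using C1 C2 D by (auto intro: finite_comps.intros)
   obtain f where f: "has_germ M D v (src D v) f" using has_germ_exists[OF M.atlas_good[OF D] elim(6)] by blast
   have "has_germ M (bcomp C1 D) (Comp c1 v) (src D v) f"
    using has_germ_bcomp[OF M.atlas_good[OF D] C1(2) f] has_germD(3)[OF f] by simp
   from has_germ_bcomp[OF M.atlas_good[OF C2(1)] this C2(2)] have "has_germ M ?D ?v (src D v) f" by simp
   from has_germ_equiv[OF M.atlas_good[OF D] M.atlas_good[OF D'(2)] f this] have e: "equiv_pt M D v ?D ?v" .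
   show ?case
   proof (intro allI impI)
    fix p q assume pt: "(p, v, q) \<in> pts (total (bp D))"
    hence pq: "p \<in> pts P" "q \<in> pts P" "\<pi> p = tgt D v" "\<pi> q = src D v" by auto
    obtain g where g: "g \<in> carrier G" "p = act g ?p" using orbit[OF elim(4) pq(1)] elim(2) pq(3) by auto
    obtain h where h: "h \<in> carrier G" "?q = act h q" using orbit[OF pq(2) elim(5)] elim(3) pq(4) by auto
    have R1: "reached C1 (p, c1, ?p)" unfolding g(2) by (rule reached_fibre[OF C1(1) _ elim(4) g(1)]) (use C1(2) elim(2) in simp)
    have R2: "reached C2 (?q, c2, q)" unfolding h(2) by (rule reached_fibre[OF C2(1) _ pq(2) h(1)]) (use C2(2) pq(4) in simp)
    have R3: "reached (bcomp C1 D) (p, Comp c1 v, ?q)"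
     by (rule reached_comp[OF C1(1) D _ _ R1 elim(1)]) (use d1 elim pq in auto)
    have "reached ?D (p, ?v, q)"
     by (rule reached_comp[OF D'(1) C2(1) _ _ R3 R2]) (use d1 d2 elim pq in auto)
    from reached_map[OF this bp_map[OF e pt] pt] show "reached D (p, v, q)" .
   qed
  qed
 qed (use assms in auto)
 thus ?thesis using assms(2) by blast
qed

end

section \<open>Transversality\<close>

lemma dmap_tvec:
 assumes f: "smooth_map X Y f" and Y: "dspace Y" and D: "D \<in> tvec X x" and x: "x \<in> pts X"
 shows "dmap X Y f D \<in> tvec Y (f x)"
proof -
 have p: "pull (pts X) f a \<in> cinf X" if "a \<in> cinf Y" for a using f that by (simp add: smooth_map_def)
 have e: "pull (pts X) f (%y. a y + b y) = (%y. pull (pts X) f a y + pull (pts X) f b y)"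
  "pull (pts X) f (%y. c * a y) = (%y. c * pull (pts X) f a y)"
  "pull (pts X) f (%y. a y * b y) = (%y. pull (pts X) f a y * pull (pts X) f b y)" for a b c
  by (auto simp: pull_def)
 have "pull (pts X) f a x = a (f x)" for a using x by (simp add: pull_def)
 thus ?thesis
  unfolding tvec_def[of Y] using Y p tvec_add[OF D] tvec_scale[OF D] tvec_mult[OF D]
  by (simp add: dmap_def cinf_add cinf_scale cinf_mult e)
qed

text \<open>A function on the open subspace has a global representative only as a germ; D does not
  distinguish two representatives, by locality.\<close>

lemma tvec_sub:
 assumes X: "dspace X" and V: "openin (dtop X) V" "x \<in> V" and D: "D \<in> tvec X x"
 shows "\<exists>D'\<in>tvec (sub X V) x. \<forall>a\<in>cinf (sub X V). \<forall>b\<in>cinf X. (near X x (%y. b y = a y)) --> D' a = D b"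
proof -
 have x: "x \<in> pts X" using V openin_subset[OF V(1)] by auto
 have "\<forall>a. \<exists>b. a \<in> cinf (sub X V) --> b \<in> cinf X \<and> (near X x (%y. b y = a y))"
  using fsm_extend[OF X] V by (metis cinf_sub)
 from choice[OF this] obtain e where e: "\<And>a. a \<in> cinf (sub X V) ==> e a \<in> cinf X"
  "\<And>a. a \<in> cinf (sub X V) ==> near X x (%y. e a y = a y)" by blast
 define D' where "D' a = (if a \<in> cinf (sub X V) then D (e a) else 0)" for a
 have D': "D' a = D b" if a: "a \<in> cinf (sub X V)" and b: "b \<in> cinf X" "near X x (%y. b y = a y)" for a b
 proof -
  have "near X x (%y. e a y = b y)" using e(2)[OF a] b(2) by eventually_elim simp
  thus ?thesis unfolding D'_def using tvec_local[OF D X x e(1)[OF a] b(1)] a by simp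
 qed
 have d: "dspace (sub X V)" by simp
 have "D' \<in> tvec (sub X V) x"
  unfolding tvec_def mem_Collect_eq
 proof (intro conjI allI ballI impI)
  show "D' a = 0" if "a \<notin> cinf (sub X V)" for a using that by (simp add: D'_def)
  fix a b c assume a: "a \<in> cinf (sub X V)" and b: "b \<in> cinf (sub X V)"
  note ea = e[OF a] and eb = e[OF b]
  have Da: "D' a = D (e a)" "D' b = D (e b)" using a b by (simp_all add: D'_def)
  have "D' (%y. a y + b y) = D (%y. e a y + e b y)"
   by (rule D'[OF cinf_add[OF d a b] cinf_add[OF X ea(1) eb(1)]]) (use ea(2) eb(2) in eventually_elim, simp)
  thus "D' (%y. a y + b y) = D' a + D' b" using tvec_add[OF D ea(1) eb(1)] Da by simp
  have "D' (%y. c * a y) = D (%y. c * e a y)"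
   by (rule D'[OF cinf_scale[OF d a] cinf_scale[OF X ea(1)]]) (use ea(2) in eventually_elim, simp)
  thus "D' (%y. c * a y) = c * D' a" using tvec_scale[OF D ea(1)] Da by simp
  have "D' (%y. a y * b y) = D (%y. e a y * e b y)"
   by (rule D'[OF cinf_mult[OF d a b] cinf_mult[OF X ea(1) eb(1)]]) (use ea(2) eb(2) in eventually_elim, simp)
  thus "D' (%y. a y * b y) = D' a * b x + a x * D' b"
   using tvec_mult[OF D ea(1) eb(1)] Da nb_self[OF ea(2) x] nb_self[OF eb(2) x] by simp
 qed
 thus ?thesis using D' by blast
qed

text \<open>For the germ of a diffeomorphism transversality is automatic: push a tangent vector by
  the target, pull it back by the inverse g, and push it by the section. The difference to the
  original vector is tangent to the target fibre.\<close>

lemma germ_carries: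
 assumes P: "dspace P" and B: "good TYPE('q) P F B" and f: "smooth_map P P f" and g: "smooth_map P P g"
  and gf: "\<And>y. y \<in> pts P ==> g (f y) = y" and fg: "\<And>y. y \<in> pts P ==> f (g y) = y"
  and w: "has_germ P B w r f"
 shows "carries P B w f"
proof -
 let ?T = "total B"
 from w obtain s where s: "sect P B r w s" and t: "near P r (%y. tgt B (s y) = f y)" unfolding has_germ_def by blast
 note S = sectD[OF s]
 have T: "dspace ?T" by (rule good_dspace[OF B])
 have ts: "smooth_map ?T P (tgt B)" using smooth_map_iff[OF T] good_tgt[OF B] by blast
 from msm_ev[OF S(1)] S(3) t have ev: "near P r (%y. msm P ?T s y \<and> src B (s y) = y \<and> tgt B (s y) = f y)" by eventually_elim simp
 obtain V where V: "openin (dtop P) V" "r \<in> V" "V \<subseteq> pts P" "\<And>y. y \<in> V ==> msm P ?T s y \<and> src B (s y) = y \<and> tgt B (s y) = f y"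
  using nb_openE[OF ev S(5)] by blast
 have sV: "smooth_map (sub P V) ?T s" using smooth_map_sub[OF V(1)] V(4) by blast
 have "tvec ?T (s x) = {(%a. D a + E a) | D E. D \<in> dmap (sub P V) ?T s ` tvec (sub P V) x \<and>
   E \<in> tvec ?T (s x) \<and> dmap ?T P (tgt B) E = (%_. 0)}" (is "_ = ?R") if x: "x \<in> V" for x
 proof (intro Set.equalityI subsetI)
  have xs: "x \<in> pts (sub P V)" "x \<in> pts P" "s x \<in> pts ?T" using x V(3) msm_tgt[of P ?T s x] V(4)[OF x] by auto
  fix D0 assume D0: "D0 \<in> tvec ?T (s x)"
  let ?D1 = "dmap ?T P (tgt B) D0" and ?D2 = "dmap P P g (dmap ?T P (tgt B) D0)"
  have fx: "tgt B (s x) = f x" "f x \<in> pts P" using V(4)[OF x] f xs by (auto simp: smooth_map_def)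
  have D1: "?D1 \<in> tvec P (f x)" using dmap_tvec[OF ts P D0 xs(3)] fx by simp
  have "?D2 \<in> tvec P (g (f x))" by (rule dmap_tvec[OF g P D1 fx(2)])
  hence D2: "?D2 \<in> tvec P x" using gf xs by simp
  from tvec_sub[OF P V(1) x D2] obtain D3 where D3: "D3 \<in> tvec (sub P V) x"
   "\<And>a b. a \<in> cinf (sub P V) ==> b \<in> cinf P ==> near P x (%y. b y = a y) ==> D3 a = ?D2 b" by blast
  let ?D = "dmap (sub P V) ?T s D3"
  have D: "?D \<in> tvec ?T (s x)" by (rule dmap_tvec[OF sV T D3(1) xs(1)])
  \<comment> \<open>The target composed with the section is f, and f inverts g; so the subtracted
    part has the same image under the target map as \<open>D0\<close>.\<close>
  define E where "E a = D0 a - ?D a" for a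
  have E: "E \<in> tvec ?T (s x)"
   using D D0 unfolding tvec_def E_def by (simp add: algebra_simps)
  have "dmap ?T P (tgt B) E a = 0" for a
  proof (cases "a \<in> cinf P")
   case True
   let ?a = "pull (pts ?T) (tgt B) a" and ?b = "pull (pts P) f a"
   have a: "?a \<in> cinf ?T" and b: "?b \<in> cinf P" using True ts f by (auto simp: smooth_map_def)
   have c: "pull (pts (sub P V)) s ?a \<in> cinf (sub P V)" using sV a by (simp add: smooth_map_def)
   have "near P x (%y. ?b y = pull (pts (sub P V)) s ?a y)"
    using nb_open[OF V(1) x] by eventually_elim (use V(3,4) msm_tgt in "fastforce simp: pull_def")
   from D3(2)[OF c b this] have "D3 (pull (pts (sub P V)) s ?a) = ?D1 (pull (pts P) g ?b)" by (simp add: dmap_def b)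
   also have "pull (pts P) g ?b = pull (pts P) (%y. f (g y)) a" using g by (auto simp: pull_def smooth_map_def fun_eq_iff)
   finally have *: "D3 (pull (pts (sub P V)) s ?a) = ?D1 (pull (pts P) (%y. f (g y)) a)" .
   have "pull (pts P) (%y. f (g y)) a = a" using True fg unfolding cinf_iff[OF P] by (auto simp: pull_def)
   thus ?thesis using True a * by (simp add: dmap_def E_def)
  qed (simp add: dmap_def)
  thus "D0 \<in> ?R" using D3(1) E by (intro CollectI exI[of _ ?D] exI[of _ E]) (auto simp: E_def)
 next
  fix D0 assume "D0 \<in> ?R"
  then obtain D3 E where D: "D0 = (%a. dmap (sub P V) ?T s D3 a + E a)" "D3 \<in> tvec (sub P V) x" "E \<in> tvec ?T (s x)" by blast
  have "dmap (sub P V) ?T s D3 \<in> tvec ?T (s x)" by (rule dmap_tvec[OF sV T D(2)]) (use x in simp)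
  thus "D0 \<in> tvec ?T (s x)" using D(3) unfolding tvec_def D(1) by (simp add: algebra_simps)
 qed
 thus ?thesis unfolding carries_def using V sV S(2,4) by (intro exI[of _ V] exI[of _ s]) simp
qed

lemma carries_germ:
 assumes c: "carries N B u f" and u: "u \<in> pts (total B)"
 shows "has_germ N B u (src B u) f"
proof -
 from c obtain V s where V: "openin (dtop N) V" "src B u \<in> V" and s: "smooth_map (sub N V) (total B) s" "s (src B u) = u"
  and e: "\<forall>x\<in>V. src B (s x) = x \<and> tgt B (s x) = f x" unfolding carries_def by blast
 have "msm N (total B) s (src B u)" using smooth_map_sub[OF V(1)] s(1) V(2) by blast
 moreover have "near N (src B u) (%y. src B (s y) = y \<and> tgt B (s y) = f y)"
  using nb_open[OF V] by eventually_elim (use e in blast)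
 ultimately show ?thesis unfolding has_germ_def sect_def using s(2) by (intro exI[of _ s]) (auto elim: eventually_mono)
qed

section \<open>Classes\<close>

lemma hclass_eqI:
 fixes N :: "'b smooth_space"
 assumes "equiv_pt N B u C v" "equiv_pt N C v B u" "u \<in> pts (total B)" "v \<in> pts (total C)"
 shows "hclass N \<U> B u = hclass N \<U> C v"
proof -
 have "equiv_pt N B u D x \<longleftrightarrow> equiv_pt N C v D x" for D :: "('b hpt, 'b) bisub" and x
  using equiv_pt_trans[OF assms(1) _ assms(3), of D x] equiv_pt_trans[OF assms(2) _ assms(4), of D x] by blast
 thus ?thesis unfolding hclass_def by simp
qed

lemma hclass_eq_nice:
 assumes "nice N F B" "nice N F C" "equiv_pt N B u C v" "u \<in> pts (total B)"
 shows "hclass N \<U> B u = hclass N \<U> C v"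
 by (rule hclass_eqI[OF assms(3) equiv_pt_sym[OF assms] assms(4) equiv_pt_tgt[OF assms(3,4)]])

lemma btranslate_simps [simp]: "total (btranslate f B) = total B" "tgt (btranslate f B) = (%w. f (tgt B w))" "src (btranslate f B) = (%w. f (src B w))"
 by (auto simp: btranslate_def)

lemma equiv_btranslate: "equiv_pt N B u C v ==> equiv_pt N (btranslate f B) u (btranslate f C) v"
 unfolding equiv_pt_def btranslate_simps by metis

section \<open>Classes of points of pullbacks and equivariance\<close>

context principal_bundle
begin

text \<open>The bisubmersion \<open>bp C\<close> lies outside the atlas; its class collects the
  equivalent points inside.\<close>

definition cls where
 "cls C v = hclass P \<W> (bp C) v"

lemma cls_mem: "(B, w) \<in> cls C v \<longleftrightarrow> B \<in> \<W> \<and> w \<in> pts (total B) \<and> equiv_pt P (bp C) v B w"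
 by (auto simp: cls_def hclass_def)

lemma cls_ne:
 assumes "C \<in> \<U>" "v \<in> pts (total (bp C))"
 shows "\<exists>B w. (B, w) \<in> cls C v"
proof -
 obtain p u q where v: "v = (p, u, q)" by (cases v)
 show ?thesis using downstairs_reached[OF assms(1), of p u q] assms(2) unfolding v reached_def cls_mem by blast
qed

lemma cls_eq:
 assumes "C \<in> \<U>" "C' \<in> \<U>" "equiv_pt P (bp C) v (bp C') v'" "v \<in> pts (total (bp C))"
 shows "cls C v = cls C' v'"
 unfolding cls_def by (rule hclass_eq_nice[OF bp_good[OF assms(1)] bp_good[OF assms(2)] assms(3,4)])

lemma cls_repr:
 assumes "C \<in> \<U>" "v \<in> pts (total (bp C))" "(B, w) \<in> cls C v"
 shows "cls C v = hclass P \<W> B w"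
 unfolding cls_def by (rule hclass_eq_nice[OF bp_good[OF assms(1)] P.atlas_good]) (use assms in "auto simp: cls_mem")

lemma cls_inj:
 assumes C: "C \<in> \<U>" "C' \<in> \<U>" and v: "v \<in> pts (total (bp C))" "v' \<in> pts (total (bp C'))" and e: "cls C v = cls C' v'"
 shows "equiv_pt P (bp C) v (bp C') v'"
proof -
 obtain B w where w: "(B, w) \<in> cls C v" using cls_ne[OF C(1) v(1)] by blast
 moreover have "(B, w) \<in> cls C' v'" using w e by simp
 ultimately have B: "B \<in> \<W>" "equiv_pt P (bp C) v B w" "equiv_pt P (bp C') v' B w" by (auto simp: cls_mem)
 show ?thesis by (rule equiv_pt_trans[OF B(2) equiv_pt_sym[OF bp_good[OF C(2)] P.atlas_good[OF B(1)] B(3) v(2)] v(1)])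
qed

lemma holonomy_cls:
 assumes "\<xi> \<in> holonomy P \<W>"
 shows "\<exists>C\<in>\<U>. \<exists>p u q. (p, u, q) \<in> pts (total (bp C)) \<and> \<xi> = cls C (p, u, q)"
proof -
 from assms obtain B w where B: "B \<in> \<W>" "w \<in> pts (total B)" "\<xi> = hclass P \<W> B w" unfolding holonomy_def by blast
 from upstairs_pullback[OF B(1,2)] obtain C p u q where C: "C \<in> \<U>" "(p, u, q) \<in> pts (total (bp C))" "equiv_pt P B w (bp C) (p, u, q)" by (metis prod_cases3)
 have "\<xi> = cls C (p, u, q)" unfolding B(3) cls_def by (rule hclass_eq_nice[OF P.atlas_good[OF B(1)] bp_good[OF C(1)] C(3) B(2)])
 thus ?thesis using C by blast
qed

lemma hol_iso_cls:
 assumes C: "C \<in> \<U>" and pt: "(p, u, q) \<in> pts (total (bp C))"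
 shows "hol_iso P M \<pi> \<U> \<W> (cls C (p, u, q)) = (p, hclass M \<U> C u, q)"
proof -
 have "(p', hclass M \<U> B u', q') = (p, hclass M \<U> C u, q)"
  if B: "B \<in> \<U>" "(p', u', q') \<in> pts (total (bp B))" "cls C (p, u, q) = cls B (p', u', q')" for p' B u' q'
 proof -
  note x = bp_unique[OF C B(1) pt cls_inj[OF C B(1) pt B(2,3)]]
  have "hclass M \<U> C u = hclass M \<U> B u'"
   by (rule hclass_eq_nice[OF M.atlas_good[OF C] M.atlas_good[OF B(1)]]) (use x pt in auto)
  thus ?thesis using x by simp
 qed
 hence "{(p', hclass M \<U> B u', q') | p' B u' q'. B \<in> \<U> \<and> (p', u', q') \<in> pts (total (bp B)) \<and>
   cls C (p, u, q) = cls B (p', u', q')} = {(p, hclass M \<U> C u, q)}" using C pt by blast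
 thus ?thesis unfolding hol_iso_def cls_def[symmetric] by simp
qed

lemma htgt_cls:
 assumes C: "C \<in> \<U>" and pt: "(p, u, q) \<in> pts (total (bp C))"
 shows "htgt (cls C (p, u, q)) = p" and "hsrc (cls C (p, u, q)) = q"
proof -
 have e: "tgt B w = p \<and> src B w = q" if "(B, w) \<in> cls C (p, u, q)" for B w
  using that equiv_pt_ends[OF _ pt] by (force simp: cls_mem)
 obtain B w where "(B, w) \<in> cls C (p, u, q)" using cls_ne[OF C pt] by blast
 hence "{tgt B w | B w. (B, w) \<in> cls C (p, u, q)} = {p}" "{src B w | B w. (B, w) \<in> cls C (p, u, q)} = {q}" using e by blast+
 thus "htgt (cls C (p, u, q)) = p" "hsrc (cls C (p, u, q)) = q" by (simp_all add: htgt_def hsrc_def)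
qed

lemma hcomp_cls:
 assumes C: "C1 \<in> \<U>" "C2 \<in> \<U>" and pt: "(p, u1, r) \<in> pts (total (bp C1))" "(r, u2, q) \<in> pts (total (bp C2))"
 shows "hcomp P \<W> (cls C1 (p, u1, r)) (cls C2 (r, u2, q)) = cls (bcomp C1 C2) (p, Comp u1 u2, q)"
proof -
 have CC: "bcomp C1 C2 \<in> \<U>" using C by (auto intro: finite_comps.intros)
 obtain g where g: "has_germ P (bp C1) (p, u1, r) r g" using bp_germ_exists[OF C(1) pt(1)] by blast
 obtain f where f: "has_germ P (bp C2) (r, u2, q) q f" using bp_germ_exists[OF C(2) pt(2)] by blast
 have fq: "r = f q" using has_germD(3)[OF f] by simp
 have ends: "src B w = tgt B' w'" if "(B, w) \<in> cls C1 (p, u1, r)" "(B', w') \<in> cls C2 (r, u2, q)" for B w B' w'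
  using that equiv_pt_ends[OF _ pt(1)] equiv_pt_ends[OF _ pt(2)] by (force simp: cls_mem)
 have e: "hclass P \<W> (bcomp B B') (Comp w w') = cls (bcomp C1 C2) (p, Comp u1 u2, q)"
  if m: "(B, w) \<in> cls C1 (p, u1, r)" "(B', w') \<in> cls C2 (r, u2, q)" for B w B' w'
 proof -
  have B: "B \<in> \<W>" "B' \<in> \<W>" "equiv_pt P (bp C1) (p, u1, r) B w" "equiv_pt P (bp C2) (r, u2, q) B' w'" using m by (auto simp: cls_mem)
  have BB: "bcomp B B' \<in> \<W>" using B by (auto intro: finite_comps.intros)
  have h: "has_germ P (bcomp B B') (Comp w w') q (%y. g (f y))"
   by (rule has_germ_bcomp[OF P.atlas_good[OF B(2)] has_germ_transfer[OF B(3) g] has_germ_transfer[OF B(4) f] fq])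
  show ?thesis unfolding cls_def
   by (rule hclass_eq_nice[OF P.atlas_good[OF BB] bp_good[OF CC] has_germ_equiv[OF P.atlas_good[OF BB] bp_good[OF CC] h bp_comp[OF C g f]] has_germD(1)[OF h]])
 qed
 obtain B w B' w' where "(B, w) \<in> cls C1 (p, u1, r)" "(B', w') \<in> cls C2 (r, u2, q)" using cls_ne[OF C(1) pt(1)] cls_ne[OF C(2) pt(2)] by blast
 hence "{hclass P \<W> (bcomp B B') (Comp w w') | B w B' w'. (B, w) \<in> cls C1 (p, u1, r) \<and> (B', w') \<in> cls C2 (r, u2, q) \<and> src B w = tgt B' w'} =
  {cls (bcomp C1 C2) (p, Comp u1 u2, q)}" using e ends by blast
 thus ?thesis unfolding hcomp_def by simp
qed

lemma act_inv:
 assumes g: "g \<in> carrier G" and p: "p \<in> pts P"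
 shows "act (inv\<^bsub>G\<^esub> g) (act g p) = p" "act g (act (inv\<^bsub>G\<^esub> g) p) = p" "inv\<^bsub>G\<^esub> g \<in> carrier G"
proof -
 interpret group G by (rule S)
 show "act (inv\<^bsub>G\<^esub> g) (act g p) = p" "act g (act (inv\<^bsub>G\<^esub> g) p) = p" "inv\<^bsub>G\<^esub> g \<in> carrier G"
  using act_mult[of "inv\<^bsub>G\<^esub> g" g p] act_mult[of g "inv\<^bsub>G\<^esub> g" p] g p by (simp_all add: act_one)
qed

lemma act_smooth: "g \<in> carrier G ==> smooth_map P P (act g)"
 using smooth_map_iff[OF manifold_dspace[OF P.N]] act_map_msm by blast

lemma bp_translate:
 assumes g: "g \<in> carrier G" and pt: "(p, u, q) \<in> pts (total (bp C))"
 shows "msm (total (bp C)) (total (bp C)) (%w. (act g (fst w), fst (snd w), act g (snd (snd w)))) (p, u, q)"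
proof -
 note m = msm_bpullback[OF pt]
 have "p \<in> pts P" "q \<in> pts P" using pt by auto
 hence l: "msm (total (bp C)) P (%w. act g (fst w)) (p, u, q)" "msm (total (bp C)) P (%w. act g (snd (snd w))) (p, u, q)"
  using msm_comp[OF m(1), of P "act g"] msm_comp[OF m(3), of P "act g"] act_map_msm[OF g] by auto
 show ?thesis by (rule msm_triple[OF l(1) m(2) l(2)]) (use nb_pts in eventually_elim, use act_\<pi>[OF g] in auto)
qed

text \<open>The map (p, u, q) to (g p, u, g q) is a morphism from the translate of
  \<open>bp C\<close> to \<open>bp C\<close>, and the inverse of g gives one back. Both directions
  are exhibited, because the symmetry of equivalence is available for good bisubmersions only and
  translates are not shown to be good.\<close>

lemma translate_cls:
 assumes g: "g \<in> carrier G" and C: "C \<in> \<U>" and pt: "(p, u, q) \<in> pts (total (bp C))"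
 shows "(act g p, u, act g q) \<in> pts (total (bp C))" and "translate_star P \<W> act g (cls C (p, u, q)) = cls C (act g p, u, act g q)"
proof -
 let ?T = "btranslate (act g)"
 have pq: "p \<in> pts P" "q \<in> pts P" using pt by auto
 show pt': "(act g p, u, act g q) \<in> pts (total (bp C))" using pt g by (auto simp: act_pts act_\<pi>)
 have e1: "equiv_pt P (?T (bp C)) (p, u, q) (bp C) (act g p, u, act g q)"
  using equiv_pt_map[of "(p, u, q)" "?T (bp C)" "bp C" "%w. (act g (fst w), fst (snd w), act g (snd (snd w)))" P] pt bp_translate[OF g pt] by simp
 have "near (total (bp C)) (act g p, u, act g q) (%w.
   act g (act (inv\<^bsub>G\<^esub> g) (fst w)) = fst w \<and> act g (act (inv\<^bsub>G\<^esub> g) (snd (snd w))) = snd (snd w))"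
  using nb_pts by eventually_elim (auto simp: act_inv[OF g])
 hence e2: "equiv_pt P (bp C) (act g p, u, act g q) (?T (bp C)) (p, u, q)"
  using equiv_pt_map[of "(act g p, u, act g q)" "bp C" "?T (bp C)" "%w. (act (inv\<^bsub>G\<^esub> g) (fst w), fst (snd w), act (inv\<^bsub>G\<^esub> g) (snd (snd w)))" P]
   pt' bp_translate[OF act_inv(3)[OF g pq(1)] pt'] by (simp add: act_inv[OF g] pq)
 have e: "hclass P \<W> (?T B) w = cls C (act g p, u, act g q)" if "(B, w) \<in> cls C (p, u, q)" for B w
 proof -
  have B: "B \<in> \<W>" "w \<in> pts (total B)" "equiv_pt P (bp C) (p, u, q) B w" using that by (auto simp: cls_mem)
  note B' = equiv_pt_sym[OF bp_good[OF C] P.atlas_good[OF B(1)] B(3) pt]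
  show ?thesis unfolding cls_def
   by (rule hclass_eqI[OF equiv_pt_trans[OF equiv_btranslate[OF B'] e1] equiv_pt_trans[OF e2 equiv_btranslate[OF B(3)]]])
    (use B(2) pt' in simp_all)
 qed
 obtain B w where "(B, w) \<in> cls C (p, u, q)" using cls_ne[OF C pt] by blast
 hence "{hclass P \<W> (?T B) w | B w. (B, w) \<in> cls C (p, u, q)} = {cls C (act g p, u, act g q)}" using e by blast
 thus "translate_star P \<W> act g (cls C (p, u, q)) = cls C (act g p, u, act g q)" unfolding translate_star_def by simp
qed

text \<open>The point (h r, c, r) over a unit c carries the germ of h. Conversely, an element with
  source r that carries h is equivalent to it because both carry the same germ, which is the
  uniqueness in the definite description.\<close>

lemma action_cls:
 assumes h: "h \<in> carrier G" and r: "r \<in> pts P" and C: "C \<in> \<U>" and c: "has_germ M C c (\<pi> r) (%y. y)"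
 shows "action_morphism P \<W> act h r = cls C (act h r, c, r)"
proof -
 have "near P r (%y. \<pi> (act h y) = \<pi> y)" using nb_pts by eventually_elim (rule act_\<pi>[OF h])
 note g = bp_germ_unit[OF C c act_map_msm[OF h r] this]
 note pt = has_germD(1)[OF g]
 show ?thesis unfolding action_morphism_def
 proof (rule the_equality, intro conjI)
  obtain B w where w: "(B, w) \<in> cls C (act h r, c, r)" using cls_ne[OF C pt] by blast
  hence B: "B \<in> \<W>" "w \<in> pts (total B)" "equiv_pt P (bp C) (act h r, c, r) B w" by (auto simp: cls_mem)
  show "cls C (act h r, c, r) \<in> holonomy P \<W>" using cls_repr[OF C pt w] B by (auto simp: holonomy_def)
  show "hsrc (cls C (act h r, c, r)) = r" by (rule htgt_cls[OF C pt])
  have "carries P B w (act h)"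
   by (rule germ_carries[OF manifold_dspace[OF P.N] P.atlas_good[OF B(1)] act_smooth[OF h] act_smooth[OF act_inv(3)[OF h r]] _ _ has_germ_transfer[OF B(3) g]])
    (simp_all add: act_inv[OF h])
  thus "hcarries P (cls C (act h r, c, r)) (act h)" using w unfolding hcarries_def by blast
 next
  fix \<xi> assume \<xi>: "\<xi> \<in> holonomy P \<W> \<and> hsrc \<xi> = r \<and> hcarries P \<xi> (act h)"
  then obtain D p u q where D: "D \<in> \<U>" "(p, u, q) \<in> pts (total (bp D))" "\<xi> = cls D (p, u, q)" using holonomy_cls by blast
  from \<xi> obtain B w where w: "(B, w) \<in> \<xi>" "carries P B w (act h)" unfolding hcarries_def by blast
  have B: "B \<in> \<W>" "w \<in> pts (total B)" "equiv_pt P (bp D) (p, u, q) B w" using w(1) unfolding D(3) by (auto simp: cls_mem)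
  have "src B w = r" using equiv_pt_ends[OF B(3) D(2)] htgt_cls(2)[OF D(1,2)] D(3) \<xi> by simp
  hence "has_germ P B w r (act h)" using carries_germ[OF w(2) B(2)] by simp
  hence "equiv_pt P (bp C) (act h r, c, r) B w" by (rule has_germ_equiv[OF bp_good[OF C] P.atlas_good[OF B(1)] g])
  hence "(B, w) \<in> cls C (act h r, c, r)" using B by (simp add: cls_mem)
  from cls_repr[OF C pt this] cls_repr[OF D(1,2) w(1)[unfolded D(3)]] show "\<xi> = cls C (act h r, c, r)" by (simp add: D(3))
 qed
qed

lemma hol_iso_equivariant:
 assumes h: "h \<in> carrier G" and g: "g \<in> carrier G" and \<xi>: "\<xi> \<in> holonomy P \<W>"
 shows "hol_iso P M \<pi> \<U> \<W> (star_action P \<W> act (h, g) \<xi>) = pullback_action G act (h, g) (hol_iso P M \<pi> \<U> \<W> \<xi>)"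
proof -
 from holonomy_cls[OF \<xi>] obtain C p u q where C: "C \<in> \<U>" and pt: "(p, u, q) \<in> pts (total (bp C))" and x: "\<xi> = cls C (p, u, q)" by blast
 let ?p = "act g p" and ?q = "act g q"
 note t = translate_cls[OF g C pt]
 have p: "p \<in> pts P" "?p \<in> pts P" using pt t by auto
 obtain D c where D: "D \<in> \<U>" "has_germ M D c (\<pi> ?p) (%y. y)" using M.unit_exists[OF msm_tgt[OF \<pi>m[OF p(2)]]] by blast
 note d = has_germD[OF D(2)]
 have pt2: "(act h ?p, c, ?p) \<in> pts (total (bp D))" using d p h by (simp add: act_pts act_\<pi>)
 have pt3: "(act h ?p, u, ?q) \<in> pts (total (bp C))" using t(1) h by (simp add: act_pts act_\<pi>)
 have DC: "bcomp D C \<in> \<U>" using D(1) C by (auto intro: finite_comps.intros)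
 have u: "u \<in> pts (total C)" "tgt C u = \<pi> ?p" using t(1) by auto
 obtain f where f: "has_germ M C u (src C u) f" using has_germ_exists[OF M.atlas_good[OF C] u(1)] by blast
 have "has_germ M (bcomp D C) (Comp c u) (src C u) f"
  using has_germ_bcomp[OF M.atlas_good[OF C] D(2) f] has_germD(3)[OF f] u(2) by simp
 \<comment> \<open>A unit composed with u carries the germ of u, so the middle component is
   unchanged as a class.\<close>
 hence "equiv_pt M C u (bcomp D C) (Comp c u)" by (rule has_germ_equiv[OF M.atlas_good[OF C] M.atlas_good[OF DC] f])
 from cls_eq[OF C DC bp_map[OF this pt3] pt3] have e: "cls (bcomp D C) (act h ?p, Comp c u, ?q) = cls C (act h ?p, u, ?q)" ..
 have "star_action P \<W> act (h, g) \<xi> = hcomp P \<W> (action_morphism P \<W> act h ?p) (cls C (?p, u, ?q))"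
  by (simp add: star_action_def left_star_def x t(2) htgt_cls[OF C t(1)])
 also have "\<dots> = cls C (act h ?p, u, ?q)"
  unfolding action_cls[OF h p(2) D] hcomp_cls[OF D(1) C pt2 t(1)] e ..
 finally show ?thesis
  by (simp add: x hol_iso_cls[OF C pt] hol_iso_cls[OF C pt3] pullback_action_def act_mult[OF h g p(1)])
qed

end

theorem proposition5p4p12:
  fixes G :: "('g, 'x) monoid_scheme" and S :: "'g smooth_space"
    and P :: "'p smooth_space" and F :: "'p vfield set" and act :: "'g \<Rightarrow> 'p \<Rightarrow> 'p"
    and M :: "'m smooth_space" and F\<^sub>M :: "'m vfield set" and \<pi> :: "'p \<Rightarrow> 'm"
    and \<U> :: "('m hpt, 'm) bisub set" and \<W> :: "('p hpt, 'p) bisub set"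
  assumes "lie_group G S" and "connected_space (dtop S)"
    and "manifold P" and "singular_foliation P F"
    and "smooth_action G S P act" and "free_action G P act" and "proper_action S P act"
    and "quotient_manifold G P act M \<pi>"
    and "ker_c P M \<pi> \<subseteq> F"
    and "singular_foliation M F\<^sub>M" and "pullback_fol P M \<pi> F\<^sub>M = F"
    and "path_holonomy_atlas M F\<^sub>M \<U>"
    and "path_holonomy_atlas P F \<W>"
  shows "\<forall>(h, g)\<in>carrier (arrow_group G). \<forall>\<xi>\<in>holonomy P \<W>.
    hol_iso P M \<pi> \<U> \<W> (star_action P \<W> act (h, g) \<xi>) =
    pullback_action G act (h, g) (hol_iso P M \<pi> \<U> \<W> \<xi>)"
proof -
 note q = assms(8)[unfolded quotient_manifold_def]
 obtain EU where EU: "\<forall>B\<in>EU. \<exists>x0. path_holonomy_bisub M F\<^sub>M x0 B" "(\<Union>B\<in>EU. src B ` pts (total B)) = pts M" "\<U> = finite_comps EU"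
  using assms(12) unfolding path_holonomy_atlas_def by blast
 obtain EW where EW: "\<forall>B\<in>EW. \<exists>x0. path_holonomy_bisub P F x0 B" "(\<Union>B\<in>EW. src B ` pts (total B)) = pts P" "\<W> = finite_comps EW"
  using assms(13) unfolding path_holonomy_atlas_def by blast
 interpret principal_bundle M "F\<^sub>M" EU P F EW \<pi> G S act
  by unfold_locales (use assms q EU EW in auto)
 show ?thesis using hol_iso_equivariant unfolding EU(3) EW(3) by (auto simp: arrow_group_def)
qed

end
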